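(* Let $\mathscr{T}$ be a $\mathscr{J}$-theory, let $\mathscr{C}$ be a $\mathscr{V}$-category with $\mathscr{J}$-powers, and suppose that $\mathscr{C}$ admits limits of $\mathscr{T}$-algebras weighted by $\mathscr{T}$-algebras. Then there is an equivalence of $\mathscr{V}'$-categories $$\mathscr{T}\text{-}\mathrm{Alg}(\mathscr{C})\;\simeq\;\mathrm{RAdj}(\mathscr{C}^{\mathrm{op}},\mathscr{T}\text{-}\mathrm{Alg})$$ under which each $\mathscr{T}$-algebra $E:\mathscr{T}\to\mathscr{C}$ corresponds to the right adjoint $\mathscr{V}$-functor $\llbracket -,E\rrbracket:\mathscr{C}^{\mathrm{op}}\to\mathscr{T}\text{-}\mathrm{Alg}$.
   Context: Setting. $\mathscr{V}=(\mathscr{V},\otimes,I)$ is a symmetric monoidal closed category whose underlying ordinary category has finite limits. $\mathscr{V}$-categories may be large; $\mathscr{V}'$ is a symmetric monoidal closed category that has all limits and colimits that are small relative to a larger universe (for which all $\mathscr{V}$-categories considered are small), equipped with a fully faithful symmetric strong monoidal embedding $\mathscr{V}\hookrightarrow\mathscr{V}'$ that preserves all limits that exist in $\mathscr{V}$. $[\mathscr{C},\mathscr{D}]$ denotes the $\mathscr{V}'$-category of $\mathscr{V}$-functors $\mathscr{C}\to\mathscr{D}$. Systems of arities and theories. $\mathscr{J}\hookrightarrow\mathscr{V}$ is a system of arities, i.e. a full sub-$\mathscr{V}$-category closed under $\otimes$ and containing $I$. A power $C^X$ in a $\mathscr{V}$-category $\mathscr{C}$ is an object with $\mathscr{V}$-natural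 isomorphisms $\mathscr{C}(B,C^X)\cong\mathscr{V}(X,\mathscr{C}(B,C))$; $\mathscr{C}$ has $\mathscr{J}$-powers if it is equipped with a designated power $C^J$ for all $J\in\mathscr{J}$, $C\in\mathscr{C}$ (with $C^I=C$, and with counit $I\to\mathscr{C}(C,C)$ the identity). A $\mathscr{J}$-theory is a $\mathscr{V}$-category $\mathscr{T}$ with $\mathrm{ob}\,\mathscr{T}=\mathrm{ob}\,\mathscr{J}$, equipped with an identity-on-objects $\mathscr{V}$-functor $\mathscr{J}^{\mathrm{op}}\to\mathscr{T}$ that preserves $\mathscr{J}$-powers. Algebras. A $\mathscr{T}$-algebra in a $\mathscr{V}$-category $\mathscr{C}$ with $\mathscr{J}$-powers is a $\mathscr{V}$-functor $\mathscr{T}\to\mathscr{C}$ that preserves $\mathscr{J}$-powers; $\mathscr{T}\text{-}\mathrm{Alg}(\mathscr{C})$ is the full sub-$\mathscr{V}'$-category of $[\mathscr{T},\mathscr{C}]$ on these, and $\mathscr{T}\text{-}\mathrm{Alg}=\mathscr{T}\text{-}\mathrm{Alg}(\mathscr{V})$, with $G^{\mathscr{T}}:\mathscr{T}\text{-}\mathrm{Alg}\to\mathscr{V}$ evaluation at $I$. Throughout, $\mathscr{J}$ is amenable: for every $\mathscr{J}$-theory $\mathscr{T}$, $\mathscr{T}\text{-}\mathrm{Alg}$ exists as a $\mathscr{V}$-category and $G^{\mathscr{T}}$ has a left adjoint. Notation for this statement. For a $\mathscr{T}$-algebra $E:\mathscr{T}\to\mathscr{C}$, $\llbracket -,E\rrbracket:\mathscr{C}^{\mathrm{op}}\to\mathscr{T}\text{-}\mathrm{Alg}$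 is the $\mathscr{V}$-functor $\llbracket C,E\rrbracket=\mathscr{C}(C,E-)$. $\mathscr{C}$ admits limits of $\mathscr{T}$-algebras weighted by $\mathscr{T}$-algebras if the weighted limit $\{A,E\}$ exists in $\mathscr{C}$ for all $\mathscr{T}$-algebras $A:\mathscr{T}\to\mathscr{V}$ and $E:\mathscr{T}\to\mathscr{C}$. $\mathrm{RAdj}(\mathscr{C}^{\mathrm{op}},\mathscr{T}\text{-}\mathrm{Alg})\hookrightarrow[\mathscr{C}^{\mathrm{op}},\mathscr{T}\text{-}\mathrm{Alg}]$ is the full sub-$\mathscr{V}'$-category on the $\mathscr{V}$-functors that are right adjoints.
   Formalization: The embedding of V into V' is additionally assumed to preserve internal homs (i.e. powers in V, as Kelly's standard enlargement does); with preservation of ordinary limits only, the claimed equivalence can fail. *)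

theory Defs
  imports Main
begin

unbundle cardinal_syntax

section \<open>Ordinary categories and their limits\<close>

record ('o, 'a) category =
  Obj :: "'o set"
  Arr :: "'a set"
  Dom :: "'a \<Rightarrow> 'o"
  Cod :: "'a \<Rightarrow> 'o"
  Idn :: "'o \<Rightarrow> 'a"
  Cmp :: "'a \<Rightarrow> 'a \<Rightarrow> 'a" (infixr "\<cdot>\<index>" 65)

definition Hom :: "('o, 'a, 'm) category_scheme \<Rightarrow> 'o \<Rightarrow> 'o \<Rightarrow> 'a set" where
  "Hom C X Y = {f \<in> Arr C. Dom C f = X \<and> Cod C f = Y}"

locale category =
  fixes C :: "('o, 'a, 'm) category_scheme" (structure)
  assumes dom_Obj: "f \<in> Arr C \<Longrightarrow> Dom C f \<in> Obj C"
    and cod_Obj: "f \<in> Arr C \<Longrightarrow> Cod C f \<in> Obj C"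
    and idn_Hom: "X \<in> Obj C \<Longrightarrow> Idn C X \<in> Hom C X X"
    and cmp_Hom: "\<lbrakk>f \<in> Hom C X Y; g \<in> Hom C Y Z\<rbrakk> \<Longrightarrow> g \<cdot> f \<in> Hom C X Z"
    and cmp_idn_left: "f \<in> Hom C X Y \<Longrightarrow> Idn C Y \<cdot> f = f"
    and cmp_idn_right: "f \<in> Hom C X Y \<Longrightarrow> f \<cdot> Idn C X = f"
    and cmp_assoc: "\<lbrakk>f \<in> Hom C W X; g \<in> Hom C X Y; h \<in> Hom C Y Z\<rbrakk>
      \<Longrightarrow> (h \<cdot> g) \<cdot> f = h \<cdot> g \<cdot> f"

definition is_inverse :: "('o, 'a, 'm) category_scheme \<Rightarrow> 'a \<Rightarrow> 'a \<Rightarrow> bool" where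
  "is_inverse C f g \<longleftrightarrow> f \<in> Arr C \<and> g \<in> Hom C (Cod C f) (Dom C f) \<and>
     g \<cdot>\<^bsub>C\<^esub> f = Idn C (Dom C f) \<and> f \<cdot>\<^bsub>C\<^esub> g = Idn C (Cod C f)"

definition is_iso :: "('o, 'a, 'm) category_scheme \<Rightarrow> 'a \<Rightarrow> bool" where
  "is_iso C f \<longleftrightarrow> (\<exists>g. is_inverse C f g)"

definition inv_arr :: "('o, 'a, 'm) category_scheme \<Rightarrow> 'a \<Rightarrow> 'a" where
  "inv_arr C f = (THE g. is_inverse C f g)"

definition dual_category :: "('o, 'a, 'm) category_scheme \<Rightarrow> ('o, 'a) category" where
  "dual_category C = \<lparr>Obj = Obj C, Arr = Arr C, Dom = Cod C, Cod = Dom C, Idn = Idn C,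
     Cmp = (\<lambda>g f. f \<cdot>\<^bsub>C\<^esub> g)\<rparr>"

definition is_functor ::
  "('i, 'k, 'm) category_scheme \<Rightarrow> ('o, 'a, 'n) category_scheme
   \<Rightarrow> ('i \<Rightarrow> 'o) \<Rightarrow> ('k \<Rightarrow> 'a) \<Rightarrow> bool" where
  "is_functor K C Fo Fa \<longleftrightarrow> category K \<and> category C \<and>
     (\<forall>i\<in>Obj K. Fo i \<in> Obj C) \<and>
     (\<forall>i\<in>Obj K. \<forall>j\<in>Obj K. \<forall>f\<in>Hom K i j. Fa f \<in> Hom C (Fo i) (Fo j)) \<and>
     (\<forall>i\<in>Obj K. Fa (Idn K i) = Idn C (Fo i)) \<and>
     (\<forall>i\<in>Obj K. \<forall>j\<in>Obj K. \<forall>k\<in>Obj K. \<forall>f\<in>Hom K i j. \<forall>g\<in>Hom K j k.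
        Fa (g \<cdot>\<^bsub>K\<^esub> f) = Fa g \<cdot>\<^bsub>C\<^esub> Fa f)"

definition is_cone ::
  "('i, 'k, 'm) category_scheme \<Rightarrow> ('o, 'a, 'n) category_scheme
   \<Rightarrow> ('i \<Rightarrow> 'o) \<Rightarrow> ('k \<Rightarrow> 'a) \<Rightarrow> 'o \<Rightarrow> ('i \<Rightarrow> 'a) \<Rightarrow> bool" where
  "is_cone K C Do Da L p \<longleftrightarrow> L \<in> Obj C \<and> (\<forall>i\<in>Obj K. p i \<in> Hom C L (Do i)) \<and>
     (\<forall>f\<in>Arr K. Da f \<cdot>\<^bsub>C\<^esub> p (Dom K f) = p (Cod K f))"

definition is_limit ::
  "('i, 'k, 'm) category_scheme \<Rightarrow> ('o, 'a, 'n) category_scheme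
   \<Rightarrow> ('i \<Rightarrow> 'o) \<Rightarrow> ('k \<Rightarrow> 'a) \<Rightarrow> 'o \<Rightarrow> ('i \<Rightarrow> 'a) \<Rightarrow> bool" where
  "is_limit K C Do Da L p \<longleftrightarrow> is_cone K C Do Da L p \<and>
     (\<forall>M q. is_cone K C Do Da M q \<longrightarrow>
        (\<exists>!h. h \<in> Hom C M L \<and> (\<forall>i\<in>Obj K. p i \<cdot>\<^bsub>C\<^esub> h = q i)))"

definition has_limits :: "(('i, 'k) category \<Rightarrow> bool) \<Rightarrow> ('o, 'a, 'n) category_scheme \<Rightarrow> bool" where
  "has_limits \<K> C \<longleftrightarrow>
     (\<forall>K Do Da. \<K> K \<and> is_functor K C Do Da \<longrightarrow> (\<exists>L p. is_limit K C Do Da L p))"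

text \<open>This is having all \<open>\<K>\<close>-indexed colimits whenever \<open>\<K>\<close> is closed under duals, as it is below.\<close>

definition has_colimits :: "(('i, 'k) category \<Rightarrow> bool) \<Rightarrow> ('o, 'a, 'n) category_scheme \<Rightarrow> bool" where
  "has_colimits \<K> C \<longleftrightarrow> has_limits \<K> (dual_category C)"

text \<open>Every finite category is isomorphic to one whose objects and arrows are natural numbers.\<close>

definition has_finite_limits :: "('o, 'a, 'n) category_scheme \<Rightarrow> bool" where
  "has_finite_limits C \<longleftrightarrow>
     has_limits (\<lambda>K :: (nat, nat) category. finite (Obj K) \<and> finite (Arr K)) C"

text \<open>
  A universe is represented by its cardinality, that of a set \<open>U\<close>: an infinite regular strong limit
  cardinal, i.e. the cardinality of a Grothendieck universe. The small sets are those of smaller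
  cardinality. Every small category is isomorphic to one with objects and arrows in
  the type of the elements of \<open>U\<close>, so index categories of that type suffice.
\<close>

definition universe :: "'u set \<Rightarrow> bool" where
  "universe U \<longleftrightarrow> infinite U \<and> regularCard |U| \<and>
     (\<forall>A :: 'u set. |A| <o |U| \<longrightarrow> |Pow A| <o |U| )"

definition small :: "'u set \<Rightarrow> 'b set \<Rightarrow> bool" where
  "small U A \<longleftrightarrow> |A| <o |U|"

definition small_category :: "'u set \<Rightarrow> ('o, 'a, 'n) category_scheme \<Rightarrow> bool" where
  "small_category U C \<longleftrightarrow> small U (Obj C) \<and> small U (Arr C)"

definition small_complete :: "'u set \<Rightarrow> ('o, 'a, 'n) category_scheme \<Rightarrow> bool" where
  "small_complete U C \<longleftrightarrow> has_limits (\<lambda>K :: ('u, 'u) category. small_category U K) C"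

definition small_cocomplete :: "'u set \<Rightarrow> ('o, 'a, 'n) category_scheme \<Rightarrow> bool" where
  "small_cocomplete U C \<longleftrightarrow> has_colimits (\<lambda>K :: ('u, 'u) category. small_category U K) C"


section \<open>Symmetric monoidal closed categories\<close>

text \<open>
  \<open>Hm V X Y\<close> is the internal hom \<open>[X, Y]\<close>, \<open>Ev V X Y\<close> the evaluation \<open>[X, Y] \<otimes> X \<rightarrow> Y\<close>.
\<close>

record ('o, 'a) smcc = "('o, 'a) category" +
  Ten :: "'o \<Rightarrow> 'o \<Rightarrow> 'o" (infixr "\<otimes>\<index>" 75)
  TenA :: "'a \<Rightarrow> 'a \<Rightarrow> 'a" (infixr "\<boxtimes>\<index>" 75)
  Unt :: 'o
  Asc :: "'o \<Rightarrow> 'o \<Rightarrow> 'o \<Rightarrow> 'a"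
  Lun :: "'o \<Rightarrow> 'a"
  Run :: "'o \<Rightarrow> 'a"
  Brd :: "'o \<Rightarrow> 'o \<Rightarrow> 'a"
  Hm :: "'o \<Rightarrow> 'o \<Rightarrow> 'o"
  Ev :: "'o \<Rightarrow> 'o \<Rightarrow> 'a"

locale smcc = category V for V :: "('o, 'a, 'm) smcc_scheme" (structure) +
  assumes ten_Obj: "\<lbrakk>X \<in> Obj V; Y \<in> Obj V\<rbrakk> \<Longrightarrow> X \<otimes> Y \<in> Obj V"
    and unt_Obj: "Unt V \<in> Obj V"
    and ten_Hom: "\<lbrakk>f \<in> Hom V X Y; g \<in> Hom V X' Y'\<rbrakk> \<Longrightarrow> f \<boxtimes> g \<in> Hom V (X \<otimes> X') (Y \<otimes> Y')"
    and ten_idn: "\<lbrakk>X \<in> Obj V; Y \<in> Obj V\<rbrakk> \<Longrightarrow> Idn V X \<boxtimes> Idn V Y = Idn V (X \<otimes> Y)"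
    and ten_cmp: "\<lbrakk>f \<in> Hom V X Y; g \<in> Hom V Y Z; f' \<in> Hom V X' Y'; g' \<in> Hom V Y' Z'\<rbrakk>
      \<Longrightarrow> (g \<cdot> f) \<boxtimes> (g' \<cdot> f') = (g \<boxtimes> g') \<cdot> (f \<boxtimes> f')"
    and asc_Hom: "\<lbrakk>X \<in> Obj V; Y \<in> Obj V; Z \<in> Obj V\<rbrakk>
      \<Longrightarrow> Asc V X Y Z \<in> Hom V ((X \<otimes> Y) \<otimes> Z) (X \<otimes> Y \<otimes> Z)"
    and asc_iso: "\<lbrakk>X \<in> Obj V; Y \<in> Obj V; Z \<in> Obj V\<rbrakk> \<Longrightarrow> is_iso V (Asc V X Y Z)"
    and asc_nat: "\<lbrakk>f \<in> Hom V X X'; g \<in> Hom V Y Y'; h \<in> Hom V Z Z'\<rbrakk>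
      \<Longrightarrow> Asc V X' Y' Z' \<cdot> ((f \<boxtimes> g) \<boxtimes> h) = (f \<boxtimes> g \<boxtimes> h) \<cdot> Asc V X Y Z"
    and lun_Hom: "X \<in> Obj V \<Longrightarrow> Lun V X \<in> Hom V (Unt V \<otimes> X) X"
    and lun_iso: "X \<in> Obj V \<Longrightarrow> is_iso V (Lun V X)"
    and lun_nat: "f \<in> Hom V X Y \<Longrightarrow> Lun V Y \<cdot> (Idn V (Unt V) \<boxtimes> f) = f \<cdot> Lun V X"
    and run_Hom: "X \<in> Obj V \<Longrightarrow> Run V X \<in> Hom V (X \<otimes> Unt V) X"
    and run_iso: "X \<in> Obj V \<Longrightarrow> is_iso V (Run V X)"
    and run_nat: "f \<in> Hom V X Y \<Longrightarrow> Run V Y \<cdot> (f \<boxtimes> Idn V (Unt V)) = f \<cdot> Run V X"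
    and pentagon: "\<lbrakk>W \<in> Obj V; X \<in> Obj V; Y \<in> Obj V; Z \<in> Obj V\<rbrakk>
      \<Longrightarrow> Asc V W X (Y \<otimes> Z) \<cdot> Asc V (W \<otimes> X) Y Z =
          (Idn V W \<boxtimes> Asc V X Y Z) \<cdot> Asc V W (X \<otimes> Y) Z \<cdot> (Asc V W X Y \<boxtimes> Idn V Z)"
    and triangle: "\<lbrakk>X \<in> Obj V; Y \<in> Obj V\<rbrakk>
      \<Longrightarrow> (Idn V X \<boxtimes> Lun V Y) \<cdot> Asc V X (Unt V) Y = Run V X \<boxtimes> Idn V Y"
    and brd_Hom: "\<lbrakk>X \<in> Obj V; Y \<in> Obj V\<rbrakk> \<Longrightarrow> Brd V X Y \<in> Hom V (X \<otimes> Y) (Y \<otimes> X)"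
    and brd_nat: "\<lbrakk>f \<in> Hom V X X'; g \<in> Hom V Y Y'\<rbrakk>
      \<Longrightarrow> Brd V X' Y' \<cdot> (f \<boxtimes> g) = (g \<boxtimes> f) \<cdot> Brd V X Y"
    and brd_sym: "\<lbrakk>X \<in> Obj V; Y \<in> Obj V\<rbrakk> \<Longrightarrow> Brd V Y X \<cdot> Brd V X Y = Idn V (X \<otimes> Y)"
    and hexagon: "\<lbrakk>X \<in> Obj V; Y \<in> Obj V; Z \<in> Obj V\<rbrakk>
      \<Longrightarrow> Asc V Y Z X \<cdot> Brd V X (Y \<otimes> Z) \<cdot> Asc V X Y Z =
          (Idn V Y \<boxtimes> Brd V X Z) \<cdot> Asc V Y X Z \<cdot> (Brd V X Y \<boxtimes> Idn V Z)"
    and hm_Obj: "\<lbrakk>X \<in> Obj V; Y \<in> Obj V\<rbrakk> \<Longrightarrow> Hm V X Y \<in> Obj V"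
    and ev_Hom: "\<lbrakk>X \<in> Obj V; Y \<in> Obj V\<rbrakk> \<Longrightarrow> Ev V X Y \<in> Hom V (Hm V X Y \<otimes> X) Y"
    and ev_univ: "\<lbrakk>X \<in> Obj V; Y \<in> Obj V; Z \<in> Obj V; f \<in> Hom V (X \<otimes> Y) Z\<rbrakk>
      \<Longrightarrow> \<exists>!g. g \<in> Hom V X (Hm V Y Z) \<and> Ev V Y Z \<cdot> (g \<boxtimes> Idn V Y) = f"

definition curry_arr :: "('o, 'a, 'm) smcc_scheme \<Rightarrow> 'o \<Rightarrow> 'o \<Rightarrow> 'o \<Rightarrow> 'a \<Rightarrow> 'a" where
  "curry_arr V X Y Z f =
     (THE g. g \<in> Hom V X (Hm V Y Z) \<and> Ev V Y Z \<cdot>\<^bsub>V\<^esub> (g \<boxtimes>\<^bsub>V\<^esub> Idn V Y) = f)"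

text \<open>The name \<open>I \<rightarrow> [X, Y]\<close> of an arrow \<open>f : X \<rightarrow> Y\<close>.\<close>

definition name_arr :: "('o, 'a, 'm) smcc_scheme \<Rightarrow> 'o \<Rightarrow> 'o \<Rightarrow> 'a \<Rightarrow> 'a" where
  "name_arr V X Y f = curry_arr V (Unt V) X Y (f \<cdot>\<^bsub>V\<^esub> Lun V X)"


section \<open>Enriched categories\<close>

text \<open>\<open>VCmp C x y z\<close> is the composition \<open>C(y, z) \<otimes> C(x, y) \<rightarrow> C(x, z)\<close>.\<close>

record ('c, 'o, 'a) vcat =
  VObj :: "'c set"
  VHom :: "'c \<Rightarrow> 'c \<Rightarrow> 'o"
  VIdn :: "'c \<Rightarrow> 'a"
  VCmp :: "'c \<Rightarrow> 'c \<Rightarrow> 'c \<Rightarrow> 'a"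

locale vcategory = smcc V for V :: "('o, 'a) smcc" (structure) +
  fixes C :: "('c, 'o, 'a) vcat"
  assumes vhom_Obj: "\<lbrakk>x \<in> VObj C; y \<in> VObj C\<rbrakk> \<Longrightarrow> VHom C x y \<in> Obj V"
    and vidn_Hom: "x \<in> VObj C \<Longrightarrow> VIdn C x \<in> Hom V (Unt V) (VHom C x x)"
    and vcmp_Hom: "\<lbrakk>x \<in> VObj C; y \<in> VObj C; z \<in> VObj C\<rbrakk>
      \<Longrightarrow> VCmp C x y z \<in> Hom V (VHom C y z \<otimes> VHom C x y) (VHom C x z)"
    and vcmp_assoc: "\<lbrakk>w \<in> VObj C; x \<in> VObj C; y \<in> VObj C; z \<in> VObj C\<rbrakk>
      \<Longrightarrow> VCmp C w x z \<cdot> (VCmp C x y z \<boxtimes> Idn V (VHom C w x)) =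
          VCmp C w y z \<cdot> (Idn V (VHom C y z) \<boxtimes> VCmp C w x y)
            \<cdot> Asc V (VHom C y z) (VHom C x y) (VHom C w x)"
    and vcmp_vidn_left: "\<lbrakk>x \<in> VObj C; y \<in> VObj C\<rbrakk>
      \<Longrightarrow> VCmp C x y y \<cdot> (VIdn C y \<boxtimes> Idn V (VHom C x y)) = Lun V (VHom C x y)"
    and vcmp_vidn_right: "\<lbrakk>x \<in> VObj C; y \<in> VObj C\<rbrakk>
      \<Longrightarrow> VCmp C x x y \<cdot> (Idn V (VHom C x y) \<boxtimes> VIdn C x) = Run V (VHom C x y)"

text \<open>
  So that equality of \<open>\<V>\<close>-functors is equality of records, the components of a \<open>\<V>\<close>-functor are
  required to be \<open>undefined\<close> outside the objects of its domain; \<open>mk_vfun\<close> enforces this.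
\<close>

record ('c, 'd, 'a) vfun =
  FO :: "'c \<Rightarrow> 'd"
  FA :: "'c \<Rightarrow> 'c \<Rightarrow> 'a"

definition mk_vfun ::
  "('c, 'o, 'a) vcat \<Rightarrow> ('c \<Rightarrow> 'd) \<Rightarrow> ('c \<Rightarrow> 'c \<Rightarrow> 'b) \<Rightarrow> ('c, 'd, 'b) vfun" where
  "mk_vfun C Fo Fa = \<lparr>FO = (\<lambda>x. if x \<in> VObj C then Fo x else undefined),
     FA = (\<lambda>x y. if x \<in> VObj C \<and> y \<in> VObj C then Fa x y else undefined)\<rparr>"

locale vfunctor = dom: vcategory V C + cod: vcategory V D
  for V :: "('o, 'a) smcc" (structure) and C :: "('c, 'o, 'a) vcat" and D :: "('d, 'o, 'a) vcat" +
  fixes F :: "('c, 'd, 'a) vfun"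
  assumes FO_VObj: "x \<in> VObj C \<Longrightarrow> FO F x \<in> VObj D"
    and FA_Hom: "\<lbrakk>x \<in> VObj C; y \<in> VObj C\<rbrakk>
      \<Longrightarrow> FA F x y \<in> Hom V (VHom C x y) (VHom D (FO F x) (FO F y))"
    and FA_vidn: "x \<in> VObj C \<Longrightarrow> FA F x x \<cdot> VIdn C x = VIdn D (FO F x)"
    and FA_vcmp: "\<lbrakk>x \<in> VObj C; y \<in> VObj C; z \<in> VObj C\<rbrakk>
      \<Longrightarrow> FA F x z \<cdot> VCmp C x y z =
          VCmp D (FO F x) (FO F y) (FO F z) \<cdot> (FA F y z \<boxtimes> FA F x y)"
    and ext: "mk_vfun C (FO F) (FA F) = F"

definition vop :: "('o, 'a) smcc \<Rightarrow> ('c, 'o, 'a) vcat \<Rightarrow> ('c, 'o, 'a) vcat" where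
  "vop V C = \<lparr>VObj = VObj C, VHom = (\<lambda>x y. VHom C y x), VIdn = VIdn C,
     VCmp = (\<lambda>x y z. VCmp C z y x \<cdot>\<^bsub>V\<^esub> Brd V (VHom C z y) (VHom C y x))\<rparr>"

definition vop_fun :: "('c, 'd, 'a) vfun \<Rightarrow> ('c, 'd, 'a) vfun" where
  "vop_fun F = \<lparr>FO = FO F, FA = (\<lambda>x y. FA F y x)\<rparr>"

definition vfull :: "('c, 'o, 'a) vcat \<Rightarrow> 'c set \<Rightarrow> ('c, 'o, 'a) vcat" where
  "vfull C S = C\<lparr>VObj := S\<rparr>"

text \<open>\<open>\<V>\<close> as a \<open>\<V>\<close>-category\<close>

definition vself :: "('o, 'a) smcc \<Rightarrow> ('o, 'o, 'a) vcat" where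
  "vself V = \<lparr>VObj = Obj V, VHom = Hm V, VIdn = (\<lambda>X. curry_arr V (Unt V) X X (Lun V X)),
     VCmp = (\<lambda>X Y Z. curry_arr V (Hm V Y Z \<otimes>\<^bsub>V\<^esub> Hm V X Y) X Z
       (Ev V Y Z \<cdot>\<^bsub>V\<^esub> (Idn V (Hm V Y Z) \<boxtimes>\<^bsub>V\<^esub> Ev V X Y) \<cdot>\<^bsub>V\<^esub> Asc V (Hm V Y Z) (Hm V X Y) X))\<rparr>"

definition vid :: "('o, 'a) smcc \<Rightarrow> ('c, 'o, 'a) vcat \<Rightarrow> ('c, 'c, 'a) vfun" where
  "vid V C = mk_vfun C (\<lambda>x. x) (\<lambda>x y. Idn V (VHom C x y))"

definition vcomp ::
  "('o, 'a) smcc \<Rightarrow> ('c, 'o, 'a) vcat \<Rightarrow> ('d, 'e, 'a) vfun \<Rightarrow> ('c, 'd, 'a) vfun \<Rightarrow> ('c, 'e, 'a) vfun" where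
  "vcomp V C G F = mk_vfun C (\<lambda>x. FO G (FO F x)) (\<lambda>x y. FA G (FO F x) (FO F y) \<cdot>\<^bsub>V\<^esub> FA F x y)"

text \<open>The composite \<open>I \<rightarrow> C(x, z)\<close> of \<open>a : I \<rightarrow> C(x, y)\<close> and \<open>b : I \<rightarrow> C(y, z)\<close>\<close>

definition vcmp_el ::
  "('o, 'a) smcc \<Rightarrow> ('c, 'o, 'a) vcat \<Rightarrow> 'c \<Rightarrow> 'c \<Rightarrow> 'c \<Rightarrow> 'a \<Rightarrow> 'a \<Rightarrow> 'a" where
  "vcmp_el V C x y z b a = VCmp C x y z \<cdot>\<^bsub>V\<^esub> (b \<boxtimes>\<^bsub>V\<^esub> a) \<cdot>\<^bsub>V\<^esub> inv_arr V (Lun V (Unt V))"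

definition vnat ::
  "('o, 'a) smcc \<Rightarrow> ('c, 'o, 'a) vcat \<Rightarrow> ('d, 'o, 'a) vcat
   \<Rightarrow> ('c, 'd, 'a) vfun \<Rightarrow> ('c, 'd, 'a) vfun \<Rightarrow> ('c \<Rightarrow> 'a) \<Rightarrow> bool" where
  "vnat V C D F G \<alpha> \<longleftrightarrow>
     (\<forall>x\<in>VObj C. \<alpha> x \<in> Hom V (Unt V) (VHom D (FO F x) (FO G x))) \<and>
     (\<forall>x\<in>VObj C. \<forall>y\<in>VObj C.
        VCmp D (FO F x) (FO F y) (FO G y) \<cdot>\<^bsub>V\<^esub> (\<alpha> y \<boxtimes>\<^bsub>V\<^esub> FA F x y) \<cdot>\<^bsub>V\<^esub> inv_arr V (Lun V (VHom C x y)) =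
        VCmp D (FO F x) (FO G x) (FO G y) \<cdot>\<^bsub>V\<^esub> (FA G x y \<boxtimes>\<^bsub>V\<^esub> \<alpha> x) \<cdot>\<^bsub>V\<^esub> inv_arr V (Run V (VHom C x y)))"

definition vnat_iso ::
  "('o, 'a) smcc \<Rightarrow> ('c, 'o, 'a) vcat \<Rightarrow> ('d, 'o, 'a) vcat
   \<Rightarrow> ('c, 'd, 'a) vfun \<Rightarrow> ('c, 'd, 'a) vfun \<Rightarrow> ('c \<Rightarrow> 'a) \<Rightarrow> bool" where
  "vnat_iso V C D F G \<alpha> \<longleftrightarrow> vnat V C D F G \<alpha> \<and>
     (\<exists>\<beta>. vnat V C D G F \<beta> \<and> (\<forall>x\<in>VObj C.
        vcmp_el V D (FO F x) (FO G x) (FO F x) (\<beta> x) (\<alpha> x) = VIdn D (FO F x) \<and>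
        vcmp_el V D (FO G x) (FO F x) (FO G x) (\<alpha> x) (\<beta> x) = VIdn D (FO G x)))"

text \<open>For \<open>\<V>\<close>-valued \<open>\<V>\<close>-functors, the components may be given as arrows \<open>F x \<rightarrow> G x\<close> of \<open>\<V>\<close>.\<close>

definition vnat_iso_arr ::
  "('o, 'a) smcc \<Rightarrow> ('c, 'o, 'a) vcat
   \<Rightarrow> ('c, 'o, 'a) vfun \<Rightarrow> ('c, 'o, 'a) vfun \<Rightarrow> ('c \<Rightarrow> 'a) \<Rightarrow> bool" where
  "vnat_iso_arr V C F G \<theta> \<longleftrightarrow> (\<forall>x\<in>VObj C. \<theta> x \<in> Hom V (FO F x) (FO G x)) \<and>
     vnat_iso V C (vself V) F G (\<lambda>x. name_arr V (FO F x) (FO G x) (\<theta> x))"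

text \<open>\<open>C(c, -) : C \<rightarrow> \<V>\<close> and \<open>C(-, c) : C\<^sup>o\<^sup>p \<rightarrow> \<V>\<close>\<close>

definition hom_from :: "('o, 'a) smcc \<Rightarrow> ('c, 'o, 'a) vcat \<Rightarrow> 'c \<Rightarrow> ('c, 'o, 'a) vfun" where
  "hom_from V C c = mk_vfun C (VHom C c)
     (\<lambda>x y. curry_arr V (VHom C x y) (VHom C c x) (VHom C c y) (VCmp C c x y))"

definition hom_to :: "('o, 'a) smcc \<Rightarrow> ('c, 'o, 'a) vcat \<Rightarrow> 'c \<Rightarrow> ('c, 'o, 'a) vfun" where
  "hom_to V C c = mk_vfun C (\<lambda>x. VHom C x c)
     (\<lambda>x y. curry_arr V (VHom C y x) (VHom C x c) (VHom C y c)
       (VCmp C y x c \<cdot>\<^bsub>V\<^esub> Brd V (VHom C y x) (VHom C x c)))"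

definition is_right_adjoint ::
  "('o, 'a) smcc \<Rightarrow> ('c, 'o, 'a) vcat \<Rightarrow> ('d, 'o, 'a) vcat \<Rightarrow> ('c, 'd, 'a) vfun \<Rightarrow> bool" where
  "is_right_adjoint V A B R \<longleftrightarrow> vfunctor V A B R \<and>
     (\<exists>L \<phi>. vfunctor V B A L \<and>
        (\<forall>b\<in>VObj B. vnat_iso_arr V A
           (hom_from V A (FO L b)) (vcomp V A (hom_from V B b) R) (\<phi> b)) \<and>
        (\<forall>a\<in>VObj A. vnat_iso_arr V (vop V B)
           (vcomp V (vop V B) (hom_to V A a) (vop_fun L)) (hom_to V B (FO R a)) (\<lambda>b. \<phi> b a)))"

definition vequivalence ::
  "('o, 'a) smcc \<Rightarrow> ('c, 'o, 'a) vcat \<Rightarrow> ('d, 'o, 'a) vcat \<Rightarrow> ('c, 'd, 'a) vfun \<Rightarrow> bool" where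
  "vequivalence V A B P \<longleftrightarrow> vfunctor V A B P \<and>
     (\<exists>Q \<eta> \<epsilon>. vfunctor V B A Q \<and>
        vnat_iso V A A (vid V A) (vcomp V A Q P) \<eta> \<and>
        vnat_iso V B B (vcomp V B P Q) (vid V B) \<epsilon>)"


section \<open>Powers\<close>

text \<open>
  \<open>is_power V C X c P \<theta>\<close>: \<open>P\<close> is a power \<open>c\<^sup>X\<close>, with \<open>\<theta> b : C(b, P) \<cong> [X, C(b, c)]\<close> natural in \<open>b\<close>.
  The counit \<open>X \<rightarrow> C(P, c)\<close> corresponds to \<open>\<theta> P\<close> applied to the identity of \<open>P\<close>.
\<close>

definition is_power ::
  "('o, 'a) smcc \<Rightarrow> ('c, 'o, 'a) vcat \<Rightarrow> 'o \<Rightarrow> 'c \<Rightarrow> 'c \<Rightarrow> ('c \<Rightarrow> 'a) \<Rightarrow> bool" where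
  "is_power V C X c P \<theta> \<longleftrightarrow> X \<in> Obj V \<and> c \<in> VObj C \<and> P \<in> VObj C \<and>
     vnat_iso_arr V (vop V C) (hom_to V C P)
       (vcomp V (vop V C) (hom_from V (vself V) X) (hom_to V C c)) \<theta>"

definition power_counit ::
  "('o, 'a) smcc \<Rightarrow> ('c, 'o, 'a) vcat \<Rightarrow> 'o \<Rightarrow> 'c \<Rightarrow> 'c \<Rightarrow> ('c \<Rightarrow> 'a) \<Rightarrow> 'a" where
  "power_counit V C X c P \<theta> =
     Ev V X (VHom C P c) \<cdot>\<^bsub>V\<^esub> ((\<theta> P \<cdot>\<^bsub>V\<^esub> VIdn C P) \<boxtimes>\<^bsub>V\<^esub> Idn V X) \<cdot>\<^bsub>V\<^esub> inv_arr V (Lun V X)"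

definition preserves_powers ::
  "('o, 'a) smcc \<Rightarrow> 'o set \<Rightarrow> ('c, 'o, 'a) vcat \<Rightarrow> ('d, 'o, 'a) vcat \<Rightarrow> ('c, 'd, 'a) vfun \<Rightarrow> bool" where
  "preserves_powers V \<J> C D F \<longleftrightarrow>
     (\<forall>X\<in>\<J>. \<forall>c P \<theta>. is_power V C X c P \<theta> \<longrightarrow>
        (\<exists>\<theta>'. is_power V D X (FO F c) (FO F P) \<theta>' \<and>
           power_counit V D X (FO F c) (FO F P) \<theta>' = FA F P c \<cdot>\<^bsub>V\<^esub> power_counit V C X c P \<theta>))"

text \<open>Designated powers \<open>pw X c\<close> with \<open>pw I c = c\<close>, the counit \<open>I \<rightarrow> C(c, c)\<close> being the identity\<close>

definition designated_powers ::
  "('o, 'a) smcc \<Rightarrow> 'o set \<Rightarrow> ('c, 'o, 'a) vcat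
   \<Rightarrow> ('o \<Rightarrow> 'c \<Rightarrow> 'c) \<Rightarrow> ('o \<Rightarrow> 'c \<Rightarrow> 'c \<Rightarrow> 'a) \<Rightarrow> bool" where
  "designated_powers V \<J> C pw \<theta> \<longleftrightarrow>
     (\<forall>X\<in>\<J>. \<forall>c\<in>VObj C. is_power V C X c (pw X c) (\<theta> X c)) \<and>
     (\<forall>c\<in>VObj C. pw (Unt V) c = c \<and> power_counit V C (Unt V) c c (\<theta> (Unt V) c) = VIdn C c)"


section \<open>The embedding and change of base\<close>

text \<open>\<open>jT X Y : j X \<otimes> j Y \<rightarrow> j (X \<otimes> Y)\<close> and \<open>jU : I \<rightarrow> j I\<close> are the strong monoidal structure.\<close>

record ('o, 'a, 'p, 'b) emb =
  jO :: "'o \<Rightarrow> 'p"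
  jA :: "'a \<Rightarrow> 'b"
  jT :: "'o \<Rightarrow> 'o \<Rightarrow> 'b"
  jU :: 'b

locale sym_monoidal_embedding = src: smcc V + tgt: smcc V'
  for V :: "('o, 'a) smcc" and V' :: "('p, 'b) smcc" and j :: "('o, 'a, 'p, 'b) emb" +
  assumes j_functor: "is_functor V V' (jO j) (jA j)"
    and j_fully_faithful: "\<lbrakk>X \<in> Obj V; Y \<in> Obj V\<rbrakk>
      \<Longrightarrow> bij_betw (jA j) (Hom V X Y) (Hom V' (jO j X) (jO j Y))"
    and jT_Hom: "\<lbrakk>X \<in> Obj V; Y \<in> Obj V\<rbrakk>
      \<Longrightarrow> jT j X Y \<in> Hom V' (jO j X \<otimes>\<^bsub>V'\<^esub> jO j Y) (jO j (X \<otimes>\<^bsub>V\<^esub> Y))"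
    and jT_iso: "\<lbrakk>X \<in> Obj V; Y \<in> Obj V\<rbrakk> \<Longrightarrow> is_iso V' (jT j X Y)"
    and jT_nat: "\<lbrakk>f \<in> Hom V X X'; g \<in> Hom V Y Y'\<rbrakk>
      \<Longrightarrow> jT j X' Y' \<cdot>\<^bsub>V'\<^esub> (jA j f \<boxtimes>\<^bsub>V'\<^esub> jA j g) = jA j (f \<boxtimes>\<^bsub>V\<^esub> g) \<cdot>\<^bsub>V'\<^esub> jT j X Y"
    and jU_Hom: "jU j \<in> Hom V' (Unt V') (jO j (Unt V))"
    and jU_iso: "is_iso V' (jU j)"
    and j_asc: "\<lbrakk>X \<in> Obj V; Y \<in> Obj V; Z \<in> Obj V\<rbrakk>
      \<Longrightarrow> jA j (Asc V X Y Z) \<cdot>\<^bsub>V'\<^esub> jT j (X \<otimes>\<^bsub>V\<^esub> Y) Z \<cdot>\<^bsub>V'\<^esub> (jT j X Y \<boxtimes>\<^bsub>V'\<^esub> Idn V' (jO j Z)) =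
          jT j X (Y \<otimes>\<^bsub>V\<^esub> Z) \<cdot>\<^bsub>V'\<^esub> (Idn V' (jO j X) \<boxtimes>\<^bsub>V'\<^esub> jT j Y Z)
            \<cdot>\<^bsub>V'\<^esub> Asc V' (jO j X) (jO j Y) (jO j Z)"
    and j_lun: "X \<in> Obj V
      \<Longrightarrow> jA j (Lun V X) \<cdot>\<^bsub>V'\<^esub> jT j (Unt V) X \<cdot>\<^bsub>V'\<^esub> (jU j \<boxtimes>\<^bsub>V'\<^esub> Idn V' (jO j X)) = Lun V' (jO j X)"
    and j_run: "X \<in> Obj V
      \<Longrightarrow> jA j (Run V X) \<cdot>\<^bsub>V'\<^esub> jT j X (Unt V) \<cdot>\<^bsub>V'\<^esub> (Idn V' (jO j X) \<boxtimes>\<^bsub>V'\<^esub> jU j) = Run V' (jO j X)"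
    and j_brd: "\<lbrakk>X \<in> Obj V; Y \<in> Obj V\<rbrakk>
      \<Longrightarrow> jA j (Brd V X Y) \<cdot>\<^bsub>V'\<^esub> jT j X Y = jT j Y X \<cdot>\<^bsub>V'\<^esub> Brd V' (jO j X) (jO j Y)"

definition preserves_small_limits ::
  "'u set \<Rightarrow> ('o, 'a) smcc \<Rightarrow> ('p, 'b) smcc \<Rightarrow> ('o, 'a, 'p, 'b) emb \<Rightarrow> bool" where
  "preserves_small_limits U V V' j \<longleftrightarrow>
     (\<forall>(K :: ('u, 'u) category) Do Da L p.
        small_category U K \<and> is_functor K V Do Da \<and> is_limit K V Do Da L p \<longrightarrow>
        is_limit K V' (\<lambda>i. jO j (Do i)) (\<lambda>f. jA j (Da f)) (jO j L) (\<lambda>i. jA j (p i)))"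

text \<open>
  Internal homs are the powers in \<open>\<V>\<close>, hence limits in the enriched sense; their preservation does not
  follow from that of ordinary limits.
\<close>

definition preserves_internal_homs ::
  "('o, 'a) smcc \<Rightarrow> ('p, 'b) smcc \<Rightarrow> ('o, 'a, 'p, 'b) emb \<Rightarrow> bool" where
  "preserves_internal_homs V V' j \<longleftrightarrow>
     (\<forall>X\<in>Obj V. \<forall>Y\<in>Obj V. is_iso V' (curry_arr V' (jO j (Hm V X Y)) (jO j X) (jO j Y)
        (jA j (Ev V X Y) \<cdot>\<^bsub>V'\<^esub> jT j (Hm V X Y) X)))"

text \<open>A \<open>\<V>\<close>-category regarded as a \<open>\<V>'\<close>-category, and a \<open>\<V>\<close>-functor out of \<open>C\<close> as a \<open>\<V>'\<close>-functor\<close>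

definition base_cat ::
  "('p, 'b) smcc \<Rightarrow> ('o, 'a, 'p, 'b) emb \<Rightarrow> ('c, 'o, 'a) vcat \<Rightarrow> ('c, 'p, 'b) vcat" where
  "base_cat V' j C = \<lparr>VObj = VObj C, VHom = (\<lambda>x y. jO j (VHom C x y)),
     VIdn = (\<lambda>x. jA j (VIdn C x) \<cdot>\<^bsub>V'\<^esub> jU j),
     VCmp = (\<lambda>x y z. jA j (VCmp C x y z) \<cdot>\<^bsub>V'\<^esub> jT j (VHom C y z) (VHom C x y))\<rparr>"

definition base_fun ::
  "('o, 'a, 'p, 'b) emb \<Rightarrow> ('c, 'o, 'a) vcat \<Rightarrow> ('c, 'd, 'a) vfun \<Rightarrow> ('c, 'd, 'b) vfun" where
  "base_fun j C F = mk_vfun C (FO F) (\<lambda>x y. jA j (FA F x y))"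


section \<open>Functor categories\<close>

text \<open>
  \<open>is_nat_object V C D F G e p\<close>: the object \<open>e\<close> with the family \<open>p x : e \<rightarrow> D(F x, G x)\<close> is the object of
  \<open>\<V>\<close>-natural transformations from \<open>F\<close> to \<open>G\<close>, i.e. the end of \<open>D(F -, G -)\<close>.
\<close>

definition is_nat_family ::
  "('o, 'a) smcc \<Rightarrow> ('c, 'o, 'a) vcat \<Rightarrow> ('d, 'o, 'a) vcat
   \<Rightarrow> ('c, 'd, 'a) vfun \<Rightarrow> ('c, 'd, 'a) vfun \<Rightarrow> 'o \<Rightarrow> ('c \<Rightarrow> 'a) \<Rightarrow> bool" where
  "is_nat_family V C D F G e p \<longleftrightarrow> e \<in> Obj V \<and>
     (\<forall>x\<in>VObj C. p x \<in> Hom V e (VHom D (FO F x) (FO G x))) \<and>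
     (\<forall>x\<in>VObj C. \<forall>y\<in>VObj C.
        VCmp D (FO F x) (FO F y) (FO G y) \<cdot>\<^bsub>V\<^esub> (p y \<boxtimes>\<^bsub>V\<^esub> FA F x y) =
        VCmp D (FO F x) (FO G x) (FO G y) \<cdot>\<^bsub>V\<^esub> (FA G x y \<boxtimes>\<^bsub>V\<^esub> p x) \<cdot>\<^bsub>V\<^esub> Brd V e (VHom C x y))"

definition is_nat_object ::
  "('o, 'a) smcc \<Rightarrow> ('c, 'o, 'a) vcat \<Rightarrow> ('d, 'o, 'a) vcat
   \<Rightarrow> ('c, 'd, 'a) vfun \<Rightarrow> ('c, 'd, 'a) vfun \<Rightarrow> 'o \<Rightarrow> ('c \<Rightarrow> 'a) \<Rightarrow> bool" where
  "is_nat_object V C D F G e p \<longleftrightarrow> is_nat_family V C D F G e p \<and>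
     (\<forall>e' p'. is_nat_family V C D F G e' p' \<longrightarrow>
        (\<exists>!h. h \<in> Hom V e' e \<and> (\<forall>x\<in>VObj C. p x \<cdot>\<^bsub>V\<^esub> h = p' x)))"

text \<open>
  The category with objects \<open>S\<close>, hom-objects \<open>e F G\<close>, and the unique identities and composition making
  the families \<open>p F G x : e F G \<rightarrow> D(F x, G x)\<close> functorial in each \<open>x\<close>.
\<close>

definition nat_category ::
  "('o, 'a) smcc \<Rightarrow> 'c set \<Rightarrow> ('d, 'o, 'a) vcat \<Rightarrow> ('c, 'd, 'k) vfun set
   \<Rightarrow> (('c, 'd, 'k) vfun \<Rightarrow> ('c, 'd, 'k) vfun \<Rightarrow> 'o)
   \<Rightarrow> (('c, 'd, 'k) vfun \<Rightarrow> ('c, 'd, 'k) vfun \<Rightarrow> 'c \<Rightarrow> 'a) \<Rightarrow> (('c, 'd, 'k) vfun, 'o, 'a) vcat" where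
  "nat_category V Xs D S e p = \<lparr>VObj = S, VHom = e,
     VIdn = (\<lambda>F. THE u. u \<in> Hom V (Unt V) (e F F) \<and> (\<forall>x\<in>Xs. p F F x \<cdot>\<^bsub>V\<^esub> u = VIdn D (FO F x))),
     VCmp = (\<lambda>F G H. THE m. m \<in> Hom V (e G H \<otimes>\<^bsub>V\<^esub> e F G) (e F H) \<and>
       (\<forall>x\<in>Xs. p F H x \<cdot>\<^bsub>V\<^esub> m = VCmp D (FO F x) (FO G x) (FO H x) \<cdot>\<^bsub>V\<^esub> (p G H x \<boxtimes>\<^bsub>V\<^esub> p F G x)))\<rparr>"

text \<open>The \<open>\<V>'\<close>-category \<open>[C, D]\<close> of \<open>\<V>\<close>-functors\<close>

definition funcat_nat ::
  "('p, 'b) smcc \<Rightarrow> ('o, 'a, 'p, 'b) emb \<Rightarrow> ('c, 'o, 'a) vcat \<Rightarrow> ('d, 'o, 'a) vcat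
   \<Rightarrow> ('c, 'd, 'a) vfun \<Rightarrow> ('c, 'd, 'a) vfun \<Rightarrow> 'p \<times> ('c \<Rightarrow> 'b)" where
  "funcat_nat V' j C D F G = (SOME (e, p).
     is_nat_object V' (base_cat V' j C) (base_cat V' j D) (base_fun j C F) (base_fun j C G) e p)"

definition funcat ::
  "('o, 'a) smcc \<Rightarrow> ('p, 'b) smcc \<Rightarrow> ('o, 'a, 'p, 'b) emb \<Rightarrow> ('c, 'o, 'a) vcat \<Rightarrow> ('d, 'o, 'a) vcat
   \<Rightarrow> (('c, 'd, 'a) vfun, 'p, 'b) vcat" where
  "funcat V V' j C D = nat_category V' (VObj C) (base_cat V' j D) {F. vfunctor V C D F}
     (\<lambda>F G. fst (funcat_nat V' j C D F G)) (\<lambda>F G. snd (funcat_nat V' j C D F G))"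


section \<open>Theories and algebras\<close>

text \<open>The full sub-\<open>\<V>\<close>-category \<open>vfull (vself V) \<J>\<close> is given by its set \<open>\<J>\<close> of objects.\<close>

definition arity_system :: "('o, 'a) smcc \<Rightarrow> 'o set \<Rightarrow> bool" where
  "arity_system V \<J> \<longleftrightarrow> \<J> \<subseteq> Obj V \<and> Unt V \<in> \<J> \<and> (\<forall>X\<in>\<J>. \<forall>Y\<in>\<J>. X \<otimes>\<^bsub>V\<^esub> Y \<in> \<J>)"

definition is_theory :: "('o, 'a) smcc \<Rightarrow> 'o set \<Rightarrow> ('o, 'o, 'a) vcat \<Rightarrow> ('o, 'o, 'a) vfun \<Rightarrow> bool" where
  "is_theory V \<J> T \<tau> \<longleftrightarrow> vcategory V T \<and> VObj T = \<J> \<and>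
     vfunctor V (vop V (vfull (vself V) \<J>)) T \<tau> \<and> (\<forall>X\<in>\<J>. FO \<tau> X = X) \<and>
     preserves_powers V \<J> (vop V (vfull (vself V) \<J>)) T \<tau>"

definition algebras ::
  "('o, 'a) smcc \<Rightarrow> 'o set \<Rightarrow> ('o, 'o, 'a) vcat \<Rightarrow> ('c, 'o, 'a) vcat \<Rightarrow> ('o, 'c, 'a) vfun set" where
  "algebras V \<J> T C = {E. vfunctor V T C E \<and> preserves_powers V \<J> T C E}"

text \<open>\<open>T-Alg(C)\<close>\<close>

definition alg_in ::
  "('o, 'a) smcc \<Rightarrow> ('p, 'b) smcc \<Rightarrow> ('o, 'a, 'p, 'b) emb \<Rightarrow> 'o set \<Rightarrow> ('o, 'o, 'a) vcat
   \<Rightarrow> ('c, 'o, 'a) vcat \<Rightarrow> (('o, 'c, 'a) vfun, 'p, 'b) vcat" where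
  "alg_in V V' j \<J> T C = vfull (funcat V V' j T C) (algebras V \<J> T C)"

text \<open>
  \<open>T-Alg\<close> as a \<open>\<V>\<close>-category: it exists when each hom-object of \<open>T-Alg(\<V>)\<close>, an object of \<open>\<V>'\<close>, is given by
  an object of \<open>\<V>\<close>, i.e. when some \<open>j e\<close> carries the structure of the end that defines it.
\<close>

definition is_alg_hom ::
  "('o, 'a) smcc \<Rightarrow> ('p, 'b) smcc \<Rightarrow> ('o, 'a, 'p, 'b) emb \<Rightarrow> ('o, 'o, 'a) vcat
   \<Rightarrow> ('o, 'o, 'a) vfun \<Rightarrow> ('o, 'o, 'a) vfun \<Rightarrow> 'o \<Rightarrow> ('o \<Rightarrow> 'a) \<Rightarrow> bool" where
  "is_alg_hom V V' j T A B e p \<longleftrightarrow>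
     e \<in> Obj V \<and> (\<forall>t\<in>VObj T. p t \<in> Hom V e (Hm V (FO A t) (FO B t))) \<and>
     is_nat_object V' (base_cat V' j T) (base_cat V' j (vself V)) (base_fun j T A) (base_fun j T B)
       (jO j e) (\<lambda>t. jA j (p t))"

definition alg_exists ::
  "('o, 'a) smcc \<Rightarrow> ('p, 'b) smcc \<Rightarrow> ('o, 'a, 'p, 'b) emb \<Rightarrow> 'o set \<Rightarrow> ('o, 'o, 'a) vcat \<Rightarrow> bool" where
  "alg_exists V V' j \<J> T \<longleftrightarrow>
     (\<forall>A\<in>algebras V \<J> T (vself V). \<forall>B\<in>algebras V \<J> T (vself V). \<exists>e p. is_alg_hom V V' j T A B e p)"

definition alg_hom ::
  "('o, 'a) smcc \<Rightarrow> ('p, 'b) smcc \<Rightarrow> ('o, 'a, 'p, 'b) emb \<Rightarrow> ('o, 'o, 'a) vcat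
   \<Rightarrow> ('o, 'o, 'a) vfun \<Rightarrow> ('o, 'o, 'a) vfun \<Rightarrow> 'o \<times> ('o \<Rightarrow> 'a)" where
  "alg_hom V V' j T A B = (SOME (e, p). is_alg_hom V V' j T A B e p)"

definition alg ::
  "('o, 'a) smcc \<Rightarrow> ('p, 'b) smcc \<Rightarrow> ('o, 'a, 'p, 'b) emb \<Rightarrow> 'o set \<Rightarrow> ('o, 'o, 'a) vcat
   \<Rightarrow> (('o, 'o, 'a) vfun, 'o, 'a) vcat" where
  "alg V V' j \<J> T = nat_category V (VObj T) (vself V) (algebras V \<J> T (vself V))
     (\<lambda>A B. fst (alg_hom V V' j T A B)) (\<lambda>A B. snd (alg_hom V V' j T A B))"

text \<open>Evaluation at the unit object\<close>

definition alg_forget ::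
  "('o, 'a) smcc \<Rightarrow> ('p, 'b) smcc \<Rightarrow> ('o, 'a, 'p, 'b) emb \<Rightarrow> 'o set \<Rightarrow> ('o, 'o, 'a) vcat
   \<Rightarrow> (('o, 'o, 'a) vfun, 'o, 'a) vfun" where
  "alg_forget V V' j \<J> T = mk_vfun (alg V V' j \<J> T) (\<lambda>A. FO A (Unt V))
     (\<lambda>A B. snd (alg_hom V V' j T A B) (Unt V))"

definition amenable ::
  "('o, 'a) smcc \<Rightarrow> ('p, 'b) smcc \<Rightarrow> ('o, 'a, 'p, 'b) emb \<Rightarrow> 'o set \<Rightarrow> bool" where
  "amenable V V' j \<J> \<longleftrightarrow> (\<forall>T \<tau>. is_theory V \<J> T \<tau> \<longrightarrow>
     alg_exists V V' j \<J> T \<and>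
     is_right_adjoint V (alg V V' j \<J> T) (vself V) (alg_forget V V' j \<J> T))"


section \<open>The functors \<open>C(-, E)\<close> and weighted limits\<close>

text \<open>The \<open>\<V>'\<close>-functor \<open>C(-, E) : C\<^sup>o\<^sup>p \<rightarrow> [T, \<V>]\<close> associated to a \<open>\<V>\<close>-functor \<open>E : T \<rightarrow> C\<close>\<close>

definition hom_family ::
  "('o, 'a) smcc \<Rightarrow> ('p, 'b) smcc \<Rightarrow> ('o, 'a, 'p, 'b) emb \<Rightarrow> ('t, 'o, 'a) vcat \<Rightarrow> ('c, 'o, 'a) vcat
   \<Rightarrow> ('t, 'c, 'a) vfun \<Rightarrow> ('c, ('t, 'o, 'a) vfun, 'b) vfun" where
  "hom_family V V' j T C E =
    (let H = (\<lambda>c. vcomp V T (hom_from V C c) E) in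
     mk_vfun C H (\<lambda>c d. THE h.
       h \<in> Hom V' (jO j (VHom C d c)) (VHom (funcat V V' j T (vself V)) (H c) (H d)) \<and>
       (\<forall>t\<in>VObj T. snd (funcat_nat V' j T (vself V) (H c) (H d)) t \<cdot>\<^bsub>V'\<^esub> h =
          jA j (FA (hom_to V C (FO E t)) c d))))"

text \<open>
  \<open>is_weighted_limit V V' j T C A E L \<theta>\<close>: \<open>L\<close> is the limit \<open>{A, E}\<close> of \<open>E : T \<rightarrow> C\<close> weighted by \<open>A : T \<rightarrow> \<V>\<close>,
  with \<open>\<theta> b : C(b, L) \<cong> [T, \<V>](A, C(b, E -))\<close> natural in \<open>b\<close>. Since the right-hand side is in general only
  an object of \<open>\<V>'\<close>, this is an isomorphism of \<open>\<V>'\<close>-functors.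
\<close>

definition is_weighted_limit ::
  "('o, 'a) smcc \<Rightarrow> ('p, 'b) smcc \<Rightarrow> ('o, 'a, 'p, 'b) emb \<Rightarrow> ('t, 'o, 'a) vcat \<Rightarrow> ('c, 'o, 'a) vcat
   \<Rightarrow> ('t, 'o, 'a) vfun \<Rightarrow> ('t, 'c, 'a) vfun \<Rightarrow> 'c \<Rightarrow> ('c \<Rightarrow> 'b) \<Rightarrow> bool" where
  "is_weighted_limit V V' j T C A E L \<theta> \<longleftrightarrow> L \<in> VObj C \<and>
     vnat_iso_arr V' (vop V' (base_cat V' j C))
       (hom_to V' (base_cat V' j C) L)
       (vcomp V' (vop V' (base_cat V' j C))
          (hom_from V' (funcat V V' j T (vself V)) A) (hom_family V V' j T C E)) \<theta>"

definition admits_algebra_limits ::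
  "('o, 'a) smcc \<Rightarrow> ('p, 'b) smcc \<Rightarrow> ('o, 'a, 'p, 'b) emb \<Rightarrow> 'o set \<Rightarrow> ('o, 'o, 'a) vcat
   \<Rightarrow> ('c, 'o, 'a) vcat \<Rightarrow> bool" where
  "admits_algebra_limits V V' j \<J> T C \<longleftrightarrow>
     (\<forall>A\<in>algebras V \<J> T (vself V). \<forall>E\<in>algebras V \<J> T C. \<exists>L \<theta>. is_weighted_limit V V' j T C A E L \<theta>)"

text \<open>The \<open>\<V>\<close>-functor \<open>\<lbrakk>-, E\<rbrakk> : C\<^sup>o\<^sup>p \<rightarrow> T-Alg\<close>\<close>

definition bracket ::
  "('o, 'a) smcc \<Rightarrow> ('p, 'b) smcc \<Rightarrow> ('o, 'a, 'p, 'b) emb \<Rightarrow> 'o set \<Rightarrow> ('o, 'o, 'a) vcat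
   \<Rightarrow> ('c, 'o, 'a) vcat \<Rightarrow> ('o, 'c, 'a) vfun \<Rightarrow> ('c, ('o, 'o, 'a) vfun, 'a) vfun" where
  "bracket V V' j \<J> T C E =
    (let H = (\<lambda>c. vcomp V T (hom_from V C c) E) in
     mk_vfun C H (\<lambda>c d. THE h.
       h \<in> Hom V (VHom C d c) (VHom (alg V V' j \<J> T) (H c) (H d)) \<and>
       (\<forall>t\<in>VObj T. snd (alg_hom V V' j T (H c) (H d)) t \<cdot>\<^bsub>V\<^esub> h = FA (hom_to V C (FO E t)) c d)))"

definition RAdj ::
  "('o, 'a) smcc \<Rightarrow> ('p, 'b) smcc \<Rightarrow> ('o, 'a, 'p, 'b) emb \<Rightarrow> ('c, 'o, 'a) vcat \<Rightarrow> ('d, 'o, 'a) vcat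
   \<Rightarrow> (('c, 'd, 'a) vfun, 'p, 'b) vcat" where
  "RAdj V V' j A B = vfull (funcat V V' j A B) {R. is_right_adjoint V A B R}"

end

theory Submission
  imports Defs
begin

text \<open>
  The functor \<open>E \<mapsto> \<lbrakk>-, E\<rbrakk>\<close> is fully faithful by the Yoneda lemma: a natural family of homomorphisms
  \<open>\<lbrakk>c, E\<rbrakk> \<rightarrow> \<lbrakk>c, F\<rbrakk>\<close> is composition with the elements of \<open>C(E t, F t)\<close> that are its values at the
    identities of the
  \<open>E t\<close>, so that \<open>[T, C](E, F)\<close> has the universal property of \<open>[C\<^sup>o\<^sup>p, T-Alg](\<lbrakk>-, E\<rbrakk>, \<lbrakk>-, F\<rbrakk>)\<close>.
  It takes values in right adjoints because \<open>T-Alg(A, \<lbrakk>c, E\<rbrakk>) \<cong> C(c, {A, E})\<close>. Conversely, if \<open>L\<close> is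
    left adjoint to
  \<open>R\<close>, put \<open>E t = L (T(t, -))\<close>. Then \<open>C(c, E t) \<cong> T-Alg(T(t, -), R c) \<cong> (R c) t\<close>, naturally in \<open>c\<close>
    and \<open>t\<close>; hence
  \<open>E\<close> preserves powers, since every \<open>R c\<close> does, and \<open>\<lbrakk>-, E\<rbrakk> \<cong> R\<close>.
\<close>

section \<open>Symmetric monoidal closed categories\<close>

text \<open>Two bases are in play. \<open>T-Alg\<close> and the adjunctions live over
  \<open>V\<close>, whereas the homs on both sides of the equivalence are ends obtained from the
  completeness of \<open>V'\<close>. So full faithfulness is proved over \<open>V'\<close>, while
  the algebra \<open>E\<close> belonging to a right adjoint \<open>R\<close> and the isomorphism of
  \<open>\<lbrakk>-, E\<rbrakk>\<close> with \<open>R\<close> are built over \<open>V\<close> and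
  then carried along \<open>j\<close>. \<open>T-Alg\<close> can be used over \<open>V'\<close>
  because its homs are by definition ends in \<open>V'\<close> with vertex and projections from
  \<open>V\<close>, and because \<open>j\<close> preserves internal homs: an arrow from
  \<open>W\<close> into such a hom amounts to a compatible family of arrows
  \<open>W \<otimes> A t \<rightarrow> B t\<close>. Axioms phrased in terms of these actions hold
  over both bases. The representables \<open>T(t, -)\<close> are algebras because the identity of
  \<open>T\<close> is an algebra in \<open>T\<close>; they are the values of
  \<open>\<lbrakk>-, id\<rbrakk>\<close>. The homs of \<open>T-Alg\<close> and of
  \<open>[T, \<V>]\<close> are chosen independently, so the weighted limits, which mention
  \<open>[T, \<V>]\<close>, are moved to \<open>T-Alg\<close> along canonical isomorphisms of ends
  before they yield a left adjoint.\<close>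

context category
begin

text \<open>Typing is expressed by equations for \<open>Dom\<close> and \<open>Cod\<close>, so that
  the simplifier can discharge the side conditions of all later rules by rewriting.\<close>

lemma Hom_iff: "f \<in> Hom C X Y \<longleftrightarrow> f \<in> Arr C \<and> Dom C f = X \<and> Cod C f = Y"
  by (auto simp: Hom_def)

lemma arr_Hom: "f \<in> Arr C \<Longrightarrow> f \<in> Hom C (Dom C f) (Cod C f)"
  by (simp add: Hom_iff)

lemma dom_Obj' [simp]: "f \<in> Arr C \<Longrightarrow> Dom C f \<in> Obj C"
  and cod_Obj' [simp]: "f \<in> Arr C \<Longrightarrow> Cod C f \<in> Obj C"
  by (auto simp: dom_Obj cod_Obj)

lemma idn_simps [simp]:
  assumes "X \<in> Obj C"
  shows "Idn C X \<in> Arr C" "Dom C (Idn C X) = X" "Cod C (Idn C X) = X"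
  using idn_Hom[OF assms] by (auto simp: Hom_iff)

lemma cmp_simps [simp]:
  assumes "f \<in> Arr C" "g \<in> Arr C" "Dom C g = Cod C f"
  shows "g \<cdot> f \<in> Arr C" "Dom C (g \<cdot> f) = Dom C f" "Cod C (g \<cdot> f) = Cod C g"
  using cmp_Hom[of f "Dom C f" "Cod C f" g "Cod C g"] assms by (auto simp: Hom_iff)

lemma cmp_idn_simps [simp]:
  "\<lbrakk>f \<in> Arr C; Cod C f = X\<rbrakk> \<Longrightarrow> Idn C X \<cdot> f = f"
  "\<lbrakk>f \<in> Arr C; Dom C f = X\<rbrakk> \<Longrightarrow> f \<cdot> Idn C X = f"
  using cmp_idn_left cmp_idn_right by (auto simp: Hom_iff)

lemma assoc [simp]:
  "\<lbrakk>f \<in> Arr C; g \<in> Arr C; h \<in> Arr C; Dom C g = Cod C f; Dom C h = Cod C g\<rbrakk>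
   \<Longrightarrow> (h \<cdot> g) \<cdot> f = h \<cdot> g \<cdot> f"
  using cmp_assoc[of f "Dom C f" "Cod C f" g "Cod C g" h "Cod C h"] by (auto simp: Hom_iff)

lemma is_inverse_unique:
  assumes "is_inverse C f g" "is_inverse C f h" shows "g = h"
proof -
  have f: "f \<in> Arr C" "g \<in> Arr C" "h \<in> Arr C" "Dom C g = Cod C f" "Cod C g = Dom C f"
    "Dom C h = Cod C f" "Cod C h = Dom C f"
    using assms by (auto simp: is_inverse_def Hom_iff)
  have "g = g \<cdot> (f \<cdot> h)" using assms f by (simp add: is_inverse_def)
  also have "\<dots> = (g \<cdot> f) \<cdot> h" using f by simp
  also have "\<dots> = h" using assms f by (simp add: is_inverse_def del: assoc)
  finally show ?thesis .
qed

lemma is_inverse_sym: "is_inverse C f g \<Longrightarrow> is_inverse C g f"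
  by (auto simp: is_inverse_def Hom_iff)

lemma inv_arr_eq: "is_inverse C f g \<Longrightarrow> inv_arr C f = g"
  unfolding inv_arr_def using is_inverse_unique by blast

lemma is_inverse_inv: "is_iso C f \<Longrightarrow> is_inverse C f (inv_arr C f)"
  unfolding is_iso_def using inv_arr_eq by blast

lemma iso_Arr [simp]: "is_iso C f \<Longrightarrow> f \<in> Arr C"
  by (auto simp: is_iso_def is_inverse_def)

lemma inv_simps [simp]:
  assumes "is_iso C f"
  shows "inv_arr C f \<in> Arr C" "Dom C (inv_arr C f) = Cod C f" "Cod C (inv_arr C f) = Dom C f"
    "f \<cdot> inv_arr C f = Idn C (Cod C f)" "inv_arr C f \<cdot> f = Idn C (Dom C f)"
  using is_inverse_inv[OF assms] by (auto simp: is_inverse_def Hom_iff)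

lemma inv_cancel [simp]:
  assumes "is_iso C f"
  shows "\<lbrakk>g \<in> Arr C; Cod C g = Cod C f\<rbrakk> \<Longrightarrow> f \<cdot> inv_arr C f \<cdot> g = g"
    "\<lbrakk>g \<in> Arr C; Cod C g = Dom C f\<rbrakk> \<Longrightarrow> inv_arr C f \<cdot> f \<cdot> g = g"
  using assms by (simp_all add: assoc[symmetric] del: assoc)

lemma is_inverseI:
  "\<lbrakk>f \<in> Arr C; g \<in> Arr C; Dom C g = Cod C f; Cod C g = Dom C f;
    g \<cdot> f = Idn C (Dom C f); f \<cdot> g = Idn C (Cod C f)\<rbrakk> \<Longrightarrow> is_inverse C f g"
  by (auto simp: is_inverse_def Hom_iff)

lemma is_isoI:
  "\<lbrakk>f \<in> Arr C; g \<in> Arr C; Dom C g = Cod C f; Cod C g = Dom C f;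
    g \<cdot> f = Idn C (Dom C f); f \<cdot> g = Idn C (Cod C f)\<rbrakk> \<Longrightarrow> is_iso C f"
  unfolding is_iso_def using is_inverseI by blast

lemma iso_idn [simp]: "X \<in> Obj C \<Longrightarrow> is_iso C (Idn C X)"
  by (rule is_isoI[of _ "Idn C X"]) auto

lemma iso_inv [simp]: "is_iso C f \<Longrightarrow> is_iso C (inv_arr C f)"
  unfolding is_iso_def using inv_arr_eq is_inverse_sym by blast

lemma iso_cmp [simp]: "\<lbrakk>is_iso C f; is_iso C g; Dom C g = Cod C f\<rbrakk> \<Longrightarrow> is_iso C (g \<cdot> f)"
  by (rule is_isoI[of _ "inv_arr C f \<cdot> inv_arr C g"]) auto

lemma iso_epi: "\<lbrakk>f \<cdot> u = g \<cdot> u; is_iso C u; f \<in> Arr C; g \<in> Arr C; Dom C f = Cod C u; Dom C g = Cod C u\<rbrakk>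
   \<Longrightarrow> f = g"
  by (metis assoc inv_simps(1,3,4) iso_Arr inv_simps(2) cmp_idn_simps(2))

lemma iso_mono: "\<lbrakk>u \<cdot> f = u \<cdot> g; is_iso C u; f \<in> Arr C; g \<in> Arr C; Cod C f = Dom C u; Cod C g = Dom C u\<rbrakk>
   \<Longrightarrow> f = g"
  by (metis inv_cancel(2))

end

section \<open>Typing rules and unit coherences of a symmetric monoidal category\<close>

context smcc
begin

lemma ten_Obj' [simp]: "\<lbrakk>X \<in> Obj V; Y \<in> Obj V\<rbrakk> \<Longrightarrow> X \<otimes> Y \<in> Obj V"
  and unt_Obj' [simp]: "Unt V \<in> Obj V"
  and hm_Obj' [simp]: "\<lbrakk>X \<in> Obj V; Y \<in> Obj V\<rbrakk> \<Longrightarrow> Hm V X Y \<in> Obj V"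
  by (auto simp: ten_Obj unt_Obj hm_Obj)

lemma ten_simps [simp]:
  assumes "f \<in> Arr V" "g \<in> Arr V"
  shows "f \<boxtimes> g \<in> Arr V" "Dom V (f \<boxtimes> g) = Dom V f \<otimes> Dom V g" "Cod V (f \<boxtimes> g) = Cod V f \<otimes> Cod V g"
  using ten_Hom[OF assms[THEN arr_Hom]] by (auto simp: Hom_iff)

lemma ten_idn' [simp]: "\<lbrakk>X \<in> Obj V; Y \<in> Obj V\<rbrakk> \<Longrightarrow> Idn V X \<boxtimes> Idn V Y = Idn V (X \<otimes> Y)"
  by (rule ten_idn)

lemma ten_cmp' [simp]:
  assumes "f \<in> Arr V" "g \<in> Arr V" "f' \<in> Arr V" "g' \<in> Arr V" "Dom V g = Cod V f" "Dom V g' = Cod V f'"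
  shows "(g \<boxtimes> g') \<cdot> (f \<boxtimes> f') = (g \<cdot> f) \<boxtimes> (g' \<cdot> f')"
  using ten_cmp[of f "Dom V f" "Cod V f" g "Cod V g" f' "Dom V f'" "Cod V f'" g' "Cod V g'"] assms
  by (simp add: Hom_iff)

text \<open>Composites are normalised to the right, so the interchange law must also fire when a
  further arrow \<open>k\<close> follows inside. \<open>brd_cancel\<close>, \<open>pentagon2\<close>
  and \<open>asc_nat2\<close> exist for the same reason.\<close>

lemma ten_cmp2 [simp]:
  assumes "f \<in> Arr V" "g \<in> Arr V" "f' \<in> Arr V" "g' \<in> Arr V" "Dom V g = Cod V f" "Dom V g' = Cod V f'"
    "k \<in> Arr V" "Cod V k = Dom V f \<otimes> Dom V f'"
  shows "(g \<boxtimes> g') \<cdot> (f \<boxtimes> f') \<cdot> k = ((g \<cdot> f) \<boxtimes> (g' \<cdot> f')) \<cdot> k"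
  using assms assoc[of k "f \<boxtimes> f'" "g \<boxtimes> g'"] by (simp del: assoc)

lemma asc_simps [simp]:
  assumes "X \<in> Obj V" "Y \<in> Obj V" "Z \<in> Obj V"
  shows "Asc V X Y Z \<in> Arr V" "Dom V (Asc V X Y Z) = (X \<otimes> Y) \<otimes> Z" "Cod V (Asc V X Y Z) = X \<otimes> Y \<otimes> Z"
    "is_iso V (Asc V X Y Z)"
  using asc_Hom[OF assms] asc_iso[OF assms] by (auto simp: Hom_iff)

lemma lun_simps [simp]:
  assumes "X \<in> Obj V"
  shows "Lun V X \<in> Arr V" "Dom V (Lun V X) = Unt V \<otimes> X" "Cod V (Lun V X) = X" "is_iso V (Lun V X)"
    "Run V X \<in> Arr V" "Dom V (Run V X) = X \<otimes> Unt V" "Cod V (Run V X) = X" "is_iso V (Run V X)"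
  using lun_Hom[OF assms] lun_iso[OF assms] run_Hom[OF assms] run_iso[OF assms] by (auto simp: Hom_iff)

lemma brd_simps [simp]:
  assumes "X \<in> Obj V" "Y \<in> Obj V"
  shows "Brd V X Y \<in> Arr V" "Dom V (Brd V X Y) = X \<otimes> Y" "Cod V (Brd V X Y) = Y \<otimes> X"
    "Brd V Y X \<cdot> Brd V X Y = Idn V (X \<otimes> Y)"
  using brd_Hom[OF assms] brd_sym[OF assms] by (auto simp: Hom_iff)

lemma brd_cancel [simp]: "\<lbrakk>X \<in> Obj V; Y \<in> Obj V; k \<in> Arr V; Cod V k = X \<otimes> Y\<rbrakk>
    \<Longrightarrow> Brd V Y X \<cdot> Brd V X Y \<cdot> k = k"
  using assoc[of k "Brd V X Y" "Brd V Y X"] by (simp del: assoc)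

lemma iso_brd [simp]: "\<lbrakk>X \<in> Obj V; Y \<in> Obj V\<rbrakk> \<Longrightarrow> is_iso V (Brd V X Y)"
  by (rule is_isoI[of _ "Brd V Y X"]) auto

lemma ev_simps [simp]:
  assumes "X \<in> Obj V" "Y \<in> Obj V"
  shows "Ev V X Y \<in> Arr V" "Dom V (Ev V X Y) = Hm V X Y \<otimes> X" "Cod V (Ev V X Y) = Y"
  using ev_Hom[OF assms] by (auto simp: Hom_iff)

lemma asc_nat': "\<lbrakk>f \<in> Arr V; g \<in> Arr V; h \<in> Arr V\<rbrakk> \<Longrightarrow>
    Asc V (Cod V f) (Cod V g) (Cod V h) \<cdot> ((f \<boxtimes> g) \<boxtimes> h) =
    (f \<boxtimes> g \<boxtimes> h) \<cdot> Asc V (Dom V f) (Dom V g) (Dom V h)"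
  using asc_nat[OF arr_Hom arr_Hom arr_Hom] .

lemma brd_nat': "\<lbrakk>f \<in> Arr V; g \<in> Arr V\<rbrakk> \<Longrightarrow>
    Brd V (Cod V f) (Cod V g) \<cdot> (f \<boxtimes> g) = (g \<boxtimes> f) \<cdot> Brd V (Dom V f) (Dom V g)"
  using brd_nat[OF arr_Hom arr_Hom] .

lemma lun_nat': "f \<in> Arr V \<Longrightarrow> Lun V (Cod V f) \<cdot> (Idn V (Unt V) \<boxtimes> f) = f \<cdot> Lun V (Dom V f)"
  using lun_nat[OF arr_Hom] .

lemma run_nat': "f \<in> Arr V \<Longrightarrow> Run V (Cod V f) \<cdot> (f \<boxtimes> Idn V (Unt V)) = f \<cdot> Run V (Dom V f)"
  using run_nat[OF arr_Hom] .

lemma iso_ten [simp]: "\<lbrakk>is_iso V f; is_iso V g\<rbrakk> \<Longrightarrow> is_iso V (f \<boxtimes> g)"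
  by (rule is_isoI[of _ "inv_arr V f \<boxtimes> inv_arr V g"]) auto

lemma inv_eqI: "\<lbrakk>f \<in> Arr V; g \<in> Arr V; Dom V g = Cod V f; Cod V g = Dom V f;
    g \<cdot> f = Idn V (Dom V f); f \<cdot> g = Idn V (Cod V f)\<rbrakk> \<Longrightarrow> inv_arr V f = g"
  by (rule inv_arr_eq, rule is_inverseI)

text \<open>Naturality of \<open>Lun\<close> recovers \<open>f\<close> from
  \<open>I \<otimes> f\<close>, because \<open>Lun\<close> is invertible.\<close>

lemma unit_faithful_left:
  assumes "Idn V (Unt V) \<boxtimes> f = Idn V (Unt V) \<boxtimes> g" "f \<in> Arr V" "g \<in> Arr V"
    "Dom V f = Dom V g" "Cod V f = Cod V g"
  shows "f = g"
proof -
  have "f \<cdot> Lun V (Dom V f) = g \<cdot> Lun V (Dom V f)"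
    using lun_nat'[of f] lun_nat'[of g] assms by simp
  then show ?thesis by (rule iso_epi) (use assms in auto)
qed

lemma unit_faithful_right:
  assumes "f \<boxtimes> Idn V (Unt V) = g \<boxtimes> Idn V (Unt V)" "f \<in> Arr V" "g \<in> Arr V"
    "Dom V f = Dom V g" "Cod V f = Cod V g"
  shows "f = g"
proof -
  have "f \<cdot> Run V (Dom V f) = g \<cdot> Run V (Dom V f)"
    using run_nat'[of f] run_nat'[of g] assms by simp
  then show ?thesis by (rule iso_epi) (use assms in auto)
qed

text \<open>Kelly's argument that this unit law follows from pentagon and triangle. It suffices to
  prove it tensored with \<open>I\<close> on the left and precomposed with the invertible
  \<open>?w\<close>; the pentagon for \<open>I, I, X, Y\<close> and two triangles close the
  diagram.\<close>

lemma lun_ten: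
  assumes [simp]: "X \<in> Obj V" "Y \<in> Obj V"
  shows "Lun V (X \<otimes> Y) \<cdot> Asc V (Unt V) X Y = Lun V X \<boxtimes> Idn V Y"
proof -
  let ?I = "Unt V" and ?i = "Idn V (Unt V)"
  let ?w = "Asc V ?I (?I \<otimes> X) Y \<cdot> (Asc V ?I ?I X \<boxtimes> Idn V Y)"
  have "(?i \<boxtimes> (Lun V (X \<otimes> Y) \<cdot> Asc V ?I X Y)) \<cdot> ?w
      = (?i \<boxtimes> Lun V (X \<otimes> Y)) \<cdot> ((?i \<boxtimes> Asc V ?I X Y) \<cdot> ?w)"
    by simp
  also have "\<dots> = (?i \<boxtimes> Lun V (X \<otimes> Y)) \<cdot> (Asc V ?I ?I (X \<otimes> Y) \<cdot> Asc V (?I \<otimes> ?I) X Y)"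
    by (subst pentagon) simp_all
  also have "\<dots> = ((?i \<boxtimes> Lun V (X \<otimes> Y)) \<cdot> Asc V ?I ?I (X \<otimes> Y)) \<cdot> Asc V (?I \<otimes> ?I) X Y"
    by simp
  also have "\<dots> = (Run V ?I \<boxtimes> Idn V X \<boxtimes> Idn V Y) \<cdot> Asc V (?I \<otimes> ?I) X Y"
    by (subst triangle) simp_all
  also have "\<dots> = Asc V ?I X Y \<cdot> ((Run V ?I \<boxtimes> Idn V X) \<boxtimes> Idn V Y)"
    using asc_nat'[of "Run V ?I" "Idn V X" "Idn V Y"] by simp
  also have "\<dots> = Asc V ?I X Y \<cdot> (((?i \<boxtimes> Lun V X) \<cdot> Asc V ?I ?I X) \<boxtimes> Idn V Y)"
    by (subst triangle) simp_all
  also have "\<dots> = (Asc V ?I X Y \<cdot> ((?i \<boxtimes> Lun V X) \<boxtimes> Idn V Y)) \<cdot> (Asc V ?I ?I X \<boxtimes> Idn V Y)"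
    by simp
  also have "\<dots> = (?i \<boxtimes> (Lun V X \<boxtimes> Idn V Y)) \<cdot> ?w"
    using asc_nat'[of ?i "Lun V X" "Idn V Y"] by simp
  finally have "?i \<boxtimes> (Lun V (X \<otimes> Y) \<cdot> Asc V ?I X Y) = ?i \<boxtimes> (Lun V X \<boxtimes> Idn V Y)"
    by (rule iso_epi) auto
  then show ?thesis by (rule unit_faithful_left) auto
qed

text \<open>Naturality of \<open>Lun\<close> along itself gives
  \<open>I \<otimes> Lun I = Lun (I \<otimes> I)\<close>; then \<open>lun_ten\<close> and the
  triangle identify \<open>Lun I \<otimes> I\<close> with \<open>Run I \<otimes> I\<close>.\<close>

lemma lun_unit: "Lun V (Unt V) = Run V (Unt V)"
proof -
  let ?I = "Unt V" and ?i = "Idn V (Unt V)"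
  have "Lun V ?I \<cdot> (?i \<boxtimes> Lun V ?I) = Lun V ?I \<cdot> Lun V (?I \<otimes> ?I)"
    using lun_nat'[of "Lun V ?I"] by simp
  then have "?i \<boxtimes> Lun V ?I = Lun V (?I \<otimes> ?I)" by (rule iso_mono) auto
  then have "Lun V ?I \<boxtimes> ?i = Run V ?I \<boxtimes> ?i"
    using lun_ten[of ?I ?I] triangle[of ?I ?I] by simp
  then show ?thesis by (rule unit_faithful_right) auto
qed

text \<open>The hexagon for \<open>X, I, I\<close> and \<open>lun_ten\<close> give an equation with
  the braiding \<open>?b\<close> as outermost arrow on both sides; cancelling it leaves the claim
  tensored with \<open>I\<close>.\<close>

lemma lun_brd:
  assumes [simp]: "X \<in> Obj V"
  shows "Lun V X \<cdot> Brd V X (Unt V) = Run V X"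
proof -
  let ?I = "Unt V" and ?i = "Idn V (Unt V)" and ?b = "Brd V X (Unt V)"
  have "?b \<cdot> (Run V X \<boxtimes> ?i) = ?b \<cdot> ((Idn V X \<boxtimes> Lun V ?I) \<cdot> Asc V X ?I ?I)"
    by (subst triangle) simp_all
  also have "\<dots> = (?b \<cdot> (Idn V X \<boxtimes> Lun V ?I)) \<cdot> Asc V X ?I ?I" by simp
  also have "\<dots> = (Lun V ?I \<boxtimes> Idn V X) \<cdot> Brd V X (?I \<otimes> ?I) \<cdot> Asc V X ?I ?I"
    using brd_nat'[of "Idn V X" "Lun V ?I"] by simp
  also have "\<dots> = Lun V (?I \<otimes> X) \<cdot> (Asc V ?I ?I X \<cdot> Brd V X (?I \<otimes> ?I) \<cdot> Asc V X ?I ?I)"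
    by (subst lun_ten[symmetric]) simp_all
  also have "\<dots> = (Lun V (?I \<otimes> X) \<cdot> (?i \<boxtimes> ?b)) \<cdot> Asc V ?I X ?I \<cdot> (?b \<boxtimes> ?i)"
    by (subst hexagon) simp_all
  also have "\<dots> = ?b \<cdot> (Lun V (X \<otimes> ?I) \<cdot> Asc V ?I X ?I) \<cdot> (?b \<boxtimes> ?i)"
    using lun_nat'[of ?b] by simp
  also have "\<dots> = ?b \<cdot> ((Lun V X \<cdot> ?b) \<boxtimes> ?i)"
    by (subst lun_ten) simp_all
  finally have "Run V X \<boxtimes> ?i = (Lun V X \<cdot> ?b) \<boxtimes> ?i"
    by (rule iso_mono) auto
  then show ?thesis by (rule unit_faithful_right[symmetric]) auto
qed

end

section \<open>Coherence\<close>

text \<open>The elementary step of a shuffle: \<open>W\<close> passes \<open>X\<close> while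
  \<open>Y\<close> stays in place.\<close>

definition swp :: "('o, 'a, 'm) smcc_scheme \<Rightarrow> 'o \<Rightarrow> 'o \<Rightarrow> 'o \<Rightarrow> 'a" where
  "swp V W X Y = Asc V X W Y \<cdot>\<^bsub>V\<^esub> (Brd V W X \<boxtimes>\<^bsub>V\<^esub> Idn V Y) \<cdot>\<^bsub>V\<^esub> inv_arr V (Asc V W X Y)"

context smcc
begin

lemma swp_simps [simp]:
  assumes "W \<in> Obj V" "X \<in> Obj V" "Y \<in> Obj V"
  shows "swp V W X Y \<in> Arr V" "Dom V (swp V W X Y) = W \<otimes> X \<otimes> Y" "Cod V (swp V W X Y) = X \<otimes> W \<otimes> Y"
    "is_iso V (swp V W X Y)"
  using assms by (auto simp: swp_def)

lemma swp_asc: "\<lbrakk>W \<in> Obj V; X \<in> Obj V; Y \<in> Obj V\<rbrakk> \<Longrightarrow>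
    swp V W X Y \<cdot> Asc V W X Y = Asc V X W Y \<cdot> (Brd V W X \<boxtimes> Idn V Y)"
  by (simp add: swp_def)

lemma swp_asc2: "\<lbrakk>W \<in> Obj V; X \<in> Obj V; Y \<in> Obj V; k \<in> Arr V; Cod V k = (W \<otimes> X) \<otimes> Y\<rbrakk> \<Longrightarrow>
    swp V W X Y \<cdot> Asc V W X Y \<cdot> k = Asc V X W Y \<cdot> (Brd V W X \<boxtimes> Idn V Y) \<cdot> k"
  by (simp add: swp_def)

lemma pentagon2: "\<lbrakk>W \<in> Obj V; X \<in> Obj V; Y \<in> Obj V; Z \<in> Obj V; k \<in> Arr V; Cod V k = ((W \<otimes> X) \<otimes> Y) \<otimes> Z\<rbrakk>
      \<Longrightarrow> Asc V W X (Y \<otimes> Z) \<cdot> Asc V (W \<otimes> X) Y Z \<cdot> k =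
          (Idn V W \<boxtimes> Asc V X Y Z) \<cdot> Asc V W (X \<otimes> Y) Z \<cdot> (Asc V W X Y \<boxtimes> Idn V Z) \<cdot> k"
  using pentagon[of W X Y Z] assoc[of k "Asc V (W \<otimes> X) Y Z" "Asc V W X (Y \<otimes> Z)"]
  by simp

lemma asc_nat2: "\<lbrakk>f \<in> Arr V; g \<in> Arr V; h \<in> Arr V; k \<in> Arr V; Cod V k = (Dom V f \<otimes> Dom V g) \<otimes> Dom V h\<rbrakk> \<Longrightarrow>
    Asc V (Cod V f) (Cod V g) (Cod V h) \<cdot> ((f \<boxtimes> g) \<boxtimes> h) \<cdot> k =
    (f \<boxtimes> g \<boxtimes> h) \<cdot> Asc V (Dom V f) (Dom V g) (Dom V h) \<cdot> k"
  using asc_nat'[of f g h] assoc[of k "(f \<boxtimes> g) \<boxtimes> h" "Asc V (Cod V f) (Cod V g) (Cod V h)"] by simp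

lemma asc_inv_nat: "\<lbrakk>f \<in> Arr V; g \<in> Arr V; h \<in> Arr V\<rbrakk> \<Longrightarrow>
    inv_arr V (Asc V (Cod V f) (Cod V g) (Cod V h)) \<cdot> (f \<boxtimes> g \<boxtimes> h) =
    ((f \<boxtimes> g) \<boxtimes> h) \<cdot> inv_arr V (Asc V (Dom V f) (Dom V g) (Dom V h))"
  by (rule iso_epi[of _ "Asc V (Dom V f) (Dom V g) (Dom V h)"]) (simp_all flip: asc_nat')

lemma swp_nat:
  assumes [simp]: "f \<in> Arr V" "g \<in> Arr V" "h \<in> Arr V"
  shows "swp V (Cod V f) (Cod V g) (Cod V h) \<cdot> (f \<boxtimes> g \<boxtimes> h) = (g \<boxtimes> f \<boxtimes> h) \<cdot> swp V (Dom V f) (Dom V g)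
    (Dom V h)"
proof (rule iso_epi[of _ "Asc V (Dom V f) (Dom V g) (Dom V h)"])
  show "(swp V (Cod V f) (Cod V g) (Cod V h) \<cdot> (f \<boxtimes> g \<boxtimes> h)) \<cdot> Asc V (Dom V f) (Dom V g) (Dom V h) =
      ((g \<boxtimes> f \<boxtimes> h) \<cdot> swp V (Dom V f) (Dom V g) (Dom V h)) \<cdot> Asc V (Dom V f) (Dom V g) (Dom V h)"
    using asc_nat'[of f g h] brd_nat'[of f g] asc_nat2[of g f h "Brd V (Dom V f) (Dom V g) \<boxtimes> Idn V
      (Dom V h)"]
    by (simp add: swp_asc swp_asc2 flip: asc_nat')
qed auto

text \<open>\<open>coh_left\<close>, \<open>coh_mid\<close> and \<open>coh_right\<close> are the
  induction steps of \<open>shuf_assoc\<close>, according to which of the three factors absorbs the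
  next object \<open>W\<close>. In each, precomposing with \<open>?u\<close> makes one side of the
  pentagon appear.\<close>

lemma coh_left:
  assumes [simp]: "W \<in> Obj V" "A \<in> Obj V" "B \<in> Obj V" "C \<in> Obj V"
  shows "Asc V (W \<otimes> A) B C \<cdot> (inv_arr V (Asc V W A B) \<boxtimes> Idn V C) \<cdot> inv_arr V (Asc V W (A \<otimes> B) C) =
    inv_arr V (Asc V W A (B \<otimes> C)) \<cdot> (Idn V W \<boxtimes> Asc V A B C)" (is "?l = ?r")
proof (rule iso_epi)
  let ?u = "Asc V W (A \<otimes> B) C \<cdot> (Asc V W A B \<boxtimes> Idn V C)"
  have "?r \<cdot> ?u = inv_arr V (Asc V W A (B \<otimes> C)) \<cdot> ((Idn V W \<boxtimes> Asc V A B C) \<cdot> ?u)" by simp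
  also have "\<dots> = Asc V (W \<otimes> A) B C" by (subst pentagon[symmetric]) simp_all
  finally show "?l \<cdot> ?u = ?r \<cdot> ?u" by simp
qed auto

lemma coh_mid:
  assumes [simp]: "W \<in> Obj V" "A \<in> Obj V" "B \<in> Obj V" "C \<in> Obj V"
  shows "Asc V A (W \<otimes> B) C \<cdot> (swp V W A B \<boxtimes> Idn V C) \<cdot> inv_arr V (Asc V W (A \<otimes> B) C) =
    (Idn V A \<boxtimes> inv_arr V (Asc V W B C)) \<cdot> swp V W A (B \<otimes> C) \<cdot> (Idn V W \<boxtimes> Asc V A B C)" (is "?l = ?r")
proof (rule iso_epi)
  let ?u = "Asc V W (A \<otimes> B) C \<cdot> (Asc V W A B \<boxtimes> Idn V C)" and ?b = "Brd V W A"
  have "?r \<cdot> ?u = (Idn V A \<boxtimes> inv_arr V (Asc V W B C)) \<cdot> swp V W A (B \<otimes> C) \<cdot> ((Idn V W \<boxtimes> Asc V A B C)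
    \<cdot> ?u)" by simp
  also have "\<dots> = (Idn V A \<boxtimes> inv_arr V (Asc V W B C)) \<cdot> Asc V A W (B \<otimes> C) \<cdot>
     ((?b \<boxtimes> Idn V (B \<otimes> C)) \<cdot> Asc V (W \<otimes> A) B C)"
    by (subst pentagon[symmetric]) (simp_all add: swp_asc2)
  also have "\<dots> = (Idn V A \<boxtimes> inv_arr V (Asc V W B C)) \<cdot>
     (Asc V A W (B \<otimes> C) \<cdot> Asc V (A \<otimes> W) B C \<cdot> ((?b \<boxtimes> Idn V B) \<boxtimes> Idn V C))"
    using asc_nat'[of ?b "Idn V B" "Idn V C"] by simp
  also have "\<dots> = ?l \<cdot> ?u"
    by (subst pentagon2) (simp_all add: swp_asc)
  finally show "?l \<cdot> ?u = ?r \<cdot> ?u" by simp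
qed auto

lemma coh_right:
  assumes [simp]: "W \<in> Obj V" "A \<in> Obj V" "B \<in> Obj V" "C \<in> Obj V"
  shows "Asc V A B (W \<otimes> C) \<cdot> swp V W (A \<otimes> B) C =
    (Idn V A \<boxtimes> swp V W B C) \<cdot> swp V W A (B \<otimes> C) \<cdot> (Idn V W \<boxtimes> Asc V A B C)" (is "?l = ?r")
proof (rule iso_epi)
  let ?u = "Asc V W (A \<otimes> B) C \<cdot> (Asc V W A B \<boxtimes> Idn V C)" and ?b = "Brd V W A"
  let ?k = "(Idn V A \<boxtimes> Asc V B W C) \<cdot> Asc V A (B \<otimes> W) C"
  have "?r \<cdot> ?u = (Idn V A \<boxtimes> swp V W B C) \<cdot> swp V W A (B \<otimes> C) \<cdot> ((Idn V W \<boxtimes> Asc V A B C) \<cdot> ?u)" by simp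
  also have "\<dots> = (Idn V A \<boxtimes> swp V W B C) \<cdot> Asc V A W (B \<otimes> C) \<cdot>
     ((?b \<boxtimes> Idn V (B \<otimes> C)) \<cdot> Asc V (W \<otimes> A) B C)"
    by (subst pentagon[symmetric]) (simp_all add: swp_asc2)
  also have "\<dots> = (Idn V A \<boxtimes> swp V W B C) \<cdot>
     (Asc V A W (B \<otimes> C) \<cdot> Asc V (A \<otimes> W) B C \<cdot> ((?b \<boxtimes> Idn V B) \<boxtimes> Idn V C))"
    using asc_nat'[of ?b "Idn V B" "Idn V C"] by simp
  also have "\<dots> = (Idn V A \<boxtimes> Asc V B W C) \<cdot> ((Idn V A \<boxtimes> (Brd V W B \<boxtimes> Idn V C)) \<cdot> Asc V A (W \<otimes> B) C \<cdot>
      ((Asc V A W B \<cdot> (?b \<boxtimes> Idn V B)) \<boxtimes> Idn V C))"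
    by (subst pentagon2) (simp_all add: swp_asc)
  also have "\<dots> = ?k \<cdot> (((Idn V A \<boxtimes> Brd V W B) \<cdot> Asc V A W B \<cdot> (?b \<boxtimes> Idn V B)) \<boxtimes> Idn V C)"
    using asc_nat2[of "Idn V A" "Brd V W B" "Idn V C" "(Asc V A W B \<cdot> (?b \<boxtimes> Idn V B)) \<boxtimes> Idn V C"]
      by simp
  \<comment> \<open>The hexagon enters here: carrying \<open>W\<close> past \<open>A\<close> and
    then past \<open>B\<close> is the same as carrying it past \<open>A \<otimes> B\<close>.\<close>
  also have "\<dots> = ?k \<cdot> ((Asc V A B W \<cdot> Brd V W (A \<otimes> B) \<cdot> Asc V W A B) \<boxtimes> Idn V C)"
    by (subst hexagon) simp_all
  also have "\<dots> = ((Idn V A \<boxtimes> Asc V B W C) \<cdot> Asc V A (B \<otimes> W) C \<cdot> (Asc V A B W \<boxtimes> Idn V C) \<cdot>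
      ((Brd V W (A \<otimes> B) \<cdot> Asc V W A B) \<boxtimes> Idn V C))" by simp
  also have "\<dots> = Asc V A B (W \<otimes> C) \<cdot> Asc V (A \<otimes> B) W C \<cdot> ((Brd V W (A \<otimes> B) \<cdot> Asc V W A B) \<boxtimes> Idn V C)"
    by (subst pentagon2) simp_all
  also have "\<dots> = ?l \<cdot> ?u"
    by (simp add: swp_asc2)
  finally show "?l \<cdot> ?u = ?r \<cdot> ?u" by simp
qed auto

text \<open>First induction step of \<open>shuf_brd\<close>. The arrow \<open>?m\<close> is inverse
  to the left side by symmetry of the braiding, and the hexagon shows that the right side is a left
  inverse of \<open>?m\<close>; hence the two sides agree.\<close>

lemma coh_brd1:
  assumes [simp]: "W \<in> Obj V" "A \<in> Obj V" "B \<in> Obj V"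
  shows "Brd V (W \<otimes> A) B \<cdot> inv_arr V (Asc V W A B) = swp V W B A \<cdot> (Idn V W \<boxtimes> Brd V A B)" (is "?l = ?r")
proof -
  let ?m = "Asc V W A B \<cdot> Brd V B (W \<otimes> A)"
  have "?m \<cdot> Asc V B W A = (Idn V W \<boxtimes> Brd V B A) \<cdot> Asc V W B A \<cdot> (Brd V B W \<boxtimes> Idn V A)"
    using hexagon[of B W A] by simp
  then have "(?m \<cdot> Asc V B W A) \<cdot> inv_arr V (Asc V B W A)
    = ((Idn V W \<boxtimes> Brd V B A) \<cdot> Asc V W B A \<cdot> (Brd V B W \<boxtimes> Idn V A)) \<cdot> inv_arr V (Asc V B W A)" by simp
  then have m: "?m = (Idn V W \<boxtimes> Brd V B A) \<cdot> Asc V W B A \<cdot> (Brd V B W \<boxtimes> Idn V A) \<cdot> inv_arr V (Asc V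
    B W A)"
    by simp
  have "?r \<cdot> ?m = Idn V (B \<otimes> W \<otimes> A)"
    unfolding m by (simp add: swp_def)
  then have "(?r \<cdot> ?m) \<cdot> ?l = ?l" by (simp del: assoc)
  then show ?thesis by simp
qed

text \<open>Second induction step of \<open>shuf_brd\<close>, deduced from \<open>coh_brd1\<close>
  with \<open>A\<close> and \<open>B\<close> exchanged because the braiding is its own
  inverse.\<close>

lemma coh_brd2:
  assumes [simp]: "W \<in> Obj V" "A \<in> Obj V" "B \<in> Obj V"
  shows "Brd V A (W \<otimes> B) \<cdot> swp V W A B = inv_arr V (Asc V W B A) \<cdot> (Idn V W \<boxtimes> Brd V A B)"
proof -
  have "swp V W A B = swp V W A B \<cdot> (Idn V W \<boxtimes> Brd V B A) \<cdot> (Idn V W \<boxtimes> Brd V A B)" by simp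
  also have "\<dots> = Brd V (W \<otimes> B) A \<cdot> inv_arr V (Asc V W B A) \<cdot> (Idn V W \<boxtimes> Brd V A B)"
    using coh_brd1[of W B A] by (simp add: assoc[symmetric] del: assoc ten_cmp' ten_cmp2)
  finally show ?thesis by simp
qed

lemma coh_lun:
  assumes [simp]: "W \<in> Obj V" "B \<in> Obj V"
  shows "Lun V (W \<otimes> B) \<cdot> swp V W (Unt V) B = Idn V W \<boxtimes> Lun V B"
proof -
  have "Lun V (W \<otimes> B) \<cdot> swp V W (Unt V) B
    = (Lun V (W \<otimes> B) \<cdot> Asc V (Unt V) W B) \<cdot> (Brd V W (Unt V) \<boxtimes> Idn V B) \<cdot> inv_arr V (Asc V W (Unt V) B)"
    by (simp add: swp_def)
  also have "\<dots> = (Run V W \<boxtimes> Idn V B) \<cdot> inv_arr V (Asc V W (Unt V) B)"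
    by (subst lun_ten) (simp_all add: lun_brd)
  also have "\<dots> = ((Idn V W \<boxtimes> Lun V B) \<cdot> Asc V W (Unt V) B) \<cdot> inv_arr V (Asc V W (Unt V) B)"
    by (subst triangle) simp_all
  finally show ?thesis by simp
qed

end

text \<open>
  \<open>shuf V is s t\<close> is the canonical isomorphism from the tensor product over the disjoint union of
    the families
  \<open>s\<close> and \<open>t\<close>, taken in the order of the list \<open>is\<close>, to the tensor product of those over \<open>s\<close> and
    over \<open>t\<close>.
\<close>

primrec tns :: "('o, 'a, 'm) smcc_scheme \<Rightarrow> nat list \<Rightarrow> (nat \<Rightarrow> 'o option) \<Rightarrow> 'o" where
  "tns V [] s = Unt V"
| "tns V (i # is) s = (case s i of None \<Rightarrow> tns V is s | Some W \<Rightarrow> W \<otimes>\<^bsub>V\<^esub> tns V is s)"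

primrec shuf :: "('o, 'a, 'm) smcc_scheme \<Rightarrow> nat list \<Rightarrow> (nat \<Rightarrow> 'o option) \<Rightarrow> (nat \<Rightarrow> 'o option) \<Rightarrow> 'a" where
  "shuf V [] s t = inv_arr V (Lun V (Unt V))"
| "shuf V (i # is) s t =
    (case s i of
       Some W \<Rightarrow> inv_arr V (Asc V W (tns V is s) (tns V is t)) \<cdot>\<^bsub>V\<^esub> (Idn V W \<boxtimes>\<^bsub>V\<^esub> shuf V is s t)
     | None \<Rightarrow>
        (case t i of
           Some W \<Rightarrow> swp V W (tns V is s) (tns V is t) \<cdot>\<^bsub>V\<^esub> (Idn V W \<boxtimes>\<^bsub>V\<^esub> shuf V is s t)
         | None \<Rightarrow> shuf V is s t))"

context smcc
begin

lemma tns_Obj [simp]: "ran s \<subseteq> Obj V \<Longrightarrow> tns V is s \<in> Obj V"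
  by (induction "is") (auto split: option.splits simp: ran_def)

text \<open>\<open>shuf\<close> looks at \<open>s\<close> first, whereas \<open>++\<close> prefers
  its right argument; disjointness of the domains makes the two conventions agree.\<close>

lemma shuf_simps:
  assumes "ran s \<subseteq> Obj V" "ran t \<subseteq> Obj V" "dom s \<inter> dom t = {}"
  shows "is_iso V (shuf V is s t) \<and> Dom V (shuf V is s t) = tns V is (s ++ t) \<and>
     Cod V (shuf V is s t) = tns V is s \<otimes> tns V is t"
proof (induction "is")
  case (Cons i "is")
  have d: "s i = None \<or> t i = None" using assms(3) by auto
  have o: "\<And>W. s i = Some W \<Longrightarrow> W \<in> Obj V" "\<And>W. t i = Some W \<Longrightarrow> W \<in> Obj V"
    using assms by (auto simp: ran_def)
  show ?case using Cons assms d o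
    by (auto split: option.splits simp: map_add_def)
qed simp

lemma shuf_simps' [simp]:
  assumes "ran s \<subseteq> Obj V" "ran t \<subseteq> Obj V" "dom s \<inter> dom t = {}"
  shows "is_iso V (shuf V is s t)" "shuf V is s t \<in> Arr V" "Dom V (shuf V is s t) = tns V is (s ++ t)"
     "Cod V (shuf V is s t) = tns V is s \<otimes> tns V is t"
  using shuf_simps[OF assms] by auto

lemma ran_map_add_disj: "ran s \<subseteq> S \<Longrightarrow> ran t \<subseteq> S \<Longrightarrow> ran (s ++ t) \<subseteq> S"
  unfolding ran_def by (auto simp: map_add_Some_iff)

lemma shuf_unit:
  assumes "ran t \<subseteq> Obj V"
  shows "Lun V (tns V is t) \<cdot> shuf V is Map.empty t = Idn V (tns V is t)"
proof (induction "is")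
  case (Cons i "is")
  have e: "tns V is Map.empty = Unt V" for "is" by (induction "is") auto
  show ?case
  proof (cases "t i")
    case (Some W)
    then have [simp]: "W \<in> Obj V" using assms by (auto simp: ran_def)
    let ?B = "tns V is t"
    have [simp]: "?B \<in> Obj V" using assms by simp
    have "Lun V (W \<otimes> ?B) \<cdot> swp V W (Unt V) ?B \<cdot> (Idn V W \<boxtimes> shuf V is Map.empty t)
      = (Lun V (W \<otimes> ?B) \<cdot> swp V W (Unt V) ?B) \<cdot> (Idn V W \<boxtimes> shuf V is Map.empty t)"
      using assms by (simp add: e)
    also have "\<dots> = Idn V (W \<otimes> ?B)"
      using assms Cons by (subst coh_lun) (simp_all add: e)
    finally show ?thesis using Some by (simp add: e)
  qed (use Cons in simp)
qed simp

text \<open>Disjoint families satisfy \<open>s ++ t = t ++ s\<close>, so both shuffles start from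
  the same object and may be compared. The next object lies in \<open>s\<close>, in \<open>t\<close>
  or in neither, which gives \<open>coh_brd1\<close>, \<open>coh_brd2\<close> or nothing to
  do.\<close>

lemma shuf_brd:
  assumes "ran s \<subseteq> Obj V" "ran t \<subseteq> Obj V" "dom s \<inter> dom t = {}"
  shows "Brd V (tns V is s) (tns V is t) \<cdot> shuf V is s t = shuf V is t s"
proof (induction "is")
  case Nil
  \<comment> \<open>For empty families the braiding of \<open>I\<close> with itself has to vanish;
    \<open>lun_brd\<close> turns \<open>Lun\<close> into \<open>Run\<close>, and these agree on
    \<open>I\<close>.\<close>
  have "Lun V (Unt V) \<cdot> Brd V (Unt V) (Unt V) \<cdot> inv_arr V (Lun V (Unt V))
    = (Lun V (Unt V) \<cdot> Brd V (Unt V) (Unt V)) \<cdot> inv_arr V (Lun V (Unt V))" by simp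
  also have "\<dots> = Lun V (Unt V) \<cdot> inv_arr V (Lun V (Unt V))"
    by (subst lun_brd) (simp_all add: lun_unit)
  finally show ?case by (auto intro: iso_mono[of "Lun V (Unt V)"])
next
  case (Cons i "is")
  let ?s = "tns V is s" and ?t = "tns V is t" and ?m = "shuf V is s t"
  have [simp]: "?s \<in> Obj V" "?t \<in> Obj V" using assms by auto
  have c: "s ++ t = t ++ s" using assms by (intro map_add_comm) auto
  have d: "s i = None \<or> t i = None" using assms(3) by auto
  have o: "\<And>W. s i = Some W \<Longrightarrow> W \<in> Obj V" "\<And>W. t i = Some W \<Longrightarrow> W \<in> Obj V"
    using assms by (auto simp: ran_def)
  consider W where "s i = Some W" "t i = None" | W where "s i = None" "t i = Some W" | "s i =
    None" "t i = None"
    using d by fastforce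
  then show ?case
  proof cases
    case (1 W)
    then have [simp]: "W \<in> Obj V" using o by auto
    have "(Brd V (W \<otimes> ?s) ?t \<cdot> inv_arr V (Asc V W ?s ?t)) \<cdot> (Idn V W \<boxtimes> ?m)
       = swp V W ?t ?s \<cdot> (Idn V W \<boxtimes> (Brd V ?s ?t \<cdot> ?m))"
      by (subst coh_brd1) (use assms in simp_all)
    then show ?thesis using 1 assms Cons by simp
  next
    case (2 W)
    then have [simp]: "W \<in> Obj V" using o by auto
    have "(Brd V ?s (W \<otimes> ?t) \<cdot> swp V W ?s ?t) \<cdot> (Idn V W \<boxtimes> ?m)
       = inv_arr V (Asc V W ?t ?s) \<cdot> (Idn V W \<boxtimes> (Brd V ?s ?t \<cdot> ?m))"
      by (subst coh_brd2) (use assms in simp_all)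
    then show ?thesis using 2 assms Cons by simp
  qed (use Cons in simp)
qed

text \<open>This takes the place of a coherence theorem for associators. The empty case is the
  triangle at \<open>I\<close>; in the inductive step one of \<open>coh_left\<close>,
  \<open>coh_mid\<close>, \<open>coh_right\<close> moves the new object outward, and naturality
  brings the induction hypothesis into position.\<close>

lemma shuf_assoc:
  assumes "ran s \<subseteq> Obj V" "ran t \<subseteq> Obj V" "ran u \<subseteq> Obj V"
    "dom s \<inter> dom t = {}" "dom s \<inter> dom u = {}" "dom t \<inter> dom u = {}"
  shows "Asc V (tns V is s) (tns V is t) (tns V is u) \<cdot> (shuf V is s t \<boxtimes> Idn V (tns V is u)) \<cdot> shuf
    V is (s ++ t) u =
    (Idn V (tns V is s) \<boxtimes> shuf V is t u) \<cdot> shuf V is s (t ++ u)"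
proof (induction "is")
  case Nil
  let ?I = "Unt V" let ?l = "Lun V ?I"
  have "(Idn V ?I \<boxtimes> ?l) \<cdot> Asc V ?I ?I ?I \<cdot> (inv_arr V ?l \<boxtimes> Idn V ?I) =
    ((Idn V ?I \<boxtimes> ?l) \<cdot> Asc V ?I ?I ?I) \<cdot> (inv_arr V ?l \<boxtimes> Idn V ?I)" by simp
  also have "\<dots> = (Idn V ?I \<boxtimes> ?l) \<cdot> (Idn V ?I \<boxtimes> inv_arr V ?l)"
    by (subst triangle) (simp_all add: lun_unit[symmetric])
  finally have "Asc V ?I ?I ?I \<cdot> (inv_arr V ?l \<boxtimes> Idn V ?I) = Idn V ?I \<boxtimes> inv_arr V ?l"
    by (rule iso_mono) auto
  then have "(Asc V ?I ?I ?I \<cdot> (inv_arr V ?l \<boxtimes> Idn V ?I)) \<cdot> inv_arr V ?l = (Idn V ?I \<boxtimes> inv_arr V ?l)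
    \<cdot> inv_arr V ?l"
    by simp
  then show ?case by simp
next
  case (Cons i "is")
  let ?s = "tns V is s" and ?t = "tns V is t" and ?u = "tns V is u"
  let ?m = "shuf V is s t" and ?m' = "shuf V is (s ++ t) u"
  let ?n = "shuf V is t u" and ?n' = "shuf V is s (t ++ u)"
  let ?st = "tns V is (s ++ t)" and ?tu = "tns V is (t ++ u)"
  have [simp]: "?s \<in> Obj V" "?t \<in> Obj V" "?u \<in> Obj V" using assms by auto
  have r [simp]: "ran (s ++ t) \<subseteq> Obj V" "ran (t ++ u) \<subseteq> Obj V"
    using assms ran_map_add_disj by blast+
  have d: "dom (s ++ t) \<inter> dom u = {}" "dom s \<inter> dom (t ++ u) = {}"
    using assms by auto
  have m: "?m \<in> Arr V" "Dom V ?m = ?st" "Cod V ?m = ?s \<otimes> ?t"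
    "?m' \<in> Arr V" "Dom V ?m' = tns V is (s ++ t ++ u)" "Cod V ?m' = ?st \<otimes> ?u"
    "?n \<in> Arr V" "Dom V ?n = ?tu" "Cod V ?n = ?t \<otimes> ?u"
    "?n' \<in> Arr V" "Dom V ?n' = tns V is (s ++ t ++ u)" "Cod V ?n' = ?s \<otimes> ?tu"
    using assms d r by (simp_all)
  note [simp] = m
  have [simp]: "?st \<in> Obj V" "?tu \<in> Obj V" using r by auto
  have ma: "(x ++ y) i = (case y i of None \<Rightarrow> x i | Some z \<Rightarrow> Some z)" for x y :: "nat \<Rightarrow> 'o option"
    by (simp add: map_add_def)
  have o: "\<And>W. s i = Some W \<Longrightarrow> W \<in> Obj V" "\<And>W. t i = Some W \<Longrightarrow> W \<in> Obj V" "\<And>W. u i = Some W \<Longrightarrow> W \<in> Obj V"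
    using assms by (auto simp: ran_def)
  have "s i = None \<or> t i = None" "s i = None \<or> u i = None" "t i = None \<or> u i = None"
    using assms by auto
  then consider W where "s i = Some W" "t i = None" "u i = None"
    | W where "s i = None" "t i = Some W" "u i = None"
    | W where "s i = None" "t i = None" "u i = Some W" | "s i = None" "t i = None" "u i = None"
    by (cases "s i"; cases "t i"; cases "u i") auto
  then show ?case
  proof cases
    case (1 W)
    then have [simp]: "W \<in> Obj V" using o by auto
    have "Asc V (W \<otimes> ?s) ?t ?u \<cdot> ((inv_arr V (Asc V W ?s ?t) \<cdot> (Idn V W \<boxtimes> ?m)) \<boxtimes> Idn V ?u)
        \<cdot> inv_arr V (Asc V W ?st ?u) \<cdot> (Idn V W \<boxtimes> ?m')
      = Asc V (W \<otimes> ?s) ?t ?u \<cdot> (inv_arr V (Asc V W ?s ?t) \<boxtimes> Idn V ?u) \<cdot> (((Idn V W \<boxtimes> ?m) \<boxtimes> Idn V ?u)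
        \<cdot> inv_arr V (Asc V W ?st ?u)) \<cdot> (Idn V W \<boxtimes> ?m')" by simp
    also have "((Idn V W \<boxtimes> ?m) \<boxtimes> Idn V ?u) \<cdot> inv_arr V (Asc V W ?st ?u)
      = inv_arr V (Asc V W (?s \<otimes> ?t) ?u) \<cdot> (Idn V W \<boxtimes> ?m \<boxtimes> Idn V ?u)"
      using asc_inv_nat[of "Idn V W" ?m "Idn V ?u"] by simp
    also have "Asc V (W \<otimes> ?s) ?t ?u \<cdot> (inv_arr V (Asc V W ?s ?t) \<boxtimes> Idn V ?u) \<cdot>
       (inv_arr V (Asc V W (?s \<otimes> ?t) ?u) \<cdot> (Idn V W \<boxtimes> ?m \<boxtimes> Idn V ?u)) \<cdot> (Idn V W \<boxtimes> ?m')
      = (Asc V (W \<otimes> ?s) ?t ?u \<cdot> (inv_arr V (Asc V W ?s ?t) \<boxtimes> Idn V ?u) \<cdot>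
       inv_arr V (Asc V W (?s \<otimes> ?t) ?u)) \<cdot> (Idn V W \<boxtimes> ((?m \<boxtimes> Idn V ?u) \<cdot> ?m'))" by simp
    also have "\<dots> = inv_arr V (Asc V W ?s (?t \<otimes> ?u)) \<cdot> (Idn V W \<boxtimes> (Asc V ?s ?t ?u \<cdot> (?m \<boxtimes> Idn V ?u) \<cdot>
      ?m'))"
      by (subst coh_left) simp_all
    also have "\<dots> = inv_arr V (Asc V W ?s (?t \<otimes> ?u)) \<cdot> (Idn V W \<boxtimes> ((Idn V ?s \<boxtimes> ?n) \<cdot> ?n'))"
      using Cons by simp
    also have "\<dots> = (inv_arr V (Asc V W ?s (?t \<otimes> ?u)) \<cdot> (Idn V W \<boxtimes> Idn V ?s \<boxtimes> ?n)) \<cdot> (Idn V W \<boxtimes> ?n')"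
      by simp
    also have "inv_arr V (Asc V W ?s (?t \<otimes> ?u)) \<cdot> (Idn V W \<boxtimes> Idn V ?s \<boxtimes> ?n) =
       (Idn V (W \<otimes> ?s) \<boxtimes> ?n) \<cdot> inv_arr V (Asc V W ?s ?tu)"
      using asc_inv_nat[of "Idn V W" "Idn V ?s" ?n] by simp
    finally show ?thesis using 1 by (simp add: ma)
  next
    case (2 W)
    then have [simp]: "W \<in> Obj V" using o by auto
    have "Asc V ?s (W \<otimes> ?t) ?u \<cdot> ((swp V W ?s ?t \<cdot> (Idn V W \<boxtimes> ?m)) \<boxtimes> Idn V ?u)
        \<cdot> inv_arr V (Asc V W ?st ?u) \<cdot> (Idn V W \<boxtimes> ?m')
      = Asc V ?s (W \<otimes> ?t) ?u \<cdot> (swp V W ?s ?t \<boxtimes> Idn V ?u) \<cdot> (((Idn V W \<boxtimes> ?m) \<boxtimes> Idn V ?u)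
        \<cdot> inv_arr V (Asc V W ?st ?u)) \<cdot> (Idn V W \<boxtimes> ?m')" by simp
    also have "((Idn V W \<boxtimes> ?m) \<boxtimes> Idn V ?u) \<cdot> inv_arr V (Asc V W ?st ?u)
      = inv_arr V (Asc V W (?s \<otimes> ?t) ?u) \<cdot> (Idn V W \<boxtimes> ?m \<boxtimes> Idn V ?u)"
      using asc_inv_nat[of "Idn V W" ?m "Idn V ?u"] by simp
    also have "Asc V ?s (W \<otimes> ?t) ?u \<cdot> (swp V W ?s ?t \<boxtimes> Idn V ?u) \<cdot>
       (inv_arr V (Asc V W (?s \<otimes> ?t) ?u) \<cdot> (Idn V W \<boxtimes> ?m \<boxtimes> Idn V ?u)) \<cdot> (Idn V W \<boxtimes> ?m')
      = (Asc V ?s (W \<otimes> ?t) ?u \<cdot> (swp V W ?s ?t \<boxtimes> Idn V ?u) \<cdot>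
       inv_arr V (Asc V W (?s \<otimes> ?t) ?u)) \<cdot> (Idn V W \<boxtimes> ((?m \<boxtimes> Idn V ?u) \<cdot> ?m'))" by simp
    also have "\<dots> = (Idn V ?s \<boxtimes> inv_arr V (Asc V W ?t ?u)) \<cdot> swp V W ?s (?t \<otimes> ?u) \<cdot>
        (Idn V W \<boxtimes> (Asc V ?s ?t ?u \<cdot> (?m \<boxtimes> Idn V ?u) \<cdot> ?m'))"
      by (subst coh_mid) simp_all
    also have "\<dots> = (Idn V ?s \<boxtimes> inv_arr V (Asc V W ?t ?u)) \<cdot> swp V W ?s (?t \<otimes> ?u) \<cdot>
        (Idn V W \<boxtimes> ((Idn V ?s \<boxtimes> ?n) \<cdot> ?n'))"
      using Cons by simp
    also have "\<dots> = (Idn V ?s \<boxtimes> inv_arr V (Asc V W ?t ?u)) \<cdot> (swp V W ?s (?t \<otimes> ?u) \<cdot>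
        (Idn V W \<boxtimes> Idn V ?s \<boxtimes> ?n)) \<cdot> (Idn V W \<boxtimes> ?n')"
      by simp
    also have "swp V W ?s (?t \<otimes> ?u) \<cdot> (Idn V W \<boxtimes> Idn V ?s \<boxtimes> ?n) =
      (Idn V ?s \<boxtimes> Idn V W \<boxtimes> ?n) \<cdot> swp V W ?s ?tu"
      using swp_nat[of "Idn V W" "Idn V ?s" ?n] by simp
    finally show ?thesis using 2 by (simp add: ma)
  next
    case (3 W)
    then have [simp]: "W \<in> Obj V" using o by auto
    have "Asc V ?s ?t (W \<otimes> ?u) \<cdot> (?m \<boxtimes> Idn V (W \<otimes> ?u)) \<cdot> swp V W ?st ?u \<cdot> (Idn V W \<boxtimes> ?m')
      = Asc V ?s ?t (W \<otimes> ?u) \<cdot> ((?m \<boxtimes> Idn V (W \<otimes> ?u)) \<cdot> swp V W ?st ?u) \<cdot> (Idn V W \<boxtimes> ?m')" by simp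
    also have "(?m \<boxtimes> Idn V (W \<otimes> ?u)) \<cdot> swp V W ?st ?u = swp V W (?s \<otimes> ?t) ?u \<cdot> (Idn V W \<boxtimes> (?m \<boxtimes> Idn
      V ?u))"
      using swp_nat[of "Idn V W" ?m "Idn V ?u"] by simp
    also have "Asc V ?s ?t (W \<otimes> ?u) \<cdot> (swp V W (?s \<otimes> ?t) ?u \<cdot> (Idn V W \<boxtimes> (?m \<boxtimes> Idn V ?u))) \<cdot> (Idn V
      W \<boxtimes> ?m')
      = (Asc V ?s ?t (W \<otimes> ?u) \<cdot> swp V W (?s \<otimes> ?t) ?u) \<cdot> (Idn V W \<boxtimes> ((?m \<boxtimes> Idn V ?u) \<cdot> ?m'))" by simp
    also have "\<dots> = (Idn V ?s \<boxtimes> swp V W ?t ?u) \<cdot> swp V W ?s (?t \<otimes> ?u) \<cdot>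
        (Idn V W \<boxtimes> (Asc V ?s ?t ?u \<cdot> (?m \<boxtimes> Idn V ?u) \<cdot> ?m'))"
      by (subst coh_right) simp_all
    also have "\<dots> = (Idn V ?s \<boxtimes> swp V W ?t ?u) \<cdot> swp V W ?s (?t \<otimes> ?u) \<cdot>
        (Idn V W \<boxtimes> ((Idn V ?s \<boxtimes> ?n) \<cdot> ?n'))"
      using Cons by simp
    also have "\<dots> = (Idn V ?s \<boxtimes> swp V W ?t ?u) \<cdot> (swp V W ?s (?t \<otimes> ?u) \<cdot>
        (Idn V W \<boxtimes> Idn V ?s \<boxtimes> ?n)) \<cdot> (Idn V W \<boxtimes> ?n')"
      by simp
    also have "swp V W ?s (?t \<otimes> ?u) \<cdot> (Idn V W \<boxtimes> Idn V ?s \<boxtimes> ?n) =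
      (Idn V ?s \<boxtimes> Idn V W \<boxtimes> ?n) \<cdot> swp V W ?s ?tu"
      using swp_nat[of "Idn V W" "Idn V ?s" ?n] by simp
    finally show ?thesis using 3 by (simp add: ma)
  qed (use Cons in \<open>simp add: ma\<close>)
qed

end

section \<open>Generalised elements\<close>

text \<open>
  Arrows are compared on generalised elements: an element of \<open>X\<close> is a pair \<open>(s, a)\<close> of a family \<open>s\<close>
    of objects
  indexed by some of the \<open>names\<close> and an arrow \<open>a\<close> from the tensor product of \<open>s\<close> to \<open>X\<close>. Elements
    with disjoint
  families are paired by \<open>pr\<close> through the shuffle isomorphism. Ordering the factors by name makes
    pairing strictly
  associative, unital and commutative, so that associators, unitors and braidings disappear from all
    calculations by
  simplification. Four names suffice because no equation below involves more than four variables.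
\<close>

definition names :: "nat list" where "names = [0, 1, 2, 3]"

definition el :: "('o, 'a, 'm) smcc_scheme \<Rightarrow> (nat \<Rightarrow> 'o option) \<times> 'a \<Rightarrow> bool" where
  "el V x \<longleftrightarrow> ran (fst x) \<subseteq> Obj V \<and> snd x \<in> Arr V \<and> Dom V (snd x) = tns V names (fst x)"

definition ty :: "('o, 'a, 'm) smcc_scheme \<Rightarrow> (nat \<Rightarrow> 'o option) \<times> 'a \<Rightarrow> 'o" where
  "ty V x = Cod V (snd x)"

definition dj :: "(nat \<Rightarrow> 'o option) \<times> 'a \<Rightarrow> (nat \<Rightarrow> 'o option) \<times> 'a \<Rightarrow> bool" where
  "dj x y \<longleftrightarrow> dom (fst x) \<inter> dom (fst y) = {}"

definition app :: "('o, 'a, 'm) smcc_scheme \<Rightarrow> 'a \<Rightarrow> (nat \<Rightarrow> 'o option) \<times> 'a \<Rightarrow> (nat \<Rightarrow> 'o option) \<times> 'a"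
    (infixr "\<bullet>\<index>" 70) where
  "f \<bullet>\<^bsub>V\<^esub> x = (fst x, f \<cdot>\<^bsub>V\<^esub> snd x)"

definition pr :: "('o, 'a, 'm) smcc_scheme \<Rightarrow> (nat \<Rightarrow> 'o option) \<times> 'a \<Rightarrow> (nat \<Rightarrow> 'o option) \<times> 'a
    \<Rightarrow> (nat \<Rightarrow> 'o option) \<times> 'a" (infixr "\<odot>\<index>" 68) where
  "x \<odot>\<^bsub>V\<^esub> y = (fst x ++ fst y, (snd x \<boxtimes>\<^bsub>V\<^esub> snd y) \<cdot>\<^bsub>V\<^esub> shuf V names (fst x) (fst y))"

definition un :: "('o, 'a, 'm) smcc_scheme \<Rightarrow> (nat \<Rightarrow> 'o option) \<times> 'a" where
  "un V = (Map.empty, Idn V (Unt V))"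

lemma dj_simps [simp]:
  "dj (f \<bullet>\<^bsub>V\<^esub> x) y = dj x y" "dj y (f \<bullet>\<^bsub>V\<^esub> x) = dj y x"
  "dj (x \<odot>\<^bsub>V\<^esub> y) z \<longleftrightarrow> dj x z \<and> dj y z" "dj z (x \<odot>\<^bsub>V\<^esub> y) \<longleftrightarrow> dj z x \<and> dj z y"
  "dj (un V) x" "dj x (un V)"
  by (auto simp: dj_def app_def pr_def un_def)

context smcc
begin

lemma tns_empty [simp]: "tns V is Map.empty = Unt V"
  by (induction "is") auto

lemma el_un [simp]: "el V (un V)" "ty V (un V) = Unt V"
  by (auto simp: el_def ty_def un_def)

lemma ty_Obj [simp]: "el V x \<Longrightarrow> ty V x \<in> Obj V"
  by (auto simp: el_def ty_def)

lemma el_app [simp]: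
  assumes "el V x" "f \<in> Arr V" "Dom V f = ty V x"
  shows "el V (f \<bullet> x)" "ty V (f \<bullet> x) = Cod V f"
  using assms by (auto simp: el_def ty_def app_def)

lemma el_pr [simp]:
  assumes "el V x" "el V y" "dj x y"
  shows "el V (x \<odot> y)" "ty V (x \<odot> y) = ty V x \<otimes> ty V y"
  using assms ran_map_add_disj[of "fst x" "Obj V" "fst y"]
  by (auto simp: el_def ty_def pr_def dj_def)

lemma app_cmp [simp]:
  "\<lbrakk>el V x; f \<in> Arr V; g \<in> Arr V; Dom V f = ty V x; Dom V g = Cod V f\<rbrakk> \<Longrightarrow> (g \<cdot> f) \<bullet> x = g \<bullet> f \<bullet> x"
  by (auto simp: el_def ty_def app_def)

lemma app_idn [simp]: "\<lbrakk>el V x; ty V x = X\<rbrakk> \<Longrightarrow> Idn V X \<bullet> x = x"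
  by (auto simp: el_def ty_def app_def)

lemma app_inv [simp]:
  "\<lbrakk>el V x; is_iso V f; Dom V f = ty V x\<rbrakk> \<Longrightarrow> inv_arr V f \<bullet> f \<bullet> x = x"
  "\<lbrakk>el V x; is_iso V f; Cod V f = ty V x\<rbrakk> \<Longrightarrow> f \<bullet> inv_arr V f \<bullet> x = x"
  by (auto simp: el_def ty_def app_def)

lemma app_mono:
  "\<lbrakk>f \<bullet> x = f \<bullet> y; is_iso V f; el V x; el V y; Dom V f = ty V x; Dom V f = ty V y\<rbrakk> \<Longrightarrow> x = y"
  by (metis app_inv(1))

lemma app_ten [simp]:
  assumes "el V x" "el V y" "dj x y" "f \<in> Arr V" "g \<in> Arr V" "Dom V f = ty V x" "Dom V g = ty V y"
  shows "(f \<boxtimes> g) \<bullet> (x \<odot> y) = f \<bullet> x \<odot> g \<bullet> y"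
  using assms by (auto simp: el_def ty_def app_def pr_def dj_def)

text \<open>Equality here includes equality of the families, which holds since \<open>++\<close>
  commutes on disjoint ones. \<open>shuf_brd\<close> supplies the arrow part, and in the same way
  \<open>shuf_assoc\<close> and \<open>shuf_unit\<close> yield \<open>app_asc\<close> and
  \<open>app_lun\<close>.\<close>

lemma app_brd [simp]:
  assumes "el V x" "el V y" "dj x y" "ty V x = X" "ty V y = Y"
  shows "Brd V X Y \<bullet> (x \<odot> y) = y \<odot> x"
proof -
  have c: "fst x ++ fst y = fst y ++ fst x" using assms by (intro map_add_comm) (auto simp: dj_def)
  have d: "dom (fst y) \<inter> dom (fst x) = {}" using assms by (auto simp: dj_def)
  let ?s = "shuf V names (fst x) (fst y)"
  have s: "?s \<in> Arr V" "Cod V ?s = Dom V (snd x) \<otimes> Dom V (snd y)"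
    using assms by (auto simp: el_def dj_def)
  have "Brd V X Y \<cdot> (snd x \<boxtimes> snd y) \<cdot> ?s = (Brd V X Y \<cdot> (snd x \<boxtimes> snd y)) \<cdot> ?s"
    using assms s by (auto simp: el_def ty_def)
  also have "\<dots> = (snd y \<boxtimes> snd x) \<cdot> Brd V (Dom V (snd x)) (Dom V (snd y)) \<cdot> ?s"
    using brd_nat'[of "snd x" "snd y"] assms s by (auto simp: el_def ty_def)
  also have "Brd V (Dom V (snd x)) (Dom V (snd y)) \<cdot> ?s = shuf V names (fst y) (fst x)"
    using shuf_brd[of "fst x" "fst y" names] assms by (auto simp: el_def dj_def)
  finally show ?thesis using c by (simp add: app_def pr_def)
qed

lemma app_asc [simp]:
  assumes "el V x" "el V y" "el V z" "dj x y" "dj x z" "dj y z" "ty V x = X" "ty V y = Y" "ty V z = Z"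
  shows "Asc V X Y Z \<bullet> ((x \<odot> y) \<odot> z) = x \<odot> y \<odot> z"
proof -
  let ?s = "fst x" and ?t = "fst y" and ?u = "fst z" and ?x = "snd x" and ?y = "snd y" and ?z = "snd z"
  have h: "ran ?s \<subseteq> Obj V" "ran ?t \<subseteq> Obj V" "ran ?u \<subseteq> Obj V"
    "dom ?s \<inter> dom ?t = {}" "dom ?s \<inter> dom ?u = {}" "dom ?t \<inter> dom ?u = {}"
    using assms by (auto simp: el_def dj_def)
  have r: "ran (?s ++ ?t) \<subseteq> Obj V" "ran (?t ++ ?u) \<subseteq> Obj V" "dom (?s ++ ?t) \<inter> dom ?u = {}"
    "dom ?s \<inter> dom (?t ++ ?u) = {}"
    using ran_map_add_disj h by (blast, blast, auto)
  note [simp] = shuf_simps'[OF h(1,2,4)] shuf_simps'[OF r(1) h(3) r(3)]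
    shuf_simps'[OF h(2,3,6)] shuf_simps'[OF h(1) r(2,4)]
  have [simp]: "?x \<in> Arr V" "?y \<in> Arr V" "?z \<in> Arr V" "Dom V ?x = tns V names ?s" "Dom V ?y =
    tns V names ?t"
    "Dom V ?z = tns V names ?u" "Cod V ?x = X" "Cod V ?y = Y" "Cod V ?z = Z"
    "tns V names ?s \<in> Obj V" "tns V names ?t \<in> Obj V" "tns V names ?u \<in> Obj V"
    using assms by (auto simp: el_def ty_def)
  have [simp]: "X \<in> Obj V" "Y \<in> Obj V" "Z \<in> Obj V" using assms by auto
  let ?m = "shuf V names ?s ?t" and ?m' = "shuf V names (?s ++ ?t) ?u"
  have "Asc V X Y Z \<cdot> (((?x \<boxtimes> ?y) \<cdot> ?m) \<boxtimes> ?z) \<cdot> ?m'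
     = Asc V X Y Z \<cdot> ((?x \<boxtimes> ?y) \<boxtimes> ?z) \<cdot> (?m \<boxtimes> Idn V (tns V names ?u)) \<cdot> ?m'"
    by simp
  also have "\<dots> = (?x \<boxtimes> ?y \<boxtimes> ?z) \<cdot> (Asc V (tns V names ?s) (tns V names ?t) (tns V names ?u) \<cdot>
      (?m \<boxtimes> Idn V (tns V names ?u)) \<cdot> ?m')"
    using asc_nat2[of ?x ?y ?z "(?m \<boxtimes> Idn V (tns V names ?u)) \<cdot> ?m'"] by simp
  also have "\<dots> = (?x \<boxtimes> ((?y \<boxtimes> ?z) \<cdot> shuf V names ?t ?u)) \<cdot> shuf V names ?s (?t ++ ?u)"
    by (subst shuf_assoc[OF h]) simp
  finally show ?thesis by (simp add: app_def pr_def)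
qed

lemma app_lun [simp]:
  assumes "el V x" "ty V x = X"
  shows "Lun V X \<bullet> (un V \<odot> x) = x"
proof -
  let ?s = "shuf V names Map.empty (fst x)"
  have s: "?s \<in> Arr V" "Cod V ?s = Unt V \<otimes> Dom V (snd x)"
    using assms by (auto simp: el_def)
  have "Lun V X \<cdot> (Idn V (Unt V) \<boxtimes> snd x) \<cdot> ?s = (Lun V X \<cdot> (Idn V (Unt V) \<boxtimes> snd x)) \<cdot> ?s"
    using assms s by (auto simp: el_def ty_def)
  also have "\<dots> = snd x \<cdot> Lun V (Dom V (snd x)) \<cdot> ?s"
    using lun_nat'[of "snd x"] assms s by (auto simp: el_def ty_def)
  also have "\<dots> = snd x"
    using shuf_unit[of "fst x" names] assms by (auto simp: el_def)
  finally show ?thesis by (simp add: app_def pr_def un_def)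
qed

lemma app_run [simp]:
  assumes "el V x" "ty V x = X"
  shows "Run V X \<bullet> (x \<odot> un V) = x"
proof -
  have [simp]: "X \<in> Obj V" using assms by auto
  show ?thesis using assms by (simp add: lun_brd[symmetric])
qed

lemma app_inv_coh [simp]:
  "\<lbrakk>el V x; ty V x = X\<rbrakk> \<Longrightarrow> inv_arr V (Lun V X) \<bullet> x = un V \<odot> x"
  "\<lbrakk>el V x; ty V x = X\<rbrakk> \<Longrightarrow> inv_arr V (Run V X) \<bullet> x = x \<odot> un V"
  by (rule app_mono[of "Lun V X"]; force) (rule app_mono[of "Run V X"]; force)

text \<open>An element whose arrow is invertible is generic: agreement on it is agreement
  everywhere.\<close>

lemma ext0:
  assumes "f \<bullet> x = g \<bullet> x" "is_iso V (snd x)" "el V x" "f \<in> Arr V" "g \<in> Arr V" "Dom V f =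
    ty V x" "Dom V g = ty V x"
  shows "f = g"
  using assms by (auto simp: app_def ty_def intro: iso_epi)

text \<open>The arrow is \<open>Run V X\<close> and not an identity because the tensor product over
  a family with the single entry \<open>X\<close> is \<open>X \<otimes> I\<close>.\<close>

definition gen :: "nat \<Rightarrow> 'o \<Rightarrow> (nat \<Rightarrow> 'o option) \<times> 'a" where
  "gen i X = ([i \<mapsto> X], Run V X)"

lemma gen [simp]:
  assumes "i < 4" "X \<in> Obj V"
  shows "el V (gen i X)" "ty V (gen i X) = X" "is_iso V (snd (gen i X))"
proof -
  have "i \<in> {0, 1, 2, 3}" using assms by auto
  then show "el V (gen i X)" using assms by (auto simp: el_def gen_def names_def)
  show "ty V (gen i X) = X" "is_iso V (snd (gen i X))"
    using assms by (auto simp: gen_def ty_def)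
qed

lemma gen_dj [simp]: "i \<noteq> k \<Longrightarrow> dj (gen i X) (gen k Y)"
  by (auto simp: gen_def dj_def)

lemma iso_pr [simp]:
  "\<lbrakk>is_iso V (snd x); is_iso V (snd y); el V x; el V y; dj x y\<rbrakk> \<Longrightarrow> is_iso V (snd (x \<odot> y))"
  by (auto simp: pr_def el_def dj_def)

lemma iso_un [simp]: "is_iso V (snd (un V))"
  by (simp add: un_def)

text \<open>The hypothesis asks for all elements, so that callers may reason about an arbitrary
  variable; it is applied to the generic element only. The variants below pair generic elements with
  distinct names, or use \<open>un V\<close> for a factor \<open>I\<close>.\<close>

lemma ext1:
  assumes "f \<in> Arr V" "g \<in> Arr V" "Dom V f = X" "Dom V g = X"
    "\<And>x. \<lbrakk>el V x; ty V x = X\<rbrakk> \<Longrightarrow> f \<bullet> x = g \<bullet> x"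
  shows "f = g"
proof -
  have [simp]: "X \<in> Obj V" using assms dom_Obj by blast
  show ?thesis by (rule ext0[of _ "gen 0 X"], rule assms(5)) (use assms(1-4) \<open>X \<in> Obj V\<close> in simp_all)
qed

lemma extU:
  assumes "f \<in> Arr V" "g \<in> Arr V" "Dom V f = Unt V" "Dom V g = Unt V"  "f \<bullet> un V = g \<bullet> un V"
  shows "f = g"
  by (rule ext0[of _ "un V"]) (use assms in simp_all)

lemma ext2:
  assumes "f \<in> Arr V" "g \<in> Arr V" "Dom V f = X \<otimes> Y" "Dom V g = X \<otimes> Y" "X \<in> Obj V" "Y \<in> Obj V"
    "\<And>x y. \<lbrakk>el V x; el V y; ty V x = X; ty V y = Y; dj x y; dj y x\<rbrakk> \<Longrightarrow> f \<bullet> (x \<odot> y) = g \<bullet> (x \<odot> y)"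
  shows "f = g"
  by (rule ext0[of _ "gen 0 X \<odot> gen 1 Y"], rule assms(7)) (use assms(1-6) in simp_all)

lemma ext2L:
  assumes "f \<in> Arr V" "g \<in> Arr V" "Dom V f = Unt V \<otimes> X" "Dom V g = Unt V \<otimes> X" "X \<in> Obj V"
    "\<And>x. \<lbrakk>el V x; ty V x = X\<rbrakk> \<Longrightarrow> f \<bullet> (un V \<odot> x) = g \<bullet> (un V \<odot> x)"
  shows "f = g"
  by (rule ext0[of _ "un V \<odot> gen 0 X"], rule assms(6)) (use assms(1-5) in simp_all)

lemma ext2R:
  assumes "f \<in> Arr V" "g \<in> Arr V" "Dom V f = X \<otimes> Unt V" "Dom V g = X \<otimes> Unt V" "X \<in> Obj V"
    "\<And>x. \<lbrakk>el V x; ty V x = X\<rbrakk> \<Longrightarrow> f \<bullet> (x \<odot> un V) = g \<bullet> (x \<odot> un V)"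
  shows "f = g"
  by (rule ext0[of _ "gen 0 X \<odot> un V"], rule assms(6)) (use assms(1-5) in simp_all)

lemma ext3:
  assumes "f \<in> Arr V" "g \<in> Arr V" "Dom V f = (X \<otimes> Y) \<otimes> Z" "Dom V g = (X \<otimes> Y) \<otimes> Z"
    "X \<in> Obj V" "Y \<in> Obj V" "Z \<in> Obj V"
    "\<And>x y z. \<lbrakk>el V x; el V y; el V z; ty V x = X; ty V y = Y; ty V z = Z; dj x y; dj y x; dj x z;
      dj z x; dj y z; dj z y\<rbrakk>
      \<Longrightarrow> f \<bullet> ((x \<odot> y) \<odot> z) = g \<bullet> ((x \<odot> y) \<odot> z)"
  shows "f = g"
  by (rule ext0[of _ "(gen 0 X \<odot> gen 1 Y) \<odot> gen 2 Z"], rule assms(8)) (use assms(1-7) in simp_all)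

lemma ext4:
  assumes "f \<in> Arr V" "g \<in> Arr V" "Dom V f = ((X \<otimes> Y) \<otimes> Z) \<otimes> W" "Dom V g = ((X \<otimes> Y) \<otimes> Z) \<otimes> W"
    "X \<in> Obj V" "Y \<in> Obj V" "Z \<in> Obj V" "W \<in> Obj V"
    "\<And>x y z w. \<lbrakk>el V x; el V y; el V z; el V w; ty V x = X; ty V y = Y; ty V z = Z; ty V w = W;
      dj x y; dj y x; dj x z; dj z x; dj y z; dj z y; dj x w; dj w x; dj y w; dj w y; dj z w; dj w z\<rbrakk>
      \<Longrightarrow> f \<bullet> (((x \<odot> y) \<odot> z) \<odot> w) = g \<bullet> (((x \<odot> y) \<odot> z) \<odot> w)"
  shows "f = g"
  by (rule ext0[of _ "((gen 0 X \<odot> gen 1 Y) \<odot> gen 2 Z) \<odot> gen 3 W"], rule assms(9)) (use assms(1-8) in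
    simp_all)

section \<open>Currying on elements\<close>

lemma ev_univ':
  assumes "f \<in> Arr V" "Dom V f = X \<otimes> Y" "Cod V f = Z" "X \<in> Obj V" "Y \<in> Obj V"
  shows "\<exists>!g. g \<in> Hom V X (Hm V Y Z) \<and> Ev V Y Z \<cdot> (g \<boxtimes> Idn V Y) = f"
  by (rule ev_univ) (use assms in \<open>auto simp: Hom_iff\<close>)

lemma curry_simps [simp]:
  assumes "f \<in> Arr V" "Dom V f = X \<otimes> Y" "Cod V f = Z" "X \<in> Obj V" "Y \<in> Obj V"
  shows "curry_arr V X Y Z f \<in> Arr V" "Dom V (curry_arr V X Y Z f) = X" "Cod V (curry_arr V X Y Z f)
    = Hm V Y Z"
    "Ev V Y Z \<cdot> (curry_arr V X Y Z f \<boxtimes> Idn V Y) = f"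
  using theI'[OF ev_univ'[OF assms], folded curry_arr_def] by (simp_all add: Hom_iff)

lemma curry_app [simp]:
  assumes "f \<in> Arr V" "Dom V f = X \<otimes> Y" "Cod V f = Z" "el V x" "el V y" "ty V x = X" "ty V y =
    Y" "dj x y"
  shows "Ev V Y Z \<bullet> (curry_arr V X Y Z f \<bullet> x \<odot> y) = f \<bullet> (x \<odot> y)"
proof -
  have [simp]: "X \<in> Obj V" "Y \<in> Obj V" "Z \<in> Obj V" using assms by auto
  have "f \<bullet> (x \<odot> y) = (Ev V Y Z \<cdot> (curry_arr V X Y Z f \<boxtimes> Idn V Y)) \<bullet> (x \<odot> y)"
    using assms by (subst curry_simps) auto
  also have "\<dots> = Ev V Y Z \<bullet> (curry_arr V X Y Z f \<bullet> x \<odot> y)"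
    using assms by (simp del: curry_simps(4))
  finally show ?thesis by simp
qed

lemma ev_inj:
  assumes "Ev V Y Z \<cdot> (g \<boxtimes> Idn V Y) = Ev V Y Z \<cdot> (h \<boxtimes> Idn V Y)" "g \<in> Arr V" "h \<in> Arr V"
    "Dom V g = Dom V h" "Cod V g = Hm V Y Z" "Cod V h = Hm V Y Z" "Y \<in> Obj V" "Z \<in> Obj V"
  shows "g = h"
proof -
  have "\<exists>!k. k \<in> Hom V (Dom V h) (Hm V Y Z) \<and> Ev V Y Z \<cdot> (k \<boxtimes> Idn V Y) = Ev V Y Z \<cdot> (h \<boxtimes> Idn V Y)"
    by (rule ev_univ') (use assms(2-) in simp_all)
  moreover have "g \<in> Hom V (Dom V h) (Hm V Y Z)" "h \<in> Hom V (Dom V h) (Hm V Y Z)"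
    using assms by (simp_all add: Hom_iff)
  ultimately show ?thesis using assms(1) by blast
qed

text \<open>The uniqueness half of the closed structure, read on elements. \<open>curry_ext2\<close>
  and \<open>curry_extU\<close> treat domains that are a tensor product or the unit, where the
  variable may be split or dropped.\<close>

lemma curry_ext:
  assumes "g \<in> Arr V" "h \<in> Arr V" "Dom V g = X" "Dom V h = X"
    "Cod V g = Hm V Y Z" "Cod V h = Hm V Y Z" "Y \<in> Obj V" "Z \<in> Obj V"
    "\<And>x y. \<lbrakk>el V x; el V y; ty V x = X; ty V y = Y; dj x y; dj y x\<rbrakk>
      \<Longrightarrow> Ev V Y Z \<bullet> (g \<bullet> x \<odot> y) = Ev V Y Z \<bullet> (h \<bullet> x \<odot> y)"
  shows "g = h"
proof (rule ev_inj[of Y Z])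
  have [simp]: "X \<in> Obj V" using assms dom_Obj by blast
  show "Ev V Y Z \<cdot> (g \<boxtimes> Idn V Y) = Ev V Y Z \<cdot> (h \<boxtimes> Idn V Y)"
    by (rule ext2[of _ _ X Y]) (use assms in simp_all)
qed (use assms in auto)

lemma curry_ext2:
  assumes "g \<in> Arr V" "h \<in> Arr V" "Dom V g = W \<otimes> X" "Dom V h = W \<otimes> X" "W \<in> Obj V" "X \<in> Obj V"
    "Cod V g = Hm V Y Z" "Cod V h = Hm V Y Z" "Y \<in> Obj V" "Z \<in> Obj V"
    "\<And>w x y. \<lbrakk>el V w; el V x; el V y; ty V w = W; ty V x = X; ty V y = Y;
        dj w x; dj x w; dj w y; dj y w; dj x y; dj y x\<rbrakk>
      \<Longrightarrow> Ev V Y Z \<bullet> (g \<bullet> (w \<odot> x) \<odot> y) = Ev V Y Z \<bullet> (h \<bullet> (w \<odot> x) \<odot> y)"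
  shows "g = h"
proof (rule ev_inj[of Y Z])
  show "Ev V Y Z \<cdot> (g \<boxtimes> Idn V Y) = Ev V Y Z \<cdot> (h \<boxtimes> Idn V Y)"
    by (rule ext3[of _ _ W X Y]) (use assms in simp_all)
qed (use assms in auto)

lemma curry_extU:
  assumes "g \<in> Arr V" "h \<in> Arr V" "Dom V g = Unt V" "Dom V h = Unt V"
    "Cod V g = Hm V Y Z" "Cod V h = Hm V Y Z" "Y \<in> Obj V" "Z \<in> Obj V"
    "\<And>y. \<lbrakk>el V y; ty V y = Y\<rbrakk> \<Longrightarrow> Ev V Y Z \<bullet> (g \<bullet> un V \<odot> y) = Ev V Y Z \<bullet> (h \<bullet> un V \<odot> y)"
  shows "g = h"
proof (rule ev_inj[of Y Z])
  show "Ev V Y Z \<cdot> (g \<boxtimes> Idn V Y) = Ev V Y Z \<cdot> (h \<boxtimes> Idn V Y)"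
    by (rule ext2L[of _ _ Y]) (use assms in simp_all)
qed (use assms in auto)

end

section \<open>Enriched categories\<close>

lemma mk_vfun_simps [simp]:
  "x \<in> VObj C \<Longrightarrow> FO (mk_vfun C a b) x = a x"
  "\<lbrakk>x \<in> VObj C; y \<in> VObj C\<rbrakk> \<Longrightarrow> FA (mk_vfun C a b) x y = b x y"
  by (auto simp: mk_vfun_def)

lemma mk_vfun_idem [simp]: "mk_vfun C (FO (mk_vfun C a b)) (FA (mk_vfun C a b)) = mk_vfun C a b"
  by (simp add: mk_vfun_def fun_eq_iff)

lemma mk_vfun_cong:
  "\<lbrakk>VObj C = VObj D; \<And>x. x \<in> VObj C \<Longrightarrow> a x = a' x; \<And>x y. x \<in> VObj C \<Longrightarrow> y \<in> VObj C \<Longrightarrow> b x y = b' x y\<rbrakk>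
   \<Longrightarrow> mk_vfun C a b = mk_vfun D a' b'"
  by (auto simp: mk_vfun_def fun_eq_iff)

context vcategory
begin

lemma vhom_Obj' [simp]: "\<lbrakk>x \<in> VObj C; y \<in> VObj C\<rbrakk> \<Longrightarrow> VHom C x y \<in> Obj V"
  by (rule vhom_Obj)

lemma vidn_simps [simp]:
  assumes "x \<in> VObj C"
  shows "VIdn C x \<in> Arr V" "Dom V (VIdn C x) = Unt V" "Cod V (VIdn C x) = VHom C x x"
  using vidn_Hom[OF assms] by (auto simp: Hom_iff)

lemma vcmp_simps [simp]:
  assumes "x \<in> VObj C" "y \<in> VObj C" "z \<in> VObj C"
  shows "VCmp C x y z \<in> Arr V" "Dom V (VCmp C x y z) = VHom C y z \<otimes> VHom C x y"
    "Cod V (VCmp C x y z) = VHom C x z"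
  using vcmp_Hom[OF assms] by (auto simp: Hom_iff)

text \<open>Directed so that nested composites are bracketed to the right. Together with the unit
  and functor laws as rewrite rules this lets the simplifier settle equations between
  composites.\<close>

lemma vassoc [simp]:
  assumes "w \<in> VObj C" "x \<in> VObj C" "y \<in> VObj C" "z \<in> VObj C" "el V h" "el V g" "el V f"
    "ty V h = VHom C y z" "ty V g = VHom C x y" "ty V f = VHom C w x" "dj h g" "dj h f" "dj g f"
  shows "VCmp C w x z \<bullet> (VCmp C x y z \<bullet> (h \<odot> g) \<odot> f) = VCmp C w y z \<bullet> (h \<odot> VCmp C w x y \<bullet> (g \<odot> f))"
  using arg_cong[OF vcmp_assoc[OF assms(1-4)], of "\<lambda>k. k \<bullet> ((h \<odot> g) \<odot> f)"] assms by simp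

lemma vid_left [simp]:
  assumes "x \<in> VObj C" "y \<in> VObj C" "el V f" "ty V f = VHom C x y"
  shows "VCmp C x y y \<bullet> (VIdn C y \<bullet> un V \<odot> f) = f"
  using arg_cong[OF vcmp_vidn_left[OF assms(1-2)], of "\<lambda>k. k \<bullet> (un V \<odot> f)"] assms by simp

lemma vid_right [simp]:
  assumes "x \<in> VObj C" "y \<in> VObj C" "el V f" "ty V f = VHom C x y"
  shows "VCmp C x x y \<bullet> (f \<odot> VIdn C x \<bullet> un V) = f"
  using arg_cong[OF vcmp_vidn_right[OF assms(1-2)], of "\<lambda>k. k \<bullet> (f \<odot> un V)"] assms by simp

end

context
  fixes V :: "('o, 'a) smcc" (structure)
  assumes V: "smcc V"
begin

interpretation smcc V by (rule V)

lemma vcmp_el_app: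
  assumes "VCmp C x y z \<in> Arr V" "Dom V (VCmp C x y z) = VHom C y z \<otimes> VHom C x y"
    "b \<in> Arr V" "Dom V b = Unt V" "Cod V b = VHom C y z" "a \<in> Arr V" "Dom V a = Unt V" "Cod V a =
      VHom C x y"
  shows "vcmp_el V C x y z b a \<in> Arr V" "Dom V (vcmp_el V C x y z b a) = Unt V"
    "Cod V (vcmp_el V C x y z b a) = Cod V (VCmp C x y z)"
    "vcmp_el V C x y z b a \<bullet> un V = VCmp C x y z \<bullet> (b \<bullet> un V \<odot> a \<bullet> un V)"
  using assms by (auto simp: vcmp_el_def)

end

text \<open>Associativity stays an equation of arrows here, because in \<open>vself V\<close> and in
  categories of natural transformations it is proved through a universal property
  (\<open>ev_inj\<close>, \<open>p_mono\<close>), which speaks of arrows. The unit laws can be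
  passed on to elements afterwards.\<close>

lemma vcategoryI:
  fixes V :: "('o, 'a) smcc" (structure)
  assumes "smcc V"
    and hom: "\<And>x y. \<lbrakk>x \<in> VObj C; y \<in> VObj C\<rbrakk> \<Longrightarrow> VHom C x y \<in> Obj V"
    and idn: "\<And>x. x \<in> VObj C \<Longrightarrow> VIdn C x \<in> Arr V \<and> Dom V (VIdn C x) = Unt V \<and> Cod V (VIdn C x) =
      VHom C x x"
    and cmp: "\<And>x y z. \<lbrakk>x \<in> VObj C; y \<in> VObj C; z \<in> VObj C\<rbrakk> \<Longrightarrow> VCmp C x y z \<in> Arr V \<and>
      Dom V (VCmp C x y z) = VHom C y z \<otimes> VHom C x y \<and> Cod V (VCmp C x y z) = VHom C x z"
    and ass: "\<And>w x y z. \<lbrakk>w \<in> VObj C; x \<in> VObj C; y \<in> VObj C; z \<in> VObj C\<rbrakk> \<Longrightarrow>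
      VCmp C w x z \<cdot> (VCmp C x y z \<boxtimes> Idn V (VHom C w x)) =
          VCmp C w y z \<cdot> (Idn V (VHom C y z) \<boxtimes> VCmp C w x y) \<cdot> Asc V (VHom C y z) (VHom C x y) (VHom
            C w x)"
    and idl: "\<And>x y f. \<lbrakk>x \<in> VObj C; y \<in> VObj C; el V f; ty V f = VHom C x y\<rbrakk> \<Longrightarrow>
      VCmp C x y y \<bullet> (VIdn C y \<bullet> un V \<odot> f) = f"
    and idr: "\<And>x y f. \<lbrakk>x \<in> VObj C; y \<in> VObj C; el V f; ty V f = VHom C x y\<rbrakk> \<Longrightarrow>
      VCmp C x x y \<bullet> (f \<odot> VIdn C x \<bullet> un V) = f"
  shows "vcategory V C"
proof -
  interpret smcc V by fact
  show ?thesis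
  proof (unfold_locales, goal_cases)
    case (1 x y) then show ?case using hom by simp
  next
    case (2 x) then show ?case using idn by (simp add: Hom_iff)
  next
    case (3 x y z) then show ?case using cmp by (simp add: Hom_iff)
  next
    case (4 w x y z) then show ?case using ass by simp
  next
    case (5 x y)
    then show ?case using idn cmp hom idl by (intro ext2L[of _ _ "VHom C x y"]) simp_all
  next
    case (6 x y)
    then show ?case using idn cmp hom idr by (intro ext2R[of _ _ "VHom C x y"]) simp_all
  qed
qed

lemma vcategoryI_el:
  fixes V :: "('o, 'a) smcc" (structure)
  assumes "smcc V"
    and hom: "\<And>x y. \<lbrakk>x \<in> VObj C; y \<in> VObj C\<rbrakk> \<Longrightarrow> VHom C x y \<in> Obj V"
    and idn: "\<And>x. x \<in> VObj C \<Longrightarrow> VIdn C x \<in> Arr V \<and> Dom V (VIdn C x) = Unt V \<and> Cod V (VIdn C x) =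
      VHom C x x"
    and cmp: "\<And>x y z. \<lbrakk>x \<in> VObj C; y \<in> VObj C; z \<in> VObj C\<rbrakk> \<Longrightarrow> VCmp C x y z \<in> Arr V \<and>
      Dom V (VCmp C x y z) = VHom C y z \<otimes> VHom C x y \<and> Cod V (VCmp C x y z) = VHom C x z"
    and ass: "\<And>w x y z h g f. \<lbrakk>w \<in> VObj C; x \<in> VObj C; y \<in> VObj C; z \<in> VObj C; el V h; el V g; el V f;
       ty V h = VHom C y z; ty V g = VHom C x y; ty V f = VHom C w x;
       dj h g; dj g h; dj h f; dj f h; dj g f; dj f g\<rbrakk> \<Longrightarrow>
      VCmp C w x z \<bullet> (VCmp C x y z \<bullet> (h \<odot> g) \<odot> f) = VCmp C w y z \<bullet> (h \<odot> VCmp C w x y \<bullet> (g \<odot> f))"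
    and idl: "\<And>x y f. \<lbrakk>x \<in> VObj C; y \<in> VObj C; el V f; ty V f = VHom C x y\<rbrakk> \<Longrightarrow>
      VCmp C x y y \<bullet> (VIdn C y \<bullet> un V \<odot> f) = f"
    and idr: "\<And>x y f. \<lbrakk>x \<in> VObj C; y \<in> VObj C; el V f; ty V f = VHom C x y\<rbrakk> \<Longrightarrow>
      VCmp C x x y \<bullet> (f \<odot> VIdn C x \<bullet> un V) = f"
  shows "vcategory V C"
proof -
  interpret smcc V by fact
  show ?thesis
  proof (rule vcategoryI, goal_cases)
    case (5 w x y z) then show ?case using hom cmp ass
      by (intro ext3[of _ _ "VHom C y z" "VHom C x y" "VHom C w x"]) simp_all
  qed (simp_all add: assms(1) hom idn cmp idl idr)
qed

section \<open>The category \<open>V\<close> enriched in itself, and opposites\<close>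

lemma vself_simps [simp]: "VObj (vself V) = Obj V" "VHom (vself V) = Hm V"
  by (auto simp: vself_def)

lemma vop_simps [simp]: "VObj (vop V C) = VObj C" "VHom (vop V C) x y = VHom C y x" "VIdn (vop V C)
  = VIdn C"
  by (auto simp: vop_def)

context
  fixes V :: "('o, 'a) smcc" (structure)
  assumes V: "smcc V"
begin

interpretation smcc V by (rule V)

lemma vself_idn:
  assumes "X \<in> Obj V"
  shows "VIdn (vself V) X \<in> Arr V" "Dom V (VIdn (vself V) X) = Unt V" "Cod V (VIdn (vself V) X) =
    Hm V X X"
  using assms by (auto simp: vself_def)

lemma vself_cmp:
  assumes "X \<in> Obj V" "Y \<in> Obj V" "Z \<in> Obj V"
  shows "VCmp (vself V) X Y Z \<in> Arr V" "Dom V (VCmp (vself V) X Y Z) = Hm V Y Z \<otimes> Hm V X Y"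
    "Cod V (VCmp (vself V) X Y Z) = Hm V X Z"
  using assms by (auto simp: vself_def)

lemma vself_idn_ev:
  "\<lbrakk>el V x; ty V x = X\<rbrakk> \<Longrightarrow> Ev V X X \<bullet> (VIdn (vself V) X \<bullet> un V \<odot> x) = x"
  using ty_Obj[of x] by (auto simp: vself_def)

lemma vself_cmp_ev:
  assumes "el V x" "ty V x = X" "el V f" "ty V f = Hm V X Y" "el V g" "ty V g = Hm V Y Z"
    "X \<in> Obj V" "Y \<in> Obj V" "Z \<in> Obj V" "dj g f" "dj f x" "dj g x"
  shows "Ev V X Z \<bullet> (VCmp (vself V) X Y Z \<bullet> (g \<odot> f) \<odot> x) = Ev V Y Z \<bullet> (g \<odot> Ev V X Y \<bullet> (f \<odot> x))"
  using assms by (simp add: vself_def)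

end

lemma vcategory_vself:
  fixes V :: "('o, 'a) smcc" (structure)
  assumes "smcc V" shows "vcategory V (vself V)"
proof -
  interpret smcc V by fact
  note [simp] = vself_idn[OF assms] vself_cmp[OF assms] vself_idn_ev[OF assms] vself_cmp_ev[OF assms]
  show ?thesis
  proof (rule vcategoryI[OF assms], goal_cases)
    case (4 W X Y Z)
    show ?case
    proof (rule ev_inj[of W Z], goal_cases)
      case 1 show ?case
        by (rule ext4[of _ _ "Hm V Y Z" "Hm V X Y" "Hm V W X" W]) (use 4 in simp_all)
    qed (use 4 in simp_all)
  next
    case (5 X Y f)
    \<comment> \<open>The given element \<open>f\<close> may already use every name, leaving none
      for the variable at which to evaluate. So the law is first shown as an equation of arrows,
      tested on fresh generic elements, and then applied to \<open>f\<close>. This pattern recurs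
      throughout.\<close>
    have "VCmp (vself V) X Y Y \<cdot> (VIdn (vself V) Y \<boxtimes> Idn V (Hm V X Y)) \<cdot> inv_arr V (Lun V (Hm V X Y))
      = Idn V (Hm V X Y)"
      by (rule curry_ext[of _ _ "Hm V X Y" X Y]) (use 5 in simp_all)
    from arg_cong[OF this, of "\<lambda>k. k \<bullet> f"] show ?case using 5 by simp
  next
    case (6 X Y f)
    have "VCmp (vself V) X X Y \<cdot> (Idn V (Hm V X Y) \<boxtimes> VIdn (vself V) X) \<cdot> inv_arr V (Run V (Hm V X Y))
      = Idn V (Hm V X Y)"
      by (rule curry_ext[of _ _ "Hm V X Y" X Y]) (use 6 in simp_all)
    from arg_cong[OF this, of "\<lambda>k. k \<bullet> f"] show ?case using 6 by simp
  qed auto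
qed

context vcategory
begin

lemmas vself_lemmas [simp] = vself_idn[OF smcc_axioms] vself_cmp[OF smcc_axioms]
  vself_idn_ev[OF smcc_axioms] vself_cmp_ev[OF smcc_axioms]

lemma vop_cmp [simp]:
  assumes "x \<in> VObj C" "y \<in> VObj C" "z \<in> VObj C"
  shows "VCmp (vop V C) x y z \<in> Arr V" "Dom V (VCmp (vop V C) x y z) = VHom C z y \<otimes> VHom C y x"
    "Cod V (VCmp (vop V C) x y z) = VHom C z x"
  using assms by (auto simp: vop_def)

lemma vop_cmp_app [simp]:
  assumes "x \<in> VObj C" "y \<in> VObj C" "z \<in> VObj C" "el V g" "el V f" "dj g f" "ty V g =
    VHom C z y" "ty V f = VHom C y x"
  shows "VCmp (vop V C) x y z \<bullet> (g \<odot> f) = VCmp C z y x \<bullet> (f \<odot> g)"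
  using assms by (auto simp: vop_def)

lemma vcategory_vop: "vcategory V (vop V C)"
  by (rule vcategoryI_el) (use smcc_axioms in simp_all)

end

lemma vfunctorI:
  fixes V :: "('o, 'a) smcc" (structure)
  assumes "vcategory V C" "vcategory V D" "F = mk_vfun C Fo Fa"
    and ob: "\<And>x. x \<in> VObj C \<Longrightarrow> Fo x \<in> VObj D"
    and ar: "\<And>x y. \<lbrakk>x \<in> VObj C; y \<in> VObj C\<rbrakk>
      \<Longrightarrow> Fa x y \<in> Arr V \<and> Dom V (Fa x y) = VHom C x y \<and> Cod V (Fa x y) = VHom D (Fo x) (Fo y)"
    and id: "\<And>x. x \<in> VObj C \<Longrightarrow> Fa x x \<bullet> VIdn C x \<bullet> un V = VIdn D (Fo x) \<bullet> un V"
    and cm: "\<And>x y z g f. \<lbrakk>x \<in> VObj C; y \<in> VObj C; z \<in> VObj C; el V g; el V f; ty V g = VHom C y z;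
      ty V f = VHom C x y;
       dj g f; dj f g\<rbrakk> \<Longrightarrow> Fa x z \<bullet> VCmp C x y z \<bullet> (g \<odot> f) = VCmp D (Fo x) (Fo y) (Fo z) \<bullet> (Fa y z \<bullet> g
         \<odot> Fa x y \<bullet> f)"
  shows "vfunctor V C D F"
proof -
  interpret C: vcategory V C by fact
  interpret D: vcategory V D by fact
  show ?thesis
  proof (unfold_locales, goal_cases)
    case (3 x) then show ?case using ob ar id by (intro C.extU) (simp_all add: assms(3))
  next
    case (4 x y z)
    then show ?case using ob ar cm by (intro C.ext2[of _ _ "VHom C y z" "VHom C x y"]) (simp_all
      add: assms(3))
  qed (use ob ar in \<open>simp_all add: assms(3) C.Hom_iff\<close>)
qed

context vfunctor
begin

lemma FO_VObj' [simp]: "x \<in> VObj C \<Longrightarrow> FO F x \<in> VObj D"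
  by (rule FO_VObj)

lemma FA_simps [simp]:
  assumes "x \<in> VObj C" "y \<in> VObj C"
  shows "FA F x y \<in> Arr V" "Dom V (FA F x y) = VHom C x y" "Cod V (FA F x y) = VHom D (FO F x) (FO F y)"
  using FA_Hom[OF assms] by (auto simp: dom.Hom_iff)

lemma FO_undef: "x \<notin> VObj C \<Longrightarrow> FO F x = undefined"
  using arg_cong[OF ext, of "\<lambda>F. FO F x"] by (simp add: mk_vfun_def)

lemma FA_undef: "x \<notin> VObj C \<or> y \<notin> VObj C \<Longrightarrow> FA F x y = undefined"
  using arg_cong[OF ext, of "\<lambda>F. FA F x y"] by (auto simp: mk_vfun_def)

lemma FA_id [simp]: "x \<in> VObj C \<Longrightarrow> FA F x x \<bullet> VIdn C x \<bullet> un V = VIdn D (FO F x) \<bullet> un V"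
  using arg_cong[OF FA_vidn, of x "\<lambda>k. k \<bullet> un V"] by simp

lemma FA_cmp [simp]:
  assumes "x \<in> VObj C" "y \<in> VObj C" "z \<in> VObj C" "el V g" "el V f" "ty V g = VHom C y z" "ty V f =
    VHom C x y" "dj g f"
  shows "FA F x z \<bullet> VCmp C x y z \<bullet> (g \<odot> f) = VCmp D (FO F x) (FO F y) (FO F z) \<bullet> (FA F y z \<bullet> g \<odot> FA
    F x y \<bullet> f)"
  using arg_cong[OF FA_vcmp, of x y z "\<lambda>k. k \<bullet> (g \<odot> f)"] assms by simp

end

section \<open>Identity, composite, representable and opposite functors\<close>

lemma vfunctor_vid: assumes "vcategory V C" shows "vfunctor V C C (vid V C)"
proof -
  interpret vcategory V C by fact
  show ?thesis by (rule vfunctorI[OF assms assms vid_def]) simp_all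
qed

lemma vfunctor_vcomp:
  assumes "vfunctor V C D F" "vfunctor V D E G" shows "vfunctor V C E (vcomp V C G F)"
proof -
  interpret F: vfunctor V C D F by fact
  interpret G: vfunctor V D E G by fact
  show ?thesis
    by (rule vfunctorI[OF F.dom.vcategory_axioms G.cod.vcategory_axioms vcomp_def]) simp_all
qed

text \<open>Gives functoriality of the contravariant hom from that of the covariant one in the
  opposite category.\<close>

lemma hom_to_eq: "hom_to V C c = hom_from V (vop V C) c"
  by (auto simp: hom_to_def hom_from_def vop_def mk_vfun_def fun_eq_iff)

context vcategory
begin

lemma vfunctor_hom_from:
  assumes [simp]: "c \<in> VObj C" shows "vfunctor V C (vself V) (hom_from V C c)"
proof (rule vfunctorI[OF vcategory_axioms vcategory_vself[OF smcc_axioms] hom_from_def], goal_cases)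
  case (3 x)
  then have "curry_arr V (VHom C x x) (VHom C c x) (VHom C c x) (VCmp C c x x) \<cdot> VIdn C x =
    VIdn (vself V) (VHom C c x)"
    by (intro curry_extU[of _ _ "VHom C c x" "VHom C c x"]) simp_all
  from arg_cong[OF this, of "\<lambda>k. k \<bullet> un V"] 3 show ?case by simp
next
  case (4 x y z g f)
  let ?h = "\<lambda>x y. curry_arr V (VHom C x y) (VHom C c x) (VHom C c y) (VCmp C c x y)"
  have "?h x z \<cdot> VCmp C x y z = VCmp (vself V) (VHom C c x) (VHom C c y) (VHom C c z) \<cdot> (?h y z \<boxtimes> ?h
    x y)"
    using 4 by (intro curry_ext2[of _ _ "VHom C y z" "VHom C x y" "VHom C c x" "VHom C c z"]) simp_all
  from arg_cong[OF this, of "\<lambda>k. k \<bullet> (g \<odot> f)"] 4 show ?case by simp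
qed simp_all

lemma hom_from_simps [simp]:
  "x \<in> VObj C \<Longrightarrow> FO (hom_from V C c) x = VHom C c x"
  by (simp add: hom_from_def)

lemma hom_from_ev [simp]:
  assumes "x \<in> VObj C" "y \<in> VObj C" "c \<in> VObj C" "el V g" "el V f" "ty V g = VHom C x y" "ty V f =
    VHom C c x" "dj g f"
  shows "Ev V (VHom C c x) (VHom C c y) \<bullet> (FA (hom_from V C c) x y \<bullet> g \<odot> f) = VCmp C c x y \<bullet> (g \<odot> f)"
  using assms by (simp add: hom_from_def)

lemma vfunctor_hom_to: "c \<in> VObj C \<Longrightarrow> vfunctor V (vop V C) (vself V) (hom_to V C c)"
  unfolding hom_to_eq using vcategory.vfunctor_hom_from[OF vcategory_vop] by simp

lemma hom_to_simps [simp]: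
  "x \<in> VObj C \<Longrightarrow> FO (hom_to V C c) x = VHom C x c"
  by (simp add: hom_to_def)

lemma hom_to_ev [simp]:
  assumes "x \<in> VObj C" "y \<in> VObj C" "c \<in> VObj C" "el V g" "el V f" "ty V g = VHom C y x" "ty V f =
    VHom C x c" "dj g f"
  shows "Ev V (VHom C x c) (VHom C y c) \<bullet> (FA (hom_to V C c) x y \<bullet> g \<odot> f) = VCmp C y x c \<bullet> (f \<odot> g)"
  using assms by (simp add: hom_to_def)

end

lemma vfunctor_vop:
  assumes "vfunctor V C D F" shows "vfunctor V (vop V C) (vop V D) (vop_fun F)"
proof -
  interpret F: vfunctor V C D F by fact
  have "vop_fun F = mk_vfun (vop V C) (FO F) (\<lambda>x y. FA F y x)"
    using F.FO_undef F.FA_undef by (auto simp: vop_fun_def mk_vfun_def fun_eq_iff)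
  then show ?thesis
    by (rule vfunctorI[OF F.dom.vcategory_vop F.cod.vcategory_vop]) simp_all
qed

text \<open>Not an instance of \<open>vfunctor_vop\<close>: composition in
  \<open>vop V (vop V C)\<close> carries two braidings, which cancel only at objects of
  \<open>C\<close>, so the double opposite is not literally \<open>C\<close>.\<close>

lemma vfunctor_vop':
  assumes "vfunctor V (vop V C) (vop V D) F" "vcategory V C" "vcategory V D"
  shows "vfunctor V C D (vop_fun F)"
proof -
  interpret F: vfunctor V "vop V C" "vop V D" F by fact
  interpret C: vcategory V C by fact
  interpret D: vcategory V D by fact
  have e: "vop_fun F = mk_vfun C (FO F) (\<lambda>x y. FA F y x)"
    using F.FO_undef F.FA_undef by (auto simp: vop_fun_def mk_vfun_def fun_eq_iff)
  have ob: "FO F x \<in> VObj D" if "x \<in> VObj C" for x using F.FO_VObj that by simp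
  have ar: "FA F y x \<in> Arr V" "Dom V (FA F y x) = VHom C x y" "Cod V (FA F y x) =
    VHom D (FO F x) (FO F y)"
    if "x \<in> VObj C" "y \<in> VObj C" for x y using F.FA_simps[of y x] that by auto
  show ?thesis
  proof (rule vfunctorI[OF assms(2,3) e], goal_cases)
    case (3 x) then show ?case using F.FA_id[of x] by simp
  next
    case (4 x y z g f) then show ?case using F.FA_cmp[of z y x f g] ob ar by simp
  qed (use ob ar in auto)
qed

section \<open>Natural transformations and ends\<close>

lemma dj_sym: "dj x y \<Longrightarrow> dj y x"
  by (auto simp: dj_def)

lemma vnatD:
  fixes V :: "('o, 'a) smcc" (structure)
  assumes "vnat V C D F G \<alpha>" "vfunctor V C D F" "vfunctor V C D G" "x \<in> VObj C"
  shows "\<alpha> x \<in> Arr V" "Dom V (\<alpha> x) = Unt V" "Cod V (\<alpha> x) = VHom D (FO F x) (FO G x)"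
    "\<lbrakk>y \<in> VObj C; el V f; ty V f = VHom C x y\<rbrakk> \<Longrightarrow>
      VCmp D (FO F x) (FO F y) (FO G y) \<bullet> (\<alpha> y \<bullet> un V \<odot> FA F x y \<bullet> f) =
      VCmp D (FO F x) (FO G x) (FO G y) \<bullet> (FA G x y \<bullet> f \<odot> \<alpha> x \<bullet> un V)"
proof -
  interpret F: vfunctor V C D F by fact
  interpret G: vfunctor V C D G by fact
  have t: "\<alpha> x \<in> Arr V \<and> Dom V (\<alpha> x) = Unt V \<and> Cod V (\<alpha> x) = VHom D (FO F x) (FO G x)" if "x \<in> VObj
    C" for x
    using assms(1) that unfolding vnat_def F.dom.Hom_iff by auto
  then show "\<alpha> x \<in> Arr V" "Dom V (\<alpha> x) = Unt V" "Cod V (\<alpha> x) = VHom D (FO F x) (FO G x)"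
    using assms by auto
  assume y: "y \<in> VObj C" "el V f" "ty V f = VHom C x y"
  have "VCmp D (FO F x) (FO F y) (FO G y) \<cdot> (\<alpha> y \<boxtimes> FA F x y) \<cdot> inv_arr V (Lun V (VHom C x y)) =
        VCmp D (FO F x) (FO G x) (FO G y) \<cdot> (FA G x y \<boxtimes> \<alpha> x) \<cdot> inv_arr V (Run V (VHom C x y))"
    using assms(1,4) y(1) unfolding vnat_def by blast
  from arg_cong[OF this, of "\<lambda>k. k \<bullet> f"]
  show "VCmp D (FO F x) (FO F y) (FO G y) \<bullet> (\<alpha> y \<bullet> un V \<odot> FA F x y \<bullet> f) =
      VCmp D (FO F x) (FO G x) (FO G y) \<bullet> (FA G x y \<bullet> f \<odot> \<alpha> x \<bullet> un V)"
    using y assms(4) t by simp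
qed

lemma vnatI:
  fixes V :: "('o, 'a) smcc" (structure)
  assumes "vfunctor V C D F" "vfunctor V C D G"
    and t: "\<And>x. x \<in> VObj C \<Longrightarrow> \<alpha> x \<in> Arr V \<and> Dom V (\<alpha> x) = Unt V \<and> Cod V (\<alpha> x) = VHom D (FO F x) (FO G x)"
    and n: "\<And>x y f. \<lbrakk>x \<in> VObj C; y \<in> VObj C; el V f; ty V f = VHom C x y\<rbrakk> \<Longrightarrow>
      VCmp D (FO F x) (FO F y) (FO G y) \<bullet> (\<alpha> y \<bullet> un V \<odot> FA F x y \<bullet> f) =
      VCmp D (FO F x) (FO G x) (FO G y) \<bullet> (FA G x y \<bullet> f \<odot> \<alpha> x \<bullet> un V)"
  shows "vnat V C D F G \<alpha>"
proof -
  interpret F: vfunctor V C D F by fact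
  interpret G: vfunctor V C D G by fact
  show ?thesis
    unfolding vnat_def
  proof (intro conjI ballI, goal_cases)
    case (1 x) then show ?case using t by (simp add: F.dom.Hom_iff)
  next
    case (2 x y) then show ?case using t n by (intro F.dom.ext1[of _ _ "VHom C x y"]) simp_all
  qed
qed

lemma vnat_isoD:
  fixes V :: "('o, 'a) smcc" (structure)
  assumes "vnat_iso V C D F G \<alpha>" "vfunctor V C D F" "vfunctor V C D G"
  obtains \<beta> where "vnat V C D G F \<beta>"
    "\<And>x. x \<in> VObj C \<Longrightarrow> VCmp D (FO F x) (FO G x) (FO F x) \<bullet> (\<beta> x \<bullet> un V \<odot> \<alpha> x \<bullet> un V) =
      VIdn D (FO F x) \<bullet> un V"
    "\<And>x. x \<in> VObj C \<Longrightarrow> VCmp D (FO G x) (FO F x) (FO G x) \<bullet> (\<alpha> x \<bullet> un V \<odot> \<beta> x \<bullet> un V) =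
      VIdn D (FO G x) \<bullet> un V"
proof -
  interpret F: vfunctor V C D F by fact
  interpret G: vfunctor V C D G by fact
  obtain \<beta> where b: "vnat V C D G F \<beta>"
    "\<And>x. x \<in> VObj C \<Longrightarrow> vcmp_el V D (FO F x) (FO G x) (FO F x) (\<beta> x) (\<alpha> x) = VIdn D (FO F x)"
    "\<And>x. x \<in> VObj C \<Longrightarrow> vcmp_el V D (FO G x) (FO F x) (FO G x) (\<alpha> x) (\<beta> x) = VIdn D (FO G x)"
    and a: "vnat V C D F G \<alpha>"
    using assms(1) unfolding vnat_iso_def by auto
  note t [simp] = vnatD(1-3)[OF a assms(2,3)] vnatD(1-3)[OF b(1) assms(3,2)]
  show ?thesis
    by (rule that[of \<beta>])
      (use b(1) arg_cong[OF b(2), of _ "\<lambda>k. k \<bullet> un V"] arg_cong[OF b(3), of _ "\<lambda>k. k \<bullet> un V"]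
        in \<open>simp_all add: vcmp_el_app[OF F.dom.smcc_axioms]\<close>)
qed

lemma vnat_isoI:
  fixes V :: "('o, 'a) smcc" (structure)
  assumes "vfunctor V C D F" "vfunctor V C D G" "vnat V C D F G \<alpha>" "vnat V C D G F \<beta>"
    "\<And>x. x \<in> VObj C \<Longrightarrow> VCmp D (FO F x) (FO G x) (FO F x) \<bullet> (\<beta> x \<bullet> un V \<odot> \<alpha> x \<bullet> un V) =
      VIdn D (FO F x) \<bullet> un V"
    "\<And>x. x \<in> VObj C \<Longrightarrow> VCmp D (FO G x) (FO F x) (FO G x) \<bullet> (\<alpha> x \<bullet> un V \<odot> \<beta> x \<bullet> un V) =
      VIdn D (FO G x) \<bullet> un V"
  shows "vnat_iso V C D F G \<alpha>"
proof -
  interpret F: vfunctor V C D F by fact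
  interpret G: vfunctor V C D G by fact
  note t [simp] = vnatD(1-3)[OF assms(3,1,2)] vnatD(1-3)[OF assms(4,2,1)]
  show ?thesis
    unfolding vnat_iso_def
  proof (intro conjI exI[of _ \<beta>] ballI, goal_cases)
    case (3 x) then show ?case using assms(5)[of x]
      by (intro F.dom.extU) (simp_all add: vcmp_el_app[OF F.dom.smcc_axioms])
  next
    case (4 x) then show ?case using assms(6)[of x]
      by (intro F.dom.extU) (simp_all add: vcmp_el_app[OF F.dom.smcc_axioms])
  qed (use assms in auto)
qed

context
  fixes V :: "('o, 'a) smcc" (structure)
  assumes V: "smcc V"
begin

interpretation smcc V by (rule V)

lemma name_simps:
  assumes "f \<in> Arr V" "Dom V f = X" "Cod V f = Y"
  shows "name_arr V X Y f \<in> Arr V" "Dom V (name_arr V X Y f) = Unt V" "Cod V (name_arr V X Y f) =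
    Hm V X Y"
proof -
  have "X \<in> Obj V" "Y \<in> Obj V" using assms by auto
  then show "name_arr V X Y f \<in> Arr V" "Dom V (name_arr V X Y f) = Unt V" "Cod V (name_arr V X Y f)
    = Hm V X Y"
    using assms by (simp_all add: name_arr_def)
qed

lemma name_ev:
  assumes "f \<in> Arr V" "Dom V f = X" "Cod V f = Y" "el V x" "ty V x = X"
  shows "Ev V X Y \<bullet> (name_arr V X Y f \<bullet> un V \<odot> x) = f \<bullet> x"
proof -
  have "X \<in> Obj V" "Y \<in> Obj V" using assms by auto
  then show ?thesis using assms by (simp_all add: name_arr_def)
qed

end

text \<open>Naming identifies arrows \<open>F x \<rightarrow> G x\<close> with elements
  \<open>I \<rightarrow> [F x, G x]\<close> and turns composition in \<open>vself V\<close> into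
  composition in \<open>V\<close>. The right side is the form in which adjunctions, powers and
  weighted limits are used.\<close>

lemma vnat_iso_arr_iff:
  fixes V :: "('o, 'a) smcc" (structure)
  assumes FV: "vfunctor V C (vself V) F" and GV: "vfunctor V C (vself V) G"
  shows "vnat_iso_arr V C F G \<theta> \<longleftrightarrow>
    (\<forall>x\<in>VObj C. is_iso V (\<theta> x) \<and> Dom V (\<theta> x) = FO F x \<and> Cod V (\<theta> x) = FO G x) \<and>
    (\<forall>x\<in>VObj C. \<forall>y\<in>VObj C. \<forall>f u. el V f \<and> el V u \<and> ty V f = VHom C x y \<and> ty V u = FO F x \<and> dj f u \<longrightarrow>
      \<theta> y \<bullet> Ev V (FO F x) (FO F y) \<bullet> (FA F x y \<bullet> f \<odot> u) = Ev V (FO G x) (FO G y) \<bullet> (FA G x y \<bullet> f \<odot> \<theta>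
        x \<bullet> u))"
    (is "?l \<longleftrightarrow> ?r")
proof -
  interpret F: vfunctor V C "vself V" F by fact
  interpret G: vfunctor V C "vself V" G by fact
  note nm [simp] = name_simps[OF F.dom.smcc_axioms] name_ev[OF F.dom.smcc_axioms]
  have [simp]: "FO F x \<in> Obj V" "FO G x \<in> Obj V" if "x \<in> VObj C" for x
    using F.FO_VObj[OF that] G.FO_VObj[OF that] by auto
  let ?n = "\<lambda>\<theta> x. name_arr V (FO F x) (FO G x) (\<theta> x)"
  let ?n' = "\<lambda>\<theta> x. name_arr V (FO G x) (FO F x) (\<theta> x)"
  show ?thesis
  proof
    assume ?l
    then have t: "\<theta> x \<in> Arr V" "Dom V (\<theta> x) = FO F x" "Cod V (\<theta> x) = FO G x" if "x \<in> VObj C" for x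
      using that unfolding vnat_iso_arr_def F.dom.Hom_iff by auto
    note [simp] = t
    have iso: "vnat_iso V C (vself V) F G (?n \<theta>)" using \<open>?l\<close> unfolding vnat_iso_arr_def by auto
    then have n: "vnat V C (vself V) F G (?n \<theta>)" unfolding vnat_iso_def by auto
    obtain \<beta> where b: "vnat V C (vself V) G F \<beta>"
      "\<And>x. x \<in> VObj C \<Longrightarrow> VCmp (vself V) (FO F x) (FO G x) (FO F x) \<bullet> (\<beta> x \<bullet> un V \<odot> ?n \<theta> x \<bullet> un V) =
        VIdn (vself V) (FO F x) \<bullet> un V"
      "\<And>x. x \<in> VObj C \<Longrightarrow> VCmp (vself V) (FO G x) (FO F x) (FO G x) \<bullet> (?n \<theta> x \<bullet> un V \<odot> \<beta> x \<bullet> un V) =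
        VIdn (vself V) (FO G x) \<bullet> un V"
      using vnat_isoD[OF iso FV GV] by blast
    note [simp] = vnatD(1-3)[OF b(1) GV FV]
    have "is_iso V (\<theta> x)" if x [simp]: "x \<in> VObj C" for x
    \<comment> \<open>The inverse of \<open>\<theta> x\<close> is the arrow named by
      \<open>\<beta> x\<close>, recovered by evaluation.\<close>
    proof (rule F.dom.is_isoI[of _ "Ev V (FO G x) (FO F x) \<cdot> (\<beta> x \<boxtimes> Idn V (FO G x)) \<cdot> inv_arr V (Lun
      V (FO G x))"])
      show "(Ev V (FO G x) (FO F x) \<cdot> (\<beta> x \<boxtimes> Idn V (FO G x)) \<cdot> inv_arr V (Lun V (FO G x))) \<cdot> \<theta> x =
        Idn V (Dom V (\<theta> x))"
      proof (rule F.dom.ext1[of _ _ "FO F x"], simp_all, goal_cases)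
        case (1 u)
        then show ?case
          using arg_cong[OF b(2)[OF x], of "\<lambda>k. Ev V (FO F x) (FO F x) \<bullet> (k \<odot> u)"] by simp
      qed
      show "\<theta> x \<cdot> Ev V (FO G x) (FO F x) \<cdot> (\<beta> x \<boxtimes> Idn V (FO G x)) \<cdot> inv_arr V (Lun V (FO G x)) =
        Idn V (Cod V (\<theta> x))"
      proof (rule F.dom.ext1[of _ _ "FO G x"], simp_all, goal_cases)
        case (1 u)
        then show ?case
          using arg_cong[OF b(3)[OF x], of "\<lambda>k. Ev V (FO G x) (FO G x) \<bullet> (k \<odot> u)"] by simp
      qed
    qed simp_all
    moreover have "\<theta> y \<bullet> Ev V (FO F x) (FO F y) \<bullet> (FA F x y \<bullet> f \<odot> u) = Ev V (FO G x) (FO G y) \<bullet> (FA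
      G x y \<bullet> f \<odot> \<theta> x \<bullet> u)"
      if [simp]: "x \<in> VObj C" "y \<in> VObj C" "el V f" "el V u" "ty V f = VHom C x y" "ty V u =
        FO F x" "dj f u" for x y f u
      using arg_cong[OF vnatD(4)[OF n FV GV that(1,2,3,5)], of "\<lambda>k. Ev V (FO F x) (FO G y) \<bullet> (k \<odot> u)"]
      by simp
    ultimately show ?r using t by auto
  next
    assume r: ?r
    then have t: "is_iso V (\<theta> x)" "Dom V (\<theta> x) = FO F x" "Cod V (\<theta> x) = FO G x" if "x \<in> VObj C" for x
      using that by auto
    note [simp] = t
    let ?t = "\<lambda>x. inv_arr V (\<theta> x)"
    have n: "\<theta> y \<bullet> Ev V (FO F x) (FO F y) \<bullet> (FA F x y \<bullet> f \<odot> u) = Ev V (FO G x) (FO G y) \<bullet> (FA G x y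
      \<bullet> f \<odot> \<theta> x \<bullet> u)"
      if [simp]: "x \<in> VObj C" "y \<in> VObj C" "el V f" "el V u" "ty V f = VHom C x y" "ty V u =
        FO F x" "dj f u" for x y f u
      using r that by blast
    \<comment> \<open>Componentwise inverses of a natural family are natural: \<open>n\<close> is
      applied to the preimage of \<open>u\<close> and \<open>\<theta> y\<close> is
      cancelled.\<close>
    have n': "?t y \<bullet> Ev V (FO G x) (FO G y) \<bullet> (FA G x y \<bullet> f \<odot> u) = Ev V (FO F x) (FO F y) \<bullet> (FA F x
      y \<bullet> f \<odot> ?t x \<bullet> u)"
      if [simp]: "x \<in> VObj C" "y \<in> VObj C" "el V f" "el V u" "ty V f = VHom C x y" "ty V u =
        FO G x" "dj f u" for x y f u
      by (rule F.dom.app_mono[of "\<theta> y"]) (use n[of x y f "?t x \<bullet> u"] in simp_all)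
    have "vnat_iso V C (vself V) F G (?n \<theta>)"
    proof (rule vnat_isoI[OF FV GV, of _ "?n' ?t"])
      show "vnat V C (vself V) F G (?n \<theta>)"
      proof (rule vnatI[OF FV GV])
        fix x y f assume a [simp]: "x \<in> VObj C" "y \<in> VObj C" "el V f" "ty V f = VHom C x y"
        have "VCmp (vself V) (FO F x) (FO F y) (FO G y) \<cdot> (?n \<theta> y \<boxtimes> FA F x y) \<cdot> inv_arr V (Lun V
          (VHom C x y)) =
          VCmp (vself V) (FO F x) (FO G x) (FO G y) \<cdot> (FA G x y \<boxtimes> ?n \<theta> x) \<cdot> inv_arr V (Run V (VHom C
            x y))"
          by (rule F.dom.curry_ext[of _ _ "VHom C x y" "FO F x" "FO G y"]) (simp_all add: n)
        from arg_cong[OF this, of "\<lambda>k. k \<bullet> f"]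
        show "VCmp (vself V) (FO F x) (FO F y) (FO G y) \<bullet> (?n \<theta> y \<bullet> un V \<odot> FA F x y \<bullet> f) =
          VCmp (vself V) (FO F x) (FO G x) (FO G y) \<bullet> (FA G x y \<bullet> f \<odot> ?n \<theta> x \<bullet> un V)" by simp
      qed simp
      show "vnat V C (vself V) G F (?n' ?t)"
      proof (rule vnatI[OF GV FV])
        fix x y f assume a [simp]: "x \<in> VObj C" "y \<in> VObj C" "el V f" "ty V f = VHom C x y"
        have "VCmp (vself V) (FO G x) (FO G y) (FO F y) \<cdot> (?n' ?t y \<boxtimes> FA G x y) \<cdot> inv_arr V (Lun V
          (VHom C x y)) =
          VCmp (vself V) (FO G x) (FO F x) (FO F y) \<cdot> (FA F x y \<boxtimes> ?n' ?t x) \<cdot> inv_arr V (Run V (VHom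
            C x y))"
          by (rule F.dom.curry_ext[of _ _ "VHom C x y" "FO G x" "FO F y"]) (simp_all add: n')
        from arg_cong[OF this, of "\<lambda>k. k \<bullet> f"]
        show "VCmp (vself V) (FO G x) (FO G y) (FO F y) \<bullet> (?n' ?t y \<bullet> un V \<odot> FA G x y \<bullet> f) =
          VCmp (vself V) (FO G x) (FO F x) (FO F y) \<bullet> (FA F x y \<bullet> f \<odot> ?n' ?t x \<bullet> un V)" by simp
      qed simp
    next
      fix x assume [simp]: "x \<in> VObj C"
      have "VCmp (vself V) (FO F x) (FO G x) (FO F x) \<cdot> (?n' ?t x \<boxtimes> ?n \<theta> x) \<cdot> inv_arr V (Lun V (Unt
        V)) = VIdn (vself V) (FO F x)"
        by (rule F.dom.curry_extU[of _ _ "FO F x" "FO F x"]) simp_all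
      from arg_cong[OF this, of "\<lambda>k. k \<bullet> un V"]
      show "VCmp (vself V) (FO F x) (FO G x) (FO F x) \<bullet> (?n' ?t x \<bullet> un V \<odot> ?n \<theta> x \<bullet> un V) =
        VIdn (vself V) (FO F x) \<bullet> un V"
        by simp
      have "VCmp (vself V) (FO G x) (FO F x) (FO G x) \<cdot> (?n \<theta> x \<boxtimes> ?n' ?t x) \<cdot> inv_arr V (Lun V (Unt
        V)) = VIdn (vself V) (FO G x)"
        by (rule F.dom.curry_extU[of _ _ "FO G x" "FO G x"]) simp_all
      from arg_cong[OF this, of "\<lambda>k. k \<bullet> un V"]
      show "VCmp (vself V) (FO G x) (FO F x) (FO G x) \<bullet> (?n \<theta> x \<bullet> un V \<odot> ?n' ?t x \<bullet> un V) =
        VIdn (vself V) (FO G x) \<bullet> un V"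
        by simp
    qed
    then show ?l using t unfolding vnat_iso_arr_def F.dom.Hom_iff by auto
  qed
qed

section \<open>Objects of natural transformations\<close>

lemma nat_familyI:
  fixes V :: "('o, 'a) smcc" (structure)
  assumes "vfunctor V C D F" "vfunctor V C D G" "e \<in> Obj V"
    and t: "\<And>x. x \<in> VObj C \<Longrightarrow> p x \<in> Arr V \<and> Dom V (p x) = e \<and> Cod V (p x) = VHom D (FO F x) (FO G x)"
    and n: "\<And>x y f a. \<lbrakk>x \<in> VObj C; y \<in> VObj C; el V f; el V a; ty V f = VHom C x y; ty V a = e;
      dj a f; dj f a\<rbrakk> \<Longrightarrow>
      VCmp D (FO F x) (FO F y) (FO G y) \<bullet> (p y \<bullet> a \<odot> FA F x y \<bullet> f) =
      VCmp D (FO F x) (FO G x) (FO G y) \<bullet> (FA G x y \<bullet> f \<odot> p x \<bullet> a)"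
  shows "is_nat_family V C D F G e p"
proof -
  interpret F: vfunctor V C D F by fact
  interpret G: vfunctor V C D G by fact
  show ?thesis
    unfolding is_nat_family_def
  proof (intro conjI ballI, goal_cases)
    case (2 x) then show ?case using t by (simp add: F.dom.Hom_iff)
  next
    case (3 x y) then show ?case using t n assms(3) by (intro F.dom.ext2[of _ _ e "VHom C x y"])
      simp_all
  qed fact
qed

lemma nat_familyD:
  fixes V :: "('o, 'a) smcc" (structure)
  assumes "is_nat_family V C D F G e p" "vfunctor V C D F" "vfunctor V C D G"
  shows "e \<in> Obj V" "x \<in> VObj C \<Longrightarrow> p x \<in> Arr V" "x \<in> VObj C \<Longrightarrow> Dom V (p x) = e"
    "x \<in> VObj C \<Longrightarrow> Cod V (p x) = VHom D (FO F x) (FO G x)"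
    "\<lbrakk>x \<in> VObj C; y \<in> VObj C; el V f; el V a; ty V f = VHom C x y; ty V a = e; dj a f\<rbrakk> \<Longrightarrow>
      VCmp D (FO F x) (FO F y) (FO G y) \<bullet> (p y \<bullet> a \<odot> FA F x y \<bullet> f) =
      VCmp D (FO F x) (FO G x) (FO G y) \<bullet> (FA G x y \<bullet> f \<odot> p x \<bullet> a)"
proof -
  interpret F: vfunctor V C D F by fact
  interpret G: vfunctor V C D G by fact
  have t: "p x \<in> Arr V \<and> Dom V (p x) = e \<and> Cod V (p x) = VHom D (FO F x) (FO G x)" if "x \<in> VObj C" for x
    using assms(1) that unfolding is_nat_family_def F.dom.Hom_iff by auto
  show "e \<in> Obj V" using assms(1) unfolding is_nat_family_def by auto
  show "x \<in> VObj C \<Longrightarrow> p x \<in> Arr V" "x \<in> VObj C \<Longrightarrow> Dom V (p x) = e"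
    "x \<in> VObj C \<Longrightarrow> Cod V (p x) = VHom D (FO F x) (FO G x)" using t by auto
  assume a: "x \<in> VObj C" "y \<in> VObj C" "el V f" "el V a" "ty V f = VHom C x y" "ty V a = e" "dj a f"
  have "VCmp D (FO F x) (FO F y) (FO G y) \<cdot> (p y \<boxtimes> FA F x y) =
        VCmp D (FO F x) (FO G x) (FO G y) \<cdot> (FA G x y \<boxtimes> p x) \<cdot> Brd V e (VHom C x y)"
    using assms(1) a unfolding is_nat_family_def by blast
  from arg_cong[OF this, of "\<lambda>k. k \<bullet> (a \<odot> f)"] a t \<open>e \<in> Obj V\<close> dj_sym[OF a(7)]
  show "VCmp D (FO F x) (FO F y) (FO G y) \<bullet> (p y \<bullet> a \<odot> FA F x y \<bullet> f) =
      VCmp D (FO F x) (FO G x) (FO G y) \<bullet> (FA G x y \<bullet> f \<odot> p x \<bullet> a)"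
    by simp
qed

lemma nat_object_lift:
  fixes V :: "('o, 'a) smcc" (structure)
  assumes "is_nat_object V C D F G e p" "is_nat_family V C D F G e' p'"
  obtains h where "h \<in> Hom V e' e" "\<And>x. x \<in> VObj C \<Longrightarrow> p x \<cdot> h = p' x"
  using assms unfolding is_nat_object_def by metis

lemma nat_family_precomp:
  fixes V :: "('o, 'a) smcc" (structure)
  assumes "is_nat_family V C D F G e p" "vfunctor V C D F" "vfunctor V C D G" "h \<in> Arr V" "Cod V h = e"
  shows "is_nat_family V C D F G (Dom V h) (\<lambda>x. p x \<cdot> h)"
proof -
  interpret F: vfunctor V C D F by fact
  interpret G: vfunctor V C D G by fact
  note n = nat_familyD[OF assms(1-3)]
  show ?thesis
    by (rule nat_familyI[OF assms(2,3)]) (use assms(4,5) n in simp_all)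
qed

text \<open>The family \<open>p x \<cdot> h'\<close> is itself natural, so \<open>h\<close> and
  \<open>h'\<close> are two factorisations of one family.\<close>

lemma nat_object_mono:
  fixes V :: "('o, 'a) smcc" (structure)
  assumes "is_nat_object V C D F G e p" "vfunctor V C D F" "vfunctor V C D G"
    "h \<in> Arr V" "h' \<in> Arr V" "Cod V h = e" "Cod V h' = e" "Dom V h = Dom V h'"
    "\<And>x. x \<in> VObj C \<Longrightarrow> p x \<cdot> h = p x \<cdot> h'"
  shows "h = h'"
proof -
  interpret F: vfunctor V C D F by fact
  have "is_nat_family V C D F G (Dom V h') (\<lambda>x. p x \<cdot> h')"
    by (rule nat_family_precomp) (use assms in \<open>auto simp: is_nat_object_def\<close>)
  then have "\<exists>!k. k \<in> Hom V (Dom V h') e \<and> (\<forall>x\<in>VObj C. p x \<cdot> k = p x \<cdot> h')"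
    using assms(1) unfolding is_nat_object_def by blast
  moreover have "h \<in> Hom V (Dom V h') e" "h' \<in> Hom V (Dom V h') e"
    using assms by (auto simp: F.dom.Hom_iff)
  ultimately show ?thesis using assms(9) by blast
qed

text \<open>
  \<open>\<Phi>\<close> allows the objects of the category to be \<open>\<V>\<close>-functors of which \<open>\<V>'\<close>-functors are obtained by
    change of base.
\<close>

locale nat_cat = vcategory V D + C: vcategory V C
  for V :: "('o, 'a) smcc" (structure) and C :: "('c, 'o, 'a) vcat" and D :: "('d, 'o, 'a) vcat" +
  fixes S :: "('c, 'd, 'k) vfun set" and \<Phi> :: "('c, 'd, 'k) vfun \<Rightarrow> ('c, 'd, 'a) vfun"
    and e :: "('c, 'd, 'k) vfun \<Rightarrow> ('c, 'd, 'k) vfun \<Rightarrow> 'o"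
    and p :: "('c, 'd, 'k) vfun \<Rightarrow> ('c, 'd, 'k) vfun \<Rightarrow> 'c \<Rightarrow> 'a"
  assumes \<Phi>_fun: "F \<in> S \<Longrightarrow> vfunctor V C D (\<Phi> F)"
    and \<Phi>_FO: "\<lbrakk>F \<in> S; x \<in> VObj C\<rbrakk> \<Longrightarrow> FO (\<Phi> F) x = FO F x"
    and nat_obj: "\<lbrakk>F \<in> S; G \<in> S\<rbrakk> \<Longrightarrow> is_nat_object V C D (\<Phi> F) (\<Phi> G) (e F G) (p F G)"
begin

definition "N = nat_category V (VObj C) D S e p"

lemma nat_fam: "\<lbrakk>F \<in> S; G \<in> S\<rbrakk> \<Longrightarrow> is_nat_family V C D (\<Phi> F) (\<Phi> G) (e F G) (p F G)"
  using nat_obj unfolding is_nat_object_def by blast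

lemma N_simps [simp]: "VObj N = S" "VHom N = e"
  by (auto simp: N_def nat_category_def)

lemma FO_S [simp]: "\<lbrakk>F \<in> S; x \<in> VObj C\<rbrakk> \<Longrightarrow> FO F x \<in> VObj D"
  using vfunctor.FO_VObj[OF \<Phi>_fun, of F x] \<Phi>_FO[of F x] by simp

lemma FA_\<Phi> [simp]:
  assumes "F \<in> S" "x \<in> VObj C" "y \<in> VObj C"
  shows "FA (\<Phi> F) x y \<in> Arr V" "Dom V (FA (\<Phi> F) x y) = VHom C x y" "Cod V (FA (\<Phi> F) x y) =
    VHom D (FO F x) (FO F y)"
  using vfunctor.FA_simps[OF \<Phi>_fun[OF assms(1)] assms(2,3)] assms by (auto simp: \<Phi>_FO)

lemma e_Obj [simp]: "\<lbrakk>F \<in> S; G \<in> S\<rbrakk> \<Longrightarrow> e F G \<in> Obj V"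
  using nat_familyD(1)[OF nat_fam \<Phi>_fun \<Phi>_fun] .

lemma p_simps [simp]:
  assumes "F \<in> S" "G \<in> S" "x \<in> VObj C"
  shows "p F G x \<in> Arr V" "Dom V (p F G x) = e F G" "Cod V (p F G x) = VHom D (FO F x) (FO G x)"
  using nat_familyD(2-4)[OF nat_fam \<Phi>_fun \<Phi>_fun] assms by (auto simp: \<Phi>_FO)

lemma p_nat:
  assumes "F \<in> S" "G \<in> S" "x \<in> VObj C" "y \<in> VObj C" "el V f" "el V a" "ty V f =
    VHom C x y" "ty V a = e F G" "dj a f"
  shows "VCmp D (FO F x) (FO F y) (FO G y) \<bullet> (p F G y \<bullet> a \<odot> FA (\<Phi> F) x y \<bullet> f) =
      VCmp D (FO F x) (FO G x) (FO G y) \<bullet> (FA (\<Phi> G) x y \<bullet> f \<odot> p F G x \<bullet> a)"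
  using nat_familyD(5)[OF nat_fam \<Phi>_fun \<Phi>_fun] assms by (auto simp: \<Phi>_FO)

lemma p_mono:
  assumes "F \<in> S" "G \<in> S" "h \<in> Arr V" "h' \<in> Arr V" "Cod V h = e F G" "Cod V h' = e F G" "Dom V h =
    Dom V h'"
    "\<And>x. x \<in> VObj C \<Longrightarrow> p F G x \<cdot> h = p F G x \<cdot> h'"
  shows "h = h'"
  by (rule nat_object_mono[OF nat_obj \<Phi>_fun \<Phi>_fun]) (use assms in auto)

lemma p_lift:
  assumes "F \<in> S" "G \<in> S" "e' \<in> Obj V"
    and "\<And>x. x \<in> VObj C \<Longrightarrow> q x \<in> Arr V \<and> Dom V (q x) = e' \<and> Cod V (q x) = VHom D (FO F x) (FO G x)"
    and "\<And>x y f a. \<lbrakk>x \<in> VObj C; y \<in> VObj C; el V f; el V a; ty V f = VHom C x y; ty V a = e';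
      dj a f; dj f a\<rbrakk> \<Longrightarrow>
      VCmp D (FO F x) (FO F y) (FO G y) \<bullet> (q y \<bullet> a \<odot> FA (\<Phi> F) x y \<bullet> f) =
      VCmp D (FO F x) (FO G x) (FO G y) \<bullet> (FA (\<Phi> G) x y \<bullet> f \<odot> q x \<bullet> a)"
  shows "\<exists>!h. h \<in> Hom V e' (e F G) \<and> (\<forall>x\<in>VObj C. p F G x \<cdot> h = q x)"
proof -
  have "is_nat_family V C D (\<Phi> F) (\<Phi> G) e' q"
    by (rule nat_familyI) (use assms in \<open>simp_all add: \<Phi>_fun \<Phi>_FO\<close>)
  then show ?thesis using nat_obj[OF assms(1,2)] unfolding is_nat_object_def by blast
qed

text \<open>Discharges the definite description in \<open>nat_category\<close>: the identities of
  the \<open>F x\<close> form a natural family and hence factor uniquely through the end.\<close>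

lemma N_idn:
  assumes F: "F \<in> S"
  shows "VIdn N F \<in> Hom V (Unt V) (e F F) \<and> (\<forall>x\<in>VObj C. p F F x \<cdot> VIdn N F = VIdn D (FO F x))"
proof -
  have "\<exists>!u. u \<in> Hom V (Unt V) (e F F) \<and> (\<forall>x\<in>VObj C. p F F x \<cdot> u = VIdn D (FO F x))"
  proof (rule p_lift[OF F F], goal_cases)
    case (3 x y f a)
    \<comment> \<open>The variable \<open>a\<close> is an arbitrary element of \<open>I\<close>, to
      which the unit laws do not apply; as an equation of arrows the claim can be tested on
      \<open>un V\<close> instead.\<close>
    have "VCmp D (FO F x) (FO F y) (FO F y) \<cdot> (VIdn D (FO F y) \<boxtimes> FA (\<Phi> F) x y) =
      VCmp D (FO F x) (FO F x) (FO F y) \<cdot> (FA (\<Phi> F) x y \<boxtimes> VIdn D (FO F x)) \<cdot> Brd V (Unt V) (VHom C x y)"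
      by (rule ext2L[of _ _ "VHom C x y"]) (use 3 F in simp_all)
    from arg_cong[OF this, of "\<lambda>k. k \<bullet> (a \<odot> f)"] show ?case using 3 F by simp
  qed (use F in simp_all)
  from theI'[OF this] show ?thesis by (simp add: N_def nat_category_def)
qed

lemma N_idn_simps [simp]:
  assumes F: "F \<in> S"
  shows "VIdn N F \<in> Arr V" "Dom V (VIdn N F) = Unt V" "Cod V (VIdn N F) = e F F"
    "x \<in> VObj C \<Longrightarrow> p F F x \<bullet> VIdn N F \<bullet> un V = VIdn D (FO F x) \<bullet> un V"
proof -
  show *: "VIdn N F \<in> Arr V" "Dom V (VIdn N F) = Unt V" "Cod V (VIdn N F) = e F F"
    using N_idn[OF F] by (auto simp: Hom_iff)
  show "x \<in> VObj C \<Longrightarrow> p F F x \<bullet> VIdn N F \<bullet> un V = VIdn D (FO F x) \<bullet> un V"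
    using arg_cong[OF N_idn[OF F, THEN conjunct2, THEN bspec, of x], of "\<lambda>k. k \<bullet> un V"] F * by simp
qed

text \<open>Pointwise composites are natural because \<open>p_nat\<close> moves the action of
  \<open>f\<close> past \<open>a\<close>, from \<open>F\<close> to \<open>G\<close>, and then past
  \<open>b\<close>, from \<open>G\<close> to \<open>H\<close>. As an arbitrary element of the tensor
  product need not be a pair, the equation is proved for arrows first.\<close>

lemma N_cmp:
  assumes F: "F \<in> S" "G \<in> S" "H \<in> S"
  shows "VCmp N F G H \<in> Hom V (e G H \<otimes> e F G) (e F H) \<and>
    (\<forall>x\<in>VObj C. p F H x \<cdot> VCmp N F G H = VCmp D (FO F x) (FO G x) (FO H x) \<cdot> (p G H x \<boxtimes> p F G x))"
proof -
  have "\<exists>!m. m \<in> Hom V (e G H \<otimes> e F G) (e F H) \<and>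
    (\<forall>x\<in>VObj C. p F H x \<cdot> m = VCmp D (FO F x) (FO G x) (FO H x) \<cdot> (p G H x \<boxtimes> p F G x))"
  proof (rule p_lift[OF F(1,3)], goal_cases)
    case (3 x y f a)
    let ?l = "\<lambda>x y z. VCmp D (FO F x) (FO F y) (FO H y) \<bullet> z"
    have "VCmp D (FO F x) (FO F y) (FO H y) \<cdot> ((VCmp D (FO F y) (FO G y) (FO H y) \<cdot> (p G H y \<boxtimes> p F G
      y)) \<boxtimes> FA (\<Phi> F) x y) =
      VCmp D (FO F x) (FO H x) (FO H y) \<cdot> (FA (\<Phi> H) x y \<boxtimes> (VCmp D (FO F x) (FO G x) (FO H x) \<cdot> (p G
        H x \<boxtimes> p F G x))) \<cdot>
        Brd V (e G H \<otimes> e F G) (VHom C x y)"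
    proof (rule ext3[of _ _ "e G H" "e F G" "VHom C x y"])
      fix b a f assume [simp]: "el V b" "el V a" "el V f" "ty V b = e G H" "ty V a =
        e F G" "ty V f = VHom C x y"
        "dj b a" "dj a b" "dj b f" "dj f b" "dj a f" "dj f a"
      have "VCmp D (FO F x) (FO G y) (FO H y) \<bullet> (p G H y \<bullet> b \<odot> VCmp D (FO F x) (FO F y) (FO G y) \<bullet>
        (p F G y \<bullet> a \<odot> FA (\<Phi> F) x y \<bullet> f))
        = VCmp D (FO F x) (FO G x) (FO H y) \<bullet> (VCmp D (FO G x) (FO G y) (FO H y) \<bullet> (p G H y \<bullet> b \<odot> FA
          (\<Phi> G) x y \<bullet> f) \<odot> p F G x \<bullet> a)"
        using F 3 by (subst p_nat) simp_all
      also have "\<dots> = VCmp D (FO F x) (FO H x) (FO H y) \<bullet> (FA (\<Phi> H) x y \<bullet> f \<odot> VCmp D (FO F x) (FO G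
        x) (FO H x) \<bullet> (p G H x \<bullet> b \<odot> p F G x \<bullet> a))"
        using F 3 by (subst p_nat) simp_all
      finally show "(VCmp D (FO F x) (FO F y) (FO H y) \<cdot> ((VCmp D (FO F y) (FO G y) (FO H y) \<cdot> (p G
        H y \<boxtimes> p F G y)) \<boxtimes> FA (\<Phi> F) x y)) \<bullet> ((b \<odot> a) \<odot> f) =
      (VCmp D (FO F x) (FO H x) (FO H y) \<cdot> (FA (\<Phi> H) x y \<boxtimes> (VCmp D (FO F x) (FO G x) (FO H x) \<cdot> (p G
        H x \<boxtimes> p F G x))) \<cdot>
        Brd V (e G H \<otimes> e F G) (VHom C x y)) \<bullet> ((b \<odot> a) \<odot> f)"
        using F 3 by simp
    qed (use F 3 in simp_all)
    from arg_cong[OF this, of "\<lambda>k. k \<bullet> (a \<odot> f)"] show ?case using 3 F by simp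
  qed (use F in simp_all)
  from theI'[OF this] show ?thesis by (simp add: N_def nat_category_def)
qed

lemma N_cmp_simps [simp]:
  assumes F: "F \<in> S" "G \<in> S" "H \<in> S"
  shows "VCmp N F G H \<in> Arr V" "Dom V (VCmp N F G H) = e G H \<otimes> e F G" "Cod V (VCmp N F G H) = e F H"
    "\<lbrakk>x \<in> VObj C; el V a; el V b; ty V a = e F G; ty V b = e G H; dj b a\<rbrakk> \<Longrightarrow>
     p F H x \<bullet> VCmp N F G H \<bullet> (b \<odot> a) = VCmp D (FO F x) (FO G x) (FO H x) \<bullet> (p G H x \<bullet> b \<odot> p F G x \<bullet> a)"
proof -
  show *: "VCmp N F G H \<in> Arr V" "Dom V (VCmp N F G H) = e G H \<otimes> e F G" "Cod V (VCmp N F G H) = e F H"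
    using N_cmp[OF F] by (auto simp: Hom_iff)
  show "\<lbrakk>x \<in> VObj C; el V a; el V b; ty V a = e F G; ty V b = e G H; dj b a\<rbrakk> \<Longrightarrow>
     p F H x \<bullet> VCmp N F G H \<bullet> (b \<odot> a) = VCmp D (FO F x) (FO G x) (FO H x) \<bullet> (p G H x \<bullet> b \<odot> p F G x \<bullet> a)"
    using arg_cong[OF N_cmp[OF F, THEN conjunct2, THEN bspec, of x], of "\<lambda>k. k \<bullet> (b \<odot> a)"] F * by simp
qed

text \<open>The projections are jointly monic by \<open>p_mono\<close> and preserve composition and
  identities, so the axioms are inherited from \<open>D\<close>.\<close>

lemma vcategory_N: "vcategory V N"
proof (rule vcategoryI[OF smcc_axioms], goal_cases)
  case (4 F G H K)
  show ?case
  proof (rule p_mono[of F K], goal_cases)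
    case (8 x)
    show ?case by (rule ext3[of _ _ "e H K" "e G H" "e F G"]) (use 4 8 in simp_all)
  qed (use 4 in simp_all)
next
  case (5 F G f)
  have "VCmp N F G G \<cdot> (VIdn N G \<boxtimes> Idn V (e F G)) \<cdot> inv_arr V (Lun V (e F G)) = Idn V (e F G)"
  proof (rule p_mono[of F G], goal_cases)
    case (8 x)
    show ?case by (rule ext1[of _ _ "e F G"]) (use 5 8 in simp_all)
  qed (use 5 in simp_all)
  from arg_cong[OF this, of "\<lambda>k. k \<bullet> f"] show ?case using 5 by simp
next
  case (6 F G f)
  have "VCmp N F F G \<cdot> (Idn V (e F G) \<boxtimes> VIdn N F) \<cdot> inv_arr V (Run V (e F G)) = Idn V (e F G)"
  proof (rule p_mono[of F G], goal_cases)
    case (8 x)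
    show ?case by (rule ext1[of _ _ "e F G"]) (use 6 8 in simp_all)
  qed (use 6 in simp_all)
  from arg_cong[OF this, of "\<lambda>k. k \<bullet> f"] show ?case using 6 by simp
qed simp_all

end

section \<open>Existence of ends\<close>

text \<open>
  The end of \<open>D(F -, G -)\<close> is an ordinary limit: \<open>Pt x\<close> stands for \<open>D(F x, G x)\<close>, \<open>Pr x y\<close> for
    \<open>[C(x, y), D(F x, G y)]\<close>,
  and \<open>Lf x y\<close>, \<open>Rt x y\<close> for the two arrows into the latter.
\<close>

datatype 'c end_shape = Pt 'c | Pr 'c 'c | Lf 'c 'c | Rt 'c 'c

definition end_shapes :: "'c set \<Rightarrow> 'c end_shape set" where
  "end_shapes X = Pt ` X \<union> case_prod Pr ` (X \<times> X) \<union> case_prod Lf ` (X \<times> X) \<union> case_prod Rt ` (X \<times> X)"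

fun shape_dom :: "'c end_shape \<Rightarrow> 'c end_shape" where
  "shape_dom (Lf x y) = Pt x" | "shape_dom (Rt x y) = Pt y" | "shape_dom z = z"

fun shape_cod :: "'c end_shape \<Rightarrow> 'c end_shape" where
  "shape_cod (Lf x y) = Pr x y" | "shape_cod (Rt x y) = Pr x y" | "shape_cod z = z"

text \<open>The injection \<open>g\<close> moves the shape into the type of elements of the
  universe, where index categories are required to live. An object serves as its own identity, and
  composition merely selects the factor that need not be an identity.\<close>

definition shape_cat :: "('c end_shape \<Rightarrow> 'u) \<Rightarrow> 'c set \<Rightarrow> ('u, 'u) category" where
  "shape_cat g X = (let h = inv_into (end_shapes X) g in
     \<lparr>Obj = g ` (Pt ` X \<union> case_prod Pr ` (X \<times> X)), Arr = g ` end_shapes X,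
      Dom = (\<lambda>a. g (shape_dom (h a))), Cod = (\<lambda>a. g (shape_cod (h a))), Idn = (\<lambda>i. i),
      Cmp = (\<lambda>b a. if shape_dom (h a) = h a then b else a)\<rparr>)"

lemma end_shapes_iff [simp]:
  "Pt x \<in> end_shapes X \<longleftrightarrow> x \<in> X" "Pr x y \<in> end_shapes X \<longleftrightarrow> x \<in> X \<and> y \<in> X"
  "Lf x y \<in> end_shapes X \<longleftrightarrow> x \<in> X \<and> y \<in> X" "Rt x y \<in> end_shapes X \<longleftrightarrow> x \<in> X \<and> y \<in> X"
  by (auto simp: end_shapes_def)

lemma card_image_ordLess: "|A| <o |U| \<Longrightarrow> |f ` A| <o |U|"
  using card_of_image ordLeq_ordLess_trans by blast

lemma card_Un_ordLess: "\<lbrakk>|A| <o |U|; |B| <o |U|; infinite U\<rbrakk> \<Longrightarrow> |A \<union> B| <o |U|"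
  by (intro card_of_Un_ordLess_infinite_Field) (auto simp: Field_card_of card_of_Card_order
    card_of_card_order_on)

text \<open>Squares and finite unions of small sets are small because \<open>U\<close> is infinite,
  and smaller cardinality provides the injection.\<close>

lemma small_end_shapes:
  assumes "universe (U :: 'u set)" "small U (X :: 'c set)"
  obtains g :: "'c end_shape \<Rightarrow> 'u" where "inj_on g (end_shapes X)" "small U (end_shapes X)"
proof -
  have inf: "infinite U" using assms(1) by (auto simp: universe_def)
  have x: "|X| <o |U|" using assms(2) by (auto simp: small_def)
  have xx: "|X \<times> X| <o |U|"
  proof (cases "finite X")
    case True then show ?thesis using inf by (intro finite_ordLess_infinite) (auto simp:
      Field_card_of card_of_Well_order card_of_well_order_on)
  next
    case False then show ?thesis using card_of_Times_same_infinite x ordIso_ordLess_trans by blast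
  qed
  have s: "|end_shapes X| <o |U|"
    unfolding end_shapes_def by (intro card_Un_ordLess card_image_ordLess x xx inf)
  obtain g :: "'c end_shape \<Rightarrow> 'u" where "inj_on g (end_shapes X)"
    using ordLess_imp_ordLeq[OF s] unfolding card_of_ordLeq[symmetric] by auto
  then show ?thesis using that s by (auto simp: small_def)
qed

locale end_diagram = F: vfunctor V C D F + G: vfunctor V C D G
  for V :: "('o, 'a) smcc" (structure) and C :: "('c, 'o, 'a) vcat" and D :: "('d, 'o, 'a) vcat"
    and F :: "('c, 'd, 'a) vfun" and G :: "('c, 'd, 'a) vfun" +
  fixes g :: "'c end_shape \<Rightarrow> 'u"
  assumes g: "inj_on g (end_shapes (VObj C))"
begin

abbreviation "Z \<equiv> end_shapes (VObj C)"
abbreviation "h \<equiv> inv_into Z g"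
abbreviation "K \<equiv> shape_cat g (VObj C)"

lemma h [simp]: "z \<in> Z \<Longrightarrow> h (g z) = z"
  using g by simp

lemma g_eq [simp]: "\<lbrakk>z \<in> Z; w \<in> Z\<rbrakk> \<Longrightarrow> g z = g w \<longleftrightarrow> z = w"
  using g by (auto simp: inj_on_def)

lemma shape_dom_Z [simp]: "z \<in> Z \<Longrightarrow> shape_dom z \<in> Z" "z \<in> Z \<Longrightarrow> shape_cod z \<in> Z"
  by (cases z; simp)+

lemma K_simps [simp]:
  "Idn K i = i" "z \<in> Z \<Longrightarrow> Dom K (g z) = g (shape_dom z)" "z \<in> Z \<Longrightarrow> Cod K (g z) = g (shape_cod z)"
  "\<lbrakk>z \<in> Z; w \<in> Z\<rbrakk> \<Longrightarrow> Cmp K (g w) (g z) = (if shape_dom z = z then g w else g z)"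
  by (simp_all add: shape_cat_def Let_def)

lemma K_Arr: "a \<in> Arr K \<longleftrightarrow> (\<exists>z\<in>Z. a = g z)"
  by (auto simp: shape_cat_def Let_def)

lemma K_Obj: "i \<in> Obj K \<longleftrightarrow> (\<exists>z\<in>Z. i = g z \<and> shape_dom z = z)"
proof
  assume "i \<in> Obj K"
  then show "\<exists>z\<in>Z. i = g z \<and> shape_dom z = z"
    by (auto simp: shape_cat_def Let_def intro: bexI[of _ "Pt x" for x] bexI[of _ "Pr x y" for x y])
next
  assume "\<exists>z\<in>Z. i = g z \<and> shape_dom z = z"
  then obtain z where z: "z \<in> Z" "i = g z" "shape_dom z = z" by auto
  then show "i \<in> Obj K"
    by (cases z) (auto simp: shape_cat_def Let_def)
qed

lemma K_Hom: "a \<in> Hom K i k \<longleftrightarrow> (\<exists>z\<in>Z. a = g z \<and> i = g (shape_dom z) \<and> k = g (shape_cod z))"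
  by (auto simp: Hom_def K_Arr)

lemma shape_dom_idem [simp]: "shape_dom (shape_dom z) = shape_dom z" "shape_dom (shape_cod z) =
  shape_cod z"
  "shape_cod (shape_dom z) = shape_dom z" "shape_cod (shape_cod z) = shape_cod z"
  by (cases z; simp)+

lemma shape_idn: "shape_dom z = z \<longleftrightarrow> shape_cod z = z"
  by (cases z) auto

text \<open>Every arrow other than an identity runs from a \<open>Pt\<close> to a \<open>Pr\<close>,
  so two of them never compose. This is why the composition of \<open>shape_cat\<close> is
  associative.\<close>

lemma shape_comp: "shape_dom w = shape_cod z \<Longrightarrow> shape_dom z = z \<or> shape_dom w = w"
  by (cases z; cases w) auto

lemma category_K: "category K"
proof (unfold_locales, goal_cases)
  case (1 f) then show ?case by (auto simp: K_Arr K_Obj)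
next
  case (2 f) then show ?case by (auto simp: K_Arr K_Obj)
next
  case (3 X)
  then obtain z where "z \<in> Z" "X = g z" "shape_dom z = z" by (auto simp: K_Obj)
  then show ?case using shape_idn[of z] by (auto simp: K_Hom intro!: bexI[of _ z])
next
  case (4 f X Y b Z')
  then obtain z w where z: "z \<in> Z" "w \<in> Z" "f = g z" "b = g w" "X = g (shape_dom z)" "Z' =
    g (shape_cod w)"
    and c: "shape_dom w = shape_cod z" by (auto simp: K_Hom)
  show ?case
  proof (cases "shape_dom z = z")
    case True then show ?thesis using z c shape_idn[of z] by (auto simp: K_Hom intro!: bexI[of _ w])
  next
    case False then show ?thesis using z c shape_comp[OF c] shape_idn[of w]
      by (auto simp: K_Hom intro!: bexI[of _ z])
  qed
next
  case (5 f X Y)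
  then obtain z where z: "z \<in> Z" "f = g z" "Y = g (shape_cod z)" by (auto simp: K_Hom)
  then show ?case using shape_idn[of z] by (cases "shape_dom z = z") auto
next
  case (6 f X Y)
  then obtain z where z: "z \<in> Z" "f = g z" "X = g (shape_dom z)" by (auto simp: K_Hom)
  then show ?case by simp
next
  case (7 f W X b Y c)
  then obtain z w v where z: "z \<in> Z" "w \<in> Z" "v \<in> Z" "f = g z" "b = g w" "c = g v"
    and c: "shape_dom w = shape_cod z" "shape_dom v = shape_cod w" by (auto simp: K_Hom)
  show ?case using z shape_comp[OF c(1)] by auto
qed

text \<open>The transposes of the two legs of the naturality condition: \<open>dl\<close>
  postcomposes with the action of \<open>G\<close>, \<open>dr\<close> precomposes with that of
  \<open>F\<close>. Equality of the two after projection is naturality.\<close>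

definition "dl x y = curry_arr V (VHom D (FO F x) (FO G x)) (VHom C x y) (VHom D (FO F x) (FO G y))
   (VCmp D (FO F x) (FO G x) (FO G y) \<cdot> (FA G x y \<boxtimes> Idn V (VHom D (FO F x) (FO G x)))
      \<cdot> Brd V (VHom D (FO F x) (FO G x)) (VHom C x y))"

definition "dr x y = curry_arr V (VHom D (FO F y) (FO G y)) (VHom C x y) (VHom D (FO F x) (FO G y))
   (VCmp D (FO F x) (FO F y) (FO G y) \<cdot> (Idn V (VHom D (FO F y) (FO G y)) \<boxtimes> FA F x y))"

lemma dl_simps [simp]:
  assumes "x \<in> VObj C" "y \<in> VObj C"
  shows "dl x y \<in> Arr V" "Dom V (dl x y) = VHom D (FO F x) (FO G x)"
    "Cod V (dl x y) = Hm V (VHom C x y) (VHom D (FO F x) (FO G y))"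
    "dr x y \<in> Arr V" "Dom V (dr x y) = VHom D (FO F y) (FO G y)"
    "Cod V (dr x y) = Hm V (VHom C x y) (VHom D (FO F x) (FO G y))"
  using assms by (simp_all add: dl_def dr_def)

lemma dl_ev [simp]:
  assumes "x \<in> VObj C" "y \<in> VObj C" "el V f" "el V a" "ty V f = VHom C x y" "dj a f" "dj f a"
  shows "ty V a = VHom D (FO F x) (FO G x) \<Longrightarrow>
      Ev V (VHom C x y) (VHom D (FO F x) (FO G y)) \<bullet> (dl x y \<bullet> a \<odot> f) = VCmp D (FO F x) (FO G x) (FO
        G y) \<bullet> (FA G x y \<bullet> f \<odot> a)"
    "ty V a = VHom D (FO F y) (FO G y) \<Longrightarrow>
      Ev V (VHom C x y) (VHom D (FO F x) (FO G y)) \<bullet> (dr x y \<bullet> a \<odot> f) = VCmp D (FO F x) (FO F y) (FO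
        G y) \<bullet> (a \<odot> FA F x y \<bullet> f)"
  using assms by (simp_all add: dl_def dr_def)

definition "Do i = (case h i of Pt x \<Rightarrow> VHom D (FO F x) (FO G x)
   | Pr x y \<Rightarrow> Hm V (VHom C x y) (VHom D (FO F x) (FO G y)) | _ \<Rightarrow> undefined)"

definition "Da a = (case h a of Pt x \<Rightarrow> Idn V (Do a) | Pr x y \<Rightarrow> Idn V (Do a) | Lf x y \<Rightarrow> dl x y | Rt x
  y \<Rightarrow> dr x y)"

lemma Do_simps [simp]:
  "x \<in> VObj C \<Longrightarrow> Do (g (Pt x)) = VHom D (FO F x) (FO G x)"
  "\<lbrakk>x \<in> VObj C; y \<in> VObj C\<rbrakk> \<Longrightarrow> Do (g (Pr x y)) = Hm V (VHom C x y) (VHom D (FO F x) (FO G y))"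
  by (simp_all add: Do_def)

lemma Da_simps [simp]:
  "x \<in> VObj C \<Longrightarrow> Da (g (Pt x)) = Idn V (Do (g (Pt x)))"
  "\<lbrakk>x \<in> VObj C; y \<in> VObj C\<rbrakk> \<Longrightarrow> Da (g (Pr x y)) = Idn V (Do (g (Pr x y)))"
  "\<lbrakk>x \<in> VObj C; y \<in> VObj C\<rbrakk> \<Longrightarrow> Da (g (Lf x y)) = dl x y"
  "\<lbrakk>x \<in> VObj C; y \<in> VObj C\<rbrakk> \<Longrightarrow> Da (g (Rt x y)) = dr x y"
  by (simp_all add: Da_def)

lemma Da_arr: "z \<in> Z \<Longrightarrow> Da (g z) \<in> Arr V \<and> Dom V (Da (g z)) = Do (g (shape_dom z)) \<and>
  Cod V (Da (g z)) = Do (g (shape_cod z))"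
  by (cases z) simp_all

lemma Da_idn: "z \<in> Z \<Longrightarrow> shape_dom z = z \<Longrightarrow> Da (g z) = Idn V (Do (g z))"
  by (cases z) simp_all

lemma functor_D: "is_functor K V Do Da"
  unfolding is_functor_def
proof (intro conjI ballI, goal_cases)
  case (3 i) then obtain z where "z \<in> Z" "i = g z" "shape_dom z = z" by (auto simp: K_Obj)
  then show ?case using F.dom.dom_Obj'[of "Da (g z)"] Da_arr[of z] by simp
next
  case (4 i k f) then show ?case using Da_arr by (auto simp: K_Hom F.dom.Hom_iff)
next
  case (5 i) then show ?case using Da_idn by (auto simp: K_Obj)
next
  case (6 i k l a b)
  then obtain z w where z: "z \<in> Z" "w \<in> Z" "a = g z" "b = g w" "g (shape_cod z) = g (shape_dom w)"
    by (auto simp: K_Hom)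
  then have c: "shape_dom w = shape_cod z" by simp
  then show ?case
  proof (cases "shape_dom z = z")
    case True
    then show ?thesis using z c Da_arr[of w] Da_idn[of z] shape_idn[of z] by simp
  next
    case False
    then have "shape_dom w = w" using shape_comp[OF c] by auto
    then show ?thesis using False z c Da_arr[of z] Da_idn[of w] by simp
  qed
qed (auto intro: category_K F.dom.category_axioms)

lemma nat_object_of_limit:
  assumes L: "is_limit K V Do Da L q"
  shows "is_nat_object V C D F G L (\<lambda>x. q (g (Pt x)))"
proof -
  have LO: "L \<in> Obj V" and qH: "\<And>i. i \<in> Obj K \<Longrightarrow> q i \<in> Hom V L (Do i)"
    and qc: "\<And>f. f \<in> Arr K \<Longrightarrow> Da f \<cdot> q (Dom K f) = q (Cod K f)"
    using L by (auto simp: is_limit_def is_cone_def)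
  have q1: "q (g (Pt x)) \<in> Hom V L (VHom D (FO F x) (FO G x))" if "x \<in> VObj C" for x
    using qH[of "g (Pt x)"] that by (force simp: K_Obj)
  have q2: "q (g (Pr x y)) \<in> Hom V L (Hm V (VHom C x y) (VHom D (FO F x) (FO G y)))" if "x \<in> VObj C"
    "y \<in> VObj C" for x y
    using qH[of "g (Pr x y)"] that by (force simp: K_Obj)
  have c1: "dl x y \<cdot> q (g (Pt x)) = q (g (Pr x y))" "dr x y \<cdot> q (g (Pt y)) = q (g (Pr x y))"
    if "x \<in> VObj C" "y \<in> VObj C" for x y
    using qc[of "g (Lf x y)"] qc[of "g (Rt x y)"] that by (force simp: K_Arr)+
  note q1' [simp] = q1[unfolded F.dom.Hom_iff, THEN conjunct1] q1[unfolded F.dom.Hom_iff, THEN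
    conjunct2, THEN conjunct1]
     q1[unfolded F.dom.Hom_iff, THEN conjunct2, THEN conjunct2]
  have fam: "is_nat_family V C D F G L (\<lambda>x. q (g (Pt x)))"
  proof (rule nat_familyI[OF F.vfunctor_axioms G.vfunctor_axioms LO], goal_cases)
    case (2 x y f a)
    have "dl x y \<cdot> q (g (Pt x)) = dr x y \<cdot> q (g (Pt y))" using c1 2 by simp
    from arg_cong[OF this, of "\<lambda>k. Ev V (VHom C x y) (VHom D (FO F x) (FO G y)) \<bullet> (k \<bullet> a \<odot> f)"]
    show ?case using 2 by simp
  qed simp
  show ?thesis
    unfolding is_nat_object_def
  proof (intro conjI allI impI, rule fam)
    fix e' p' assume p': "is_nat_family V C D F G e' p'"
    note n = nat_familyD[OF p' F.vfunctor_axioms G.vfunctor_axioms]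
    note [simp] = n(1-4)
    \<comment> \<open>At \<open>Pr x y\<close> the cone is forced by the arrow
      \<open>Lf x y\<close>; the equation \<open>eq\<close> below says that \<open>Rt x y\<close>
      forces the same value.\<close>
    define q' where "q' i = (case h i of Pt x \<Rightarrow> p' x | Pr x y \<Rightarrow> dl x y \<cdot> p' x | _ \<Rightarrow> undefined)" for i
    have q'_simps [simp]: "x \<in> VObj C \<Longrightarrow> q' (g (Pt x)) = p' x"
      "\<lbrakk>x \<in> VObj C; y \<in> VObj C\<rbrakk> \<Longrightarrow> q' (g (Pr x y)) = dl x y \<cdot> p' x" for x y
      by (simp_all add: q'_def)
    have eq: "dr x y \<cdot> p' y = dl x y \<cdot> p' x" if [simp]: "x \<in> VObj C" "y \<in> VObj C" for x y
      by (rule F.dom.curry_ext[of _ _ e' "VHom C x y" "VHom D (FO F x) (FO G y)"])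
        (simp_all add: n(5))
    have "is_cone K V Do Da e' q'"
      unfolding is_cone_def
    proof (intro conjI ballI, goal_cases)
      case (2 i)
      then obtain z where z: "z \<in> Z" "i = g z" "shape_dom z = z" by (auto simp: K_Obj)
      then show ?case by (cases z) (auto simp: F.dom.Hom_iff)
    next
      case (3 f)
      then obtain z where z: "z \<in> Z" "f = g z" by (auto simp: K_Arr)
      then show ?case by (cases z) (auto simp: eq)
    qed simp
    then obtain k where k: "k \<in> Hom V e' L" "\<forall>i\<in>Obj K. q i \<cdot> k = q' i"
      and uk: "\<And>k'. k' \<in> Hom V e' L \<and> (\<forall>i\<in>Obj K. q i \<cdot> k' = q' i) \<Longrightarrow> k' = k"
      using L unfolding is_limit_def by metis
    have k1: "q (g (Pt x)) \<cdot> k = p' x" if "x \<in> VObj C" for x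
      using k(2) that by (force simp: K_Obj)
    show "\<exists>!h. h \<in> Hom V e' L \<and> (\<forall>x\<in>VObj C. q (g (Pt x)) \<cdot> h = p' x)"
    proof (intro ex1I[of _ k] conjI ballI k(1) k1)
      fix k' assume k': "k' \<in> Hom V e' L \<and> (\<forall>x\<in>VObj C. q (g (Pt x)) \<cdot> k' = p' x)"
      then have [simp]: "k' \<in> Arr V" "Dom V k' = e'" "Cod V k' = L" by (auto simp: F.dom.Hom_iff)
      have "q i \<cdot> k' = q' i" if i: "i \<in> Obj K" for i
      proof -
        obtain z where z: "z \<in> Z" "i = g z" "shape_dom z = z" using i unfolding K_Obj by blast
        show ?thesis
          by (cases z) (use z k' in \<open>auto simp: c1(1)[symmetric]\<close>)
      qed
      then show "k' = k" using uk k' by auto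
    qed
  qed
qed

end

lemma nat_object_exists:
  fixes C :: "('c, 'o, 'a) vcat"
  assumes "universe (U :: 'u set)" "small U (VObj C)" "small_complete U V" "vfunctor V C D F"
    "vfunctor V C D G"
  shows "\<exists>e p. is_nat_object V C D F G e p"
proof -
  obtain g :: "'c end_shape \<Rightarrow> 'u" where g: "inj_on g (end_shapes (VObj C))" "small U (end_shapes
    (VObj C))"
    using small_end_shapes[OF assms(1,2)] by blast
  note sm = g(2)
  interpret F: vfunctor V C D F by fact
  interpret G: vfunctor V C D G by fact
  interpret end_diagram V C D F G g by unfold_locales (fact g(1))
  have "Arr K = g ` Z" "Obj K \<subseteq> g ` Z" by (auto simp: K_Arr K_Obj)
  then have "|Arr K| <o |U| \<and> |Obj K| <o |U|"
    using sm card_of_image card_of_mono1 ordLeq_ordLess_trans unfolding small_def by metis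
  then have "small_category U K" by (auto simp: small_category_def small_def)
  then obtain L q where "is_limit K V Do Da L q"
    using assms(3) functor_D unfolding small_complete_def has_limits_def by blast
  then show ?thesis using nat_object_of_limit by blast
qed

section \<open>Change of base\<close>

context sym_monoidal_embedding
begin

lemma jO_Obj [simp]: "X \<in> Obj V \<Longrightarrow> jO j X \<in> Obj V'"
  using j_functor by (auto simp: is_functor_def)

lemma jA_simps [simp]:
  assumes "f \<in> Arr V"
  shows "jA j f \<in> Arr V'" "Dom V' (jA j f) = jO j (Dom V f)" "Cod V' (jA j f) = jO j (Cod V f)"
proof -
  have "jA j f \<in> Hom V' (jO j (Dom V f)) (jO j (Cod V f))"
    using j_functor src.arr_Hom[OF assms] src.dom_Obj[OF assms] src.cod_Obj[OF assms]
    unfolding is_functor_def by blast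
  then show "jA j f \<in> Arr V'" "Dom V' (jA j f) = jO j (Dom V f)" "Cod V' (jA j f) = jO j (Cod V f)"
    by (auto simp: tgt.Hom_iff)
qed

lemma jA_idn [simp]: "X \<in> Obj V \<Longrightarrow> jA j (Idn V X) = Idn V' (jO j X)"
  using j_functor by (auto simp: is_functor_def)

lemma jA_cmp [simp]:
  assumes "f \<in> Arr V" "g \<in> Arr V" "Dom V g = Cod V f"
  shows "jA j (g \<cdot>\<^bsub>V\<^esub> f) = jA j g \<cdot>\<^bsub>V'\<^esub> jA j f"
proof -
  have "f \<in> Hom V (Dom V f) (Cod V f)" "g \<in> Hom V (Cod V f) (Cod V g)"
    using assms by (auto simp: src.Hom_iff)
  then show ?thesis
    using j_functor src.dom_Obj[OF assms(1)] src.cod_Obj[OF assms(1)] src.cod_Obj[OF assms(2)]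
    unfolding is_functor_def by blast
qed

lemma jA_inj:
  assumes "jA j f = jA j g" "f \<in> Arr V" "g \<in> Arr V" "Dom V f = Dom V g" "Cod V f = Cod V g"
  shows "f = g"
  using j_fully_faithful[of "Dom V g" "Cod V g"] assms by (auto simp: bij_betw_def inj_on_def
    src.Hom_iff)

lemma jA_surj:
  assumes "h \<in> Arr V'" "Dom V' h = jO j X" "Cod V' h = jO j Y" "X \<in> Obj V" "Y \<in> Obj V"
  obtains f where "f \<in> Arr V" "Dom V f = X" "Cod V f = Y" "jA j f = h"
proof -
  have "h \<in> jA j ` Hom V X Y"
    using j_fully_faithful[of X Y] assms by (auto simp: bij_betw_def tgt.Hom_iff)
  then show ?thesis using that by (auto simp: src.Hom_iff)
qed

lemma jA_iso [simp]: "is_iso V f \<Longrightarrow> is_iso V' (jA j f)"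
  by (rule tgt.is_isoI[of _ "jA j (inv_arr V f)"]) (simp_all flip: jA_cmp)

lemma jA_inv [simp]: "is_iso V f \<Longrightarrow> jA j (inv_arr V f) = inv_arr V' (jA j f)"
  by (rule tgt.inv_eqI[symmetric]) (simp_all flip: jA_cmp)

lemma jA_iso_reflect:
  assumes "is_iso V' (jA j f)" "f \<in> Arr V"
  shows "is_iso V f"
proof -
  obtain g where g: "g \<in> Arr V" "Dom V g = Cod V f" "Cod V g = Dom V f" "jA j g = inv_arr V' (jA j f)"
    by (rule jA_surj[of "inv_arr V' (jA j f)" "Cod V f" "Dom V f"]) (use assms in auto)
  show ?thesis
    by (rule src.is_isoI[of _ g]) (rule assms g | rule jA_inj, use assms g in simp_all)+
qed

lemma jT_simps [simp]:
  assumes "X \<in> Obj V" "Y \<in> Obj V"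
  shows "jT j X Y \<in> Arr V'" "Dom V' (jT j X Y) = jO j X \<otimes>\<^bsub>V'\<^esub> jO j Y" "Cod V' (jT j X Y) = jO j (X \<otimes>\<^bsub>V\<^esub> Y)"
    "is_iso V' (jT j X Y)"
  using jT_Hom[OF assms] jT_iso[OF assms] by (auto simp: tgt.Hom_iff)

lemma jU_simps [simp]: "jU j \<in> Arr V'" "Dom V' (jU j) = Unt V'" "Cod V' (jU j) =
  jO j (Unt V)" "is_iso V' (jU j)"
  using jU_Hom jU_iso by (auto simp: tgt.Hom_iff)

lemma j_ten_app [simp]:
  assumes "el V' x" "el V' y" "dj x y" "f \<in> Arr V" "g \<in> Arr V" "Dom V f = X" "Dom V g =
    Y" "ty V' x = jO j X" "ty V' y = jO j Y"
  shows "jA j (f \<boxtimes>\<^bsub>V\<^esub> g) \<bullet>\<^bsub>V'\<^esub> jT j X Y \<bullet>\<^bsub>V'\<^esub> (x \<odot>\<^bsub>V'\<^esub> y) = jT j (Cod V f) (Cod V g) \<bullet>\<^bsub>V'\<^esub> (jA j f \<bullet>\<^bsub>V'\<^esub> x \<odot>\<^bsub>V'\<^esub>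
    jA j g \<bullet>\<^bsub>V'\<^esub> y)"
proof -
  have [simp]: "X \<in> Obj V" "Y \<in> Obj V" using assms by auto
  show ?thesis
    using arg_cong[OF jT_nat[OF src.arr_Hom[OF assms(4)] src.arr_Hom[OF assms(5)]], of "\<lambda>k. k \<bullet>\<^bsub>V'\<^esub> (x
      \<odot>\<^bsub>V'\<^esub> y)"] assms
    by simp
qed

lemma j_asc_app [simp]:
  assumes "X \<in> Obj V" "Y \<in> Obj V" "Z \<in> Obj V" "el V' x" "el V' y" "el V' z" "dj x y" "dj x z" "dj y z"
    "ty V' x = jO j X" "ty V' y = jO j Y" "ty V' z = jO j Z"
  shows "jA j (Asc V X Y Z) \<bullet>\<^bsub>V'\<^esub> jT j (X \<otimes>\<^bsub>V\<^esub> Y) Z \<bullet>\<^bsub>V'\<^esub> (jT j X Y \<bullet>\<^bsub>V'\<^esub> (x \<odot>\<^bsub>V'\<^esub> y) \<odot>\<^bsub>V'\<^esub> z) =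
    jT j X (Y \<otimes>\<^bsub>V\<^esub> Z) \<bullet>\<^bsub>V'\<^esub> (x \<odot>\<^bsub>V'\<^esub> jT j Y Z \<bullet>\<^bsub>V'\<^esub> (y \<odot>\<^bsub>V'\<^esub> z))"
  using arg_cong[OF j_asc[OF assms(1-3)], of "\<lambda>k. k \<bullet>\<^bsub>V'\<^esub> ((x \<odot>\<^bsub>V'\<^esub> y) \<odot>\<^bsub>V'\<^esub> z)"] assms by simp

lemma j_brd_app [simp]:
  assumes "X \<in> Obj V" "Y \<in> Obj V" "el V' x" "el V' y" "dj x y" "ty V' x = jO j X" "ty V' y = jO j Y"
  shows "jA j (Brd V X Y) \<bullet>\<^bsub>V'\<^esub> jT j X Y \<bullet>\<^bsub>V'\<^esub> (x \<odot>\<^bsub>V'\<^esub> y) = jT j Y X \<bullet>\<^bsub>V'\<^esub> (y \<odot>\<^bsub>V'\<^esub> x)"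
  using arg_cong[OF j_brd[OF assms(1-2)], of "\<lambda>k. k \<bullet>\<^bsub>V'\<^esub> (x \<odot>\<^bsub>V'\<^esub> y)"] assms by simp

lemma j_lun_app [simp]:
  assumes "X \<in> Obj V" "el V' x" "ty V' x = jO j X"
  shows "jA j (Lun V X) \<bullet>\<^bsub>V'\<^esub> jT j (Unt V) X \<bullet>\<^bsub>V'\<^esub> (jU j \<bullet>\<^bsub>V'\<^esub> un V' \<odot>\<^bsub>V'\<^esub> x) = x"
    "inv_arr V' (jA j (Lun V X)) \<bullet>\<^bsub>V'\<^esub> x = jT j (Unt V) X \<bullet>\<^bsub>V'\<^esub> (jU j \<bullet>\<^bsub>V'\<^esub> un V' \<odot>\<^bsub>V'\<^esub> x)"
proof -
  show *: "jA j (Lun V X) \<bullet>\<^bsub>V'\<^esub> jT j (Unt V) X \<bullet>\<^bsub>V'\<^esub> (jU j \<bullet>\<^bsub>V'\<^esub> un V' \<odot>\<^bsub>V'\<^esub> x) = x"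
    using arg_cong[OF j_lun[OF assms(1)], of "\<lambda>k. k \<bullet>\<^bsub>V'\<^esub> (un V' \<odot>\<^bsub>V'\<^esub> x)"] assms by simp
  show "inv_arr V' (jA j (Lun V X)) \<bullet>\<^bsub>V'\<^esub> x = jT j (Unt V) X \<bullet>\<^bsub>V'\<^esub> (jU j \<bullet>\<^bsub>V'\<^esub> un V' \<odot>\<^bsub>V'\<^esub> x)"
    by (rule tgt.app_mono[of "jA j (Lun V X)"]) (use * assms in simp_all)
qed

lemma j_run_app [simp]:
  assumes "X \<in> Obj V" "el V' x" "ty V' x = jO j X"
  shows "jA j (Run V X) \<bullet>\<^bsub>V'\<^esub> jT j X (Unt V) \<bullet>\<^bsub>V'\<^esub> (x \<odot>\<^bsub>V'\<^esub> jU j \<bullet>\<^bsub>V'\<^esub> un V') = x"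
    "inv_arr V' (jA j (Run V X)) \<bullet>\<^bsub>V'\<^esub> x = jT j X (Unt V) \<bullet>\<^bsub>V'\<^esub> (x \<odot>\<^bsub>V'\<^esub> jU j \<bullet>\<^bsub>V'\<^esub> un V')"
proof -
  show *: "jA j (Run V X) \<bullet>\<^bsub>V'\<^esub> jT j X (Unt V) \<bullet>\<^bsub>V'\<^esub> (x \<odot>\<^bsub>V'\<^esub> jU j \<bullet>\<^bsub>V'\<^esub> un V') = x"
    using arg_cong[OF j_run[OF assms(1)], of "\<lambda>k. k \<bullet>\<^bsub>V'\<^esub> (x \<odot>\<^bsub>V'\<^esub> un V')"] assms by simp
  show "inv_arr V' (jA j (Run V X)) \<bullet>\<^bsub>V'\<^esub> x = jT j X (Unt V) \<bullet>\<^bsub>V'\<^esub> (x \<odot>\<^bsub>V'\<^esub> jU j \<bullet>\<^bsub>V'\<^esub> un V')"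
    by (rule tgt.app_mono[of "jA j (Run V X)"]) (use * assms in simp_all)
qed

text \<open>Faithfulness of \<open>j\<close> and invertibility of \<open>jT\<close> allow an
  equation in \<open>V\<close> to be tested on elements of \<open>V'\<close>.\<close>

lemma jext2:
  assumes "f \<in> Arr V" "g \<in> Arr V" "Dom V f = X \<otimes>\<^bsub>V\<^esub> Y" "Dom V g = X \<otimes>\<^bsub>V\<^esub> Y" "Cod V f =
    Cod V g" "X \<in> Obj V" "Y \<in> Obj V"
    "\<And>x y. \<lbrakk>el V' x; el V' y; ty V' x = jO j X; ty V' y = jO j Y; dj x y; dj y x\<rbrakk>
       \<Longrightarrow> jA j f \<bullet>\<^bsub>V'\<^esub> jT j X Y \<bullet>\<^bsub>V'\<^esub> (x \<odot>\<^bsub>V'\<^esub> y) = jA j g \<bullet>\<^bsub>V'\<^esub> jT j X Y \<bullet>\<^bsub>V'\<^esub> (x \<odot>\<^bsub>V'\<^esub> y)"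
  shows "f = g"
proof (rule jA_inj)
  have "jA j f \<cdot>\<^bsub>V'\<^esub> jT j X Y = jA j g \<cdot>\<^bsub>V'\<^esub> jT j X Y"
    by (rule tgt.ext2[of _ _ "jO j X" "jO j Y"]) (use assms(1-7) in \<open>simp_all add: assms(8)\<close>)
  then show "jA j f = jA j g"
    by (rule tgt.iso_epi) (use assms(1-7) in auto)
qed (use assms(1-7) in auto)

section \<open>Base change of categories, functors and natural families\<close>

abbreviation "bc \<equiv> base_cat V' j"

lemma base_simps [simp]: "VObj (bc C) = VObj C" "VHom (bc C) x y = jO j (VHom C x y)"
  by (simp_all add: base_cat_def)

text \<open>The last two conclusions are directed so that \<open>jA\<close>, \<open>jT\<close> and
  \<open>jU\<close> disappear into the structure of the base change. For modules they are used in
  the opposite direction, so that equations of \<open>V\<close> pushed along \<open>jA\<close> can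
  be applied.\<close>

lemma vcategory_base_aux:
  assumes "vcategory V C"
  shows "vcategory V' (bc C)"
    "x \<in> VObj C \<Longrightarrow> jA j (VIdn C x) \<bullet>\<^bsub>V'\<^esub> jU j \<bullet>\<^bsub>V'\<^esub> un V' = VIdn (bc C) x \<bullet>\<^bsub>V'\<^esub> un V'"
    "\<lbrakk>x \<in> VObj C; y \<in> VObj C; z \<in> VObj C; el V' g; el V' f; ty V' g = jO j (VHom C y z); ty V' f =
      jO j (VHom C x y); dj g f\<rbrakk> \<Longrightarrow>
      jA j (VCmp C x y z) \<bullet>\<^bsub>V'\<^esub> jT j (VHom C y z) (VHom C x y) \<bullet>\<^bsub>V'\<^esub> (g \<odot>\<^bsub>V'\<^esub> f) =
        VCmp (bc C) x y z \<bullet>\<^bsub>V'\<^esub> (g \<odot>\<^bsub>V'\<^esub> f)"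
proof -
  interpret vcategory V C by fact
  have i: "VIdn (bc C) x = jA j (VIdn C x) \<cdot>\<^bsub>V'\<^esub> jU j"
    and c: "VCmp (bc C) x y z = jA j (VCmp C x y z) \<cdot>\<^bsub>V'\<^esub> jT j (VHom C y z) (VHom C x y)" for x y z
    by (simp_all add: base_cat_def)
  show "jA j (VIdn C x) \<bullet>\<^bsub>V'\<^esub> jU j \<bullet>\<^bsub>V'\<^esub> un V' = VIdn (bc C) x \<bullet>\<^bsub>V'\<^esub> un V'" if "x \<in> VObj C" using that by
    (simp add: i)
  show "jA j (VCmp C x y z) \<bullet>\<^bsub>V'\<^esub> jT j (VHom C y z) (VHom C x y) \<bullet>\<^bsub>V'\<^esub> (g \<odot>\<^bsub>V'\<^esub> f) =
    VCmp (bc C) x y z \<bullet>\<^bsub>V'\<^esub> (g \<odot>\<^bsub>V'\<^esub> f)"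
    if "x \<in> VObj C" "y \<in> VObj C" "z \<in> VObj C" "el V' g" "el V' f" "ty V' g =
      jO j (VHom C y z)" "ty V' f = jO j (VHom C x y)" "dj g f"
    using that by (simp add: c)
  show "vcategory V' (bc C)"
  proof (rule vcategoryI_el, goal_cases)
    case (5 w x y z h g f)
    have "jA j (VCmp C w x z \<cdot>\<^bsub>V\<^esub> (VCmp C x y z \<boxtimes>\<^bsub>V\<^esub> Idn V (VHom C w x))) \<bullet>\<^bsub>V'\<^esub>
        jT j (VHom C y z \<otimes>\<^bsub>V\<^esub> VHom C x y) (VHom C w x) \<bullet>\<^bsub>V'\<^esub> (jT j (VHom C y z) (VHom C x y) \<bullet>\<^bsub>V'\<^esub> (h \<odot>\<^bsub>V'\<^esub>
          g) \<odot>\<^bsub>V'\<^esub> f)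
      = jA j (VCmp C w y z \<cdot>\<^bsub>V\<^esub> (Idn V (VHom C y z) \<boxtimes>\<^bsub>V\<^esub> VCmp C w x y) \<cdot>\<^bsub>V\<^esub> Asc V (VHom C y z) (VHom C x
        y) (VHom C w x)) \<bullet>\<^bsub>V'\<^esub>
        jT j (VHom C y z \<otimes>\<^bsub>V\<^esub> VHom C x y) (VHom C w x) \<bullet>\<^bsub>V'\<^esub> (jT j (VHom C y z) (VHom C x y) \<bullet>\<^bsub>V'\<^esub> (h \<odot>\<^bsub>V'\<^esub>
          g) \<odot>\<^bsub>V'\<^esub> f)"
      using 5 by (subst vcmp_assoc) simp_all
    then show ?case using 5 by (simp add: c)
  next
    case (6 x y f)
    have "jA j (VCmp C x y y \<cdot>\<^bsub>V\<^esub> (VIdn C y \<boxtimes>\<^bsub>V\<^esub> Idn V (VHom C x y))) \<bullet>\<^bsub>V'\<^esub> jT j (Unt V) (VHom C x y) \<bullet>\<^bsub>V'\<^esub>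
      (jU j \<bullet>\<^bsub>V'\<^esub> un V' \<odot>\<^bsub>V'\<^esub> f) = f"
      using 6 by (subst vcmp_vidn_left) simp_all
    then show ?case using 6 by (simp add: c i)
  next
    case (7 x y f)
    have "jA j (VCmp C x x y \<cdot>\<^bsub>V\<^esub> (Idn V (VHom C x y) \<boxtimes>\<^bsub>V\<^esub> VIdn C x)) \<bullet>\<^bsub>V'\<^esub> jT j (VHom C x y) (Unt V) \<bullet>\<^bsub>V'\<^esub>
      (f \<odot>\<^bsub>V'\<^esub> jU j \<bullet>\<^bsub>V'\<^esub> un V') = f"
      using 7 by (subst vcmp_vidn_right) simp_all
    then show ?case using 7 by (simp add: c i)
  qed (simp_all add: c i tgt.smcc_axioms)
qed

lemmas vcategory_base = vcategory_base_aux(1)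
lemmas base_idn_app = vcategory_base_aux(2)
lemmas base_cmp_app = vcategory_base_aux(3)

text \<open>Compatibility of \<open>j\<close> with the braiding lets opposites commute with base
  change on elements.\<close>

lemma base_vop_app:
  assumes "vcategory V C" "x \<in> VObj C" "y \<in> VObj C" "z \<in> VObj C" "el V' g" "el V' f" "dj g f" "dj f g"
    "ty V' g = jO j (VHom C z y)" "ty V' f = jO j (VHom C y x)"
  shows "VCmp (bc (vop V C)) x y z \<bullet>\<^bsub>V'\<^esub> (g \<odot>\<^bsub>V'\<^esub> f) = VCmp (bc C) z y x \<bullet>\<^bsub>V'\<^esub> (f \<odot>\<^bsub>V'\<^esub> g)"
    "VIdn (bc (vop V C)) x = VIdn (bc C) x"
proof -
  interpret vcategory V C by fact
  interpret b: vcategory V' "bc C" by (rule vcategory_base) fact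
  have "VCmp (bc (vop V C)) x y z \<bullet>\<^bsub>V'\<^esub> (g \<odot>\<^bsub>V'\<^esub> f) = jA j (VCmp (vop V C) x y z) \<bullet>\<^bsub>V'\<^esub> jT j (VHom C z y)
    (VHom C y x) \<bullet>\<^bsub>V'\<^esub> (g \<odot>\<^bsub>V'\<^esub> f)"
    using assms by (subst base_cmp_app[OF vcategory_vop, symmetric]) simp_all
  also have "\<dots> = VCmp (bc C) z y x \<bullet>\<^bsub>V'\<^esub> (f \<odot>\<^bsub>V'\<^esub> g)"
    using assms by (simp add: vop_def base_cmp_app)
  finally show "VCmp (bc (vop V C)) x y z \<bullet>\<^bsub>V'\<^esub> (g \<odot>\<^bsub>V'\<^esub> f) = VCmp (bc C) z y x \<bullet>\<^bsub>V'\<^esub> (f \<odot>\<^bsub>V'\<^esub> g)" .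
  show "VIdn (bc (vop V C)) x = VIdn (bc C) x" by (simp add: base_cat_def)
qed

lemma base_fun_simps [simp]:
  "x \<in> VObj C \<Longrightarrow> FO (base_fun j C F) x = FO F x"
  "\<lbrakk>x \<in> VObj C; y \<in> VObj C\<rbrakk> \<Longrightarrow> FA (base_fun j C F) x y = jA j (FA F x y)"
  by (simp_all add: base_fun_def)

lemma vfunctor_base:
  assumes "vfunctor V C D F"
  shows "vfunctor V' (bc C) (bc D) (base_fun j C F)"
proof -
  interpret F: vfunctor V C D F by fact
  note [simp] = base_cmp_app[OF F.dom.vcategory_axioms] base_cmp_app[OF F.cod.vcategory_axioms]
    base_idn_app[OF F.dom.vcategory_axioms] base_idn_app[OF F.cod.vcategory_axioms]
  have e: "base_fun j C F = mk_vfun (bc C) (FO F) (\<lambda>x y. jA j (FA F x y))"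
    by (simp add: base_fun_def mk_vfun_def)
  show ?thesis
  proof (rule vfunctorI[OF vcategory_base vcategory_base e], goal_cases)
    case (5 x)
    then show ?case using arg_cong[OF F.FA_vidn, of x "\<lambda>k. jA j k \<bullet>\<^bsub>V'\<^esub> jU j \<bullet>\<^bsub>V'\<^esub> un V'"] by simp
  next
    case (6 x y z g f)
    then show ?case
      using arg_cong[OF F.FA_vcmp, of x y z "\<lambda>k. jA j k \<bullet>\<^bsub>V'\<^esub> jT j (VHom C y z) (VHom C x y) \<bullet>\<^bsub>V'\<^esub> (g
        \<odot>\<^bsub>V'\<^esub> f)"] by simp
  qed (use F.dom.vcategory_axioms F.cod.vcategory_axioms in simp_all)
qed

lemma nat_family_base:
  assumes "is_nat_family V C D F G e p" "vfunctor V C D F" "vfunctor V C D G"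
  shows "is_nat_family V' (bc C) (bc D) (base_fun j C F) (base_fun j C G) (jO j e) (\<lambda>x. jA j (p x))"
proof -
  interpret F: vfunctor V C D F by fact
  interpret G: vfunctor V C D G by fact
  note n [simp] = nat_familyD(1-4)[OF assms]
  show ?thesis
  proof (rule nat_familyI[OF vfunctor_base[OF assms(2)] vfunctor_base[OF assms(3)]], goal_cases)
    case (3 x y f a)
    then have "VCmp D (FO F x) (FO F y) (FO G y) \<cdot>\<^bsub>V\<^esub> (p y \<boxtimes>\<^bsub>V\<^esub> FA F x y) =
        VCmp D (FO F x) (FO G x) (FO G y) \<cdot>\<^bsub>V\<^esub> (FA G x y \<boxtimes>\<^bsub>V\<^esub> p x) \<cdot>\<^bsub>V\<^esub> Brd V e (VHom C x y)"
      using assms(1) by (simp add: is_nat_family_def)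
    from arg_cong[OF this, of "\<lambda>k. jA j k \<bullet>\<^bsub>V'\<^esub> jT j e (VHom C x y) \<bullet>\<^bsub>V'\<^esub> (a \<odot>\<^bsub>V'\<^esub> f)"] 3
    show ?case by (simp add: base_cmp_app[OF F.cod.vcategory_axioms])
  qed simp_all
qed

text \<open>A natural family over \<open>V\<close> becomes one over \<open>V'\<close> by base
  change; its factorisation comes from \<open>V\<close> because \<open>j\<close> is full and is
  unique because \<open>j\<close> is faithful.\<close>

lemma nat_object_reflect:
  assumes o: "is_nat_object V' (bc C) (bc D) (base_fun j C F) (base_fun j C G) (jO j e) (\<lambda>x. jA j (p
    x))"
    and F: "vfunctor V C D F" and G: "vfunctor V C D G" and e [simp]: "e \<in> Obj V"
    and p: "\<And>x. x \<in> VObj C \<Longrightarrow> p x \<in> Hom V e (VHom D (FO F x) (FO G x))"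
  shows "is_nat_object V C D F G e p"
proof -
  interpret F: vfunctor V C D F by fact
  interpret G: vfunctor V C D G by fact
  have [simp]: "x \<in> VObj C \<Longrightarrow> p x \<in> Arr V" "x \<in> VObj C \<Longrightarrow> Dom V (p x) = e"
    "x \<in> VObj C \<Longrightarrow> Cod V (p x) = VHom D (FO F x) (FO G x)" for x
    using p[of x] by (auto simp: src.Hom_iff)
  have n: "is_nat_family V' (bc C) (bc D) (base_fun j C F) (base_fun j C G) (jO j e) (\<lambda>x. jA j (p x))"
    using o by (auto simp: is_nat_object_def)
  note FG = vfunctor_base[OF F] vfunctor_base[OF G]
  show ?thesis
    unfolding is_nat_object_def
  proof (intro conjI allI impI)
    show "is_nat_family V C D F G e p"
      unfolding is_nat_family_def
    proof (intro conjI ballI, goal_cases)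
      case (3 x y)
      show ?case
      proof (rule jext2[of _ _ e "VHom C x y"], goal_cases)
        case (8 a f)
        then show ?case using nat_familyD(5)[OF n FG, of x y f a] 3
          by (simp add: base_cmp_app[OF F.cod.vcategory_axioms])
      qed (use 3 in simp_all)
    qed (use p in auto)
    fix e' p' assume p': "is_nat_family V C D F G e' p'"
    note p'a [simp] = nat_familyD(1-4)[OF p' F G]
    obtain h where h: "h \<in> Hom V' (jO j e') (jO j e)" "\<And>x. x \<in> VObj C \<Longrightarrow> jA j (p x) \<cdot>\<^bsub>V'\<^esub> h = jA j (p' x)"
      using nat_object_lift[OF o nat_family_base[OF p' F G]] by auto
    obtain k where k: "k \<in> Arr V" "Dom V k = e'" "Cod V k = e" "jA j k = h"
      by (rule jA_surj[of h e' e]) (use h(1) in \<open>auto simp: tgt.Hom_iff\<close>)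
    show "\<exists>!h. h \<in> Hom V e' e \<and> (\<forall>x\<in>VObj C. p x \<cdot>\<^bsub>V\<^esub> h = p' x)"
    proof (intro ex1I[of _ k] conjI ballI)
      show "k \<in> Hom V e' e" using k by (auto simp: src.Hom_iff)
      show "p x \<cdot>\<^bsub>V\<^esub> k = p' x" if "x \<in> VObj C" for x
        by (rule jA_inj) (use that k h(2) in simp_all)
      fix k' assume k': "k' \<in> Hom V e' e \<and> (\<forall>x\<in>VObj C. p x \<cdot>\<^bsub>V\<^esub> k' = p' x)"
      then have [simp]: "k' \<in> Arr V" "Dom V k' = e'" "Cod V k' = e" by (auto simp: src.Hom_iff)
      show "k' = k"
      proof (rule jA_inj)
        show "jA j k' = jA j k"
        proof (rule nat_object_mono[OF o FG])
          fix x assume "x \<in> VObj (bc C)"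
          then show "jA j (p x) \<cdot>\<^bsub>V'\<^esub> jA j k' = jA j (p x) \<cdot>\<^bsub>V'\<^esub> jA j k"
            using k h(2)[of x] arg_cong[OF conjunct2[OF k', THEN bspec, of x], of "jA j"] by simp
        qed (use k h(1) in \<open>simp_all add: tgt.Hom_iff\<close>)
      qed (use k in simp_all)
    qed
  qed
qed

lemma vnat_base:
  assumes "vnat V C D F G \<alpha>" "vfunctor V C D F" "vfunctor V C D G"
  shows "vnat V' (bc C) (bc D) (base_fun j C F) (base_fun j C G) (\<lambda>x. jA j (\<alpha> x) \<cdot>\<^bsub>V'\<^esub> jU j)"
proof -
  interpret F: vfunctor V C D F by fact
  interpret G: vfunctor V C D G by fact
  note n [simp] = vnatD(1-3)[OF assms]
  show ?thesis
  proof (rule vnatI[OF vfunctor_base[OF assms(2)] vfunctor_base[OF assms(3)]], goal_cases)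
    case (2 x y f)
    then have "VCmp D (FO F x) (FO F y) (FO G y) \<cdot>\<^bsub>V\<^esub> (\<alpha> y \<boxtimes>\<^bsub>V\<^esub> FA F x y) \<cdot>\<^bsub>V\<^esub> inv_arr V (Lun V (VHom C x
      y)) =
        VCmp D (FO F x) (FO G x) (FO G y) \<cdot>\<^bsub>V\<^esub> (FA G x y \<boxtimes>\<^bsub>V\<^esub> \<alpha> x) \<cdot>\<^bsub>V\<^esub> inv_arr V (Run V (VHom C x y))"
      using assms(1) by (simp add: vnat_def)
    from arg_cong[OF this, of "\<lambda>k. jA j k \<bullet>\<^bsub>V'\<^esub> f"] 2
    show ?case by (simp add: base_cmp_app[OF F.cod.vcategory_axioms])
  qed simp
qed

lemma vnat_iso_base:
  assumes "vnat_iso V C D F G \<alpha>" and F: "vfunctor V C D F" and G: "vfunctor V C D G"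
  shows "vnat_iso V' (bc C) (bc D) (base_fun j C F) (base_fun j C G) (\<lambda>x. jA j (\<alpha> x) \<cdot>\<^bsub>V'\<^esub> jU j)"
proof -
  interpret F: vfunctor V C D F by fact
  interpret G: vfunctor V C D G by fact
  obtain \<beta> where b: "vnat V C D G F \<beta>"
    "\<And>x. x \<in> VObj C \<Longrightarrow> vcmp_el V D (FO F x) (FO G x) (FO F x) (\<beta> x) (\<alpha> x) = VIdn D (FO F x)"
    "\<And>x. x \<in> VObj C \<Longrightarrow> vcmp_el V D (FO G x) (FO F x) (FO G x) (\<alpha> x) (\<beta> x) = VIdn D (FO G x)"
    and a: "vnat V C D F G \<alpha>"
    using assms(1) unfolding vnat_iso_def by auto
  note [simp] = vnatD(1-3)[OF a F G] vnatD(1-3)[OF b(1) G F]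
  note c = base_cmp_app[OF F.cod.vcategory_axioms] base_idn_app[OF F.cod.vcategory_axioms]
  show ?thesis
  proof (rule vnat_isoI[OF vfunctor_base[OF F] vfunctor_base[OF G] vnat_base[OF a F G]
    vnat_base[OF b(1) G F]], goal_cases)
    case (1 x)
    then show ?case
      using arg_cong[OF b(2)[of x], of "\<lambda>k. jA j k \<bullet>\<^bsub>V'\<^esub> jU j \<bullet>\<^bsub>V'\<^esub> un V'"] by (simp add: vcmp_el_def c)
  next
    case (2 x)
    then show ?case
      using arg_cong[OF b(3)[of x], of "\<lambda>k. jA j k \<bullet>\<^bsub>V'\<^esub> jU j \<bullet>\<^bsub>V'\<^esub> un V'"] by (simp add: vcmp_el_def c)
  qed
qed

text \<open>The image of evaluation, which makes \<open>j [X, Y]\<close> a candidate for the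
  internal hom of \<open>j X\<close> and \<open>j Y\<close> in \<open>V'\<close>.\<close>

definition "jev X Y = jA j (Ev V X Y) \<cdot>\<^bsub>V'\<^esub> jT j (Hm V X Y) X"

lemma jev_simps [simp]:
  assumes "X \<in> Obj V" "Y \<in> Obj V"
  shows "jev X Y \<in> Arr V'" "Dom V' (jev X Y) = jO j (Hm V X Y) \<otimes>\<^bsub>V'\<^esub> jO j X" "Cod V' (jev X Y) = jO j Y"
  using assms by (simp_all add: jev_def)

lemma jev_cmp [simp]:
  assumes "X \<in> Obj V" "Y \<in> Obj V" "Z \<in> Obj V" "el V' g" "el V' f" "el V' x" "ty V' g = jO j (Hm V Y Z)"
    "ty V' f = jO j (Hm V X Y)" "ty V' x = jO j X" "dj g f" "dj g x" "dj f x"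
  shows "jev X Z \<bullet>\<^bsub>V'\<^esub> (VCmp (bc (vself V)) X Y Z \<bullet>\<^bsub>V'\<^esub> (g \<odot>\<^bsub>V'\<^esub> f) \<odot>\<^bsub>V'\<^esub> x) = jev Y Z \<bullet>\<^bsub>V'\<^esub> (g \<odot>\<^bsub>V'\<^esub> jev X Y
    \<bullet>\<^bsub>V'\<^esub> (f \<odot>\<^bsub>V'\<^esub> x))"
proof -
  interpret s: vcategory V "vself V" by (rule vcategory_vself[OF src.smcc_axioms])
  interpret bs: vcategory V' "bc (vself V)" by (rule vcategory_base[OF s.vcategory_axioms])
  have "Ev V X Z \<cdot>\<^bsub>V\<^esub> (VCmp (vself V) X Y Z \<boxtimes>\<^bsub>V\<^esub> Idn V X) =
     Ev V Y Z \<cdot>\<^bsub>V\<^esub> (Idn V (Hm V Y Z) \<boxtimes>\<^bsub>V\<^esub> Ev V X Y) \<cdot>\<^bsub>V\<^esub> Asc V (Hm V Y Z) (Hm V X Y) X"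
    using assms(1-3) by (intro src.ext3[of _ _ "Hm V Y Z" "Hm V X Y" X]) simp_all
  from arg_cong[OF this, of "\<lambda>k. jA j k \<bullet>\<^bsub>V'\<^esub> jT j (Hm V Y Z \<otimes>\<^bsub>V\<^esub> Hm V X Y) X \<bullet>\<^bsub>V'\<^esub> (jT j (Hm V Y Z) (Hm V
    X Y) \<bullet>\<^bsub>V'\<^esub> (g \<odot>\<^bsub>V'\<^esub> f) \<odot>\<^bsub>V'\<^esub> x)"]
    assms base_cmp_app[OF s.vcategory_axioms, of X Y Z g f]
  show ?thesis by (simp add: jev_def)
qed

lemma jev_idn [simp]:
  assumes "X \<in> Obj V" "el V' x" "ty V' x = jO j X"
  shows "jev X X \<bullet>\<^bsub>V'\<^esub> (VIdn (bc (vself V)) X \<bullet>\<^bsub>V'\<^esub> un V' \<odot>\<^bsub>V'\<^esub> x) = x"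
proof -
  interpret s: vcategory V "vself V" by (rule vcategory_vself[OF src.smcc_axioms])
  interpret bs: vcategory V' "bc (vself V)" by (rule vcategory_base[OF s.vcategory_axioms])
  have "Ev V X X \<cdot>\<^bsub>V\<^esub> (VIdn (vself V) X \<boxtimes>\<^bsub>V\<^esub> Idn V X) = Lun V X"
    using assms(1) by (intro src.ext2L[of _ _ X]) simp_all
  from arg_cong[OF this, of "\<lambda>k. jA j k \<bullet>\<^bsub>V'\<^esub> jT j (Unt V) X \<bullet>\<^bsub>V'\<^esub> (jU j \<bullet>\<^bsub>V'\<^esub> un V' \<odot>\<^bsub>V'\<^esub> x)"]
    assms base_idn_app[OF s.vcategory_axioms, of X]
  show ?thesis by (simp add: jev_def)
qed

lemma jev_curry [simp]:
  assumes "f \<in> Arr V" "Dom V f = X \<otimes>\<^bsub>V\<^esub> Y" "Cod V f = Z" "X \<in> Obj V" "Y \<in> Obj V" "el V' x" "el V' y"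
    "dj x y"
    "ty V' x = jO j X" "ty V' y = jO j Y"
  shows "jev Y Z \<bullet>\<^bsub>V'\<^esub> (jA j (curry_arr V X Y Z f) \<bullet>\<^bsub>V'\<^esub> x \<odot>\<^bsub>V'\<^esub> y) = jA j f \<bullet>\<^bsub>V'\<^esub> jT j X Y \<bullet>\<^bsub>V'\<^esub> (x \<odot>\<^bsub>V'\<^esub> y)"
proof -
  have [simp]: "Z \<in> Obj V" using assms by auto
  have "jA j (Ev V Y Z \<cdot>\<^bsub>V\<^esub> (curry_arr V X Y Z f \<boxtimes>\<^bsub>V\<^esub> Idn V Y)) \<bullet>\<^bsub>V'\<^esub> jT j X Y \<bullet>\<^bsub>V'\<^esub> (x \<odot>\<^bsub>V'\<^esub> y)
    = jA j f \<bullet>\<^bsub>V'\<^esub> jT j X Y \<bullet>\<^bsub>V'\<^esub> (x \<odot>\<^bsub>V'\<^esub> y)"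
    using assms by (subst src.curry_simps) simp_all
  then show ?thesis using assms by (simp add: jev_def del: src.curry_simps(4))
qed

text \<open>Preservation of internal homs says that the comparison \<open>?c\<close> from
  \<open>j [X, Y]\<close> to the internal hom of \<open>V'\<close> is invertible; the universal
  property of \<open>Ev V'\<close> is transported along it.\<close>

lemma jev_univ:
  assumes P: "preserves_internal_homs V V' j"
    and h: "h \<in> Arr V'" "Dom V' h = W \<otimes>\<^bsub>V'\<^esub> jO j X" "Cod V' h = jO j Y" "W \<in> Obj V'" "X \<in> Obj V" "Y \<in>
      Obj V"
  shows "\<exists>!g. g \<in> Hom V' W (jO j (Hm V X Y)) \<and> jev X Y \<cdot>\<^bsub>V'\<^esub> (g \<boxtimes>\<^bsub>V'\<^esub> Idn V' (jO j X)) = h"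
proof -
  let ?c = "curry_arr V' (jO j (Hm V X Y)) (jO j X) (jO j Y) (jev X Y)"
  have iso: "is_iso V' ?c" using P h unfolding preserves_internal_homs_def jev_def by blast
  have ct: "Dom V' ?c = jO j (Hm V X Y)" "Cod V' ?c = Hm V' (jO j X) (jO j Y)"
    using h by simp_all
  have e: "Ev V' (jO j X) (jO j Y) \<cdot>\<^bsub>V'\<^esub> ((?c \<cdot>\<^bsub>V'\<^esub> g) \<boxtimes>\<^bsub>V'\<^esub> Idn V' (jO j X)) = jev X Y \<cdot>\<^bsub>V'\<^esub> (g \<boxtimes>\<^bsub>V'\<^esub> Idn V'
    (jO j X))"
    if g: "g \<in> Hom V' W (jO j (Hm V X Y))" for g
    by (rule tgt.ext2[of _ _ W "jO j X"]) (use g h in \<open>simp_all add: tgt.Hom_iff\<close>)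
  show ?thesis
  proof (rule ex1I[of _ "inv_arr V' ?c \<cdot>\<^bsub>V'\<^esub> curry_arr V' W (jO j X) (jO j Y) h"])
    have t: "inv_arr V' ?c \<cdot>\<^bsub>V'\<^esub> curry_arr V' W (jO j X) (jO j Y) h \<in> Hom V' W (jO j (Hm V X Y))"
      using h iso ct by (simp add: tgt.Hom_iff)
    show "inv_arr V' ?c \<cdot>\<^bsub>V'\<^esub> curry_arr V' W (jO j X) (jO j Y) h \<in> Hom V' W (jO j (Hm V X Y)) \<and>
       jev X Y \<cdot>\<^bsub>V'\<^esub> ((inv_arr V' ?c \<cdot>\<^bsub>V'\<^esub> curry_arr V' W (jO j X) (jO j Y) h) \<boxtimes>\<^bsub>V'\<^esub> Idn V' (jO j X)) = h"
      using t e[OF t] h iso ct by simp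
    fix g assume g: "g \<in> Hom V' W (jO j (Hm V X Y)) \<and> jev X Y \<cdot>\<^bsub>V'\<^esub> (g \<boxtimes>\<^bsub>V'\<^esub> Idn V' (jO j X)) = h"
    then have gt: "g \<in> Arr V'" "Dom V' g = W" "Cod V' g = jO j (Hm V X Y)" by (auto simp: tgt.Hom_iff)
    have "?c \<cdot>\<^bsub>V'\<^esub> g = curry_arr V' W (jO j X) (jO j Y) h"
      by (rule tgt.ev_inj[of "jO j X" "jO j Y"]) (use g e[of g] gt h ct iso in simp_all)
    then show "g = inv_arr V' ?c \<cdot>\<^bsub>V'\<^esub> curry_arr V' W (jO j X) (jO j Y) h"
      using iso ct gt by (metis tgt.inv_cancel(2))
  qed
qed

end

section \<open>Categories of modules\<close>

text \<open>
  \<open>D\<close> is, up to isomorphism, a full sub-\<open>\<V>\<close>-category of \<open>\<V>\<close>: the object \<open>x\<close> stands for \<open>ro x\<close>, and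
    \<open>D(x, y)\<close> for the
  internal hom. The second instance, besides \<open>\<V>\<close> itself, is \<open>\<V>\<close> as a \<open>\<V>'\<close>-category.
\<close>

locale realized = vcategory V D
  for V :: "('o, 'a) smcc" (structure) and D :: "('d, 'o, 'a) vcat" +
  fixes ro :: "'d \<Rightarrow> 'o" and ev :: "'d \<Rightarrow> 'd \<Rightarrow> 'a"
  assumes ro_Obj [simp]: "x \<in> VObj D \<Longrightarrow> ro x \<in> Obj V"
    and ev_Arr [simp]: "\<lbrakk>x \<in> VObj D; y \<in> VObj D\<rbrakk> \<Longrightarrow> ev x y \<in> Arr V"
    and ev_Dom [simp]: "\<lbrakk>x \<in> VObj D; y \<in> VObj D\<rbrakk> \<Longrightarrow> Dom V (ev x y) = VHom D x y \<otimes> ro x"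
    and ev_Cod [simp]: "\<lbrakk>x \<in> VObj D; y \<in> VObj D\<rbrakk> \<Longrightarrow> Cod V (ev x y) = ro y"
    and ev_idn [simp]: "\<lbrakk>x \<in> VObj D; el V u; ty V u = ro x\<rbrakk> \<Longrightarrow> ev x x \<bullet> (VIdn D x \<bullet> un V \<odot> u) = u"
    and ev_cmp [simp]: "\<lbrakk>x \<in> VObj D; y \<in> VObj D; z \<in> VObj D; el V g; el V f; el V u; ty V g =
      VHom D y z;
       ty V f = VHom D x y; ty V u = ro x; dj g f; dj g u; dj f u\<rbrakk> \<Longrightarrow>
       ev x z \<bullet> (VCmp D x y z \<bullet> (g \<odot> f) \<odot> u) = ev y z \<bullet> (g \<odot> ev x y \<bullet> (f \<odot> u))"
    and ev_universal: "\<lbrakk>x \<in> VObj D; y \<in> VObj D; h \<in> Arr V; Dom V h = W \<otimes> ro x; Cod V h = ro y;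
      W \<in> Obj V\<rbrakk> \<Longrightarrow>
       \<exists>!g. g \<in> Hom V W (VHom D x y) \<and> ev x y \<cdot> (g \<boxtimes> Idn V (ro x)) = h"
begin

lemma rv_inj:
  assumes "ev x y \<cdot> (g \<boxtimes> Idn V (ro x)) = ev x y \<cdot> (h \<boxtimes> Idn V (ro x))" "g \<in> Arr V" "h \<in> Arr V"
    "Dom V g = Dom V h" "Cod V g = VHom D x y" "Cod V h = VHom D x y" "x \<in> VObj D" "y \<in> VObj D"
  shows "g = h"
proof -
  have "\<exists>!k. k \<in> Hom V (Dom V h) (VHom D x y) \<and> ev x y \<cdot> (k \<boxtimes> Idn V (ro x)) =
    ev x y \<cdot> (h \<boxtimes> Idn V (ro x))"
    by (rule ev_universal) (use assms(2-) in simp_all)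
  moreover have "g \<in> Hom V (Dom V h) (VHom D x y)" "h \<in> Hom V (Dom V h) (VHom D x y)"
    using assms by (simp_all add: Hom_iff)
  ultimately show ?thesis using assms(1) by blast
qed

text \<open>An arrow into the end is a natural family \<open>W \<rightarrow> D(F t, G t)\<close>,
  hence by transposition a family of arrows \<open>W \<otimes> F t \<rightarrow> G t\<close>.
  Naturality then becomes compatibility with the actions of \<open>C\<close> on \<open>F\<close> and
  \<open>G\<close>; this is the shape of \<open>act_univ\<close> below.\<close>

lemma action_universal:
  assumes o: "is_nat_object V C D F G e p" and FV: "vfunctor V C D F" and GV: "vfunctor V C D G"
    and W: "W \<in> Obj V"
    and q: "\<And>t. t \<in> VObj C \<Longrightarrow> q t \<in> Arr V \<and> Dom V (q t) = W \<otimes> ro (FO F t) \<and> Cod V (q t) = ro (FO G t)"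
    and n: "\<And>s t w f x. \<lbrakk>s \<in> VObj C; t \<in> VObj C; el V w; el V f; el V x; ty V w = W; ty V f =
      VHom C s t;
        ty V x = ro (FO F s); dj w f; dj f w; dj w x; dj x w; dj f x; dj x f\<rbrakk> \<Longrightarrow>
      q t \<bullet> (w \<odot> ev (FO F s) (FO F t) \<bullet> (FA F s t \<bullet> f \<odot> x)) = ev (FO G s) (FO G t) \<bullet> (FA G s t \<bullet> f \<odot>
        q s \<bullet> (w \<odot> x))"
  shows "\<exists>!h. h \<in> Hom V W e \<and> (\<forall>t\<in>VObj C. ev (FO F t) (FO G t) \<cdot> ((p t \<cdot> h) \<boxtimes> Idn V (ro (FO F t))) =
    q t)"
proof -
  interpret F: vfunctor V C D F by fact
  interpret G: vfunctor V C D G by fact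
  have pt: "p t \<in> Arr V" "Dom V (p t) = e" "Cod V (p t) = VHom D (FO F t) (FO G t)" if "t \<in> VObj C"
    for t
    using nat_familyD(2-4)[OF _ FV GV] o that unfolding is_nat_object_def by blast+
  \<comment> \<open>The transpose of \<open>q t\<close> under the universal property of
    \<open>ev\<close>.\<close>
  define r where "r t = (THE g. g \<in> Hom V W (VHom D (FO F t) (FO G t)) \<and> ev (FO F t) (FO G t) \<cdot> (g \<boxtimes>
    Idn V (ro (FO F t))) = q t)" for t
  have r: "r t \<in> Hom V W (VHom D (FO F t) (FO G t)) \<and> ev (FO F t) (FO G t) \<cdot> (r t \<boxtimes> Idn V (ro (FO F
    t))) = q t" if t: "t \<in> VObj C" for t
    unfolding r_def by (rule theI', rule ev_universal) (use q t W in auto)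
  have rt: "r t \<in> Arr V" "Dom V (r t) = W" "Cod V (r t) = VHom D (FO F t) (FO G t)" if "t \<in> VObj C"
    for t
    using r[OF that] by (auto simp: Hom_iff)
  have re: "ev (FO F t) (FO G t) \<bullet> (r t \<bullet> w \<odot> x) = q t \<bullet> (w \<odot> x)"
    if "t \<in> VObj C" "el V w" "el V x" "ty V w = W" "ty V x = ro (FO F t)" "dj w x" for t w x
    using arg_cong[OF conjunct2[OF r[OF that(1)]], of "\<lambda>k. k \<bullet> (w \<odot> x)"] that rt[OF that(1)] by simp
  have "is_nat_family V C D F G W r"
    unfolding is_nat_family_def
  proof (intro conjI ballI, rule W, goal_cases)
    case (2 x y)
    show ?case
    proof (rule rv_inj[of "FO F x" "FO G y"], goal_cases)
      case 1
      show ?case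
      proof (rule ext3[of _ _ W "VHom C x y" "ro (FO F x)"], goal_cases)
        case (8 w f u)
        then show ?case using 2 W n[of x y w f u] q[of x] q[of y] by (simp add: rt re)
      qed (use 2 W in \<open>simp_all add: rt\<close>)
    qed (use 2 W in \<open>simp_all add: rt\<close>)
  qed (use r in auto)
  then have u: "\<exists>!h. h \<in> Hom V W e \<and> (\<forall>t\<in>VObj C. p t \<cdot> h = r t)"
    using o unfolding is_nat_object_def by blast
  have "p t \<cdot> h = r t \<longleftrightarrow> ev (FO F t) (FO G t) \<cdot> ((p t \<cdot> h) \<boxtimes> Idn V (ro (FO F t))) = q t"
    if t: "t \<in> VObj C" and h: "h \<in> Hom V W e" for t h
  proof
    assume a: "ev (FO F t) (FO G t) \<cdot> ((p t \<cdot> h) \<boxtimes> Idn V (ro (FO F t))) = q t"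
    show "p t \<cdot> h = r t"
      by (rule rv_inj[of "FO F t" "FO G t"]) (use t h a r[OF t] rt[OF t] pt[OF t]
        in \<open>simp_all add: Hom_iff\<close>)
  qed (use r[OF t] in simp)
  then have "(h \<in> Hom V W e \<and> (\<forall>t\<in>VObj C. p t \<cdot> h = r t)) \<longleftrightarrow>
    (h \<in> Hom V W e \<and> (\<forall>t\<in>VObj C. ev (FO F t) (FO G t) \<cdot> ((p t \<cdot> h) \<boxtimes> Idn V (ro (FO F t))) = q t))" for h
    by blast
  then show ?thesis using u by simp
qed

end

text \<open>
  An axiomatisation of \<open>T-Alg\<close> by actions, valid over both \<open>\<V>\<close> and \<open>\<V>'\<close>: \<open>ob M t\<close> is the value of
    \<open>M\<close> at \<open>t\<close>,
  \<open>rho M s t : T(s, t) \<otimes> M s \<rightarrow> M t\<close> is the action of \<open>T\<close>, and \<open>act M N t : A(M, N) \<otimes> M t \<rightarrow> N t\<close> is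
    evaluation.
\<close>

locale module_category = T: vcategory V T + A: vcategory V A
  for V :: "('o, 'a) smcc" (structure) and T :: "('t, 'o, 'a) vcat" and A :: "('m, 'o, 'a) vcat" +
  fixes ob :: "'m \<Rightarrow> 't \<Rightarrow> 'o" and rho :: "'m \<Rightarrow> 't \<Rightarrow> 't \<Rightarrow> 'a" and act :: "'m \<Rightarrow> 'm \<Rightarrow> 't \<Rightarrow> 'a"
  assumes ob_Obj [simp]: "\<lbrakk>M \<in> VObj A; t \<in> VObj T\<rbrakk> \<Longrightarrow> ob M t \<in> Obj V"
    and rho_Hom: "\<lbrakk>M \<in> VObj A; s \<in> VObj T; t \<in> VObj T\<rbrakk> \<Longrightarrow> rho M s t \<in> Hom V (VHom T s t \<otimes> ob M s) (ob
      M t)"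
    and rho_idn [simp]: "\<lbrakk>M \<in> VObj A; t \<in> VObj T; el V x; ty V x = ob M t\<rbrakk> \<Longrightarrow>
      rho M t t \<bullet> (VIdn T t \<bullet> un V \<odot> x) = x"
    and rho_cmp [simp]: "\<lbrakk>M \<in> VObj A; r \<in> VObj T; s \<in> VObj T; t \<in> VObj T; el V g; el V f; el V x;
      ty V g = VHom T s t; ty V f = VHom T r s; ty V x = ob M r; dj g f; dj g x; dj f x\<rbrakk> \<Longrightarrow>
      rho M r t \<bullet> (VCmp T r s t \<bullet> (g \<odot> f) \<odot> x) = rho M s t \<bullet> (g \<odot> rho M r s \<bullet> (f \<odot> x))"
    and act_Hom: "\<lbrakk>M \<in> VObj A; N \<in> VObj A; t \<in> VObj T\<rbrakk> \<Longrightarrow> act M N t \<in> Hom V (VHom A M N \<otimes> ob M t) (ob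
      N t)"
    and act_idn [simp]: "\<lbrakk>M \<in> VObj A; t \<in> VObj T; el V x; ty V x = ob M t\<rbrakk> \<Longrightarrow>
      act M M t \<bullet> (VIdn A M \<bullet> un V \<odot> x) = x"
    and act_cmp [simp]: "\<lbrakk>M \<in> VObj A; N \<in> VObj A; K \<in> VObj A; t \<in> VObj T; el V b; el V a; el V x;
      ty V b = VHom A N K; ty V a = VHom A M N; ty V x = ob M t; dj b a; dj b x; dj a x\<rbrakk> \<Longrightarrow>
      act M K t \<bullet> (VCmp A M N K \<bullet> (b \<odot> a) \<odot> x) = act N K t \<bullet> (b \<odot> act M N t \<bullet> (a \<odot> x))"
    and act_nat: "\<lbrakk>M \<in> VObj A; N \<in> VObj A; s \<in> VObj T; t \<in> VObj T; el V a; el V f; el V x;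
      ty V a = VHom A M N; ty V f = VHom T s t; ty V x = ob M s; dj a f; dj a x; dj f x\<rbrakk> \<Longrightarrow>
      act M N t \<bullet> (a \<odot> rho M s t \<bullet> (f \<odot> x)) = rho N s t \<bullet> (f \<odot> act M N s \<bullet> (a \<odot> x))"
    and act_univ: "\<And>M N W q. \<lbrakk>M \<in> VObj A; N \<in> VObj A; W \<in> Obj V;
      \<And>t. t \<in> VObj T \<Longrightarrow> q t \<in> Hom V (W \<otimes> ob M t) (ob N t);
      \<And>s t w f x. \<lbrakk>s \<in> VObj T; t \<in> VObj T; el V w; el V f; el V x; ty V w = W; ty V f = VHom T s t;
        ty V x = ob M s; dj w f; dj f w; dj w x; dj x w; dj f x; dj x f\<rbrakk> \<Longrightarrow>
        q t \<bullet> (w \<odot> rho M s t \<bullet> (f \<odot> x)) = rho N s t \<bullet> (f \<odot> q s \<bullet> (w \<odot> x))\<rbrakk> \<Longrightarrow>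
      \<exists>!h. h \<in> Hom V W (VHom A M N) \<and> (\<forall>t\<in>VObj T. act M N t \<cdot> (h \<boxtimes> Idn V (ob M t)) = q t)"
begin

lemma rho_simps [simp]:
  assumes "M \<in> VObj A" "s \<in> VObj T" "t \<in> VObj T"
  shows "rho M s t \<in> Arr V" "Dom V (rho M s t) = VHom T s t \<otimes> ob M s" "Cod V (rho M s t) = ob M t"
  using rho_Hom[OF assms] by (auto simp: T.Hom_iff)

lemma act_simps [simp]:
  assumes "M \<in> VObj A" "N \<in> VObj A" "t \<in> VObj T"
  shows "act M N t \<in> Arr V" "Dom V (act M N t) = VHom A M N \<otimes> ob M t" "Cod V (act M N t) = ob N t"
  using act_Hom[OF assms] by (auto simp: T.Hom_iff)

lemma act_lift:
  assumes "M \<in> VObj A" "N \<in> VObj A" "W \<in> Obj V"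
    "\<And>t. t \<in> VObj T \<Longrightarrow> q t \<in> Arr V \<and> Dom V (q t) = W \<otimes> ob M t \<and> Cod V (q t) = ob N t"
    "\<And>s t w f x. \<lbrakk>s \<in> VObj T; t \<in> VObj T; el V w; el V f; el V x; ty V w = W; ty V f = VHom T s t;
        ty V x = ob M s; dj w f; dj f w; dj w x; dj x w; dj f x; dj x f\<rbrakk> \<Longrightarrow>
        q t \<bullet> (w \<odot> rho M s t \<bullet> (f \<odot> x)) = rho N s t \<bullet> (f \<odot> q s \<bullet> (w \<odot> x))"
  obtains h where "h \<in> Arr V" "Dom V h = W" "Cod V h = VHom A M N"
    "\<And>t w x. \<lbrakk>t \<in> VObj T; el V w; el V x; ty V w = W; ty V x = ob M t; dj w x\<rbrakk> \<Longrightarrow>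
       act M N t \<bullet> (h \<bullet> w \<odot> x) = q t \<bullet> (w \<odot> x)"
proof -
  have "\<exists>!h. h \<in> Hom V W (VHom A M N) \<and> (\<forall>t\<in>VObj T. act M N t \<cdot> (h \<boxtimes> Idn V (ob M t)) = q t)"
    by (rule act_univ) (use assms in \<open>auto simp: T.Hom_iff\<close>)
  then obtain h where h: "h \<in> Arr V" "Dom V h = W" "Cod V h = VHom A M N"
    "\<And>t. t \<in> VObj T \<Longrightarrow> act M N t \<cdot> (h \<boxtimes> Idn V (ob M t)) = q t"
    by (auto simp: T.Hom_iff)
  show ?thesis
  proof (rule that[OF h(1-3)], goal_cases)
    case (1 t w x)
    then show ?case using arg_cong[OF h(4), of t "\<lambda>k. k \<bullet> (w \<odot> x)"] h(1-3) assms(1,2) by simp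
  qed
qed

text \<open>The family obtained by letting \<open>h'\<close> act is compatible by
  \<open>act_nat\<close>, so the uniqueness in \<open>act_univ\<close> applies to it.\<close>

lemma act_inj:
  assumes h: "h \<in> Arr V" "h' \<in> Arr V" "Dom V h = Dom V h'" "Cod V h = VHom A M N" "Cod V h' =
    VHom A M N"
    "M \<in> VObj A" "N \<in> VObj A"
    and eq: "\<And>t. t \<in> VObj T \<Longrightarrow> act M N t \<cdot> (h \<boxtimes> Idn V (ob M t)) = act M N t \<cdot> (h' \<boxtimes> Idn V (ob M t))"
  shows "h = h'"
proof -
  have "\<exists>!k. k \<in> Hom V (Dom V h') (VHom A M N) \<and>
      (\<forall>t\<in>VObj T. act M N t \<cdot> (k \<boxtimes> Idn V (ob M t)) = act M N t \<cdot> (h' \<boxtimes> Idn V (ob M t)))"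
    by (rule act_univ) (use h in \<open>simp_all add: T.Hom_iff act_nat\<close>)
  moreover have "h \<in> Hom V (Dom V h') (VHom A M N)" "h' \<in> Hom V (Dom V h') (VHom A M N)"
    using h by (auto simp: T.Hom_iff)
  ultimately show ?thesis using eq by blast
qed

lemma act_ext:
  assumes "h \<in> Arr V" "h' \<in> Arr V" "Dom V h = W" "Dom V h' = W" "Cod V h = VHom A M N" "Cod V h' =
    VHom A M N"
    "M \<in> VObj A" "N \<in> VObj A"
    "\<And>t w x. \<lbrakk>t \<in> VObj T; el V w; el V x; ty V w = W; ty V x = ob M t; dj w x; dj x w\<rbrakk> \<Longrightarrow>
      act M N t \<bullet> (h \<bullet> w \<odot> x) = act M N t \<bullet> (h' \<bullet> w \<odot> x)"
  shows "h = h'"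
proof (rule act_inj)
  have [simp]: "W \<in> Obj V" using assms(1,3) by auto
  show "act M N t \<cdot> (h \<boxtimes> Idn V (ob M t)) = act M N t \<cdot> (h' \<boxtimes> Idn V (ob M t))" if "t \<in> VObj T" for t
    by (rule T.ext2[of _ _ W "ob M t"]) (use assms(1-8) that in \<open>simp_all add: assms(9)\<close>)
qed (use assms(1-8) in auto)

lemma act_ext2:
  assumes "h \<in> Arr V" "h' \<in> Arr V" "Dom V h = W \<otimes> W'" "Dom V h' = W \<otimes> W'" "Cod V h =
    VHom A M N" "Cod V h' = VHom A M N"
    "M \<in> VObj A" "N \<in> VObj A" "W \<in> Obj V" "W' \<in> Obj V"
    "\<And>t w w' x. \<lbrakk>t \<in> VObj T; el V w; el V w'; el V x; ty V w = W; ty V w' = W'; ty V x = ob M t;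
      dj w w'; dj w' w; dj w x; dj x w; dj w' x; dj x w'\<rbrakk> \<Longrightarrow>
      act M N t \<bullet> (h \<bullet> (w \<odot> w') \<odot> x) = act M N t \<bullet> (h' \<bullet> (w \<odot> w') \<odot> x)"
  shows "h = h'"
proof (rule act_inj)
  show "act M N t \<cdot> (h \<boxtimes> Idn V (ob M t)) = act M N t \<cdot> (h' \<boxtimes> Idn V (ob M t))" if "t \<in> VObj T" for t
    by (rule T.ext3[of _ _ W W' "ob M t"]) (use assms(1-10) that in \<open>simp_all add: assms(11)\<close>)
qed (use assms(1-10) in auto)

lemma act_extU:
  assumes "h \<in> Arr V" "h' \<in> Arr V" "Dom V h = Unt V" "Dom V h' = Unt V" "Cod V h =
    VHom A M N" "Cod V h' = VHom A M N"
    "M \<in> VObj A" "N \<in> VObj A"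
    "\<And>t x. \<lbrakk>t \<in> VObj T; el V x; ty V x = ob M t\<rbrakk> \<Longrightarrow>
      act M N t \<bullet> (h \<bullet> un V \<odot> x) = act M N t \<bullet> (h' \<bullet> un V \<odot> x)"
  shows "h = h'"
proof (rule act_inj)
  show "act M N t \<cdot> (h \<boxtimes> Idn V (ob M t)) = act M N t \<cdot> (h' \<boxtimes> Idn V (ob M t))" if "t \<in> VObj T" for t
    by (rule T.ext2L[of _ _ "ob M t"]) (use assms(1-8) that in \<open>simp_all add: assms(9)\<close>)
qed (use assms(1-8) in auto)

text \<open>The case \<open>W = I\<close> of the universal property: a homomorphism given by plain
  arrows \<open>M t \<rightarrow> N t\<close> is a global element of the hom.\<close>

lemma act_global:
  assumes [simp]: "M \<in> VObj A" "N \<in> VObj A"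
    and psi: "\<And>t. t \<in> VObj T \<Longrightarrow> \<psi> t \<in> Arr V \<and> Dom V (\<psi> t) = ob M t \<and> Cod V (\<psi> t) = ob N t"
    and n: "\<And>s t f x. \<lbrakk>s \<in> VObj T; t \<in> VObj T; el V f; el V x; ty V f = VHom T s t; ty V x = ob M s;
      dj f x\<rbrakk> \<Longrightarrow>
      \<psi> t \<bullet> rho M s t \<bullet> (f \<odot> x) = rho N s t \<bullet> (f \<odot> \<psi> s \<bullet> x)"
  shows "\<exists>k. k \<in> Hom V (Unt V) (VHom A M N) \<and> (\<forall>t x. t \<in> VObj T \<longrightarrow> el V x \<longrightarrow> ty V x = ob M t \<longrightarrow>
      act M N t \<bullet> (k \<bullet> un V \<odot> x) = \<psi> t \<bullet> x)"
proof -
  obtain k where k: "k \<in> Arr V" "Dom V k = Unt V" "Cod V k = VHom A M N"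
    "\<And>t w x. \<lbrakk>t \<in> VObj T; el V w; el V x; ty V w = Unt V; ty V x = ob M t; dj w x\<rbrakk> \<Longrightarrow>
       act M N t \<bullet> (k \<bullet> w \<odot> x) = (\<psi> t \<cdot> Lun V (ob M t)) \<bullet> (w \<odot> x)"
  proof (rule act_lift[of M N "Unt V" "\<lambda>t. \<psi> t \<cdot> Lun V (ob M t)"], goal_cases)
    case (5 s t w f x)
    have "(\<psi> t \<cdot> Lun V (ob M t)) \<cdot> (Idn V (Unt V) \<boxtimes> rho M s t) \<cdot> Asc V (Unt V) (VHom T s t) (ob M s) =
      rho N s t \<cdot> (Idn V (VHom T s t) \<boxtimes> (\<psi> s \<cdot> Lun V (ob M s))) \<cdot>
        Asc V (VHom T s t) (Unt V) (ob M s) \<cdot> (Brd V (Unt V) (VHom T s t) \<boxtimes> Idn V (ob M s))"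
      by (rule T.ext0[of _ "(un V \<odot> T.gen 0 (VHom T s t)) \<odot> T.gen 1 (ob M s)"])
        (use 5 psi[of s] psi[of t] in \<open>simp_all add: n\<close>)
    from arg_cong[OF this, of "\<lambda>k. k \<bullet> ((w \<odot> f) \<odot> x)"] 5 psi[of s] psi[of t] show ?case by simp
  qed (use psi in simp_all)
  then show ?thesis using psi by (intro exI[of _ k]) (simp add: T.Hom_iff)
qed

text \<open>Arrows into the homs of \<open>A\<close> are tested on actions, where
  \<open>bact\<close> reads precomposition in \<open>C\<close>; functoriality becomes associativity
  and the unit law of \<open>C\<close>.\<close>

lemma bracket_functor:
  assumes C: "vcategory V C" and E: "vfunctor V T C E"
    and br [simp]: "\<And>c. c \<in> VObj C \<Longrightarrow> br c \<in> VObj A"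
    and ob [simp]: "\<And>c t. \<lbrakk>c \<in> VObj C; t \<in> VObj T\<rbrakk> \<Longrightarrow> ob (br c) t = VHom C c (FO E t)"
    and R: "R = mk_vfun (vop V C) br b"
    and b: "\<And>c d. \<lbrakk>c \<in> VObj C; d \<in> VObj C\<rbrakk> \<Longrightarrow> b c d \<in> Arr V \<and> Dom V (b c d) = VHom C d c \<and>
      Cod V (b c d) = VHom A (br c) (br d)"
    and bact: "\<And>c d t g h. \<lbrakk>c \<in> VObj C; d \<in> VObj C; t \<in> VObj T; el V g; el V h; ty V g = VHom C d c;
       ty V h = VHom C c (FO E t); dj g h\<rbrakk> \<Longrightarrow> act (br c) (br d) t \<bullet> (b c d \<bullet> g \<odot> h) =
         VCmp C d c (FO E t) \<bullet> (h \<odot> g)"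
  shows "vfunctor V (vop V C) A R"
proof -
  interpret C: vcategory V C by fact
  interpret E: vfunctor V T C E by fact
  show ?thesis
  proof (rule vfunctorI[OF C.vcategory_vop A.vcategory_axioms R], goal_cases)
    case (3 x)
    have "b x x \<cdot> VIdn C x = VIdn A (br x)"
      by (rule act_extU[of _ _ "br x" "br x"]) (use 3 b bact in simp_all)
    from arg_cong[OF this, of "\<lambda>k. k \<bullet> un V"] show ?case using 3 b by simp
  next
    case (4 x y z g f)
    have "b x z \<cdot> VCmp (vop V C) x y z = VCmp A (br x) (br y) (br z) \<cdot> (b y z \<boxtimes> b x y)"
      by (rule act_ext2[of _ _ "VHom C z y" "VHom C y x" "br x" "br z"]) (use 4 b bact in simp_all)
    from arg_cong[OF this, of "\<lambda>k. k \<bullet> (g \<odot> f)"] show ?case using 4 b by simp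
  qed (use b in simp_all)
qed

text \<open>The Yoneda map, evaluation of a homomorphism at the identity of \<open>t\<close>. It is
  meaningful when \<open>M\<close> is the representable at \<open>t\<close>, so that the identity is
  an element of \<open>M t\<close>.\<close>

definition "yev M N t = act M N t \<cdot> (Idn V (VHom A M N) \<boxtimes> VIdn T t) \<cdot> inv_arr V (Run V (VHom A M N))"

lemma yev:
  assumes "M \<in> VObj A" "N \<in> VObj A" "t \<in> VObj T" "ob M t = VHom T t t"
  shows "yev M N t \<in> Arr V" "Dom V (yev M N t) = VHom A M N" "Cod V (yev M N t) = ob N t"
    "\<lbrakk>el V a; ty V a = VHom A M N\<rbrakk> \<Longrightarrow> yev M N t \<bullet> a = act M N t \<bullet> (a \<odot> VIdn T t \<bullet> un V)"
  using assms by (simp_all add: yev_def)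

text \<open>The Yoneda lemma for modules. The representable enters only through its values and its
  action, because the module used later is a value of \<open>bracket\<close> and not a hom functor
  on the nose.\<close>

lemma yoneda_iso:
  assumes [simp]: "M \<in> VObj A" "N \<in> VObj A" "t \<in> VObj T"
    and ob [simp]: "\<And>s. s \<in> VObj T \<Longrightarrow> ob M s = VHom T t s"
    and rho [simp]: "\<And>r s f g. \<lbrakk>r \<in> VObj T; s \<in> VObj T; el V f; el V g; ty V f = VHom T r s;
      ty V g = VHom T t r; dj f g\<rbrakk> \<Longrightarrow>
       rho M r s \<bullet> (f \<odot> g) = VCmp T t r s \<bullet> (f \<odot> g)"
  shows "is_iso V (yev M N t)"
proof -
  note y [simp] = yev[of M N t]
  \<comment> \<open>The inverse sends \<open>n\<close> in \<open>N t\<close> to the homomorphism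
    which takes \<open>f\<close> in \<open>T(t, s)\<close> to the action of \<open>f\<close> on
    \<open>n\<close>.\<close>
  obtain h where h: "h \<in> Arr V" "Dom V h = ob N t" "Cod V h = VHom A M N"
    "\<And>s w x. \<lbrakk>s \<in> VObj T; el V w; el V x; ty V w = ob N t; ty V x = ob M s; dj w x\<rbrakk> \<Longrightarrow>
       act M N s \<bullet> (h \<bullet> w \<odot> x) = (rho N t s \<cdot> Brd V (ob N t) (VHom T t s)) \<bullet> (w \<odot> x)"
    by (rule act_lift[of M N "ob N t" "\<lambda>s. rho N t s \<cdot> Brd V (ob N t) (VHom T t s)"]) simp_all
  note [simp] = h
  show ?thesis
  proof (rule T.is_isoI[of _ h])
    \<comment> \<open>Read backwards, \<open>act_nat\<close> turns the action of \<open>g\<close> on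
      the value of a homomorphism at the identity into its value at \<open>g\<close>.\<close>
    show "h \<cdot> yev M N t = Idn V (Dom V (yev M N t))"
      by (rule act_ext[of _ _ "VHom A M N" M N]) (simp_all flip: act_nat)
    show "yev M N t \<cdot> h = Idn V (Cod V (yev M N t))"
      by (rule T.ext1[of _ _ "ob N t"]) simp_all
  qed simp_all
qed

end

text \<open>Functor actions and projections become module actions by evaluating. Naturality of the
  projections is then \<open>act_nat\<close>, and \<open>action_universal\<close> is
  \<open>act_univ\<close>.\<close>

lemma module_category_of_nat_cat:
  fixes V :: "('o, 'a) smcc" (structure)
  assumes "nat_cat V C D S \<Phi> e p" and "realized V D ro ev"
  shows "module_category V C (nat_cat.N V C D S e p) (\<lambda>F t. ro (FO F t))
    (\<lambda>F s t. ev (FO F s) (FO F t) \<cdot> (FA (\<Phi> F) s t \<boxtimes> Idn V (ro (FO F s))))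
    (\<lambda>F G t. ev (FO F t) (FO G t) \<cdot> (p F G t \<boxtimes> Idn V (ro (FO F t))))"
proof -
  interpret N: nat_cat V C D S \<Phi> e p by fact
  interpret r: realized V D ro ev by fact
  interpret N': vcategory V N.N by (rule N.vcategory_N)
  note [simp] = N.Hom_iff
  have id: "FA (\<Phi> F) t t \<bullet> VIdn C t \<bullet> un V = VIdn D (FO F t) \<bullet> un V" if "F \<in> S" "t \<in> VObj C" for F t
    using vfunctor.FA_id[OF N.\<Phi>_fun] that N.\<Phi>_FO by simp
  have cm: "FA (\<Phi> F) x z \<bullet> VCmp C x y z \<bullet> (g \<odot> f) = VCmp D (FO F x) (FO F y) (FO F z) \<bullet> (FA (\<Phi> F) y
    z \<bullet> g \<odot> FA (\<Phi> F) x y \<bullet> f)"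
    if "F \<in> S" "x \<in> VObj C" "y \<in> VObj C" "z \<in> VObj C" "el V g" "el V f" "ty V g =
      VHom C y z" "ty V f = VHom C x y" "dj g f" for F x y z f g
    using vfunctor.FA_cmp[OF N.\<Phi>_fun, of F x y z g f] that N.\<Phi>_FO by simp
  show ?thesis
  proof (unfold_locales, goal_cases)
    case (8 F G s t a f x)
    then have "ev (FO F s) (FO G t) \<bullet> (VCmp D (FO F s) (FO F t) (FO G t) \<bullet> (p F G t \<bullet> a \<odot> FA (\<Phi> F) s
      t \<bullet> f) \<odot> x) =
       ev (FO F s) (FO G t) \<bullet> (VCmp D (FO F s) (FO G s) (FO G t) \<bullet> (FA (\<Phi> G) s t \<bullet> f \<odot> p F G s \<bullet> a)
         \<odot> x)"
      by (subst N.p_nat) simp_all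
    with 8 dj_sym[OF \<open>dj a f\<close>] show ?case by simp
  next
    case (9 F G W q)
    have FG: "F \<in> S" "G \<in> S" using 9 by auto
    have q: "q t \<in> Arr V \<and> Dom V (q t) = W \<otimes> ro (FO F t) \<and> Cod V (q t) = ro (FO G t)" if "t \<in> VObj
      C" for t
      using 9(4)[OF that] by simp
    have "\<exists>!h. h \<in> Hom V W (e F G) \<and> (\<forall>t\<in>VObj C. ev (FO (\<Phi> F) t) (FO (\<Phi> G) t) \<cdot> ((p F G t \<cdot> h) \<boxtimes> Idn
      V (ro (FO (\<Phi> F) t))) = q t)"
    proof (rule r.action_universal[OF N.nat_obj[OF FG] N.\<Phi>_fun[OF FG(1)] N.\<Phi>_fun[OF FG(2)]
      9(3)], goal_cases)
      case (1 t) then show ?case using q[of t] FG N.\<Phi>_FO by simp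
    next
      case (2 s t w f x)
      then show ?case using 9(5)[of s t w f x] q[of t] q[of s] FG N.\<Phi>_FO by simp
    qed
    moreover have "ev (FO (\<Phi> F) t) (FO (\<Phi> G) t) \<cdot> ((p F G t \<cdot> h) \<boxtimes> Idn V (ro (FO (\<Phi> F) t))) =
       (ev (FO F t) (FO G t) \<cdot> (p F G t \<boxtimes> Idn V (ro (FO F t)))) \<cdot> (h \<boxtimes> Idn V (ro (FO F t)))"
      if "t \<in> VObj C" "h \<in> Hom V W (e F G)" for t h
      using FG that by (simp add: N.\<Phi>_FO)
    ultimately show ?case by (auto cong: conj_cong)
  qed (simp_all add: id cm)
qed

context sym_monoidal_embedding
begin

text \<open>The equational axioms are turned into equations of arrows in \<open>V\<close> and pushed
  along \<open>j\<close>. The universal property quantifies over objects \<open>W\<close> of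
  \<open>V'\<close> outside the image of \<open>j\<close>, so it cannot be transported and is
  demanded separately as \<open>univ\<close>.\<close>

lemma module_category_base:
  assumes "module_category V T A ob rho act"
    and univ: "\<And>M N W q. \<lbrakk>M \<in> VObj A; N \<in> VObj A; W \<in> Obj V';
      \<And>t. t \<in> VObj T \<Longrightarrow> q t \<in> Hom V' (W \<otimes>\<^bsub>V'\<^esub> jO j (ob M t)) (jO j (ob N t));
      \<And>s t w f x. \<lbrakk>s \<in> VObj T; t \<in> VObj T; el V' w; el V' f; el V' x; ty V' w = W; ty V' f =
        jO j (VHom T s t);
        ty V' x = jO j (ob M s); dj w f; dj f w; dj w x; dj x w; dj f x; dj x f\<rbrakk> \<Longrightarrow>
        q t \<bullet>\<^bsub>V'\<^esub> (w \<odot>\<^bsub>V'\<^esub> jA j (rho M s t) \<bullet>\<^bsub>V'\<^esub> jT j (VHom T s t) (ob M s) \<bullet>\<^bsub>V'\<^esub> (f \<odot>\<^bsub>V'\<^esub> x)) =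
        jA j (rho N s t) \<bullet>\<^bsub>V'\<^esub> jT j (VHom T s t) (ob N s) \<bullet>\<^bsub>V'\<^esub> (f \<odot>\<^bsub>V'\<^esub> q s \<bullet>\<^bsub>V'\<^esub> (w \<odot>\<^bsub>V'\<^esub> x))\<rbrakk> \<Longrightarrow>
      \<exists>!h. h \<in> Hom V' W (jO j (VHom A M N)) \<and> (\<forall>t\<in>VObj T.
        (jA j (act M N t) \<cdot>\<^bsub>V'\<^esub> jT j (VHom A M N) (ob M t)) \<cdot>\<^bsub>V'\<^esub> (h \<boxtimes>\<^bsub>V'\<^esub> Idn V' (jO j (ob M t))) = q t)"
  shows "module_category V' (bc T) (bc A) (\<lambda>M t. jO j (ob M t))
    (\<lambda>M s t. jA j (rho M s t) \<cdot>\<^bsub>V'\<^esub> jT j (VHom T s t) (ob M s))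
    (\<lambda>M N t. jA j (act M N t) \<cdot>\<^bsub>V'\<^esub> jT j (VHom A M N) (ob M t))"
proof -
  interpret m: module_category V T A ob rho act by fact
  interpret bT: vcategory V' "bc T" by (rule vcategory_base) (rule m.T.vcategory_axioms)
  interpret bA: vcategory V' "bc A" by (rule vcategory_base) (rule m.A.vcategory_axioms)
  note [simp] = base_cmp_app[OF m.T.vcategory_axioms, symmetric]
    base_cmp_app[OF m.A.vcategory_axioms, symmetric]
    base_idn_app[OF m.T.vcategory_axioms, symmetric] base_idn_app[OF m.A.vcategory_axioms, symmetric]
  note [simp] = tgt.Hom_iff
  show ?thesis
  proof (unfold_locales, goal_cases)
    case (3 M t x)
    have "rho M t t \<cdot>\<^bsub>V\<^esub> (VIdn T t \<boxtimes>\<^bsub>V\<^esub> Idn V (ob M t)) = Lun V (ob M t)"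
      by (rule src.ext2L[of _ _ "ob M t"]) (use 3 in simp_all)
    from arg_cong[OF this, of "\<lambda>k. jA j k \<bullet>\<^bsub>V'\<^esub> jT j (Unt V) (ob M t) \<bullet>\<^bsub>V'\<^esub> (jU j \<bullet>\<^bsub>V'\<^esub> un V' \<odot>\<^bsub>V'\<^esub> x)"] 3
    show ?case by simp
  next
    case (4 M r s t g f x)
    have "rho M r t \<cdot>\<^bsub>V\<^esub> (VCmp T r s t \<boxtimes>\<^bsub>V\<^esub> Idn V (ob M r)) =
      rho M s t \<cdot>\<^bsub>V\<^esub> (Idn V (VHom T s t) \<boxtimes>\<^bsub>V\<^esub> rho M r s) \<cdot>\<^bsub>V\<^esub> Asc V (VHom T s t) (VHom T r s) (ob M r)"
      by (rule src.ext3[of _ _ "VHom T s t" "VHom T r s" "ob M r"]) (use 4 in simp_all)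
    from arg_cong[OF this, of "\<lambda>k. jA j k \<bullet>\<^bsub>V'\<^esub> jT j (VHom T s t \<otimes>\<^bsub>V\<^esub> VHom T r s) (ob M r) \<bullet>\<^bsub>V'\<^esub> (jT j
      (VHom T s t) (VHom T r s) \<bullet>\<^bsub>V'\<^esub> (g \<odot>\<^bsub>V'\<^esub> f) \<odot>\<^bsub>V'\<^esub> x)"] 4
    show ?case by simp
  next
    case (6 M t x)
    have "act M M t \<cdot>\<^bsub>V\<^esub> (VIdn A M \<boxtimes>\<^bsub>V\<^esub> Idn V (ob M t)) = Lun V (ob M t)"
      by (rule src.ext2L[of _ _ "ob M t"]) (use 6 in simp_all)
    from arg_cong[OF this, of "\<lambda>k. jA j k \<bullet>\<^bsub>V'\<^esub> jT j (Unt V) (ob M t) \<bullet>\<^bsub>V'\<^esub> (jU j \<bullet>\<^bsub>V'\<^esub> un V' \<odot>\<^bsub>V'\<^esub> x)"] 6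
    show ?case by simp
  next
    case (7 M N K t b a x)
    have "act M K t \<cdot>\<^bsub>V\<^esub> (VCmp A M N K \<boxtimes>\<^bsub>V\<^esub> Idn V (ob M t)) =
      act N K t \<cdot>\<^bsub>V\<^esub> (Idn V (VHom A N K) \<boxtimes>\<^bsub>V\<^esub> act M N t) \<cdot>\<^bsub>V\<^esub> Asc V (VHom A N K) (VHom A M N) (ob M t)"
      by (rule src.ext3[of _ _ "VHom A N K" "VHom A M N" "ob M t"]) (use 7 in simp_all)
    from arg_cong[OF this, of "\<lambda>k. jA j k \<bullet>\<^bsub>V'\<^esub> jT j (VHom A N K \<otimes>\<^bsub>V\<^esub> VHom A M N) (ob M t) \<bullet>\<^bsub>V'\<^esub> (jT j
      (VHom A N K) (VHom A M N) \<bullet>\<^bsub>V'\<^esub> (b \<odot>\<^bsub>V'\<^esub> a) \<odot>\<^bsub>V'\<^esub> x)"] 7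
    show ?case by simp
  next
    case (8 M N s t a f x)
    have "act M N t \<cdot>\<^bsub>V\<^esub> (Idn V (VHom A M N) \<boxtimes>\<^bsub>V\<^esub> rho M s t) \<cdot>\<^bsub>V\<^esub> Asc V (VHom A M N) (VHom T s t) (ob M s) =
      rho N s t \<cdot>\<^bsub>V\<^esub> (Idn V (VHom T s t) \<boxtimes>\<^bsub>V\<^esub> act M N s) \<cdot>\<^bsub>V\<^esub> Asc V (VHom T s t) (VHom A M N) (ob M s)
        \<cdot>\<^bsub>V\<^esub> (Brd V (VHom A M N) (VHom T s t) \<boxtimes>\<^bsub>V\<^esub> Idn V (ob M s))"
      by (rule src.ext3[of _ _ "VHom A M N" "VHom T s t" "ob M s"]) (use 8 in \<open>simp_all add: m.act_nat\<close>)
    from arg_cong[OF this, of "\<lambda>k. jA j k \<bullet>\<^bsub>V'\<^esub> jT j (VHom A M N \<otimes>\<^bsub>V\<^esub> VHom T s t) (ob M s) \<bullet>\<^bsub>V'\<^esub> (jT j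
      (VHom A M N) (VHom T s t) \<bullet>\<^bsub>V'\<^esub> (a \<odot>\<^bsub>V'\<^esub> f) \<odot>\<^bsub>V'\<^esub> x)"] 8 dj_sym[OF \<open>dj a f\<close>]
    show ?case by simp
  next
    case (9 M N W q)
    have q: "q t \<in> Arr V'" "Dom V' (q t) = W \<otimes>\<^bsub>V'\<^esub> jO j (ob M t)" "Cod V' (q t) =
      jO j (ob N t)" if "t \<in> VObj T" for t
      using 9(4)[of t] that by auto
    show ?case
      using univ[of M N W q] 9(1-3) q 9(5) by (simp del: tgt.Hom_iff) (simp add: tgt.Hom_iff)
  qed simp_all
qed

end

section \<open>Adjunctions and equivalences\<close>

lemma vcomp_simps [simp]:
  "x \<in> VObj C \<Longrightarrow> FO (vcomp V C G F) x = FO G (FO F x)"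
  "\<lbrakk>x \<in> VObj C; y \<in> VObj C\<rbrakk> \<Longrightarrow> FA (vcomp V C G F) x y = FA G (FO F x) (FO F y) \<cdot>\<^bsub>V\<^esub> FA F x y"
  by (simp_all add: vcomp_def)

lemma vop_fun_simps [simp]: "FO (vop_fun F) = FO F" "FA (vop_fun F) x y = FA F y x"
  by (simp_all add: vop_fun_def)

lemma vid_simps [simp]:
  "x \<in> VObj C \<Longrightarrow> FO (vid V C) x = x"
  "\<lbrakk>x \<in> VObj C; y \<in> VObj C\<rbrakk> \<Longrightarrow> FA (vid V C) x y = Idn V (VHom C x y)"
  by (simp_all add: vid_def)

text \<open>Pointwise representability suffices: the action of the left adjoint on homs is
  determined by the representations.\<close>

lemma right_adjoint_of_representable:
  fixes V :: "('o, 'a) smcc" (structure)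
  assumes RV: "vfunctor V X B R"
    and Lo [simp]: "\<And>b. b \<in> VObj B \<Longrightarrow> Lo b \<in> VObj X"
    and iso: "\<And>b x. \<lbrakk>b \<in> VObj B; x \<in> VObj X\<rbrakk> \<Longrightarrow> is_iso V (\<phi> b x) \<and> Dom V (\<phi> b x) = VHom X (Lo b) x \<and>
       Cod V (\<phi> b x) = VHom B b (FO R x)"
    and nat: "\<And>b x y g f. \<lbrakk>b \<in> VObj B; x \<in> VObj X; y \<in> VObj X; el V g; el V f; ty V g = VHom X x y;
       ty V f = VHom X (Lo b) x; dj g f\<rbrakk> \<Longrightarrow>
       \<phi> b y \<bullet> VCmp X (Lo b) x y \<bullet> (g \<odot> f) = VCmp B b (FO R x) (FO R y) \<bullet> (FA R x y \<bullet> g \<odot> \<phi> b x \<bullet> f)"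
  shows "is_right_adjoint V X B R"
proof -
  interpret R: vfunctor V X B R by fact
  have p [simp]: "is_iso V (\<phi> b x)" "Dom V (\<phi> b x) = VHom X (Lo b) x" "Cod V (\<phi> b x) =
    VHom B b (FO R x)"
    if "b \<in> VObj B" "x \<in> VObj X" for b x using iso[OF that] by auto
  \<comment> \<open>The unit of the adjunction, that is the universal element of the representation
    at \<open>b\<close>; \<open>phi\<close> below expresses \<open>\<phi>\<close> through
    it.\<close>
  define \<eta> where "\<eta> b = \<phi> b (Lo b) \<cdot> VIdn X (Lo b)" for b
  have [simp]: "\<eta> b \<in> Arr V" "Dom V (\<eta> b) = Unt V" "Cod V (\<eta> b) = VHom B b (FO R (Lo b))" if "b \<in>
    VObj B" for b
    using that by (simp_all add: \<eta>_def)
  have phi: "VCmp B b (FO R (Lo b)) (FO R x) \<bullet> (FA R (Lo b) x \<bullet> f \<odot> \<eta> b \<bullet> un V) = \<phi> b x \<bullet> f"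
    if "b \<in> VObj B" "x \<in> VObj X" "el V f" "ty V f = VHom X (Lo b) x" for b x f
    using nat[of b "Lo b" x f "VIdn X (Lo b) \<bullet> un V"] that by (simp add: \<eta>_def)
  \<comment> \<open>Forced by naturality of the unit: the image of
    \<open>a : b \<rightarrow> c\<close> must correspond under \<open>\<phi>\<close> to
    \<open>a\<close> followed by \<open>\<eta> c\<close>.\<close>
  define La where "La b c = inv_arr V (\<phi> b (Lo c)) \<cdot> VCmp B b c (FO R (Lo c)) \<cdot> (\<eta> c \<boxtimes> Idn V (VHom B
    b c)) \<cdot>
     inv_arr V (Lun V (VHom B b c))" for b c
  have La [simp]: "La b c \<in> Arr V" "Dom V (La b c) = VHom B b c" "Cod V (La b c) = VHom X (Lo b) (Lo c)"
    if "b \<in> VObj B" "c \<in> VObj B" for b c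
    using that by (simp_all add: La_def)
  have La_phi [simp]: "\<phi> b (Lo c) \<bullet> La b c \<bullet> a = VCmp B b c (FO R (Lo c)) \<bullet> (\<eta> c \<bullet> un V \<odot> a)"
    if "b \<in> VObj B" "c \<in> VObj B" "el V a" "ty V a = VHom B b c" for b c a
    using that by (simp add: La_def)
  define L where "L = mk_vfun B Lo La"
  have LV: "vfunctor V B X L"
  proof (rule vfunctorI[OF R.cod.vcategory_axioms R.dom.vcategory_axioms L_def], goal_cases)
    case (3 b)
    then show ?case
      by - (rule R.dom.app_mono[of "\<phi> b (Lo b)"], simp_all, simp add: \<eta>_def)
  next
    case (4 b c d g f)
    have "VCmp B b c (FO R (Lo d)) \<bullet> (VCmp B c (FO R (Lo c)) (FO R (Lo d)) \<bullet> (FA R (Lo c) (Lo d) \<bullet>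
      La c d \<bullet> g \<odot> \<eta> c \<bullet> un V) \<odot> f)
       = VCmp B b c (FO R (Lo d)) \<bullet> (VCmp B c d (FO R (Lo d)) \<bullet> (\<eta> d \<bullet> un V \<odot> g) \<odot> f)"
      by (subst phi) (use 4 in simp_all)
    then show ?case using 4
      by - (rule R.dom.app_mono[of "\<phi> b (Lo d)"], simp_all add: nat)
  qed simp_all
  interpret L: vfunctor V B X L by (rule LV)
  have L_simps [simp]: "b \<in> VObj B \<Longrightarrow> FO L b = Lo b" "\<lbrakk>b \<in> VObj B; c \<in> VObj B\<rbrakk> \<Longrightarrow> FA L b c =
    La b c" for b c
    by (simp_all add: L_def)
  \<comment> \<open>Naturality in \<open>b\<close> is a consequence of how \<open>La\<close> was
    defined, once \<open>\<phi>\<close> is written through the unit.\<close>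
  have nat2: "\<phi> c a \<bullet> VCmp X (Lo c) (Lo b) a \<bullet> (u \<odot> La c b \<bullet> f) = VCmp B c b (FO R a) \<bullet> (\<phi> b a \<bullet> u \<odot> f)"
    if "a \<in> VObj X" "b \<in> VObj B" "c \<in> VObj B" "el V u" "el V f" "ty V f = VHom B c b" "ty V u =
      VHom X (Lo b) a" "dj u f" for a b c f u
  proof -
    have "VCmp B c b (FO R a) \<bullet> (\<phi> b a \<bullet> u \<odot> f) = VCmp B c b (FO R a) \<bullet> (VCmp B b (FO R (Lo b)) (FO
      R a) \<bullet> (FA R (Lo b) a \<bullet> u \<odot> \<eta> b \<bullet> un V) \<odot> f)"
      by (subst phi) (use that in simp_all)
    then show ?thesis using that by (simp add: nat)
  qed
  show ?thesis
    unfolding is_right_adjoint_def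
  proof (intro conjI exI[of _ L] exI[of _ \<phi>] ballI RV LV)
    fix b assume b [simp]: "b \<in> VObj B"
    have f1: "vfunctor V X (vself V) (hom_from V X (FO L b))" by (rule R.dom.vfunctor_hom_from) simp
    have f2: "vfunctor V X (vself V) (vcomp V X (hom_from V B b) R)"
      by (rule vfunctor_vcomp[OF RV]) (rule R.cod.vfunctor_hom_from, simp)
    interpret f3: vfunctor V B "vself V" "hom_from V B b" by (rule R.cod.vfunctor_hom_from) simp
    show "vnat_iso_arr V X (hom_from V X (FO L b)) (vcomp V X (hom_from V B b) R) (\<phi> b)"
      unfolding vnat_iso_arr_iff[OF f1 f2] by (auto simp: nat)
  next
    fix a assume a [simp]: "a \<in> VObj X"
    interpret f3: vfunctor V "vop V X" "vself V" "hom_to V X a" by (rule R.dom.vfunctor_hom_to) simp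
    have f1: "vfunctor V (vop V B) (vself V) (vcomp V (vop V B) (hom_to V X a) (vop_fun L))"
      by (rule vfunctor_vcomp[OF vfunctor_vop[OF LV]]) (rule f3.vfunctor_axioms)
    have f2: "vfunctor V (vop V B) (vself V) (hom_to V B (FO R a))"
      by (rule R.cod.vfunctor_hom_to) simp
    have [simp]: "FA (hom_to V X a) x y \<in> Arr V" "Dom V (FA (hom_to V X a) x y) = VHom X y x"
      "Cod V (FA (hom_to V X a) x y) = Hm V (VHom X x a) (VHom X y a)" if "x \<in> VObj X" "y \<in> VObj X"
        for x y
      using f3.FA_simps[of x y] that by auto
    show "vnat_iso_arr V (vop V B) (vcomp V (vop V B) (hom_to V X a) (vop_fun L)) (hom_to V B (FO R
      a)) (\<lambda>b. \<phi> b a)"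
      unfolding vnat_iso_arr_iff[OF f1 f2] by (auto simp: nat2 dj_sym)
  qed
qed

text \<open>By \<open>vnat_iso_arr_iff\<close>, the two natural isomorphisms into
  \<open>vself V\<close> become equations on elements for a single family
  \<open>\<phi>\<close>.\<close>

lemma right_adjointE:
  fixes V :: "('o, 'a) smcc" (structure)
  assumes "is_right_adjoint V X B R"
  obtains L \<phi> where "vfunctor V B X L"
    "\<And>b x. \<lbrakk>b \<in> VObj B; x \<in> VObj X\<rbrakk> \<Longrightarrow> is_iso V (\<phi> b x)"
    "\<And>b x. \<lbrakk>b \<in> VObj B; x \<in> VObj X\<rbrakk> \<Longrightarrow> Dom V (\<phi> b x) = VHom X (FO L b) x"
    "\<And>b x. \<lbrakk>b \<in> VObj B; x \<in> VObj X\<rbrakk> \<Longrightarrow> Cod V (\<phi> b x) = VHom B b (FO R x)"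
    "\<And>b x y g f. \<lbrakk>b \<in> VObj B; x \<in> VObj X; y \<in> VObj X; el V g; el V f; ty V g = VHom X x y;
       ty V f = VHom X (FO L b) x; dj g f\<rbrakk> \<Longrightarrow>
       \<phi> b y \<bullet> VCmp X (FO L b) x y \<bullet> (g \<odot> f) = VCmp B b (FO R x) (FO R y) \<bullet> (FA R x y \<bullet> g \<odot> \<phi> b x \<bullet> f)"
    "\<And>a b c u f. \<lbrakk>a \<in> VObj X; b \<in> VObj B; c \<in> VObj B; el V u; el V f; ty V f = VHom B c b; ty V u =
      VHom X (FO L b) a; dj u f\<rbrakk> \<Longrightarrow>
       \<phi> c a \<bullet> VCmp X (FO L c) (FO L b) a \<bullet> (u \<odot> FA L c b \<bullet> f) = VCmp B c b (FO R a) \<bullet> (\<phi> b a \<bullet> u \<odot> f)"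
proof -
  obtain L \<phi> where RV: "vfunctor V X B R" and LV: "vfunctor V B X L" and
    n1: "\<And>b. b \<in> VObj B \<Longrightarrow> vnat_iso_arr V X (hom_from V X (FO L b)) (vcomp V X (hom_from V B b) R) (\<phi>
      b)" and
    n2: "\<And>a. a \<in> VObj X \<Longrightarrow> vnat_iso_arr V (vop V B)
           (vcomp V (vop V B) (hom_to V X a) (vop_fun L)) (hom_to V B (FO R a)) (\<lambda>b. \<phi> b a)"
    using assms unfolding is_right_adjoint_def by auto
  interpret R: vfunctor V X B R by fact
  interpret L: vfunctor V B X L by fact
  have a1: "(\<forall>x\<in>VObj X. is_iso V (\<phi> b x) \<and> Dom V (\<phi> b x) = VHom X (FO L b) x \<and> Cod V (\<phi> b x) =
    VHom B b (FO R x)) \<and>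
    (\<forall>x\<in>VObj X. \<forall>y\<in>VObj X. \<forall>g f. el V g \<and> el V f \<and> ty V g = VHom X x y \<and> ty V f =
      VHom X (FO L b) x \<and> dj g f \<longrightarrow>
       \<phi> b y \<bullet> VCmp X (FO L b) x y \<bullet> (g \<odot> f) = VCmp B b (FO R x) (FO R y) \<bullet> (FA R x y \<bullet> g \<odot> \<phi> b x \<bullet> f))"
    if b [simp]: "b \<in> VObj B" for b
  proof -
    have f1: "vfunctor V X (vself V) (hom_from V X (FO L b))" by (rule R.dom.vfunctor_hom_from) simp
    have f2: "vfunctor V X (vself V) (vcomp V X (hom_from V B b) R)"
      by (rule vfunctor_vcomp[OF RV]) (rule R.cod.vfunctor_hom_from, simp)
    interpret f3: vfunctor V B "vself V" "hom_from V B b" by (rule R.cod.vfunctor_hom_from) simp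
    show ?thesis using n1[OF b] unfolding vnat_iso_arr_iff[OF f1 f2] by auto
  qed
  have a2: "\<phi> c a \<bullet> VCmp X (FO L c) (FO L b) a \<bullet> (u \<odot> FA L c b \<bullet> f) = VCmp B c b (FO R a) \<bullet> (\<phi> b a \<bullet>
    u \<odot> f)"
    if h [simp]: "a \<in> VObj X" "b \<in> VObj B" "c \<in> VObj B" "el V u" "el V f" "ty V f =
      VHom B c b" "ty V u = VHom X (FO L b) a" "dj u f" for a b c u f
  proof -
    interpret f3: vfunctor V "vop V X" "vself V" "hom_to V X a" by (rule R.dom.vfunctor_hom_to) simp
    have f1: "vfunctor V (vop V B) (vself V) (vcomp V (vop V B) (hom_to V X a) (vop_fun L))"
      by (rule vfunctor_vcomp[OF vfunctor_vop[OF LV]]) (rule f3.vfunctor_axioms)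
    have f2: "vfunctor V (vop V B) (vself V) (hom_to V B (FO R a))"
      by (rule R.cod.vfunctor_hom_to) simp
    have [simp]: "FA (hom_to V X a) x y \<in> Arr V" "Dom V (FA (hom_to V X a) x y) = VHom X y x"
      "Cod V (FA (hom_to V X a) x y) = Hm V (VHom X x a) (VHom X y a)" if "x \<in> VObj X" "y \<in> VObj X"
        for x y
      using f3.FA_simps[of x y] that by auto
    have [simp]: "is_iso V (\<phi> b a)" "Dom V (\<phi> b a) = VHom X (FO L b) a" "Cod V (\<phi> b a) =
      VHom B b (FO R a)"
      using a1[of b] by auto
    show ?thesis
      using n2[OF h(1), unfolded vnat_iso_arr_iff[OF f1 f2], THEN conjunct2, rule_format, of b c f
        u] dj_sym[OF h(8)]
      by simp
  qed
  show ?thesis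
    by (rule that[OF LV, of \<phi>]) (use a1 a2 in \<open>blast+\<close>)
qed

text \<open>The usual construction of a quasi-inverse; the choice of \<open>Qo\<close>,
  \<open>u\<close> and \<open>v\<close> is left to the caller. Equations in \<open>A\<close> are
  checked after applying the invertible maps \<open>FA P x y\<close>.\<close>

lemma vequivalence_of_fully_faithful:
  fixes V :: "('o, 'a) smcc" (structure)
  assumes PV: "vfunctor V A B P"
    and ff: "\<And>x y. \<lbrakk>x \<in> VObj A; y \<in> VObj A\<rbrakk> \<Longrightarrow> is_iso V (FA P x y)"
    and Qo [simp]: "\<And>b. b \<in> VObj B \<Longrightarrow> Qo b \<in> VObj A"
    and u: "\<And>b. b \<in> VObj B \<Longrightarrow> u b \<in> Hom V (Unt V) (VHom B (FO P (Qo b)) b)"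
    and v: "\<And>b. b \<in> VObj B \<Longrightarrow> v b \<in> Hom V (Unt V) (VHom B b (FO P (Qo b)))"
    and uv [simp]: "\<And>b. b \<in> VObj B \<Longrightarrow> VCmp B b (FO P (Qo b)) b \<bullet> (u b \<bullet> un V \<odot> v b \<bullet> un V) =
      VIdn B b \<bullet> un V"
    and vu [simp]: "\<And>b. b \<in> VObj B \<Longrightarrow> VCmp B (FO P (Qo b)) b (FO P (Qo b)) \<bullet> (v b \<bullet> un V \<odot> u b \<bullet> un
      V) = VIdn B (FO P (Qo b)) \<bullet> un V"
  shows "vequivalence V A B P"
proof -
  interpret P: vfunctor V A B P by fact
  have [simp]: "u b \<in> Arr V" "Dom V (u b) = Unt V" "Cod V (u b) = VHom B (FO P (Qo b)) b"
    "v b \<in> Arr V" "Dom V (v b) = Unt V" "Cod V (v b) = VHom B b (FO P (Qo b))" if "b \<in> VObj B" for b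
    using u[OF that] v[OF that] by (auto simp: P.dom.Hom_iff)
  note [simp] = ff
  have uv2 [simp]: "VCmp B a (FO P (Qo b)) b \<bullet> (u b \<bullet> un V \<odot> VCmp B a b (FO P (Qo b)) \<bullet> (v b \<bullet> un V
    \<odot> h)) = h"
    if "a \<in> VObj B" "b \<in> VObj B" "el V h" "ty V h = VHom B a b" for a b h
    using P.cod.vassoc[of a b "FO P (Qo b)" b "u b \<bullet> un V" "v b \<bullet> un V" h] that by simp
  have vu2 [simp]: "VCmp B a b (FO P (Qo b)) \<bullet> (v b \<bullet> un V \<odot> VCmp B a (FO P (Qo b)) b \<bullet> (u b \<bullet> un V
    \<odot> h)) = h"
    if "a \<in> VObj B" "b \<in> VObj B" "el V h" "ty V h = VHom B a (FO P (Qo b))" for a b h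
    using P.cod.vassoc[of a "FO P (Qo b)" b "FO P (Qo b)" "v b \<bullet> un V" "u b \<bullet> un V" h] that by simp
  \<comment> \<open>Conjugation by the isomorphisms \<open>u b\<close> and \<open>v c\<close>,
    followed by the inverse of \<open>P\<close> on homs.\<close>
  define Qa where "Qa b c = inv_arr V (FA P (Qo b) (Qo c)) \<cdot> VCmp B (FO P (Qo b)) c (FO P (Qo c)) \<cdot>
    (v c \<boxtimes> (VCmp B (FO P (Qo b)) b c \<cdot> (Idn V (VHom B b c) \<boxtimes> u b) \<cdot> inv_arr V (Run V (VHom B b c))))
      \<cdot> inv_arr V (Lun V (VHom B b c))" for b c
  have Qa [simp]: "Qa b c \<in> Arr V" "Dom V (Qa b c) = VHom B b c" "Cod V (Qa b c) = VHom A (Qo b) (Qo c)"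
    if "b \<in> VObj B" "c \<in> VObj B" for b c
    using that by (simp_all add: Qa_def)
  have PQ [simp]: "FA P (Qo b) (Qo c) \<bullet> Qa b c \<bullet> g = VCmp B (FO P (Qo b)) c (FO P (Qo c)) \<bullet> (v c \<bullet>
    un V \<odot> VCmp B (FO P (Qo b)) b c \<bullet> (g \<odot> u b \<bullet> un V))"
    if "b \<in> VObj B" "c \<in> VObj B" "el V g" "ty V g = VHom B b c" for b c g
    using that by (simp add: Qa_def)
  define Q where "Q = mk_vfun B Qo Qa"
  have QV: "vfunctor V B A Q"
  proof (rule vfunctorI[OF P.cod.vcategory_axioms P.dom.vcategory_axioms Q_def], goal_cases)
    case (3 b)
    then show ?case
      by - (rule P.dom.app_mono[of "FA P (Qo b) (Qo b)"], simp_all)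
  next
    case (4 b c d g f)
    then show ?case
      by - (rule P.dom.app_mono[of "FA P (Qo b) (Qo d)"], simp_all)
  qed simp_all
  interpret Q: vfunctor V B A Q by (rule QV)
  have Q_simps [simp]: "b \<in> VObj B \<Longrightarrow> FO Q b = Qo b" "\<lbrakk>b \<in> VObj B; c \<in> VObj B\<rbrakk> \<Longrightarrow> FA Q b c =
    Qa b c" for b c
    by (simp_all add: Q_def)
  have idA: "vfunctor V A A (vid V A)" and idB: "vfunctor V B B (vid V B)"
    by (rule vfunctor_vid, rule P.dom.vcategory_axioms P.cod.vcategory_axioms)+
  note QP = vfunctor_vcomp[OF PV QV] and PQv = vfunctor_vcomp[OF QV PV]
  \<comment> \<open>The unit at \<open>x\<close> and its inverse \<open>\<eta>' x\<close> are the
    preimages under \<open>P\<close> of \<open>v (P x)\<close> and \<open>u (P x)\<close>.\<close>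
  define \<eta> where "\<eta> x = inv_arr V (FA P x (Qo (FO P x))) \<cdot> v (FO P x)" for x
  define \<eta>' where "\<eta>' x = inv_arr V (FA P (Qo (FO P x)) x) \<cdot> u (FO P x)" for x
  have [simp]: "\<eta> x \<in> Arr V" "Dom V (\<eta> x) = Unt V" "Cod V (\<eta> x) = VHom A x (Qo (FO P x))"
    "\<eta>' x \<in> Arr V" "Dom V (\<eta>' x) = Unt V" "Cod V (\<eta>' x) = VHom A (Qo (FO P x)) x"
    "FA P x (Qo (FO P x)) \<bullet> \<eta> x \<bullet> un V = v (FO P x) \<bullet> un V"
    "FA P (Qo (FO P x)) x \<bullet> \<eta>' x \<bullet> un V = u (FO P x) \<bullet> un V" if "x \<in> VObj A" for x
    using that by (simp_all add: \<eta>_def \<eta>'_def)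
  have e: "vnat_iso V B B (vcomp V B P Q) (vid V B) u"
  proof (rule vnat_isoI[OF PQv idB, of _ v])
    show "vnat V B B (vcomp V B P Q) (vid V B) u"
      by (rule vnatI[OF PQv idB]) simp_all
    show "vnat V B B (vid V B) (vcomp V B P Q) v"
      by (rule vnatI[OF idB PQv]) simp_all
  qed simp_all
  have h: "vnat_iso V A A (vid V A) (vcomp V A Q P) \<eta>"
  proof (rule vnat_isoI[OF idA QP, of _ \<eta>'], goal_cases)
    case 1
    show ?case
    proof (rule vnatI[OF idA QP], goal_cases)
      case (2 x y f)
      then show ?case
        by - (rule P.dom.app_mono[of "FA P x (Qo (FO P y))"], simp_all)
    qed simp
  next
    case 2
    show ?case
    proof (rule vnatI[OF QP idA], goal_cases)
      case (2 x y f)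
      then show ?case
        by - (rule P.dom.app_mono[of "FA P (Qo (FO P x)) y"], simp_all)
    qed simp
  next
    case (3 x)
    then show ?case
      by - (rule P.dom.app_mono[of "FA P x x"], simp_all)
  next
    case (4 x)
    then show ?case
      by - (rule P.dom.app_mono[of "FA P (Qo (FO P x)) (Qo (FO P x))"], simp_all)
  qed
  show ?thesis
    unfolding vequivalence_def using PV QV h e by blast
qed

section \<open>Powers\<close>

text \<open>
  By the Yoneda lemma, a power \<open>P\<close> of \<open>c\<close> by \<open>X\<close> is determined by its counit \<open>k : X \<rightarrow> C(P, c)\<close>.
\<close>

definition power_map :: "('o, 'a) smcc \<Rightarrow> ('c, 'o, 'a) vcat \<Rightarrow> 'o \<Rightarrow> 'c \<Rightarrow> 'c \<Rightarrow> 'a \<Rightarrow> 'c \<Rightarrow> 'a" where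
  "power_map V C X P c k b = curry_arr V (VHom C b P) X (VHom C b c)
     (VCmp C b P c \<cdot>\<^bsub>V\<^esub> (k \<boxtimes>\<^bsub>V\<^esub> Idn V (VHom C b P)) \<cdot>\<^bsub>V\<^esub> Brd V (VHom C b P) X)"

definition is_power_counit :: "('o, 'a) smcc \<Rightarrow> ('c, 'o, 'a) vcat \<Rightarrow> 'o \<Rightarrow> 'c \<Rightarrow> 'c \<Rightarrow> 'a \<Rightarrow> bool" where
  "is_power_counit V C X P c k \<longleftrightarrow> X \<in> Obj V \<and> P \<in> VObj C \<and> c \<in> VObj C \<and> k \<in> Hom V X (VHom C P c) \<and>
     (\<forall>b\<in>VObj C. is_iso V (power_map V C X P c k b))"

text \<open>A counit \<open>X \<rightarrow> [P, Y]\<close> in \<open>V\<close> corresponds to this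
  comparison arrow \<open>P \<rightarrow> [X, Y]\<close> with the internal hom, which is the
  standard power.\<close>

definition flip_arr :: "('o, 'a) smcc \<Rightarrow> 'o \<Rightarrow> 'o \<Rightarrow> 'o \<Rightarrow> 'a \<Rightarrow> 'a" where
  "flip_arr V X P Y k = curry_arr V P X Y (Ev V P Y \<cdot>\<^bsub>V\<^esub> (k \<boxtimes>\<^bsub>V\<^esub> Idn V P) \<cdot>\<^bsub>V\<^esub> Brd V P X)"

context category
begin

lemma iso_cancel_left:
  assumes "is_iso C (g \<cdot> f)" "is_iso C g" "f \<in> Arr C" "Dom C g = Cod C f"
  shows "is_iso C f"
proof -
  have "f = inv_arr C g \<cdot> (g \<cdot> f)" using assms by simp
  then show ?thesis using assms iso_cmp[of "g \<cdot> f" "inv_arr C g"] by simp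
qed

end

context vcategory
begin

lemma power_map_simps [simp]:
  assumes "X \<in> Obj V" "P \<in> VObj C" "c \<in> VObj C" "b \<in> VObj C" "k \<in> Arr V" "Dom V k = X" "Cod V k =
    VHom C P c"
  shows "power_map V C X P c k b \<in> Arr V" "Dom V (power_map V C X P c k b) = VHom C b P"
    "Cod V (power_map V C X P c k b) = Hm V X (VHom C b c)"
    "\<lbrakk>el V h; el V x; ty V h = VHom C b P; ty V x = X; dj h x; dj x h\<rbrakk> \<Longrightarrow>
      Ev V X (VHom C b c) \<bullet> (power_map V C X P c k b \<bullet> h \<odot> x) = VCmp C b P c \<bullet> (k \<bullet> x \<odot> h)"
  using assms by (simp_all add: power_map_def)

lemma power_functors:
  assumes "X \<in> Obj V" "P \<in> VObj C" "c \<in> VObj C"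
  shows "vfunctor V (vop V C) (vself V) (hom_to V C P)"
    "vfunctor V (vop V C) (vself V) (vcomp V (vop V C) (hom_from V (vself V) X) (hom_to V C c))"
  using assms vfunctor_hom_to vcategory.vfunctor_hom_from[OF vcategory_vself[OF smcc_axioms], of X]
  by (auto intro!: vfunctor_vcomp)

lemma power_counit_of_power:
  assumes pw: "is_power V C X c P \<theta>"
  shows "is_power_counit V C X P c (power_counit V C X c P \<theta>)"
proof -
  have [simp]: "X \<in> Obj V" "c \<in> VObj C" "P \<in> VObj C" using pw by (auto simp: is_power_def)
  interpret s: vcategory V "vself V" by (rule vcategory_vself[OF smcc_axioms])
  interpret hX: vfunctor V "vself V" "vself V" "hom_from V (vself V) X" by (rule
    s.vfunctor_hom_from) simp
  note [simp] = s.hom_from_ev[unfolded vself_simps]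
  interpret hc: vfunctor V "vop V C" "vself V" "hom_to V C c" by (rule vfunctor_hom_to) simp
  note pf = power_functors[of X P c, simplified]
  have i: "vnat_iso_arr V (vop V C) (hom_to V C P) (vcomp V (vop V C) (hom_from V (vself V) X)
    (hom_to V C c)) \<theta>"
    using pw by (auto simp: is_power_def)
  note i' = i[unfolded vnat_iso_arr_iff[OF pf]]
  have t [simp]: "is_iso V (\<theta> b)" "Dom V (\<theta> b) = VHom C b P" "Cod V (\<theta> b) = Hm V X (VHom C b c)"
    if "b \<in> VObj C" for b using i' that by auto
  have hfa [simp]: "FA (hom_to V C c) x y \<in> Arr V" "Dom V (FA (hom_to V C c) x y) = VHom C y x"
      "Cod V (FA (hom_to V C c) x y) = Hm V (VHom C x c) (VHom C y c)" if "x \<in> VObj C" "y \<in> VObj C"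
        for x y
    using hc.FA_simps[of x y] that by auto
  have n: "\<theta> y \<bullet> VCmp C y x P \<bullet> (u \<odot> f) = VCmp (vself V) X (VHom C x c) (VHom C y c) \<bullet> (FA (hom_to V
    C c) x y \<bullet> f \<odot> \<theta> x \<bullet> u)"
    if "x \<in> VObj C" "y \<in> VObj C" "el V f" "el V u" "ty V f = VHom C y x" "ty V u =
      VHom C x P" "dj f u" for x y f u
    using i'[THEN conjunct2, rule_format, of x y f u] that by simp
  let ?k = "power_counit V C X c P \<theta>"
  have k [simp]: "?k \<in> Arr V" "Dom V ?k = X" "Cod V ?k = VHom C P c" by (simp_all add: power_counit_def)
  have "\<theta> b = power_map V C X P c ?k b" if [simp]: "b \<in> VObj C" for b
  proof (rule curry_ext[of _ _ "VHom C b P" X "VHom C b c"], simp_all, goal_cases)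
    case (1 h w)
    \<comment> \<open>The Yoneda step: \<open>h\<close> is the composite of itself with the identity
      of \<open>P\<close>, so naturality reduces \<open>\<theta> b\<close> to the value of
      \<open>\<theta> P\<close> at that identity.\<close>
    have "\<theta> b \<bullet> h = \<theta> b \<bullet> VCmp C b P P \<bullet> (VIdn C P \<bullet> un V \<odot> h)" using 1 by simp
    also have "\<dots> = VCmp (vself V) X (VHom C P c) (VHom C b c) \<bullet> (FA (hom_to V C c) P b \<bullet> h \<odot> \<theta> P \<bullet>
      VIdn C P \<bullet> un V)"
      by (rule n) (use 1 in simp_all)
    finally show ?case using 1 by (simp add: power_counit_def)
  qed
  then show ?thesis using t by (auto simp: is_power_counit_def Hom_iff)
qed

lemma power_of_power_counit:
  assumes pc: "is_power_counit V C X P c k"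
  shows "is_power V C X c P (power_map V C X P c k)" "power_counit V C X c P (power_map V C X P c k)
    = k"
proof -
  have [simp]: "X \<in> Obj V" "c \<in> VObj C" "P \<in> VObj C" "k \<in> Arr V" "Dom V k = X" "Cod V k = VHom C P c"
    "\<And>b. b \<in> VObj C \<Longrightarrow> is_iso V (power_map V C X P c k b)"
    using pc by (auto simp: is_power_counit_def Hom_iff)
  interpret s: vcategory V "vself V" by (rule vcategory_vself[OF smcc_axioms])
  interpret hX: vfunctor V "vself V" "vself V" "hom_from V (vself V) X" by (rule
    s.vfunctor_hom_from) simp
  note [simp] = s.hom_from_ev[unfolded vself_simps]
  interpret hc: vfunctor V "vop V C" "vself V" "hom_to V C c" by (rule vfunctor_hom_to) simp
  have hfa [simp]: "FA (hom_to V C c) x y \<in> Arr V" "Dom V (FA (hom_to V C c) x y) = VHom C y x"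
      "Cod V (FA (hom_to V C c) x y) = Hm V (VHom C x c) (VHom C y c)" if "x \<in> VObj C" "y \<in> VObj C"
        for x y
    using hc.FA_simps[of x y] that by auto
  note pf = power_functors[of X P c, simplified]
  let ?\<theta> = "power_map V C X P c k"
  have n: "?\<theta> y \<bullet> VCmp C y x P \<bullet> (u \<odot> f) = VCmp (vself V) X (VHom C x c) (VHom C y c) \<bullet> (FA (hom_to
    V C c) x y \<bullet> f \<odot> ?\<theta> x \<bullet> u)"
    if a: "x \<in> VObj C" "y \<in> VObj C" "el V f" "el V u" "ty V f = VHom C y x" "ty V u =
      VHom C x P" "dj f u" for x y f u
  proof -
    have "?\<theta> y \<cdot> VCmp C y x P \<cdot> Brd V (VHom C y x) (VHom C x P) =
      VCmp (vself V) X (VHom C x c) (VHom C y c) \<cdot> (FA (hom_to V C c) x y \<boxtimes> ?\<theta> x)"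
      by (rule curry_ext2[of _ _ "VHom C y x" "VHom C x P" X "VHom C y c"]) (use a in simp_all)
    from arg_cong[OF this, of "\<lambda>k. k \<bullet> (f \<odot> u)"] show ?thesis using a dj_sym[OF a(7)] by simp
  qed
  show "is_power V C X c P ?\<theta>"
    unfolding is_power_def vnat_iso_arr_iff[OF pf]
    by (auto simp: n dj_sym)
  show "power_counit V C X c P ?\<theta> = k"
    by (rule ext1[of _ _ X]) (simp_all add: power_counit_def)
qed

section \<open>Powers in \<open>V\<close> itself\<close>

lemma flip_simps [simp]:
  assumes "X \<in> Obj V" "P \<in> Obj V" "Y \<in> Obj V" "k \<in> Arr V" "Dom V k = X" "Cod V k = Hm V P Y"
  shows "flip_arr V X P Y k \<in> Arr V" "Dom V (flip_arr V X P Y k) = P" "Cod V (flip_arr V X P Y k) =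
    Hm V X Y"
    "\<lbrakk>el V p; el V x; ty V p = P; ty V x = X; dj p x; dj x p\<rbrakk> \<Longrightarrow>
      Ev V X Y \<bullet> (flip_arr V X P Y k \<bullet> p \<odot> x) = Ev V P Y \<bullet> (k \<bullet> x \<odot> p)"
  using assms by (simp_all add: flip_arr_def)

lemma iso_postcomp:
  assumes "is_iso V f" "X \<in> Obj V"
  shows "is_iso V (curry_arr V (Hm V X (Dom V f)) X (Cod V f) (f \<cdot> Ev V X (Dom V f)))"
proof -
  let ?p = "\<lambda>f. curry_arr V (Hm V X (Dom V f)) X (Cod V f) (f \<cdot> Ev V X (Dom V f))"
  have f: "f \<in> Arr V" "is_iso V f" "X \<in> Obj V" using assms by auto
  show ?thesis
  proof (rule is_isoI[of _ "?p (inv_arr V f)"])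
    show "?p (inv_arr V f) \<cdot> ?p f = Idn V (Dom V (?p f))"
      by (rule curry_ext[of _ _ "Hm V X (Dom V f)" X "Dom V f"]) (use f in simp_all)
    show "?p f \<cdot> ?p (inv_arr V f) = Idn V (Cod V (?p f))"
      by (rule curry_ext[of _ _ "Hm V X (Cod V f)" X "Cod V f"]) (use f in simp_all)
  qed (use f in simp_all)
qed

text \<open>The symmetry \<open>[A, [B, Y]] \<cong> [B, [A, Y]]\<close> of the internal hom,
  obtained by transposing twice.\<close>

definition "hswap A B Y = curry_arr V (Hm V A (Hm V B Y)) B (Hm V A Y)
   (curry_arr V (Hm V A (Hm V B Y) \<otimes> B) A Y (Ev V B Y \<cdot> (Ev V A (Hm V B Y) \<boxtimes> Idn V B) \<cdot>
     inv_arr V (Asc V (Hm V A (Hm V B Y)) A B) \<cdot> (Idn V (Hm V A (Hm V B Y)) \<boxtimes> Brd V B A) \<cdot> Asc V (Hm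
       V A (Hm V B Y)) B A))"

lemma app_inv_asc [simp]:
  "\<lbrakk>el V x; el V y; el V z; dj x y; dj x z; dj y z; ty V x = X; ty V y = Y; ty V z = Z\<rbrakk> \<Longrightarrow>
   inv_arr V (Asc V X Y Z) \<bullet> (x \<odot> y \<odot> z) = (x \<odot> y) \<odot> z"
  by (rule app_mono[of "Asc V X Y Z"]) auto

lemma hswap [simp]:
  assumes "A \<in> Obj V" "B \<in> Obj V" "Y \<in> Obj V"
  shows "hswap A B Y \<in> Arr V" "Dom V (hswap A B Y) = Hm V A (Hm V B Y)" "Cod V (hswap A B Y) =
    Hm V B (Hm V A Y)"
    "\<lbrakk>el V g; el V a; el V b; ty V g = Hm V A (Hm V B Y); ty V a = A; ty V b = B; dj g a; dj g b;
      dj b a; dj a b\<rbrakk> \<Longrightarrow>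
     Ev V A Y \<bullet> (Ev V B (Hm V A Y) \<bullet> (hswap A B Y \<bullet> g \<odot> b) \<odot> a) = Ev V B Y \<bullet> (Ev V A (Hm V B Y) \<bullet> (g
       \<odot> a) \<odot> b)"
  using assms by (simp_all add: hswap_def)

lemma curry_curry_ext:
  assumes "g \<in> Arr V" "h \<in> Arr V" "Dom V g = W" "Dom V h = W"
    "Cod V g = Hm V X (Hm V Y Z)" "Cod V h = Hm V X (Hm V Y Z)" "X \<in> Obj V" "Y \<in> Obj V" "Z \<in> Obj V"
    "\<And>w x y. \<lbrakk>el V w; el V x; el V y; ty V w = W; ty V x = X; ty V y = Y;
        dj w x; dj x w; dj w y; dj y w; dj x y; dj y x\<rbrakk>
      \<Longrightarrow> Ev V Y Z \<bullet> (Ev V X (Hm V Y Z) \<bullet> (g \<bullet> w \<odot> x) \<odot> y) = Ev V Y Z \<bullet> (Ev V X (Hm V Y Z) \<bullet> (h \<bullet> w \<odot>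
        x) \<odot> y)"
  shows "g = h"
proof (rule ev_inj[of X "Hm V Y Z"])
  have [simp]: "W \<in> Obj V" using assms(1,3) by auto
  show "Ev V X (Hm V Y Z) \<cdot> (g \<boxtimes> Idn V X) = Ev V X (Hm V Y Z) \<cdot> (h \<boxtimes> Idn V X)"
    by (rule curry_ext2[of _ _ W X Y Z]) (use assms(1-9) in \<open>simp_all add: assms(10)\<close>)
qed (use assms(1-9) in auto)

lemma iso_hswap [simp]:
  assumes "A \<in> Obj V" "B \<in> Obj V" "Y \<in> Obj V"
  shows "is_iso V (hswap A B Y)"
proof (rule is_isoI[of _ "hswap B A Y"])
  show "hswap B A Y \<cdot> hswap A B Y = Idn V (Dom V (hswap A B Y))"
    by (rule curry_curry_ext[of _ _ "Hm V A (Hm V B Y)" A B Y]) (use assms in simp_all)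
  show "hswap A B Y \<cdot> hswap B A Y = Idn V (Cod V (hswap A B Y))"
    by (rule curry_curry_ext[of _ _ "Hm V B (Hm V A Y)" B A Y]) (use assms in simp_all)
qed (use assms in simp_all)

text \<open>The power map at \<open>B\<close> is \<open>[B, -]\<close> applied to the flipped
  counit, followed by the invertible \<open>hswap\<close>; so an invertible flip makes every power
  map invertible. Conversely, at \<open>B = I\<close> the isomorphisms
  \<open>Z \<cong> [I, Z]\<close> turn the power map back into the flip.\<close>

lemma power_counit_vself:
  assumes [simp]: "X \<in> Obj V" "P \<in> Obj V" "Y \<in> Obj V" "k \<in> Arr V" "Dom V k = X" "Cod V k = Hm V P Y"
  shows "is_power_counit V (vself V) X P Y k \<longleftrightarrow> is_iso V (flip_arr V X P Y k)"
proof -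
  interpret s: vcategory V "vself V" by (rule vcategory_vself[OF smcc_axioms])
  note [simp] = s.power_map_simps(4)[unfolded vself_simps]
  let ?f = "flip_arr V X P Y k"
  let ?pc = "\<lambda>A f. curry_arr V (Hm V A (Dom V f)) A (Cod V f) (f \<cdot> Ev V A (Dom V f))"
  show ?thesis
  proof
    assume f: "is_iso V ?f"
    have "is_iso V (power_map V (vself V) X P Y k B)" if [simp]: "B \<in> Obj V" for B
    proof -
      have "power_map V (vself V) X P Y k B = hswap B X Y \<cdot> ?pc B ?f"
        by (rule curry_curry_ext[of _ _ "Hm V B P" X B Y]) simp_all
      then show ?thesis using iso_postcomp[OF f, of B] by simp
    qed
    then show "is_power_counit V (vself V) X P Y k" by (simp add: is_power_counit_def Hom_iff)
  next
    assume p: "is_power_counit V (vself V) X P Y k"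
    \<comment> \<open>The canonical isomorphism \<open>Z \<rightarrow> [I, Z]\<close>;
      \<open>?e\<close> is its inverse, evaluation at the unit.\<close>
    let ?i = "\<lambda>Z. curry_arr V Z (Unt V) Z (Run V Z)"
    let ?e = "\<lambda>Z. Ev V (Unt V) Z \<cdot> inv_arr V (Run V (Hm V (Unt V) Z))"
    have i [simp]: "is_iso V (?i Z)" if [simp]: "Z \<in> Obj V" for Z
    proof (rule is_isoI[of _ "?e Z"])
      show "?e Z \<cdot> ?i Z = Idn V (Dom V (?i Z))"
        by (rule ext1[of _ _ Z]) simp_all
      show "?i Z \<cdot> ?e Z = Idn V (Cod V (?i Z))"
      proof (rule ev_inj[of "Unt V" Z])
        show "Ev V (Unt V) Z \<cdot> ((?i Z \<cdot> ?e Z) \<boxtimes> Idn V (Unt V)) = Ev V (Unt V) Z \<cdot> (Idn V (Cod V (?i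
          Z)) \<boxtimes> Idn V (Unt V))"
          by (rule ext2R[of _ _ "Hm V (Unt V) Z"]) simp_all
      qed simp_all
    qed simp_all
    have p1: "is_iso V (power_map V (vself V) X P Y k (Unt V))" using p by (simp add:
      is_power_counit_def)
    have "?pc X (?i Y) \<cdot> ?f = power_map V (vself V) X P Y k (Unt V) \<cdot> ?i P"
    proof (rule ev_inj[of X "Hm V (Unt V) Y"])
      show "Ev V X (Hm V (Unt V) Y) \<cdot> ((?pc X (?i Y) \<cdot> ?f) \<boxtimes> Idn V X) =
        Ev V X (Hm V (Unt V) Y) \<cdot> ((power_map V (vself V) X P Y k (Unt V) \<cdot> ?i P) \<boxtimes> Idn V X)"
      proof (rule ev_inj[of "Unt V" Y])
        show "Ev V (Unt V) Y \<cdot> ((Ev V X (Hm V (Unt V) Y) \<cdot> ((?pc X (?i Y) \<cdot> ?f) \<boxtimes> Idn V X)) \<boxtimes> Idn V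
          (Unt V)) =
         Ev V (Unt V) Y \<cdot> ((Ev V X (Hm V (Unt V) Y) \<cdot> ((power_map V (vself V) X P Y k (Unt V) \<cdot> ?i
           P) \<boxtimes> Idn V X)) \<boxtimes> Idn V (Unt V))"
          \<comment> \<open>After two evaluations the third variable lies in \<open>I\<close>, so
            \<open>un V\<close> may be taken for it.\<close>
          by (rule ext0[of _ "(gen 0 P \<odot> gen 1 X) \<odot> un V"]) simp_all
      qed simp_all
    qed simp_all
    then have "is_iso V (?pc X (?i Y) \<cdot> ?f)" using p1 by simp
    moreover have "is_iso V (?pc X (?i Y))" using iso_postcomp[OF i[of Y], of X] by simp
    ultimately show "is_iso V ?f" by (rule iso_cancel_left) simp_all
  qed
qed

end

text \<open>A power being determined by its counit, preservation reduces to the image of each counit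
  being a counit, and the isomorphisms \<open>\<theta>\<close> drop out.\<close>

lemma preserves_powers_iff:
  assumes FV: "vfunctor V C D F"
  shows "preserves_powers V J C D F \<longleftrightarrow>
    (\<forall>X\<in>J. \<forall>P c k. is_power_counit V C X P c k \<longrightarrow> is_power_counit V D X (FO F P) (FO F c) (FA F P c
      \<cdot>\<^bsub>V\<^esub> k))"
proof -
  interpret F: vfunctor V C D F by fact
  show ?thesis
  proof (intro iffI ballI allI impI)
    fix X P c k assume p: "preserves_powers V J C D F" and X: "X \<in> J" and k: "is_power_counit V C X
      P c k"
    note pw = F.dom.power_of_power_counit[OF k]
    obtain \<theta>' where "is_power V D X (FO F c) (FO F P) \<theta>'" "power_counit V D X (FO F c) (FO F P) \<theta>' =
      FA F P c \<cdot>\<^bsub>V\<^esub> k"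
      using p X pw unfolding preserves_powers_def by metis
    then show "is_power_counit V D X (FO F P) (FO F c) (FA F P c \<cdot>\<^bsub>V\<^esub> k)"
      using F.cod.power_counit_of_power by metis
  next
    assume a: "\<forall>X\<in>J. \<forall>P c k. is_power_counit V C X P c k \<longrightarrow> is_power_counit V D X (FO F P) (FO F c)
      (FA F P c \<cdot>\<^bsub>V\<^esub> k)"
    show "preserves_powers V J C D F"
      unfolding preserves_powers_def
    proof (intro ballI allI impI)
      fix X c P \<theta> assume X: "X \<in> J" and pw: "is_power V C X c P \<theta>"
      have "is_power_counit V D X (FO F P) (FO F c) (FA F P c \<cdot>\<^bsub>V\<^esub> power_counit V C X c P \<theta>)"
        using a X F.dom.power_counit_of_power[OF pw] by blast
      from F.cod.power_of_power_counit[OF this] show "\<exists>\<theta>'. is_power V D X (FO F c) (FO F P) \<theta>' \<and>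
           power_counit V D X (FO F c) (FO F P) \<theta>' = FA F P c \<cdot>\<^bsub>V\<^esub> power_counit V C X c P \<theta>" by blast
    qed
  qed
qed

text \<open>For \<open>C(c, E -)\<close> the flip of the image of a counit is exactly the power map
  of \<open>E\<close> at the object \<open>c\<close>, which is invertible since \<open>E\<close>
  preserves the power.\<close>

lemma preserves_powers_hom:
  fixes V :: "('o, 'a) smcc" (structure)
  assumes EV: "vfunctor V T C E" and p: "preserves_powers V J T C E" and c [simp]: "c \<in> VObj C"
  shows "preserves_powers V J T (vself V) (vcomp V T (hom_from V C c) E)"
proof -
  interpret E: vfunctor V T C E by fact
  interpret h: vfunctor V C "vself V" "hom_from V C c" by (rule E.cod.vfunctor_hom_from) simp
  show ?thesis
    unfolding preserves_powers_iff[OF vfunctor_vcomp[OF EV h.vfunctor_axioms]]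
  proof (intro ballI allI impI)
    fix X P t k assume X: "X \<in> J" and k: "is_power_counit V T X P t k"
    have [simp]: "X \<in> Obj V" "P \<in> VObj T" "t \<in> VObj T" "k \<in> Arr V" "Dom V k = X" "Cod V k = VHom T P t"
      using k by (auto simp: is_power_counit_def E.dom.Hom_iff)
    have e: "is_power_counit V C X (FO E P) (FO E t) (FA E P t \<cdot> k)"
      using p X k unfolding preserves_powers_iff[OF EV] by blast
    let ?k = "FA (vcomp V T (hom_from V C c) E) P t \<cdot> k"
    have "flip_arr V X (VHom C c (FO E P)) (VHom C c (FO E t)) ?k = power_map V C X (FO E P) (FO E
      t) (FA E P t \<cdot> k) c"
      by (rule E.dom.curry_ext[of _ _ "VHom C c (FO E P)" X "VHom C c (FO E t)"]) simp_all
    then have "is_iso V (flip_arr V X (VHom C c (FO E P)) (VHom C c (FO E t)) ?k)"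
      using e by (simp add: is_power_counit_def)
    then have "is_power_counit V (vself V) X (VHom C c (FO E P)) (VHom C c (FO E t)) ?k"
      by (subst E.dom.power_counit_vself) simp_all
    then show "is_power_counit V (vself V) X (FO (vcomp V T (hom_from V C c) E) P) (FO (vcomp V T
      (hom_from V C c) E) t) ?k"
      by simp
  qed
qed

text \<open>Powers are detected by representables. Naturality of \<open>\<psi>\<close> gives a
  square whose sides are the power map at \<open>c\<close>, the postcomposition \<open>?q\<close>
  with \<open>\<psi> c t\<close>, the flipped counit for \<open>M c\<close>, and
  \<open>\<psi> c P\<close>; the last three are invertible.\<close>

lemma preserves_powers_of_hom:
  fixes V :: "('o, 'a) smcc" (structure)
  assumes EV: "vfunctor V T C E" and MV: "\<And>c. c \<in> VObj C \<Longrightarrow> vfunctor V T (vself V) (M c)"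
    and p: "\<And>c. c \<in> VObj C \<Longrightarrow> preserves_powers V J T (vself V) (M c)"
    and \<psi>: "\<And>c t. \<lbrakk>c \<in> VObj C; t \<in> VObj T\<rbrakk> \<Longrightarrow> is_iso V (\<psi> c t) \<and> Dom V (\<psi> c t) = VHom C c (FO E t) \<and>
      Cod V (\<psi> c t) = FO (M c) t"
    and n: "\<And>c s t f h. \<lbrakk>c \<in> VObj C; s \<in> VObj T; t \<in> VObj T; el V f; el V h; ty V f = VHom T s t;
      ty V h = VHom C c (FO E s); dj f h\<rbrakk> \<Longrightarrow>
      \<psi> c t \<bullet> VCmp C c (FO E s) (FO E t) \<bullet> (FA E s t \<bullet> f \<odot> h) = Ev V (FO (M c) s) (FO (M c) t) \<bullet> (FA
        (M c) s t \<bullet> f \<odot> \<psi> c s \<bullet> h)"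
  shows "preserves_powers V J T C E"
proof -
  interpret E: vfunctor V T C E by fact
  show ?thesis
    unfolding preserves_powers_iff[OF EV]
  proof (intro ballI allI impI)
    fix X P t k assume X: "X \<in> J" and k: "is_power_counit V T X P t k"
    have [simp]: "X \<in> Obj V" "P \<in> VObj T" "t \<in> VObj T" "k \<in> Arr V" "Dom V k = X" "Cod V k = VHom T P t"
      using k by (auto simp: is_power_counit_def E.dom.Hom_iff)
    have "is_iso V (power_map V C X (FO E P) (FO E t) (FA E P t \<cdot> k) c)" if c [simp]: "c \<in> VObj C" for c
    proof -
      interpret M: vfunctor V T "vself V" "M c" by (rule MV) simp
      have [simp]: "FO (M c) s \<in> Obj V" if "s \<in> VObj T" for s using M.FO_VObj[OF that] by simp
      have [simp]: "is_iso V (\<psi> c s)" "Dom V (\<psi> c s) = VHom C c (FO E s)" "Cod V (\<psi> c s) =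
        FO (M c) s" if "s \<in> VObj T" for s
        using \<psi>[OF c that] by auto
      have "is_power_counit V (vself V) X (FO (M c) P) (FO (M c) t) (FA (M c) P t \<cdot> k)"
        using p[OF c] X k unfolding preserves_powers_iff[OF MV[OF c]] by blast
      then have f [simp]: "is_iso V (flip_arr V X (FO (M c) P) (FO (M c) t) (FA (M c) P t \<cdot> k))"
        by (subst (asm) E.dom.power_counit_vself) simp_all
      let ?q = "curry_arr V (Hm V X (VHom C c (FO E t))) X (FO (M c) t) (\<psi> c t \<cdot> Ev V X (VHom C c
        (FO E t)))"
      have q: "is_iso V ?q" using E.dom.iso_postcomp[of "\<psi> c t" X] by simp
      have "?q \<cdot> power_map V C X (FO E P) (FO E t) (FA E P t \<cdot> k) c =
        flip_arr V X (FO (M c) P) (FO (M c) t) (FA (M c) P t \<cdot> k) \<cdot> \<psi> c P"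
        by (rule E.dom.curry_ext[of _ _ "VHom C c (FO E P)" X "FO (M c) t"]) (simp_all add: n)
      then have "is_iso V (?q \<cdot> power_map V C X (FO E P) (FO E t) (FA E P t \<cdot> k) c)" by simp
      then show ?thesis by (rule E.dom.iso_cancel_left[OF _ q]) simp_all
    qed
    then show "is_power_counit V C X (FO E P) (FO E t) (FA E P t \<cdot> k)"
      by (simp add: is_power_counit_def E.dom.Hom_iff)
  qed
qed

section \<open>The comparison functor\<close>

context nat_cat
begin

text \<open>The components of a natural transformation assemble to a global element of the end, and
  composites are compared on projections. This is how an isomorphism of functors becomes one inside
  the functor category.\<close>

lemma iso_of_vnat_iso:
  assumes F: "F \<in> S" and G: "G \<in> S" and i: "vnat_iso V C D (\<Phi> F) (\<Phi> G) \<alpha>"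
  shows "\<exists>u v. u \<in> Hom V (Unt V) (e F G) \<and> v \<in> Hom V (Unt V) (e G F) \<and>
     VCmp N G F G \<bullet> (u \<bullet> un V \<odot> v \<bullet> un V) = VIdn N G \<bullet> un V \<and>
     VCmp N F G F \<bullet> (v \<bullet> un V \<odot> u \<bullet> un V) = VIdn N F \<bullet> un V"
proof -
  note FV = \<Phi>_fun[OF F] and GV = \<Phi>_fun[OF G]
  have lift: "\<exists>u. u \<in> Hom V (Unt V) (e K L) \<and> (\<forall>x\<in>VObj C. p K L x \<cdot> u = \<gamma> x)"
    if KL: "K \<in> S" "L \<in> S" and n: "vnat V C D (\<Phi> K) (\<Phi> L) \<gamma>" for K L \<gamma>
  proof -
    note t = vnatD[OF n \<Phi>_fun[OF KL(1)] \<Phi>_fun[OF KL(2)]]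
    have "\<exists>!u. u \<in> Hom V (Unt V) (e K L) \<and> (\<forall>x\<in>VObj C. p K L x \<cdot> u = \<gamma> x)"
    proof (rule p_lift[OF KL], goal_cases)
      case (2 x) then show ?case using t(1-3)[of x] KL by (simp add: \<Phi>_FO)
    next
      case (3 x y f a)
      have "VCmp D (FO K x) (FO K y) (FO L y) \<cdot> (\<gamma> y \<boxtimes> FA (\<Phi> K) x y) =
        VCmp D (FO K x) (FO L x) (FO L y) \<cdot> (FA (\<Phi> L) x y \<boxtimes> \<gamma> x) \<cdot> Brd V (Unt V) (VHom C x y)"
      proof (rule ext2L[of _ _ "VHom C x y"], goal_cases)
        case (6 f)
        then show ?case using t(1-3)[of x] t(1-3)[of y] t(4)[of x y f] KL 3 by (simp add: \<Phi>_FO)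
      qed (use t(1-3)[of x] t(1-3)[of y] KL 3 in \<open>simp_all add: \<Phi>_FO\<close>)
      from arg_cong[OF this, of "\<lambda>k. k \<bullet> (a \<odot> f)"] show ?case
        using t(1-3)[of x] t(1-3)[of y] KL 3 by (simp add: \<Phi>_FO)
    qed simp
    then show ?thesis by blast
  qed
  obtain \<beta> where b: "vnat V C D (\<Phi> G) (\<Phi> F) \<beta>"
    "\<And>x. x \<in> VObj C \<Longrightarrow> VCmp D (FO F x) (FO G x) (FO F x) \<bullet> (\<beta> x \<bullet> un V \<odot> \<alpha> x \<bullet> un V) =
      VIdn D (FO F x) \<bullet> un V"
    "\<And>x. x \<in> VObj C \<Longrightarrow> VCmp D (FO G x) (FO F x) (FO G x) \<bullet> (\<alpha> x \<bullet> un V \<odot> \<beta> x \<bullet> un V) =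
      VIdn D (FO G x) \<bullet> un V"
    using vnat_isoD[OF i FV GV] \<Phi>_FO F G by metis
  have a: "vnat V C D (\<Phi> F) (\<Phi> G) \<alpha>" using i by (auto simp: vnat_iso_def)
  obtain u where u: "u \<in> Hom V (Unt V) (e F G)" "\<And>x. x \<in> VObj C \<Longrightarrow> p F G x \<cdot> u = \<alpha> x"
    using lift[OF F G a] by blast
  obtain v where v: "v \<in> Hom V (Unt V) (e G F)" "\<And>x. x \<in> VObj C \<Longrightarrow> p G F x \<cdot> v = \<beta> x"
    using lift[OF G F b(1)] by blast
  have [simp]: "u \<in> Arr V" "Dom V u = Unt V" "Cod V u = e F G" "v \<in> Arr V" "Dom V v =
    Unt V" "Cod V v = e G F"
    using u v by (auto simp: Hom_iff)
  have ux [simp]: "p F G x \<bullet> u \<bullet> un V = \<alpha> x \<bullet> un V" "p G F x \<bullet> v \<bullet> un V = \<beta> x \<bullet> un V" if "x \<in> VObj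
    C" for x
    using arg_cong[OF u(2), of x "\<lambda>k. k \<bullet> un V"] arg_cong[OF v(2), of x "\<lambda>k. k \<bullet> un V"] that F G by auto
  have i1: "VCmp N G F G \<cdot> (u \<boxtimes> v) \<cdot> inv_arr V (Lun V (Unt V)) = VIdn N G"
  proof (rule p_mono[OF G G], goal_cases)
    case (6 x)
    then show ?case by - (rule extU, use F G b in simp_all)
  qed (use F G in simp_all)
  have i2: "VCmp N F G F \<cdot> (v \<boxtimes> u) \<cdot> inv_arr V (Lun V (Unt V)) = VIdn N F"
  proof (rule p_mono[OF F F], goal_cases)
    case (6 x)
    then show ?case by - (rule extU, use F G b in simp_all)
  qed (use F G in simp_all)
  have "VCmp N G F G \<bullet> (u \<bullet> un V \<odot> v \<bullet> un V) = VIdn N G \<bullet> un V"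
     "VCmp N F G F \<bullet> (v \<bullet> un V \<odot> u \<bullet> un V) = VIdn N F \<bullet> un V"
    using F G arg_cong[OF i1, of "\<lambda>k. k \<bullet> un V"] arg_cong[OF i2, of "\<lambda>k. k \<bullet> un V"] by simp_all
  then show ?thesis using u(1) v(1) by blast
qed

end

text \<open>
  \<open>Cop\<close> stands for the opposite of \<open>C\<close>. It is a separate parameter because the change of base of
    \<open>vop V C\<close> agrees with
  the opposite of the change of base of \<open>C\<close> only on the objects of \<open>C\<close>. The functor \<open>br E\<close> is \<open>\<lbrakk>-, E\<rbrakk>\<close>.
\<close>

locale comparison = module_category V T A ob rho act + NA: nat_cat V T C S1 \<Phi>1 e1 p1 + NB: nat_cat V
  Cop A S2 \<Phi>2 e2 p2
  for V :: "('o, 'a) smcc" (structure) and T :: "('t, 'o, 'a) vcat" and A :: "('m, 'o, 'a) vcat"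
    and ob :: "'m \<Rightarrow> 't \<Rightarrow> 'o" and rho :: "'m \<Rightarrow> 't \<Rightarrow> 't \<Rightarrow> 'a" and act :: "'m \<Rightarrow> 'm \<Rightarrow> 't \<Rightarrow> 'a"
    and C :: "('c, 'o, 'a) vcat" and S1 :: "('t, 'c, 'k) vfun set" and \<Phi>1 and e1 and p1
    and Cop :: "('c, 'o, 'a) vcat" and S2 :: "('c, 'm, 'l) vfun set" and \<Phi>2 and e2 and p2 +
  fixes br :: "('t, 'c, 'k) vfun \<Rightarrow> ('c, 'm, 'l) vfun"
  assumes Cop_simps [simp]: "VObj Cop = VObj C" "VHom Cop c d = VHom C d c"
    and br_S2 [simp]: "E \<in> S1 \<Longrightarrow> br E \<in> S2"
    and br_ob [simp]: "\<lbrakk>E \<in> S1; c \<in> VObj C; t \<in> VObj T\<rbrakk> \<Longrightarrow> ob (FO (br E) c) t = VHom C c (FO E t)"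
    and br_rho [simp]: "\<lbrakk>E \<in> S1; c \<in> VObj C; s \<in> VObj T; t \<in> VObj T; el V f; el V h; ty V f =
      VHom T s t;
       ty V h = VHom C c (FO E s); dj f h\<rbrakk> \<Longrightarrow>
       rho (FO (br E) c) s t \<bullet> (f \<odot> h) = VCmp C c (FO E s) (FO E t) \<bullet> (FA (\<Phi>1 E) s t \<bullet> f \<odot> h)"
    and br_act [simp]: "\<lbrakk>E \<in> S1; c \<in> VObj C; d \<in> VObj C; t \<in> VObj T; el V g; el V h; ty V g =
      VHom C d c;
       ty V h = VHom C c (FO E t); dj g h\<rbrakk> \<Longrightarrow>
       act (FO (br E) c) (FO (br E) d) t \<bullet> (FA (\<Phi>2 (br E)) c d \<bullet> g \<odot> h) = VCmp C d c (FO E t) \<bullet> (h \<odot> g)"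
begin

lemma FO_br [simp]: "\<lbrakk>E \<in> S1; c \<in> VObj C\<rbrakk> \<Longrightarrow> FO (br E) c \<in> VObj A"
  using NB.FO_S[of "br E" c] by simp

lemma FA_br [simp]:
  assumes "E \<in> S1" "c \<in> VObj C" "d \<in> VObj C"
  shows "FA (\<Phi>2 (br E)) c d \<in> Arr V" "Dom V (FA (\<Phi>2 (br E)) c d) = VHom C d c"
    "Cod V (FA (\<Phi>2 (br E)) c d) = VHom A (FO (br E) c) (FO (br E) d)"
  using NB.FA_\<Phi>[of "br E" c d] assms by simp_all

lemma p2_simps [simp]:
  assumes "E \<in> S1" "F \<in> S1" "c \<in> VObj C"
  shows "p2 (br E) (br F) c \<in> Arr V" "Dom V (p2 (br E) (br F) c) = e2 (br E) (br F)"
    "Cod V (p2 (br E) (br F) c) = VHom A (FO (br E) c) (FO (br F) c)"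
  using NB.p_simps[of "br E" "br F" c] assms by simp_all

text \<open>Composition with the components of a natural transformation from \<open>E\<close> to
  \<open>F\<close>, as a homomorphism from \<open>C(c, E -)\<close> to
  \<open>C(c, F -)\<close>.\<close>

definition "kappa E F c = (SOME h. h \<in> Hom V (e1 E F) (VHom A (FO (br E) c) (FO (br F) c)) \<and>
   (\<forall>t w x. t \<in> VObj T \<and> el V w \<and> el V x \<and> ty V w = e1 E F \<and> ty V x = VHom C c (FO E t) \<and> dj w x \<longrightarrow>
     act (FO (br E) c) (FO (br F) c) t \<bullet> (h \<bullet> w \<odot> x) = VCmp C c (FO E t) (FO F t) \<bullet> (p1 E F t \<bullet> w \<odot>
       x)))"

lemma kappa [simp]:
  assumes EF [simp]: "E \<in> S1" "F \<in> S1" and c [simp]: "c \<in> VObj C"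
  shows "kappa E F c \<in> Arr V" "Dom V (kappa E F c) = e1 E F" "Cod V (kappa E F c) =
    VHom A (FO (br E) c) (FO (br F) c)"
    "\<lbrakk>t \<in> VObj T; el V w; el V x; ty V w = e1 E F; ty V x = VHom C c (FO E t); dj w x\<rbrakk> \<Longrightarrow>
     act (FO (br E) c) (FO (br F) c) t \<bullet> (kappa E F c \<bullet> w \<odot> x) = VCmp C c (FO E t) (FO F t) \<bullet> (p1 E
       F t \<bullet> w \<odot> x)"
proof -
  obtain h where h: "h \<in> Arr V" "Dom V h = e1 E F" "Cod V h = VHom A (FO (br E) c) (FO (br F) c)"
    "\<And>t w x. \<lbrakk>t \<in> VObj T; el V w; el V x; ty V w = e1 E F; ty V x = ob (FO (br E) c) t; dj w x\<rbrakk> \<Longrightarrow>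
       act (FO (br E) c) (FO (br F) c) t \<bullet> (h \<bullet> w \<odot> x) =
       (VCmp C c (FO E t) (FO F t) \<cdot> (p1 E F t \<boxtimes> Idn V (VHom C c (FO E t)))) \<bullet> (w \<odot> x)"
  proof (rule act_lift[of "FO (br E) c" "FO (br F) c" "e1 E F" "\<lambda>t. VCmp C c (FO E t) (FO F t) \<cdot> (p1
    E F t \<boxtimes> Idn V (VHom C c (FO E t)))"], goal_cases)
    case (5 s t w f x)
    have "VCmp C c (FO E s) (FO F t) \<bullet> (VCmp C (FO E s) (FO E t) (FO F t) \<bullet> (p1 E F t \<bullet> w \<odot> FA (\<Phi>1
      E) s t \<bullet> f) \<odot> x) =
       VCmp C c (FO E s) (FO F t) \<bullet> (VCmp C (FO E s) (FO F s) (FO F t) \<bullet> (FA (\<Phi>1 F) s t \<bullet> f \<odot> p1 E F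
         s \<bullet> w) \<odot> x)"
      using 5 by (subst NA.p_nat) simp_all
    then show ?case using 5 by simp
  qed simp_all
  have "\<exists>h. h \<in> Hom V (e1 E F) (VHom A (FO (br E) c) (FO (br F) c)) \<and>
   (\<forall>t w x. t \<in> VObj T \<and> el V w \<and> el V x \<and> ty V w = e1 E F \<and> ty V x = VHom C c (FO E t) \<and> dj w x \<longrightarrow>
     act (FO (br E) c) (FO (br F) c) t \<bullet> (h \<bullet> w \<odot> x) = VCmp C c (FO E t) (FO F t) \<bullet> (p1 E F t \<bullet> w \<odot> x))"
    using h by (intro exI[of _ h]) (simp add: T.Hom_iff)
  note k = someI_ex[OF this, folded kappa_def]
  show "kappa E F c \<in> Arr V" "Dom V (kappa E F c) = e1 E F" "Cod V (kappa E F c) =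
    VHom A (FO (br E) c) (FO (br F) c)"
    using conjunct1[OF k] by (auto simp: T.Hom_iff)
  show "\<lbrakk>t \<in> VObj T; el V w; el V x; ty V w = e1 E F; ty V x = VHom C c (FO E t); dj w x\<rbrakk> \<Longrightarrow>
     act (FO (br E) c) (FO (br F) c) t \<bullet> (kappa E F c \<bullet> w \<odot> x) = VCmp C c (FO E t) (FO F t) \<bullet> (p1 E
       F t \<bullet> w \<odot> x)"
    using conjunct2[OF k, rule_format, of t w x] by simp
qed

definition "Pa E F = (THE h. h \<in> Hom V (e1 E F) (e2 (br E) (br F)) \<and> (\<forall>c\<in>VObj Cop. p2 (br E) (br F)
  c \<cdot> h = kappa E F c))"

text \<open>The family \<open>kappa E F c\<close> is natural in \<open>c\<close> because composing
  in front commutes with composing behind, which is associativity in \<open>C\<close>.\<close>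

lemma Pa_ex:
  assumes EF [simp]: "E \<in> S1" "F \<in> S1"
  shows "Pa E F \<in> Hom V (e1 E F) (e2 (br E) (br F)) \<and> (\<forall>c\<in>VObj Cop. p2 (br E) (br F) c \<cdot> Pa E F =
    kappa E F c)"
  unfolding Pa_def
proof (rule theI', rule NB.p_lift, goal_cases)
  case (5 x y f a)
  then have xy [simp]: "x \<in> VObj C" "y \<in> VObj C" by auto
  have "VCmp A (FO (br E) x) (FO (br E) y) (FO (br F) y) \<cdot> (kappa E F y \<boxtimes> FA (\<Phi>2 (br E)) x y) =
    VCmp A (FO (br E) x) (FO (br F) x) (FO (br F) y) \<cdot> (FA (\<Phi>2 (br F)) x y \<boxtimes> kappa E F x) \<cdot> Brd V
      (e1 E F) (VHom C y x)"
    by (rule act_ext2[of _ _ "e1 E F" "VHom C y x" "FO (br E) x" "FO (br F) y"]) simp_all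
  from arg_cong[OF this, of "\<lambda>k. k \<bullet> (a \<odot> f)"] show ?case using 5 by simp
qed simp_all

lemma Pa [simp]:
  assumes EF [simp]: "E \<in> S1" "F \<in> S1"
  shows "Pa E F \<in> Arr V" "Dom V (Pa E F) = e1 E F" "Cod V (Pa E F) = e2 (br E) (br F)"
    "\<lbrakk>c \<in> VObj C; el V w; ty V w = e1 E F\<rbrakk> \<Longrightarrow> p2 (br E) (br F) c \<bullet> Pa E F \<bullet> w = kappa E F c \<bullet> w"
proof -
  show *: "Pa E F \<in> Arr V" "Dom V (Pa E F) = e1 E F" "Cod V (Pa E F) = e2 (br E) (br F)"
    using Pa_ex[OF EF] by (auto simp: T.Hom_iff)
  assume c: "c \<in> VObj C" "el V w" "ty V w = e1 E F"
  then have "p2 (br E) (br F) c \<cdot> Pa E F = kappa E F c" using Pa_ex[OF EF] by simp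
  from arg_cong[OF this, of "\<lambda>k. k \<bullet> w"] show "p2 (br E) (br F) c \<bullet> Pa E F \<bullet> w = kappa E F c \<bullet> w"
    using c * by simp
qed

definition "P = mk_vfun NA.N br Pa"

lemma P_simps [simp]:
  "E \<in> S1 \<Longrightarrow> FO P E = br E" "\<lbrakk>E \<in> S1; F \<in> S1\<rbrakk> \<Longrightarrow> FA P E F = Pa E F"
  by (simp_all add: P_def)

text \<open>Arrows into the hom of the target are tested first on the projections \<open>p2\<close>
  and then on actions; what remains are the category laws of \<open>C\<close>.\<close>

lemma vfunctor_P: "vfunctor V NA.N NB.N P"
proof (rule vfunctorI[OF NA.vcategory_N NB.vcategory_N P_def], goal_cases)
  case (3 E)
  then have [simp]: "E \<in> S1" by simp
  have "Pa E E \<cdot> VIdn NA.N E = VIdn NB.N (br E)"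
  proof (rule NB.p_mono[of "br E" "br E"], simp_all, goal_cases)
    case (1 c)
    then show ?case
      by - (rule act_extU[of _ _ "FO (br E) c" "FO (br E) c"], simp_all)
  qed
  from arg_cong[OF this, of "\<lambda>k. k \<bullet> un V"] show ?case by simp
next
  case (4 E F G b a)
  then have [simp]: "E \<in> S1" "F \<in> S1" "G \<in> S1" by simp_all
  have "Pa E G \<cdot> VCmp NA.N E F G = VCmp NB.N (br E) (br F) (br G) \<cdot> (Pa F G \<boxtimes> Pa E F)"
  proof (rule NB.p_mono[of "br E" "br G"], simp_all del: T.ten_cmp' T.assoc, goal_cases)
    case (1 c)
    then show ?case
      by - (rule act_ext2[of _ _ "e1 F G" "e1 E F" "FO (br E) c" "FO (br G) c"], simp_all)
  qed
  from arg_cong[OF this, of "\<lambda>k. k \<bullet> (b \<odot> a)"] 4 show ?case by simp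
qed simp_all

lemma iso_Pa:
  assumes EF [simp]: "E \<in> S1" "F \<in> S1"
  shows "is_iso V (Pa E F)"
proof -
  let ?e = "e2 (br E) (br F)"
  have [simp]: "?e \<in> Obj V" using NB.e_Obj[of "br E" "br F"] by simp
  \<comment> \<open>The component at the object \<open>E t\<close> is evaluated at the identity of
    \<open>E t\<close>, which leaves an element of \<open>C(E t, F t)\<close>.\<close>
  define r where "r t = act (FO (br E) (FO E t)) (FO (br F) (FO E t)) t \<cdot>
     (p2 (br E) (br F) (FO E t) \<boxtimes> VIdn C (FO E t)) \<cdot> inv_arr V (Run V ?e)" for t
  have r [simp]: "r t \<in> Arr V" "Dom V (r t) = ?e" "Cod V (r t) = VHom C (FO E t) (FO F t)"
    "\<lbrakk>el V w; ty V w = ?e\<rbrakk> \<Longrightarrow> r t \<bullet> w = act (FO (br E) (FO E t)) (FO (br F) (FO E t)) t \<bullet>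
       (p2 (br E) (br F) (FO E t) \<bullet> w \<odot> VIdn C (FO E t) \<bullet> un V)" if "t \<in> VObj T" for t w
    using that by (simp_all add: r_def)
  \<comment> \<open>Naturality along \<open>g : d \<rightarrow> E t\<close>, evaluated at the
    identity of \<open>E t\<close>: the component at any \<open>d\<close> is composition with
    \<open>r t\<close>.\<close>
  have key: "act (FO (br E) d) (FO (br F) d) t \<bullet> (p2 (br E) (br F) d \<bullet> w \<odot> g) =
    VCmp C d (FO E t) (FO F t) \<bullet> (r t \<bullet> w \<odot> g)"
    if h [simp]: "t \<in> VObj T" "d \<in> VObj C" "el V w" "el V g" "ty V w = ?e" "ty V g =
      VHom C d (FO E t)" "dj w g" "dj g w" for t d w g
  proof -
    let ?x = "FO E t"
    have "VCmp A (FO (br E) ?x) (FO (br E) d) (FO (br F) d) \<bullet> (p2 (br E) (br F) d \<bullet> w \<odot> FA (\<Phi>2 (br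
      E)) ?x d \<bullet> g)
      = VCmp A (FO (br E) ?x) (FO (br F) ?x) (FO (br F) d) \<bullet> (FA (\<Phi>2 (br F)) ?x d \<bullet> g \<odot> p2 (br E)
        (br F) ?x \<bullet> w)"
      by (rule NB.p_nat) simp_all
    from arg_cong[OF this, of "\<lambda>k. act (FO (br E) ?x) (FO (br F) d) t \<bullet> (k \<odot> VIdn C ?x \<bullet> un V)"]
    show ?thesis by simp
  qed
  have "\<exists>!h. h \<in> Hom V ?e (e1 E F) \<and> (\<forall>t\<in>VObj T. p1 E F t \<cdot> h = r t)"
  proof (rule NA.p_lift[OF EF], goal_cases)
    case (3 s t f a)
    then have [simp]: "s \<in> VObj T" "t \<in> VObj T" "el V f" "el V a" "ty V f = VHom T s t" "ty V a =
      ?e" "dj a f" "dj f a" by auto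
    \<comment> \<open>Naturality of \<open>r\<close> in \<open>t\<close> comes from the components
      being homomorphisms: by \<open>key\<close> the left side is the component at
      \<open>E s\<close> applied to the action of \<open>f\<close> on the identity, and
      \<open>act_nat\<close> moves \<open>f\<close> outside.\<close>
    have "VCmp C (FO E s) (FO E t) (FO F t) \<bullet> (r t \<bullet> a \<odot> FA (\<Phi>1 E) s t \<bullet> f) =
       act (FO (br E) (FO E s)) (FO (br F) (FO E s)) t \<bullet> (p2 (br E) (br F) (FO E s) \<bullet> a \<odot>
         rho (FO (br E) (FO E s)) s t \<bullet> (f \<odot> VIdn C (FO E s) \<bullet> un V))"
      by (subst key[symmetric]) simp_all
    also have "\<dots> = VCmp C (FO E s) (FO F s) (FO F t) \<bullet> (FA (\<Phi>1 F) s t \<bullet> f \<odot> r s \<bullet> a)"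
      by (subst act_nat) simp_all
    finally show ?case .
  qed simp_all
  then obtain h where h: "h \<in> Hom V ?e (e1 E F)" "\<And>t. t \<in> VObj T \<Longrightarrow> p1 E F t \<cdot> h = r t" by blast
  have [simp]: "h \<in> Arr V" "Dom V h = ?e" "Cod V h = e1 E F" using h(1) by (auto simp: T.Hom_iff)
  have hx: "p1 E F t \<bullet> h \<bullet> w = r t \<bullet> w" if "t \<in> VObj T" "el V w" "ty V w = ?e" for t w
    using arg_cong[OF h(2), of t "\<lambda>k. k \<bullet> w"] that by simp
  show ?thesis
  proof (rule T.is_isoI[of _ h], simp_all)
    show "h \<cdot> Pa E F = Idn V (e1 E F)"
    proof (rule NA.p_mono[OF EF], simp_all, goal_cases)
      case (1 t)
      then show ?case by - (rule T.ext1[of _ _ "e1 E F"], simp_all add: hx)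
    qed
    show "Pa E F \<cdot> h = Idn V ?e"
    proof (rule NB.p_mono[of "br E" "br F"], simp_all, goal_cases)
      case (1 c)
      show ?case
      proof (rule act_ext[of _ _ ?e "FO (br E) c" "FO (br F) c"], goal_cases)
        case (9 t w x)
        then show ?case using 1 by (simp add: hx key del: r(4))
      qed (use 1 in simp_all)
    qed
  qed
qed

end

section \<open>Algebras\<close>

locale algebra_category = sym_monoidal_embedding V V' j + T: vcategory V T
  for V :: "('o, 'a) smcc" and V' :: "('p, 'b) smcc" and j :: "('o, 'a, 'p, 'b) emb"
    and T :: "('o, 'o, 'a) vcat" +
  fixes J :: "'o set"
  assumes ex: "alg_exists V V' j J T" and ih: "preserves_internal_homs V V' j"
begin

abbreviation "algs \<equiv> algebras V J T (vself V)"
abbreviation "eh A B \<equiv> fst (alg_hom V V' j T A B)"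
abbreviation "ph A B \<equiv> snd (alg_hom V V' j T A B)"
abbreviation "Alg \<equiv> alg V V' j J T"

section \<open>Homs of algebras as ends, and algebras as modules\<close>

lemma algsD: "A \<in> algs \<Longrightarrow> vfunctor V T (vself V) A"
  by (simp add: algebras_def)

lemma alg_hom:
  fixes A B :: "('o, 'o, 'a) vfun"
  assumes "A \<in> algs" "B \<in> algs"
  shows "is_alg_hom V V' j T A B (eh A B) (ph A B)"
proof -
  have "\<exists>z. (case z of (e, p) \<Rightarrow> is_alg_hom V V' j T A B e p)"
    using ex assms unfolding alg_exists_def by auto
  from someI_ex[OF this] show ?thesis
    unfolding alg_hom_def by (simp add: case_prod_unfold)
qed

lemma alg_nat_object':
  assumes "A \<in> algs" "B \<in> algs"
  shows "is_nat_object V' (bc T) (bc (vself V)) (base_fun j T A) (base_fun j T B) (jO j (eh A B))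
    (\<lambda>t. jA j (ph A B t))"
  using alg_hom[OF assms] by (simp add: is_alg_hom_def)

text \<open>The chosen homs of algebras are ends in \<open>V'\<close> by definition;
  \<open>nat_object_reflect\<close> makes them ends in \<open>V\<close>, so the general construction
  yields \<open>T-Alg\<close> as a category over \<open>V\<close>.\<close>

sublocale nc: nat_cat V T "vself V" algs "\<lambda>A. A" eh ph
proof -
  interpret s: vcategory V "vself V" by (rule vcategory_vself[OF src.smcc_axioms])
  show "nat_cat V T (vself V) algs (\<lambda>A. A) eh ph"
  proof (rule nat_cat.intro[OF s.vcategory_axioms T.vcategory_axioms], rule nat_cat_axioms.intro,
    goal_cases)
    case (3 A B)
    then show ?case using alg_hom[of A B]
      by (intro nat_object_reflect[OF alg_nat_object' algsD algsD]) (auto simp: is_alg_hom_def)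
  qed (auto simp: algsD)
qed

lemma alg_eq: "Alg = nc.N"
  by (simp add: alg_def nc.N_def)

lemma realized_vself: "realized V (vself V) (\<lambda>x. x) (Ev V)"
proof -
  interpret s: vcategory V "vself V" by (rule vcategory_vself[OF src.smcc_axioms])
  show ?thesis
  proof (unfold_locales, goal_cases)
    case (7 x y h W) then show ?case by (simp add: src.ev_univ')
  qed simp_all
qed

lemma realized_base: "realized V' (bc (vself V)) (jO j) jev"
proof -
  interpret s: vcategory V' "bc (vself V)" by (rule vcategory_base[OF vcategory_vself[OF
    src.smcc_axioms]])
  show ?thesis
  proof (unfold_locales, goal_cases)
    case (7 x y h W) then show ?case using jev_univ[OF ih] by simp
  qed simp_all
qed

definition "rh A s t = Ev V (FO A s) (FO A t) \<cdot>\<^bsub>V\<^esub> (FA A s t \<boxtimes>\<^bsub>V\<^esub> Idn V (FO A s))"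
definition "ac A B t = Ev V (FO A t) (FO B t) \<cdot>\<^bsub>V\<^esub> (ph A B t \<boxtimes>\<^bsub>V\<^esub> Idn V (FO A t))"

sublocale m: module_category V T nc.N FO rh ac
  using module_category_of_nat_cat[OF nc.nat_cat_axioms realized_vself] unfolding rh_def ac_def by simp

lemma FO_alg [simp]: "\<lbrakk>A \<in> algs; t \<in> VObj T\<rbrakk> \<Longrightarrow> FO A t \<in> Obj V"
  using nc.FO_S[of A t] by simp

lemma FA_alg [simp]:
  assumes "A \<in> algs" "s \<in> VObj T" "t \<in> VObj T"
  shows "FA A s t \<in> Arr V" "Dom V (FA A s t) = VHom T s t" "Cod V (FA A s t) = Hm V (FO A s) (FO A t)"
  using nc.FA_\<Phi>[OF assms] by simp_all

lemma ph_alg [simp]: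
  assumes "A \<in> algs" "B \<in> algs" "t \<in> VObj T"
  shows "ph A B t \<in> Arr V" "Dom V (ph A B t) = eh A B" "Cod V (ph A B t) = Hm V (FO A t) (FO B t)"
  using nc.p_simps[OF assms] by simp_all

lemma rh_app [simp]:
  assumes "A \<in> algs" "s \<in> VObj T" "t \<in> VObj T" "el V f" "el V x" "ty V f = VHom T s t" "ty V x =
    FO A s" "dj f x"
  shows "rh A s t \<bullet>\<^bsub>V\<^esub> (f \<odot>\<^bsub>V\<^esub> x) = Ev V (FO A s) (FO A t) \<bullet>\<^bsub>V\<^esub> (FA A s t \<bullet>\<^bsub>V\<^esub> f \<odot>\<^bsub>V\<^esub> x)"
  using assms by (simp add: rh_def)

lemma ac_app:
  assumes "A \<in> algs" "B \<in> algs" "t \<in> VObj T" "el V f" "el V x" "ty V f = eh A B" "ty V x =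
    FO A t" "dj f x"
  shows "ac A B t \<bullet>\<^bsub>V\<^esub> (f \<odot>\<^bsub>V\<^esub> x) = Ev V (FO A t) (FO B t) \<bullet>\<^bsub>V\<^esub> (ph A B t \<bullet>\<^bsub>V\<^esub> f \<odot>\<^bsub>V\<^esub> x)"
  using assms by (simp add: ac_def)

abbreviation "rh' A s t \<equiv> jA j (rh A s t) \<cdot>\<^bsub>V'\<^esub> jT j (VHom T s t) (FO A s)"
abbreviation "ac' A B t \<equiv> jA j (ac A B t) \<cdot>\<^bsub>V'\<^esub> jT j (VHom nc.N A B) (FO A t)"

text \<open>The universal property over \<open>V'\<close> holds because the image under
  \<open>j\<close> of a hom of algebras is an end in \<open>V'\<close> by definition, and because
  \<open>realized_base\<close>, which rests on the preservation of internal homs, turns this end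
  into a universal action.\<close>

lemma module_category_alg_base: "module_category V' (bc T) (bc nc.N) (\<lambda>A t. jO j (FO A t)) rh' ac'"
proof (rule module_category_base[OF m.module_category_axioms], goal_cases)
  case (1 A B W q)
  then have AB: "A \<in> algs" "B \<in> algs" by auto
  interpret r: realized V' "bc (vself V)" "jO j" jev by (rule realized_base)
  have q: "q t \<in> Arr V'" "Dom V' (q t) = W \<otimes>\<^bsub>V'\<^esub> jO j (FO A t)" "Cod V' (q t) =
    jO j (FO B t)" if "t \<in> VObj T" for t
    using 1(4)[OF that] by (auto simp: tgt.Hom_iff)
  have "\<exists>!h. h \<in> Hom V' W (jO j (eh A B)) \<and> (\<forall>t\<in>VObj (bc T).
     jev (FO (base_fun j T A) t) (FO (base_fun j T B) t) \<cdot>\<^bsub>V'\<^esub> ((jA j (ph A B t) \<cdot>\<^bsub>V'\<^esub> h) \<boxtimes>\<^bsub>V'\<^esub> Idn V' (jO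
       j (FO (base_fun j T A) t))) = q t)"
  proof (rule r.action_universal[OF alg_nat_object'[OF AB] vfunctor_base[OF algsD[OF AB(1)]]
    vfunctor_base[OF algsD[OF AB(2)]] 1(3)], goal_cases)
    case (1 t) then show ?case using q by simp
  next
    case (2 s t w f x)
    then show ?case using 1(5)[of s t w f x] AB q[of s] q[of t] by (simp add: rh_def jev_def)
  qed
  moreover have "jev (FO (base_fun j T A) t) (FO (base_fun j T B) t) \<cdot>\<^bsub>V'\<^esub> ((jA j (ph A B t) \<cdot>\<^bsub>V'\<^esub> h)
    \<boxtimes>\<^bsub>V'\<^esub> Idn V' (jO j (FO (base_fun j T A) t))) =
     (jA j (ac A B t) \<cdot>\<^bsub>V'\<^esub> jT j (VHom nc.N A B) (FO A t)) \<cdot>\<^bsub>V'\<^esub> (h \<boxtimes>\<^bsub>V'\<^esub> Idn V' (jO j (FO A t)))"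
    if "t \<in> VObj T" "h \<in> Hom V' W (jO j (eh A B))" for t h
    by (rule tgt.ext2[of _ _ W "jO j (FO A t)"]) (use that AB 1(3) in \<open>simp_all add: tgt.Hom_iff
      jev_def ac_def\<close>)
  ultimately show ?case by (auto cong: conj_cong)
qed

section \<open>The functor from the opposite of \<open>C\<close> to algebras, and representable
  algebras\<close>

lemma algebra_hom:
  assumes "vcategory V C" "E \<in> algebras V J T C" "c \<in> VObj C"
  shows "vcomp V T (hom_from V C c) E \<in> algs"
  using assms vcategory.vfunctor_hom_from[of V C c] preserves_powers_hom[of V T C E J c]
  by (auto simp: algebras_def intro: vfunctor_vcomp)

abbreviation "br C E \<equiv> bracket V V' j J T C E"

text \<open>The definite description in \<open>bracket\<close> is legitimate because precomposition
  with arrows of \<open>C\<close> commutes with the action of \<open>T\<close> through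
  \<open>E\<close>, so it factors uniquely through the end. The statements about \<open>rh\<close>
  and \<open>ac\<close> restate the functor in the language of modules.\<close>

lemma bracket:
  assumes C: "vcategory V C" and E: "E \<in> algebras V J T C"
  shows bracket_FO: "c \<in> VObj C \<Longrightarrow> FO (br C E) c = vcomp V T (hom_from V C c) E"
    and bracket_ph: "\<lbrakk>c \<in> VObj C; d \<in> VObj C; t \<in> VObj T\<rbrakk> \<Longrightarrow>
       ph (vcomp V T (hom_from V C c) E) (vcomp V T (hom_from V C d) E) t \<cdot>\<^bsub>V\<^esub> FA (br C E) c d =
         FA (hom_to V C (FO E t)) c d"
    and bracket_alg: "c \<in> VObj C \<Longrightarrow> FO (br C E) c \<in> algs"
    and bracket_ob: "\<lbrakk>c \<in> VObj C; t \<in> VObj T\<rbrakk> \<Longrightarrow> FO (FO (br C E) c) t = VHom C c (FO E t)"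
    and bracket_rh: "\<lbrakk>c \<in> VObj C; s \<in> VObj T; t \<in> VObj T; el V f; el V h; ty V f = VHom T s t;
      ty V h = VHom C c (FO E s); dj f h\<rbrakk> \<Longrightarrow>
       rh (FO (br C E) c) s t \<bullet>\<^bsub>V\<^esub> (f \<odot>\<^bsub>V\<^esub> h) = VCmp C c (FO E s) (FO E t) \<bullet>\<^bsub>V\<^esub> (FA E s t \<bullet>\<^bsub>V\<^esub> f \<odot>\<^bsub>V\<^esub> h)"
    and bracket_ac: "\<lbrakk>c \<in> VObj C; d \<in> VObj C; t \<in> VObj T; el V g; el V h; ty V g = VHom C d c;
      ty V h = VHom C c (FO E t); dj g h\<rbrakk> \<Longrightarrow>
       ac (FO (br C E) c) (FO (br C E) d) t \<bullet>\<^bsub>V\<^esub> (FA (br C E) c d \<bullet>\<^bsub>V\<^esub> g \<odot>\<^bsub>V\<^esub> h) =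
         VCmp C d c (FO E t) \<bullet>\<^bsub>V\<^esub> (h \<odot>\<^bsub>V\<^esub> g)"
    and bracket_vfunctor: "vfunctor V (vop V C) nc.N (br C E)"
proof -
  interpret C: vcategory V C by (rule C)
  have EV: "vfunctor V T C E" using E by (simp add: algebras_def)
  interpret E: vfunctor V T C E by (rule EV)
  let ?H = "\<lambda>c. vcomp V T (hom_from V C c) E"
  have H [simp]: "?H c \<in> algs" if "c \<in> VObj C" for c
    using algebra_hom[OF C E that] .
  have hf [simp]: "FA (hom_from V C c) x y \<in> Arr V" "Dom V (FA (hom_from V C c) x y) = VHom C x y"
    "Cod V (FA (hom_from V C c) x y) = Hm V (VHom C c x) (VHom C c y)" if "c \<in> VObj C" "x \<in> VObj C"
      "y \<in> VObj C" for c x y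
    using vfunctor.FA_simps[OF C.vfunctor_hom_from[OF that(1)] that(2,3)] that by auto
  have ht [simp]: "FA (hom_to V C c) x y \<in> Arr V" "Dom V (FA (hom_to V C c) x y) = VHom C y x"
    "Cod V (FA (hom_to V C c) x y) = Hm V (VHom C x c) (VHom C y c)" if "c \<in> VObj C" "x \<in> VObj C" "y
      \<in> VObj C" for c x y
    using vfunctor.FA_simps[OF C.vfunctor_hom_to[OF that(1)], of x y] that by auto
  define b where "b c d = (THE h.
       h \<in> Hom V (VHom C d c) (VHom (alg V V' j J T) (?H c) (?H d)) \<and>
       (\<forall>t\<in>VObj T. ph (?H c) (?H d) t \<cdot>\<^bsub>V\<^esub> h = FA (hom_to V C (FO E t)) c d))" for c d
  have R: "br C E = mk_vfun (vop V C) ?H b"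
    unfolding bracket_def Let_def b_def by (rule mk_vfun_cong) simp_all
  have b: "b c d \<in> Hom V (VHom C d c) (eh (?H c) (?H d)) \<and>
      (\<forall>t\<in>VObj T. ph (?H c) (?H d) t \<cdot>\<^bsub>V\<^esub> b c d = FA (hom_to V C (FO E t)) c d)" if cd [simp]: "c \<in>
        VObj C" "d \<in> VObj C" for c d
    unfolding b_def alg_eq nc.N_simps
  proof (rule theI', rule nc.p_lift, goal_cases)
    case (5 s t f a)
    have "VCmp (vself V) (VHom C c (FO E s)) (VHom C c (FO E t)) (VHom C d (FO E t)) \<cdot>\<^bsub>V\<^esub>
        (FA (hom_to V C (FO E t)) c d \<boxtimes>\<^bsub>V\<^esub> FA (?H c) s t) =
      VCmp (vself V) (VHom C c (FO E s)) (VHom C d (FO E s)) (VHom C d (FO E t)) \<cdot>\<^bsub>V\<^esub>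
        (FA (?H d) s t \<boxtimes>\<^bsub>V\<^esub> FA (hom_to V C (FO E s)) c d) \<cdot>\<^bsub>V\<^esub> Brd V (VHom C d c) (VHom T s t)"
      by (rule src.curry_ext2[of _ _ "VHom C d c" "VHom T s t" "VHom C c (FO E s)" "VHom C d (FO E
        t)"]) (use 5 in simp_all)
    from arg_cong[OF this, of "\<lambda>k. k \<bullet>\<^bsub>V\<^esub> (a \<odot>\<^bsub>V\<^esub> f)"] 5 show ?case by simp
  qed simp_all
  then have b': "b c d \<in> Arr V" "Dom V (b c d) = VHom C d c" "Cod V (b c d) = eh (?H c) (?H d)"
    "t \<in> VObj T \<Longrightarrow> ph (?H c) (?H d) t \<cdot>\<^bsub>V\<^esub> b c d = FA (hom_to V C (FO E t)) c d" if "c \<in> VObj C" "d \<in>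
      VObj C" for c d t
    using that by (auto simp: src.Hom_iff)
  note [simp] = b'(1-3)
  have be [simp]: "ph (?H c) (?H d) t \<bullet>\<^bsub>V\<^esub> b c d \<bullet>\<^bsub>V\<^esub> g = FA (hom_to V C (FO E t)) c d \<bullet>\<^bsub>V\<^esub> g"
    if "c \<in> VObj C" "d \<in> VObj C" "t \<in> VObj T" "el V g" "ty V g = VHom C d c" for c d t g
    using arg_cong[OF b'(4), of c d t "\<lambda>k. k \<bullet>\<^bsub>V\<^esub> g"] that by simp
  have FOb [simp]: "FO (br C E) c = ?H c" if "c \<in> VObj C" for c
    using that by (simp add: R)
  have FAb [simp]: "FA (br C E) c d = b c d" if "c \<in> VObj C" "d \<in> VObj C" for c d
    using that by (simp add: R)
  have ac: "ac (?H c) (?H d) t \<bullet>\<^bsub>V\<^esub> (b c d \<bullet>\<^bsub>V\<^esub> g \<odot>\<^bsub>V\<^esub> h) = VCmp C d c (FO E t) \<bullet>\<^bsub>V\<^esub> (h \<odot>\<^bsub>V\<^esub> g)"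
    if "c \<in> VObj C" "d \<in> VObj C" "t \<in> VObj T" "el V g" "el V h" "ty V g = VHom C d c" "ty V h =
      VHom C c (FO E t)" "dj g h" for c d t g h
    using that by (simp add: ac_app)
  show "c \<in> VObj C \<Longrightarrow> FO (br C E) c = ?H c" by simp
  show "\<lbrakk>c \<in> VObj C; d \<in> VObj C; t \<in> VObj T\<rbrakk> \<Longrightarrow>
       ph (?H c) (?H d) t \<cdot>\<^bsub>V\<^esub> FA (br C E) c d = FA (hom_to V C (FO E t)) c d" by (simp add: b'(4))
  show "c \<in> VObj C \<Longrightarrow> FO (br C E) c \<in> algs" by simp
  show "\<lbrakk>c \<in> VObj C; t \<in> VObj T\<rbrakk> \<Longrightarrow> FO (FO (br C E) c) t = VHom C c (FO E t)" by simp
  show "\<lbrakk>c \<in> VObj C; s \<in> VObj T; t \<in> VObj T; el V f; el V h; ty V f = VHom T s t; ty V h =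
    VHom C c (FO E s); dj f h\<rbrakk> \<Longrightarrow>
       rh (FO (br C E) c) s t \<bullet>\<^bsub>V\<^esub> (f \<odot>\<^bsub>V\<^esub> h) = VCmp C c (FO E s) (FO E t) \<bullet>\<^bsub>V\<^esub> (FA E s t \<bullet>\<^bsub>V\<^esub> f \<odot>\<^bsub>V\<^esub> h)" by simp
  show "\<lbrakk>c \<in> VObj C; d \<in> VObj C; t \<in> VObj T; el V g; el V h; ty V g = VHom C d c; ty V h =
    VHom C c (FO E t); dj g h\<rbrakk> \<Longrightarrow>
       ac (FO (br C E) c) (FO (br C E) d) t \<bullet>\<^bsub>V\<^esub> (FA (br C E) c d \<bullet>\<^bsub>V\<^esub> g \<odot>\<^bsub>V\<^esub> h) =
         VCmp C d c (FO E t) \<bullet>\<^bsub>V\<^esub> (h \<odot>\<^bsub>V\<^esub> g)"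
    by (simp add: ac)
  show "vfunctor V (vop V C) nc.N (br C E)"
  proof (rule m.bracket_functor[OF C EV _ _ R], goal_cases)
    case (4 c d t g h) then show ?case by (rule ac)
  qed simp_all
qed

text \<open>Applied to this algebra, \<open>bracket\<close> takes \<open>t\<close> to
  \<open>T(t, -)\<close>, so the representables are algebras.\<close>

lemma vid_algebra: "vid V T \<in> algebras V J T T"
proof -
  have v: "vfunctor V T T (vid V T)" by (rule vfunctor_vid) (rule T.vcategory_axioms)
  have "is_power_counit V T X (FO (vid V T) P) (FO (vid V T) c) (FA (vid V T) P c \<cdot>\<^bsub>V\<^esub> k)" if
    "is_power_counit V T X P c k" for X P c k
    using that by (auto simp: is_power_counit_def src.Hom_iff)
  then have "preserves_powers V J T T (vid V T)" unfolding preserves_powers_iff[OF v] by blast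
  then show ?thesis using v by (simp add: algebras_def)
qed

text \<open>Carried out over \<open>V\<close>, where the left adjoint lives. The values
  \<open>R c t\<close> are represented by objects \<open>E t\<close>; naturality in \<open>t\<close>
  makes \<open>E\<close> an algebra and the isomorphisms homomorphisms, and naturality in
  \<open>c\<close> makes them an isomorphism of functors.\<close>

lemma right_adjoint_eso:
  assumes C: "vcategory V C" and RA: "is_right_adjoint V (vop V C) nc.N R"
  obtains E \<Psi> where "E \<in> algebras V J T C" "vnat_iso V (vop V C) nc.N (br C E) R \<Psi>"
proof (rule right_adjointE[OF RA])
  fix L \<phi>
  interpret C: vcategory V C by (rule C)
  have RV: "vfunctor V (vop V C) nc.N R" using RA by (simp add: is_right_adjoint_def)
  interpret R: vfunctor V "vop V C" nc.N R by (rule RV)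
  assume LV: "vfunctor V nc.N (vop V C) L" and
    phi0: "\<And>b x. \<lbrakk>b \<in> VObj nc.N; x \<in> VObj (vop V C)\<rbrakk> \<Longrightarrow> is_iso V (\<phi> b x)"
    "\<And>b x. \<lbrakk>b \<in> VObj nc.N; x \<in> VObj (vop V C)\<rbrakk> \<Longrightarrow> Dom V (\<phi> b x) = VHom (vop V C) (FO L b) x"
    "\<And>b x. \<lbrakk>b \<in> VObj nc.N; x \<in> VObj (vop V C)\<rbrakk> \<Longrightarrow> Cod V (\<phi> b x) = VHom nc.N b (FO R x)" and
    n1: "\<And>b x y g f. \<lbrakk>b \<in> VObj nc.N; x \<in> VObj (vop V C); y \<in> VObj (vop V C); el V g; el V f;
      ty V g = VHom (vop V C) x y;
       ty V f = VHom (vop V C) (FO L b) x; dj g f\<rbrakk> \<Longrightarrow>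
       \<phi> b y \<bullet>\<^bsub>V\<^esub> VCmp (vop V C) (FO L b) x y \<bullet>\<^bsub>V\<^esub> (g \<odot>\<^bsub>V\<^esub> f) = VCmp nc.N b (FO R x) (FO R y) \<bullet>\<^bsub>V\<^esub> (FA R x y
         \<bullet>\<^bsub>V\<^esub> g \<odot>\<^bsub>V\<^esub> \<phi> b x \<bullet>\<^bsub>V\<^esub> f)" and
    n2: "\<And>a b c u f. \<lbrakk>a \<in> VObj (vop V C); b \<in> VObj nc.N; c \<in> VObj nc.N; el V u; el V f; ty V f =
      VHom nc.N c b; ty V u = VHom (vop V C) (FO L b) a; dj u f\<rbrakk> \<Longrightarrow>
       \<phi> c a \<bullet>\<^bsub>V\<^esub> VCmp (vop V C) (FO L c) (FO L b) a \<bullet>\<^bsub>V\<^esub> (u \<odot>\<^bsub>V\<^esub> FA L c b \<bullet>\<^bsub>V\<^esub> f) =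
         VCmp nc.N c b (FO R a) \<bullet>\<^bsub>V\<^esub> (\<phi> b a \<bullet>\<^bsub>V\<^esub> u \<odot>\<^bsub>V\<^esub> f)"
  interpret L: vfunctor V nc.N "vop V C" L by (rule LV)
  note [simp] = phi0[unfolded nc.N_simps vop_simps]
  \<comment> \<open>The Yoneda functor from the opposite of \<open>T\<close> into
    \<open>T-Alg\<close>.\<close>
  let ?y = "br T (vid V T)"
  note y = bracket[OF T.vcategory_axioms vid_algebra]
  have yV: "vfunctor V (vop V T) nc.N ?y" by (rule y(7))
  interpret y: vfunctor V "vop V T" nc.N ?y by (rule yV)
  let ?Y = "\<lambda>t. FO ?y t"
  have [simp]: "?Y t \<in> algs" if "t \<in> VObj T" for t by (rule y(3)[OF that])
  have yob [simp]: "FO (?Y t) s = VHom T t s" if "t \<in> VObj T" "s \<in> VObj T" for t s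
    using y(4)[OF that] that by simp
  have [simp]: "FA ?y s t \<in> Arr V" "Dom V (FA ?y s t) = VHom T t s" "Cod V (FA ?y s t) =
    eh (?Y s) (?Y t)"
    if "s \<in> VObj T" "t \<in> VObj T" for s t using y.FA_simps[of s t] that by auto
  have [simp]: "FO L b \<in> VObj C" if "b \<in> algs" for b using L.FO_VObj[of b] that by simp
  have [simp]: "FA L b c \<in> Arr V" "Dom V (FA L b c) = eh b c" "Cod V (FA L b c) =
    VHom C (FO L c) (FO L b)"
    if "b \<in> algs" "c \<in> algs" for b c using L.FA_simps[of b c] that by auto
  have [simp]: "FO R x \<in> algs" if "x \<in> VObj C" for x using R.FO_VObj[of x] that by simp
  have [simp]: "FA R x y \<in> Arr V" "Dom V (FA R x y) = VHom C y x" "Cod V (FA R x y) =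
    eh (FO R x) (FO R y)"
    if "x \<in> VObj C" "y \<in> VObj C" for x y using R.FA_simps[of x y] that by auto
  have yrh: "rh (?Y c) s t \<bullet>\<^bsub>V\<^esub> (f \<odot>\<^bsub>V\<^esub> h) = VCmp T c s t \<bullet>\<^bsub>V\<^esub> (f \<odot>\<^bsub>V\<^esub> h)"
    if "c \<in> VObj T" "s \<in> VObj T" "t \<in> VObj T" "el V f" "el V h" "ty V f = VHom T s t" "ty V h =
      VHom T c s" "dj f h" for c s t f h
    using y(5)[of c s t f h] that by simp
  have yac: "ac (?Y c) (?Y d) t \<bullet>\<^bsub>V\<^esub> (FA ?y c d \<bullet>\<^bsub>V\<^esub> g \<odot>\<^bsub>V\<^esub> h) = VCmp T d c t \<bullet>\<^bsub>V\<^esub> (h \<odot>\<^bsub>V\<^esub> g)"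
    if "c \<in> VObj T" "d \<in> VObj T" "t \<in> VObj T" "el V g" "el V h" "ty V g = VHom T d c" "ty V h =
      VHom T c t" "dj g h" for c d t g h
    using y(6)[of c d t g h] that by simp
  \<comment> \<open>The left adjoint takes values in the opposite of \<open>C\<close>, so the
    composite \<open>L ?y\<close> goes from \<open>T^op\<close> to \<open>C^op\<close>, and its
    opposite is the wanted functor.\<close>
  define E where "E = vop_fun (vcomp V (vop V T) L ?y)"
  have EV: "vfunctor V T C E"
    unfolding E_def by (rule vfunctor_vop'[OF vfunctor_vcomp[OF yV LV] T.vcategory_axioms C])
  interpret E: vfunctor V T C E by (rule EV)
  have EO [simp]: "FO E t = FO L (?Y t)" if "t \<in> VObj T" for t
    using that by (simp add: E_def)
  have EA [simp]: "FA E s t = FA L (?Y t) (?Y s) \<cdot>\<^bsub>V\<^esub> FA ?y t s" if "s \<in> VObj T" "t \<in> VObj T" for s t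
    using that by (simp add: E_def)
  \<comment> \<open>The adjunction isomorphism \<open>C(c, E t) \<cong> T-Alg(T(t, -), R c)\<close>
    followed by the Yoneda isomorphism to \<open>(R c) t\<close>.\<close>
  define \<psi> where "\<psi> c t = m.yev (?Y t) (FO R c) t \<cdot>\<^bsub>V\<^esub> \<phi> (?Y t) c" for c t
  have yev [simp]: "m.yev (?Y t) B t \<in> Arr V" "Dom V (m.yev (?Y t) B t) = eh (?Y t) B" "Cod V (m.yev
    (?Y t) B t) = FO B t"
    "is_iso V (m.yev (?Y t) B t)"
    "\<lbrakk>el V a; ty V a = eh (?Y t) B\<rbrakk> \<Longrightarrow> m.yev (?Y t) B t \<bullet>\<^bsub>V\<^esub> a = ac (?Y t) B t \<bullet>\<^bsub>V\<^esub> (a \<odot>\<^bsub>V\<^esub> VIdn T t \<bullet>\<^bsub>V\<^esub> un V)"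
    if "t \<in> VObj T" "B \<in> algs" for t B a
  proof -
    show "is_iso V (m.yev (?Y t) B t)"
      by (rule m.yoneda_iso) (use that yrh in simp_all)
  qed (use m.yev[of "?Y t" B t] that in simp_all)
  have psi [simp]: "is_iso V (\<psi> c t)" "\<psi> c t \<in> Arr V" "Dom V (\<psi> c t) = VHom C c (FO L (?Y t))" "Cod
    V (\<psi> c t) = FO (FO R c) t"
    if "c \<in> VObj C" "t \<in> VObj T" for c t
    using that by (simp_all add: \<psi>_def)
  have psi_app: "\<psi> c t \<bullet>\<^bsub>V\<^esub> h = ac (?Y t) (FO R c) t \<bullet>\<^bsub>V\<^esub> (\<phi> (?Y t) c \<bullet>\<^bsub>V\<^esub> h \<odot>\<^bsub>V\<^esub> VIdn T t \<bullet>\<^bsub>V\<^esub> un V)"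
    if "c \<in> VObj C" "t \<in> VObj T" "el V h" "ty V h = VHom C c (FO L (?Y t))" for c t h
    using that by (simp add: \<psi>_def)
  \<comment> \<open>Naturality of the adjunction in the algebra variable, used along the Yoneda
    functor, gives the value at \<open>f\<close>. Writing \<open>f\<close> as its own action on the
    identity lets \<open>act_nat\<close> take it out.\<close>
  have nat_t: "\<psi> c t \<bullet>\<^bsub>V\<^esub> VCmp C c (FO E s) (FO E t) \<bullet>\<^bsub>V\<^esub> (FA E s t \<bullet>\<^bsub>V\<^esub> f \<odot>\<^bsub>V\<^esub> h) =
    rh (FO R c) s t \<bullet>\<^bsub>V\<^esub> (f \<odot>\<^bsub>V\<^esub> \<psi> c s \<bullet>\<^bsub>V\<^esub> h)"
    if h: "c \<in> VObj C" "s \<in> VObj T" "t \<in> VObj T" "el V f" "el V h" "ty V f = VHom T s t" "ty V h =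
      VHom C c (FO E s)" "dj f h" for c s t f h
  proof -
    note dj_sym[OF h(8)]
    have "\<phi> (?Y t) c \<bullet>\<^bsub>V\<^esub> VCmp (vop V C) (FO L (?Y t)) (FO L (?Y s)) c \<bullet>\<^bsub>V\<^esub> (h \<odot>\<^bsub>V\<^esub> FA L (?Y t) (?Y s) \<bullet>\<^bsub>V\<^esub>
      FA ?y t s \<bullet>\<^bsub>V\<^esub> f) =
      VCmp nc.N (?Y t) (?Y s) (FO R c) \<bullet>\<^bsub>V\<^esub> (\<phi> (?Y s) c \<bullet>\<^bsub>V\<^esub> h \<odot>\<^bsub>V\<^esub> FA ?y t s \<bullet>\<^bsub>V\<^esub> f)"
      by (rule n2) (use h dj_sym[OF h(8)] in simp_all)
    then have "\<psi> c t \<bullet>\<^bsub>V\<^esub> VCmp C c (FO E s) (FO E t) \<bullet>\<^bsub>V\<^esub> (FA E s t \<bullet>\<^bsub>V\<^esub> f \<odot>\<^bsub>V\<^esub> h) =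
       ac (?Y s) (FO R c) t \<bullet>\<^bsub>V\<^esub> (\<phi> (?Y s) c \<bullet>\<^bsub>V\<^esub> h \<odot>\<^bsub>V\<^esub> f)"
      using h dj_sym[OF h(8)] by (simp add: psi_app yac)
    also have "\<dots> = ac (?Y s) (FO R c) t \<bullet>\<^bsub>V\<^esub> (\<phi> (?Y s) c \<bullet>\<^bsub>V\<^esub> h \<odot>\<^bsub>V\<^esub> rh (?Y s) s t \<bullet>\<^bsub>V\<^esub> (f \<odot>\<^bsub>V\<^esub> VIdn T s \<bullet>\<^bsub>V\<^esub> un
      V))"
      by (subst yrh) (use h in simp_all)
    also have "\<dots> = rh (FO R c) s t \<bullet>\<^bsub>V\<^esub> (f \<odot>\<^bsub>V\<^esub> \<psi> c s \<bullet>\<^bsub>V\<^esub> h)"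
      by (subst m.act_nat) (use h dj_sym[OF h(8)] in \<open>simp_all add: psi_app del: rh_app\<close>)
    finally show ?thesis .
  qed
  \<comment> \<open>Here the adjunction is natural in the object of \<open>C\<close>, and evaluation
    at the identity respects composition by \<open>act_cmp\<close>.\<close>
  have nat_c: "\<psi> d t \<bullet>\<^bsub>V\<^esub> VCmp C d c (FO E t) \<bullet>\<^bsub>V\<^esub> (h \<odot>\<^bsub>V\<^esub> g) = ac (FO R c) (FO R d) t \<bullet>\<^bsub>V\<^esub> (FA R c d \<bullet>\<^bsub>V\<^esub> g
    \<odot>\<^bsub>V\<^esub> \<psi> c t \<bullet>\<^bsub>V\<^esub> h)"
    if h: "c \<in> VObj C" "d \<in> VObj C" "t \<in> VObj T" "el V g" "el V h" "ty V g = VHom C d c" "ty V h =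
      VHom C c (FO E t)" "dj g h" for c d t g h
  proof -
    have "\<phi> (?Y t) d \<bullet>\<^bsub>V\<^esub> VCmp (vop V C) (FO L (?Y t)) c d \<bullet>\<^bsub>V\<^esub> (g \<odot>\<^bsub>V\<^esub> h) =
      VCmp nc.N (?Y t) (FO R c) (FO R d) \<bullet>\<^bsub>V\<^esub> (FA R c d \<bullet>\<^bsub>V\<^esub> g \<odot>\<^bsub>V\<^esub> \<phi> (?Y t) c \<bullet>\<^bsub>V\<^esub> h)"
      by (rule n1) (use h in simp_all)
    then show ?thesis using h dj_sym[OF h(8)] by (simp add: psi_app)
  qed
  have "preserves_powers V J T C E"
  proof (rule preserves_powers_of_hom[OF EV, of "\<lambda>c. FO R c" J \<psi>], goal_cases)
    case (1 c) then show ?case by (intro algsD) simp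
  next
    case (2 c) then have "FO R c \<in> algs" by simp then show ?case by (simp add: algebras_def)
  next
    case (4 c s t f h) then show ?case using nat_t[of c s t f h] by simp
  qed simp_all
  then have EA': "E \<in> algebras V J T C" using EV by (simp add: algebras_def)
  note b = bracket[OF C EA']
  let ?b = "br C E"
  interpret b: vfunctor V "vop V C" nc.N ?b by (rule b(7))
  have [simp]: "FO ?b c \<in> algs" if "c \<in> VObj C" for c by (rule b(3)[OF that])
  have bob [simp]: "FO (FO ?b c) t = VHom C c (FO L (?Y t))" if "c \<in> VObj C" "t \<in> VObj T" for c t
    using b(4)[OF that] that by simp
  have [simp]: "FA ?b x y \<in> Arr V" "Dom V (FA ?b x y) = VHom C y x" "Cod V (FA ?b x y) =
    eh (FO ?b x) (FO ?b y)"
    if "x \<in> VObj C" "y \<in> VObj C" for x y using b.FA_simps[of x y] that by auto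
  have brh: "rh (FO ?b c) s t \<bullet>\<^bsub>V\<^esub> (f \<odot>\<^bsub>V\<^esub> h) = VCmp C c (FO E s) (FO E t) \<bullet>\<^bsub>V\<^esub> (FA E s t \<bullet>\<^bsub>V\<^esub> f \<odot>\<^bsub>V\<^esub> h)"
    if "c \<in> VObj C" "s \<in> VObj T" "t \<in> VObj T" "el V f" "el V h" "ty V f = VHom T s t" "ty V h =
      VHom C c (FO E s)" "dj f h" for c s t f h
    using b(5) that by blast
  have bac: "ac (FO ?b c) (FO ?b d) t \<bullet>\<^bsub>V\<^esub> (FA ?b c d \<bullet>\<^bsub>V\<^esub> g \<odot>\<^bsub>V\<^esub> h) = VCmp C d c (FO L (?Y t)) \<bullet>\<^bsub>V\<^esub> (h \<odot>\<^bsub>V\<^esub> g)"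
    if "c \<in> VObj C" "d \<in> VObj C" "t \<in> VObj T" "el V g" "el V h" "ty V g = VHom C d c" "ty V h =
      VHom C c (FO E t)" "dj g h" for c d t g h
    using b(6)[of c d t g h] that by simp
  have psi_rh: "\<psi> c t \<bullet>\<^bsub>V\<^esub> rh (FO ?b c) s t \<bullet>\<^bsub>V\<^esub> (f \<odot>\<^bsub>V\<^esub> h) = rh (FO R c) s t \<bullet>\<^bsub>V\<^esub> (f \<odot>\<^bsub>V\<^esub> \<psi> c s \<bullet>\<^bsub>V\<^esub> h)"
    if "c \<in> VObj C" "s \<in> VObj T" "t \<in> VObj T" "el V f" "el V h" "ty V f = VHom T s t" "ty V h =
      VHom C c (FO E s)" "dj f h" for c s t f h
    by (subst brh) (use that nat_t[of c s t f h] in simp_all)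
  \<comment> \<open>For fixed \<open>c\<close> the arrows \<open>\<psi> c t\<close> respect the
    action of \<open>T\<close> by \<open>psi_rh\<close>, so they form one homomorphism.\<close>
  have "\<exists>k. k \<in> Hom V (Unt V) (VHom nc.N (FO ?b c) (FO R c)) \<and>
     (\<forall>t x. t \<in> VObj T \<longrightarrow> el V x \<longrightarrow> ty V x = FO (FO ?b c) t \<longrightarrow>
        ac (FO ?b c) (FO R c) t \<bullet>\<^bsub>V\<^esub> (k \<bullet>\<^bsub>V\<^esub> un V \<odot>\<^bsub>V\<^esub> x) = \<psi> c t \<bullet>\<^bsub>V\<^esub> x)" if c [simp]: "c \<in> VObj C" for c
    by (rule m.act_global) (simp_all add: psi_rh del: rh_app)
  then obtain \<Psi> where P: "\<Psi> c \<in> Hom V (Unt V) (VHom nc.N (FO ?b c) (FO R c)) \<and>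
     (\<forall>t x. t \<in> VObj T \<longrightarrow> el V x \<longrightarrow> ty V x = FO (FO ?b c) t \<longrightarrow>
        ac (FO ?b c) (FO R c) t \<bullet>\<^bsub>V\<^esub> (\<Psi> c \<bullet>\<^bsub>V\<^esub> un V \<odot>\<^bsub>V\<^esub> x) = \<psi> c t \<bullet>\<^bsub>V\<^esub> x)" if "c \<in> VObj C" for c
    by metis
  have P1 [simp]: "\<Psi> c \<in> Arr V" "Dom V (\<Psi> c) = Unt V" "Cod V (\<Psi> c) = eh (FO ?b c) (FO R c)" if "c \<in>
    VObj C" for c
    using P[OF that] by (auto simp: src.Hom_iff)
  have P2 [simp]: "ac (FO ?b c) (FO R c) t \<bullet>\<^bsub>V\<^esub> (\<Psi> c \<bullet>\<^bsub>V\<^esub> un V \<odot>\<^bsub>V\<^esub> x) = \<psi> c t \<bullet>\<^bsub>V\<^esub> x"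
    if "c \<in> VObj C" "t \<in> VObj T" "el V x" "ty V x = VHom C c (FO L (?Y t))" for c t x
    using P[OF that(1), THEN conjunct2, rule_format, of t x] that by simp
  have "\<exists>k. k \<in> Hom V (Unt V) (VHom nc.N (FO R c) (FO ?b c)) \<and>
     (\<forall>t x. t \<in> VObj T \<longrightarrow> el V x \<longrightarrow> ty V x = FO (FO R c) t \<longrightarrow>
        ac (FO R c) (FO ?b c) t \<bullet>\<^bsub>V\<^esub> (k \<bullet>\<^bsub>V\<^esub> un V \<odot>\<^bsub>V\<^esub> x) = inv_arr V (\<psi> c t) \<bullet>\<^bsub>V\<^esub> x)" if c [simp]: "c \<in>
          VObj C" for c
  proof (rule m.act_global, goal_cases)
    case (4 s t f x)
    show ?case
      by (rule src.app_mono[of "\<psi> c t"])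
        (use 4 psi_rh[of c s t f "inv_arr V (\<psi> c s) \<bullet>\<^bsub>V\<^esub> x"] in \<open>simp_all del: rh_app\<close>)
  qed simp_all
  then obtain \<Psi>' where Q: "\<Psi>' c \<in> Hom V (Unt V) (VHom nc.N (FO R c) (FO ?b c)) \<and>
     (\<forall>t x. t \<in> VObj T \<longrightarrow> el V x \<longrightarrow> ty V x = FO (FO R c) t \<longrightarrow>
        ac (FO R c) (FO ?b c) t \<bullet>\<^bsub>V\<^esub> (\<Psi>' c \<bullet>\<^bsub>V\<^esub> un V \<odot>\<^bsub>V\<^esub> x) = inv_arr V (\<psi> c t) \<bullet>\<^bsub>V\<^esub> x)" if "c \<in> VObj C" for c
    by metis
  have Q1 [simp]: "\<Psi>' c \<in> Arr V" "Dom V (\<Psi>' c) = Unt V" "Cod V (\<Psi>' c) = eh (FO R c) (FO ?b c)" if "c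
    \<in> VObj C" for c
    using Q[OF that] by (auto simp: src.Hom_iff)
  have Q2 [simp]: "ac (FO R c) (FO ?b c) t \<bullet>\<^bsub>V\<^esub> (\<Psi>' c \<bullet>\<^bsub>V\<^esub> un V \<odot>\<^bsub>V\<^esub> x) = inv_arr V (\<psi> c t) \<bullet>\<^bsub>V\<^esub> x"
    if "c \<in> VObj C" "t \<in> VObj T" "el V x" "ty V x = FO (FO R c) t" for c t x
    using Q[OF that(1), THEN conjunct2, rule_format, of t x] that by simp
  have i1: "VCmp nc.N (FO ?b c) (FO R c) (FO ?b c) \<bullet>\<^bsub>V\<^esub> (\<Psi>' c \<bullet>\<^bsub>V\<^esub> un V \<odot>\<^bsub>V\<^esub> \<Psi> c \<bullet>\<^bsub>V\<^esub> un V) =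
    VIdn nc.N (FO ?b c) \<bullet>\<^bsub>V\<^esub> un V"
    if [simp]: "c \<in> VObj C" for c
  proof -
    have "VCmp nc.N (FO ?b c) (FO R c) (FO ?b c) \<cdot>\<^bsub>V\<^esub> (\<Psi>' c \<boxtimes>\<^bsub>V\<^esub> \<Psi> c) \<cdot>\<^bsub>V\<^esub> inv_arr V (Lun V (Unt V)) =
      VIdn nc.N (FO ?b c)"
      by (rule m.act_extU[of _ _ "FO ?b c" "FO ?b c"]) simp_all
    from arg_cong[OF this, of "\<lambda>k. k \<bullet>\<^bsub>V\<^esub> un V"] show ?thesis by simp
  qed
  have i2: "VCmp nc.N (FO R c) (FO ?b c) (FO R c) \<bullet>\<^bsub>V\<^esub> (\<Psi> c \<bullet>\<^bsub>V\<^esub> un V \<odot>\<^bsub>V\<^esub> \<Psi>' c \<bullet>\<^bsub>V\<^esub> un V) =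
    VIdn nc.N (FO R c) \<bullet>\<^bsub>V\<^esub> un V"
    if [simp]: "c \<in> VObj C" for c
  proof -
    have "VCmp nc.N (FO R c) (FO ?b c) (FO R c) \<cdot>\<^bsub>V\<^esub> (\<Psi> c \<boxtimes>\<^bsub>V\<^esub> \<Psi>' c) \<cdot>\<^bsub>V\<^esub> inv_arr V (Lun V (Unt V)) =
      VIdn nc.N (FO R c)"
      by (rule m.act_extU[of _ _ "FO R c" "FO R c"]) simp_all
    from arg_cong[OF this, of "\<lambda>k. k \<bullet>\<^bsub>V\<^esub> un V"] show ?thesis by simp
  qed
  have n: "VCmp nc.N (FO ?b c) (FO ?b d) (FO R d) \<bullet>\<^bsub>V\<^esub> (\<Psi> d \<bullet>\<^bsub>V\<^esub> un V \<odot>\<^bsub>V\<^esub> FA ?b c d \<bullet>\<^bsub>V\<^esub> g) =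
      VCmp nc.N (FO ?b c) (FO R c) (FO R d) \<bullet>\<^bsub>V\<^esub> (FA R c d \<bullet>\<^bsub>V\<^esub> g \<odot>\<^bsub>V\<^esub> \<Psi> c \<bullet>\<^bsub>V\<^esub> un V)"
    if h [simp]: "c \<in> VObj C" "d \<in> VObj C" "el V g" "ty V g = VHom C d c" for c d g
  proof -
    have "VCmp nc.N (FO ?b c) (FO ?b d) (FO R d) \<cdot>\<^bsub>V\<^esub> (\<Psi> d \<boxtimes>\<^bsub>V\<^esub> FA ?b c d) \<cdot>\<^bsub>V\<^esub> inv_arr V (Lun V (VHom C d
      c)) =
      VCmp nc.N (FO ?b c) (FO R c) (FO R d) \<cdot>\<^bsub>V\<^esub> (FA R c d \<boxtimes>\<^bsub>V\<^esub> \<Psi> c) \<cdot>\<^bsub>V\<^esub> inv_arr V (Run V (VHom C d c))"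
    proof (rule m.act_ext[of _ _ "VHom C d c" "FO ?b c" "FO R d"], goal_cases)
      case (9 t w x)
      then show ?case using nat_c[of c d t w x] by (simp add: bac)
    qed simp_all
    from arg_cong[OF this, of "\<lambda>k. k \<bullet>\<^bsub>V\<^esub> g"] show ?thesis by simp
  qed
  have n': "VCmp nc.N (FO R c) (FO R d) (FO ?b d) \<bullet>\<^bsub>V\<^esub> (\<Psi>' d \<bullet>\<^bsub>V\<^esub> un V \<odot>\<^bsub>V\<^esub> FA R c d \<bullet>\<^bsub>V\<^esub> g) =
      VCmp nc.N (FO R c) (FO ?b c) (FO ?b d) \<bullet>\<^bsub>V\<^esub> (FA ?b c d \<bullet>\<^bsub>V\<^esub> g \<odot>\<^bsub>V\<^esub> \<Psi>' c \<bullet>\<^bsub>V\<^esub> un V)"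
    if h [simp]: "c \<in> VObj C" "d \<in> VObj C" "el V g" "ty V g = VHom C d c" for c d g
  proof -
    have "VCmp nc.N (FO R c) (FO R d) (FO ?b d) \<cdot>\<^bsub>V\<^esub> (\<Psi>' d \<boxtimes>\<^bsub>V\<^esub> FA R c d) \<cdot>\<^bsub>V\<^esub> inv_arr V (Lun V (VHom C d
      c)) =
      VCmp nc.N (FO R c) (FO ?b c) (FO ?b d) \<cdot>\<^bsub>V\<^esub> (FA ?b c d \<boxtimes>\<^bsub>V\<^esub> \<Psi>' c) \<cdot>\<^bsub>V\<^esub> inv_arr V (Run V (VHom C d c))"
    proof (rule m.act_ext[of _ _ "VHom C d c" "FO R c" "FO ?b d"], goal_cases)
      case (9 t w x)
      \<comment> \<open>This is \<open>nat_c\<close> at the preimage of \<open>x\<close> under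
        \<open>\<psi> c t\<close>.\<close>
      have "ac (FO R c) (FO R d) t \<bullet>\<^bsub>V\<^esub> (FA R c d \<bullet>\<^bsub>V\<^esub> w \<odot>\<^bsub>V\<^esub> x) = \<psi> d t \<bullet>\<^bsub>V\<^esub> VCmp C d c (FO E t) \<bullet>\<^bsub>V\<^esub>
        (inv_arr V (\<psi> c t) \<bullet>\<^bsub>V\<^esub> x \<odot>\<^bsub>V\<^esub> w)"
        using 9 by (subst nat_c) simp_all
      then show ?case using 9 by (simp add: bac)
    qed simp_all
    from arg_cong[OF this, of "\<lambda>k. k \<bullet>\<^bsub>V\<^esub> g"] show ?thesis by simp
  qed
  have "vnat_iso V (vop V C) nc.N ?b R \<Psi>"
  proof (rule vnat_isoI[OF b(7) RV, of _ \<Psi>'])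
    show "vnat V (vop V C) nc.N ?b R \<Psi>"
      by (rule vnatI[OF b(7) RV]) (simp_all add: n)
    show "vnat V (vop V C) nc.N R ?b \<Psi>'"
      by (rule vnatI[OF RV b(7)]) (simp_all add: n')
  qed (simp_all add: i1 i2)
  then show thesis using that EA' by blast
qed

end

section \<open>The equivalence\<close>

context sym_monoidal_embedding
begin

abbreviation "fe C D F G \<equiv> fst (funcat_nat V' j C D F G)"
abbreviation "fp C D F G \<equiv> snd (funcat_nat V' j C D F G)"

text \<open>Completeness of \<open>V'\<close> supplies the ends that \<open>funcat_nat\<close>
  picks. The set \<open>S\<close> is kept arbitrary so that the full subcategories on algebras and
  on right adjoints are instances, with base change in the role of \<open>\<Phi>\<close>.\<close>

lemma nat_cat_funcat:
  fixes C :: "('c, 'o, 'a) vcat" and D :: "('d, 'o, 'a) vcat"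
  assumes U: "universe (U :: 'u set)" "small U (VObj C)" "small_complete U V'"
    and C: "vcategory V C" and D: "vcategory V D" and S: "S \<subseteq> {F. vfunctor V C D F}"
  shows "nat_cat V' (bc C) (bc D) S (base_fun j C) (fe C D) (fp C D)"
    "nat_cat.N V' (bc C) (bc D) S (fe C D) (fp C D) = vfull (funcat V V' j C D) S"
proof -
  show *: "nat_cat V' (bc C) (bc D) S (base_fun j C) (fe C D) (fp C D)"
  proof (rule nat_cat.intro[OF vcategory_base[OF D] vcategory_base[OF C]], rule
    nat_cat_axioms.intro, goal_cases)
    case (1 F) then show ?case using S vfunctor_base by auto
  next
    case (2 F x) then show ?case by simp
  next
    case (3 F G)
    then have FG: "vfunctor V C D F" "vfunctor V C D G" using S by auto
    have "\<exists>e p. is_nat_object V' (bc C) (bc D) (base_fun j C F) (base_fun j C G) e p"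
      by (rule nat_object_exists[OF U(1) _ U(3) vfunctor_base[OF FG(1)] vfunctor_base[OF FG(2)]])
        (simp add: U(2))
    then have "\<exists>z. (case z of (e, p) \<Rightarrow> is_nat_object V' (bc C) (bc D) (base_fun j C F) (base_fun j C
      G) e p)"
      by auto
    from someI_ex[OF this] show ?case
      unfolding funcat_nat_def by (simp add: case_prod_unfold)
  qed
  show "nat_cat.N V' (bc C) (bc D) S (fe C D) (fp C D) = vfull (funcat V V' j C D) S"
    unfolding nat_cat.N_def[OF *] by (simp add: vfull_def funcat_def nat_category_def)
qed

end

context algebra_category
begin

text \<open>The limit \<open>{A, E}\<close> represents
  \<open>T-Alg(A, \<lbrakk>-, E\<rbrakk>)\<close>. The work is in descending: the defining
  isomorphism of the limit is one over \<open>V'\<close> with values in homs of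
  \<open>[T, \<V>]\<close>, while the adjunction has to be found over \<open>V\<close>.\<close>

lemma bracket_right_adjoint:
  assumes U: "universe (U :: 'u set)" "small U (VObj T)" "small_complete U V'"
    and C: "vcategory V C" and E: "E \<in> algebras V J T C"
    and lim: "\<And>A. A \<in> algs \<Longrightarrow> \<exists>L \<theta>. is_weighted_limit V V' j T C A E L \<theta>"
  shows "is_right_adjoint V (vop V C) nc.N (br C E)"
proof -
  interpret C: vcategory V C by (rule C)
  interpret bC: vcategory V' "bc C" by (rule vcategory_base[OF C])
  have sV: "vcategory V (vself V)" by (rule vcategory_vself[OF src.smcc_axioms])
  interpret bN: vcategory V' "bc nc.N" by (rule vcategory_base[OF nc.vcategory_N])
  let ?F = "{F. vfunctor V T (vself V) F}"
  interpret fc: nat_cat V' "bc T" "bc (vself V)" ?F "base_fun j T" "fe T (vself V)" "fp T (vself V)"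
    by (rule nat_cat_funcat(1)[OF U T.vcategory_axioms sV]) simp
  have fN: "funcat V V' j T (vself V) = fc.N"
    using nat_cat_funcat(2)[OF U T.vcategory_axioms sV, of ?F] by (simp add: vfull_def funcat_def
      nat_category_def)
  interpret fN: vcategory V' fc.N by (rule fc.vcategory_N)
  let ?e = "fe T (vself V)" and ?p = "fp T (vself V)"
  have aF [simp]: "A \<in> algs \<Longrightarrow> vfunctor V T (vself V) A" for A by (rule algsD)
  have fe [simp]: "?e A B \<in> Obj V'" if "A \<in> algs" "B \<in> algs" for A B using fc.e_Obj[of A B] that by simp
  have fp [simp]: "?p A B t \<in> Arr V'" "Dom V' (?p A B t) = ?e A B" "Cod V' (?p A B t) =
    jO j (Hm V (FO A t) (FO B t))"
    if "A \<in> algs" "B \<in> algs" "t \<in> VObj T" for A B t using fc.p_simps[of A B t] that by auto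
  have fnat: "is_nat_object V' (bc T) (bc (vself V)) (base_fun j T A) (base_fun j T B) (?e A B) (?p
    A B)" if "A \<in> algs" "B \<in> algs" for A B
    using fc.nat_obj[of A B] that by simp
  \<comment> \<open>The hom in \<open>[T, \<V>]\<close> and the image of the hom in
    \<open>T-Alg\<close> are two choices of the same end in \<open>V'\<close>, hence canonically
    isomorphic.\<close>
  have "\<exists>k. is_iso V' k \<and> Dom V' k = jO j (eh A B) \<and> Cod V' k = ?e A B \<and> (\<forall>t\<in>VObj T. ?p A B t \<cdot>\<^bsub>V'\<^esub> k
    = jA j (ph A B t))"
    if AB [simp]: "A \<in> algs" "B \<in> algs" for A B
  proof -
    note o1 = fnat[OF AB] and o2 = alg_nat_object'[OF AB]
    note fA = vfunctor_base[OF algsD[OF AB(1)]] and fB = vfunctor_base[OF algsD[OF AB(2)]]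
    obtain k where k: "k \<in> Hom V' (jO j (eh A B)) (?e A B)" "\<And>t. t \<in> VObj (bc T) \<Longrightarrow> ?p A B t \<cdot>\<^bsub>V'\<^esub> k =
      jA j (ph A B t)"
      using nat_object_lift[OF o1] o2 unfolding is_nat_object_def by metis
    obtain l where l: "l \<in> Hom V' (?e A B) (jO j (eh A B))" "\<And>t. t \<in> VObj (bc T) \<Longrightarrow>
      jA j (ph A B t) \<cdot>\<^bsub>V'\<^esub> l = ?p A B t"
      using nat_object_lift[OF o2] o1 unfolding is_nat_object_def by metis
    have [simp]: "k \<in> Arr V'" "Dom V' k = jO j (eh A B)" "Cod V' k = ?e A B" "l \<in> Arr V'" "Dom V' l
      = ?e A B" "Cod V' l = jO j (eh A B)"
      using k l by (auto simp: tgt.Hom_iff)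
    have "is_iso V' k"
    proof (rule tgt.is_isoI[of _ l], simp_all)
      show "l \<cdot>\<^bsub>V'\<^esub> k = Idn V' (jO j (eh A B))"
      proof (rule nat_object_mono[OF o2 fA fB], goal_cases)
        case (6 t)
        have "jA j (ph A B t) \<cdot>\<^bsub>V'\<^esub> (l \<cdot>\<^bsub>V'\<^esub> k) = (jA j (ph A B t) \<cdot>\<^bsub>V'\<^esub> l) \<cdot>\<^bsub>V'\<^esub> k" using 6 by simp
        then show ?case using 6 k(2)[of t] l(2)[of t] by simp
      qed simp_all
      show "k \<cdot>\<^bsub>V'\<^esub> l = Idn V' (?e A B)"
      proof (rule nat_object_mono[OF o1 fA fB], goal_cases)
        case (6 t)
        have "?p A B t \<cdot>\<^bsub>V'\<^esub> (k \<cdot>\<^bsub>V'\<^esub> l) = (?p A B t \<cdot>\<^bsub>V'\<^esub> k) \<cdot>\<^bsub>V'\<^esub> l" using 6 by simp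
        then show ?case using 6 k(2)[of t] l(2)[of t] by simp
      qed simp_all
    qed
    then show ?thesis using k(2) by auto
  qed
  then obtain k where k: "is_iso V' (k A B) \<and> Dom V' (k A B) = jO j (eh A B) \<and> Cod V' (k A B) = ?e A B \<and>
      (\<forall>t\<in>VObj T. ?p A B t \<cdot>\<^bsub>V'\<^esub> k A B = jA j (ph A B t))" if "A \<in> algs" "B \<in> algs" for A B
    by metis
  have k1 [simp]: "is_iso V' (k A B)" "Dom V' (k A B) = jO j (eh A B)" "Cod V' (k A B) =
    ?e A B" if "A \<in> algs" "B \<in> algs" for A B
    using k[OF that] by auto
  have k2 [simp]: "?p A B t \<bullet>\<^bsub>V'\<^esub> k A B \<bullet>\<^bsub>V'\<^esub> a = jA j (ph A B t) \<bullet>\<^bsub>V'\<^esub> a"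
    if "A \<in> algs" "B \<in> algs" "t \<in> VObj T" "el V' a" "ty V' a = jO j (eh A B)" for A B t a
    using arg_cong[OF k[OF that(1,2), THEN conjunct2, THEN conjunct2, THEN conjunct2, THEN bspec, OF
      that(3)], of "\<lambda>k. k \<bullet>\<^bsub>V'\<^esub> a"] that by simp
  have phc: "jA j (ph A D t) \<bullet>\<^bsub>V'\<^esub> VCmp (bc nc.N) A B D \<bullet>\<^bsub>V'\<^esub> (b \<odot>\<^bsub>V'\<^esub> a) =
      VCmp (bc (vself V)) (FO A t) (FO B t) (FO D t) \<bullet>\<^bsub>V'\<^esub> (jA j (ph B D t) \<bullet>\<^bsub>V'\<^esub> b \<odot>\<^bsub>V'\<^esub> jA j (ph A B t)
        \<bullet>\<^bsub>V'\<^esub> a)"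
    if h: "A \<in> algs" "B \<in> algs" "D \<in> algs" "t \<in> VObj T" "el V' b" "el V' a" "ty V' b =
      jO j (eh B D)" "ty V' a = jO j (eh A B)" "dj b a" for A B D t b a
  proof -
    have "ph A D t \<cdot>\<^bsub>V\<^esub> VCmp nc.N A B D = VCmp (vself V) (FO A t) (FO B t) (FO D t) \<cdot>\<^bsub>V\<^esub> (ph B D t \<boxtimes>\<^bsub>V\<^esub> ph
      A B t)"
      using nc.N_cmp[OF h(1-3)] h(4) by blast
    from arg_cong[OF this, of "\<lambda>k. jA j k \<bullet>\<^bsub>V'\<^esub> jT j (eh B D) (eh A B) \<bullet>\<^bsub>V'\<^esub> (b \<odot>\<^bsub>V'\<^esub> a)"] h
      base_cmp_app[OF nc.vcategory_N, of A B D b a, symmetric] base_cmp_app[OF sV]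
    show ?thesis by simp
  qed
  \<comment> \<open>The isomorphisms \<open>k\<close> commute with the projections, and on
    projections both compositions are computed in \<open>V\<close>. With \<open>ki\<close> this says
    that \<open>k\<close> is the hom part of a fully faithful functor from the base change of
    \<open>T-Alg\<close>.\<close>
  have kc [simp]: "k A D \<bullet>\<^bsub>V'\<^esub> VCmp (bc nc.N) A B D \<bullet>\<^bsub>V'\<^esub> (b \<odot>\<^bsub>V'\<^esub> a) = VCmp fc.N A B D \<bullet>\<^bsub>V'\<^esub> (k B D \<bullet>\<^bsub>V'\<^esub> b
    \<odot>\<^bsub>V'\<^esub> k A B \<bullet>\<^bsub>V'\<^esub> a)"
    if h [simp]: "A \<in> algs" "B \<in> algs" "D \<in> algs" "el V' b" "el V' a" "ty V' b =
      jO j (eh B D)" "ty V' a = jO j (eh A B)" "dj b a" for A B D b a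
  proof -
    have "k A D \<cdot>\<^bsub>V'\<^esub> VCmp (bc nc.N) A B D = VCmp fc.N A B D \<cdot>\<^bsub>V'\<^esub> (k B D \<boxtimes>\<^bsub>V'\<^esub> k A B)"
    proof (rule fc.p_mono[of A D], goal_cases)
      case (8 t)
      show ?case
        by (rule tgt.ext2[of _ _ "jO j (eh B D)" "jO j (eh A B)"]) (use 8 in \<open>simp_all add: phc\<close>)
    qed simp_all
    from arg_cong[OF this, of "\<lambda>k. k \<bullet>\<^bsub>V'\<^esub> (b \<odot>\<^bsub>V'\<^esub> a)"] show ?thesis by simp
  qed
  have ki [simp]: "k A A \<bullet>\<^bsub>V'\<^esub> VIdn (bc nc.N) A \<bullet>\<^bsub>V'\<^esub> un V' = VIdn fc.N A \<bullet>\<^bsub>V'\<^esub> un V'" if [simp]: "A \<in>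
    algs" for A
  proof -
    have "k A A \<cdot>\<^bsub>V'\<^esub> VIdn (bc nc.N) A = VIdn fc.N A"
    proof (rule fc.p_mono[of A A], goal_cases)
      case (8 t)
      have "ph A A t \<cdot>\<^bsub>V\<^esub> VIdn nc.N A = VIdn (vself V) (FO A t)"
        using nc.N_idn[OF that] 8 by simp
      from arg_cong[OF this, of "\<lambda>k. jA j k \<bullet>\<^bsub>V'\<^esub> jU j \<bullet>\<^bsub>V'\<^esub> un V'"] 8
        base_idn_app[OF nc.vcategory_N, of A, symmetric] base_idn_app[OF sV]
      have "jA j (ph A A t) \<bullet>\<^bsub>V'\<^esub> VIdn (bc nc.N) A \<bullet>\<^bsub>V'\<^esub> un V' = VIdn (bc (vself V)) (FO A t) \<bullet>\<^bsub>V'\<^esub> un V'"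
        by simp
      then show ?case using 8 by - (rule tgt.extU, simp_all)
    qed simp_all
    from arg_cong[OF this, of "\<lambda>k. k \<bullet>\<^bsub>V'\<^esub> un V'"] show ?thesis by simp
  qed
  note b = bracket[OF C E]
  let ?H = "\<lambda>c. vcomp V T (hom_from V C c) E"
  have H [simp]: "?H c \<in> algs" if "c \<in> VObj C" for c using algebra_hom[OF C E that] .
  let ?b = "FA (br C E)"
  interpret b: vfunctor V "vop V C" nc.N "br C E" by (rule b(7))
  have FOb [simp]: "FO (br C E) c = ?H c" if "c \<in> VObj C" for c by (rule b(1)[OF that])
  have FAb [simp]: "?b c d \<in> Arr V" "Dom V (?b c d) = VHom C d c" "Cod V (?b c d) =
    eh (?H c) (?H d)" if "c \<in> VObj C" "d \<in> VObj C" for c d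
    using b.FA_simps[of c d] that by auto
  interpret bb: vfunctor V' "bc (vop V C)" "bc nc.N" "base_fun j (vop V C) (br C E)" by (rule
    vfunctor_base[OF b(7)])
  have bbc: "jA j (?b x z) \<bullet>\<^bsub>V'\<^esub> VCmp (bc C) z y x \<bullet>\<^bsub>V'\<^esub> (f \<odot>\<^bsub>V'\<^esub> g) =
      VCmp (bc nc.N) (?H x) (?H y) (?H z) \<bullet>\<^bsub>V'\<^esub> (jA j (?b y z) \<bullet>\<^bsub>V'\<^esub> g \<odot>\<^bsub>V'\<^esub> jA j (?b x y) \<bullet>\<^bsub>V'\<^esub> f)"
    if h: "x \<in> VObj C" "y \<in> VObj C" "z \<in> VObj C" "el V' g" "el V' f" "ty V' g =
      jO j (VHom C z y)" "ty V' f = jO j (VHom C y x)" "dj g f" "dj f g" for x y z g f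
    using bb.FA_cmp[of x y z g f] base_vop_app(1)[OF C h(1,2,3,4,5,8,9,6,7)] h by simp
  have bbi: "jA j (?b x x) \<bullet>\<^bsub>V'\<^esub> VIdn (bc C) x \<bullet>\<^bsub>V'\<^esub> un V' = VIdn (bc nc.N) (?H x) \<bullet>\<^bsub>V'\<^esub> un V'" if "x \<in>
    VObj C" for x
  proof -
    have "VIdn (bc (vop V C)) x = VIdn (bc C) x" by (simp add: base_cat_def)
    then show ?thesis using bb.FA_id[of x] that by simp
  qed
  define hf where "hf c d = (THE h.
       h \<in> Hom V' (jO j (VHom C d c)) (VHom (funcat V V' j T (vself V)) (?H c) (?H d)) \<and>
       (\<forall>t\<in>VObj T. ?p (?H c) (?H d) t \<cdot>\<^bsub>V'\<^esub> h = jA j (FA (hom_to V C (FO E t)) c d)))" for c d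
  \<comment> \<open>Both sides have the same projections at every \<open>t\<close>. Hence
    \<open>hom_family\<close> is the base change of \<open>bracket\<close> followed by
    \<open>k\<close>.\<close>
  have hf [simp]: "hf c d = k (?H c) (?H d) \<cdot>\<^bsub>V'\<^esub> jA j (?b c d)" if cd [simp]: "c \<in> VObj C" "d \<in> VObj
    C" for c d
    unfolding hf_def
  proof (rule the_equality, goal_cases)
    case 1
    have "?p (?H c) (?H d) t \<cdot>\<^bsub>V'\<^esub> (k (?H c) (?H d) \<cdot>\<^bsub>V'\<^esub> jA j (?b c d)) = jA j (FA (hom_to V C (FO E
      t)) c d)" if t: "t \<in> VObj T" for t
    proof -
      have "?p (?H c) (?H d) t \<cdot>\<^bsub>V'\<^esub> (k (?H c) (?H d) \<cdot>\<^bsub>V'\<^esub> jA j (?b c d)) = (?p (?H c) (?H d) t \<cdot>\<^bsub>V'\<^esub> k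
        (?H c) (?H d)) \<cdot>\<^bsub>V'\<^esub> jA j (?b c d)"
        using t by simp
      also have "\<dots> = jA j (ph (?H c) (?H d) t) \<cdot>\<^bsub>V'\<^esub> jA j (?b c d)"
        using k[of "?H c" "?H d"] t by simp
      also have "\<dots> = jA j (ph (?H c) (?H d) t \<cdot>\<^bsub>V\<^esub> ?b c d)" using t by simp
      finally show ?thesis using b(2)[OF cd t] by simp
    qed
    then show ?case by (simp add: tgt.Hom_iff fN)
  next
    case (2 h)
    then have [simp]: "h \<in> Arr V'" "Dom V' h = jO j (VHom C d c)" "Cod V' h = ?e (?H c) (?H d)"
      by (auto simp: tgt.Hom_iff fN)
    show ?case
    proof (rule fc.p_mono[of "?H c" "?H d"], goal_cases)
      case (8 t)
      then have t: "t \<in> VObj T" by simp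
      have "?p (?H c) (?H d) t \<cdot>\<^bsub>V'\<^esub> (k (?H c) (?H d) \<cdot>\<^bsub>V'\<^esub> jA j (?b c d)) = (?p (?H c) (?H d) t \<cdot>\<^bsub>V'\<^esub> k
        (?H c) (?H d)) \<cdot>\<^bsub>V'\<^esub> jA j (?b c d)"
        using t by simp
      also have "\<dots> = jA j (ph (?H c) (?H d) t) \<cdot>\<^bsub>V'\<^esub> jA j (?b c d)"
        using k[of "?H c" "?H d"] t by simp
      also have "\<dots> = jA j (ph (?H c) (?H d) t \<cdot>\<^bsub>V\<^esub> ?b c d)" using t by simp
      finally show ?case using b(2)[OF cd t] 2 t by simp
    qed simp_all
  qed
  have hfam: "hom_family V V' j T C E = mk_vfun (vop V' (bc C)) ?H hf"
    unfolding hom_family_def Let_def hf_def by (rule mk_vfun_cong) simp_all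
  have hfV: "vfunctor V' (vop V' (bc C)) fc.N (hom_family V V' j T C E)"
  proof (rule vfunctorI[OF bC.vcategory_vop fc.vcategory_N hfam], goal_cases)
    case (3 x) then show ?case by (simp add: bbi)
  next
    case (4 x y z g f) then show ?case by (simp add: bbc)
  qed simp_all
  \<comment> \<open>Naturality is kept as an equation of arrows, since it is obtained by
    \<open>jext2\<close> from elements of \<open>V'\<close> and needed for elements of
    \<open>V\<close>.\<close>
  have "\<exists>L \<phi>. L \<in> VObj C \<and> (\<forall>x\<in>VObj C. is_iso V (\<phi> x) \<and> Dom V (\<phi> x) = VHom C x L \<and> Cod V (\<phi> x) =
    eh A (?H x)) \<and>
     (\<forall>x\<in>VObj C. \<forall>y\<in>VObj C. \<phi> y \<cdot>\<^bsub>V\<^esub> VCmp (vop V C) L x y = VCmp nc.N A (?H x) (?H y) \<cdot>\<^bsub>V\<^esub> (?b x y \<boxtimes>\<^bsub>V\<^esub> \<phi> x))"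
    if A [simp]: "A \<in> algs" for A
  proof -
    obtain L \<theta> where L [simp]: "L \<in> VObj C" and
      n: "vnat_iso_arr V' (vop V' (bc C)) (hom_to V' (bc C) L)
       (vcomp V' (vop V' (bc C)) (hom_from V' fc.N A) (hom_family V V' j T C E)) \<theta>"
      using lim[OF A] unfolding is_weighted_limit_def fN by auto
    have f1: "vfunctor V' (vop V' (bc C)) (vself V') (hom_to V' (bc C) L)"
      by (rule bC.vfunctor_hom_to) simp
    have f2': "vfunctor V' fc.N (vself V') (hom_from V' fc.N A)"
      by (rule fN.vfunctor_hom_from) simp
    interpret f2': vfunctor V' fc.N "vself V'" "hom_from V' fc.N A" by (rule f2')
    have f2: "vfunctor V' (vop V' (bc C)) (vself V') (vcomp V' (vop V' (bc C)) (hom_from V' fc.N A)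
      (hom_family V V' j T C E))"
      by (rule vfunctor_vcomp[OF hfV f2'])
    note n' = n[unfolded vnat_iso_arr_iff[OF f1 f2]]
    have th [simp]: "is_iso V' (\<theta> x)" "Dom V' (\<theta> x) = jO j (VHom C x L)" "Cod V' (\<theta> x) =
      ?e A (?H x)" if "x \<in> VObj C" for x
      using n' that by (auto simp: hfam)
    have tn: "\<theta> y \<bullet>\<^bsub>V'\<^esub> VCmp (bc C) y x L \<bullet>\<^bsub>V'\<^esub> (u \<odot>\<^bsub>V'\<^esub> g) = VCmp fc.N A (?H x) (?H y) \<bullet>\<^bsub>V'\<^esub>
       (k (?H x) (?H y) \<bullet>\<^bsub>V'\<^esub> jA j (?b x y) \<bullet>\<^bsub>V'\<^esub> g \<odot>\<^bsub>V'\<^esub> \<theta> x \<bullet>\<^bsub>V'\<^esub> u)"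
      if "x \<in> VObj C" "y \<in> VObj C" "el V' g" "el V' u" "ty V' g = jO j (VHom C y x)" "ty V' u =
        jO j (VHom C x L)" "dj g u" for x y g u
      using n'[THEN conjunct2, rule_format, of x y g u] that fN.hom_from_ev[of "?H x" "?H y" A "hf x
        y \<bullet>\<^bsub>V'\<^esub> g" "\<theta> x \<bullet>\<^bsub>V'\<^esub> u"]
        bC.hom_to_ev[of x y L g u]
      by (simp add: hfam)
    \<comment> \<open>Composing \<open>\<theta> x\<close> with the inverse of \<open>k\<close> gives
      an arrow between objects in the image of \<open>j\<close>, which fullness brings back to
      \<open>V\<close>; invertibility is reflected.\<close>
    have "\<exists>f. f \<in> Arr V \<and> Dom V f = VHom C x L \<and> Cod V f = eh A (?H x) \<and> jA j f =
      inv_arr V' (k A (?H x)) \<cdot>\<^bsub>V'\<^esub> \<theta> x"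
      if "x \<in> VObj C" for x
      by (rule jA_surj[of "inv_arr V' (k A (?H x)) \<cdot>\<^bsub>V'\<^esub> \<theta> x" "VHom C x L" "eh A (?H x)"]) (use that
        in auto)
    then obtain \<phi> where ph: "\<phi> x \<in> Arr V \<and> Dom V (\<phi> x) = VHom C x L \<and> Cod V (\<phi> x) = eh A (?H x) \<and>
       jA j (\<phi> x) = inv_arr V' (k A (?H x)) \<cdot>\<^bsub>V'\<^esub> \<theta> x" if "x \<in> VObj C" for x
      by metis
    have ph1 [simp]: "\<phi> x \<in> Arr V" "Dom V (\<phi> x) = VHom C x L" "Cod V (\<phi> x) = eh A (?H x)"
      "jA j (\<phi> x) = inv_arr V' (k A (?H x)) \<cdot>\<^bsub>V'\<^esub> \<theta> x" if "x \<in> VObj C" for x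
      using ph[OF that] by auto
    have "is_iso V (\<phi> x)" if "x \<in> VObj C" for x
      by (rule jA_iso_reflect) (use that in simp_all)
    moreover have "\<phi> y \<cdot>\<^bsub>V\<^esub> VCmp (vop V C) L x y = VCmp nc.N A (?H x) (?H y) \<cdot>\<^bsub>V\<^esub> (?b x y \<boxtimes>\<^bsub>V\<^esub> \<phi> x)"
      if xy [simp]: "x \<in> VObj C" "y \<in> VObj C" for x y
    proof (rule jext2[of _ _ "VHom C y x" "VHom C x L"], goal_cases)
      case (8 g u)
      have c1: "jA j (VCmp (vop V C) L x y) \<bullet>\<^bsub>V'\<^esub> jT j (VHom C y x) (VHom C x L) \<bullet>\<^bsub>V'\<^esub> (g \<odot>\<^bsub>V'\<^esub> u) =
        VCmp (bc C) y x L \<bullet>\<^bsub>V'\<^esub> (u \<odot>\<^bsub>V'\<^esub> g)"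
        using base_cmp_app[OF C.vcategory_vop, of L x y g u] base_vop_app(1)[OF C, of L x y g u]
          8 by simp
      have "\<theta> y \<bullet>\<^bsub>V'\<^esub> VCmp (bc C) y x L \<bullet>\<^bsub>V'\<^esub> (u \<odot>\<^bsub>V'\<^esub> g) = k A (?H y) \<bullet>\<^bsub>V'\<^esub> VCmp (bc nc.N) A (?H x) (?H y) \<bullet>\<^bsub>V'\<^esub>
         (jA j (?b x y) \<bullet>\<^bsub>V'\<^esub> g \<odot>\<^bsub>V'\<^esub> inv_arr V' (k A (?H x)) \<bullet>\<^bsub>V'\<^esub> \<theta> x \<bullet>\<^bsub>V'\<^esub> u)"
        by (subst tn) (use 8 in simp_all)
      then show ?case using 8 c1 base_cmp_app[OF nc.vcategory_N] by (simp del: kc)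
    qed simp_all
    ultimately show ?thesis
      by (intro exI[of _ L] exI[of _ \<phi>]) simp
  qed
  then obtain Lo \<phi> where L: "Lo A \<in> VObj C \<and> (\<forall>x\<in>VObj C. is_iso V (\<phi> A x) \<and> Dom V (\<phi> A x) =
    VHom C x (Lo A) \<and> Cod V (\<phi> A x) = eh A (?H x)) \<and>
     (\<forall>x\<in>VObj C. \<forall>y\<in>VObj C. \<phi> A y \<cdot>\<^bsub>V\<^esub> VCmp (vop V C) (Lo A) x y = VCmp nc.N A (?H x) (?H y) \<cdot>\<^bsub>V\<^esub> (?b x
       y \<boxtimes>\<^bsub>V\<^esub> \<phi> A x))"
    if "A \<in> algs" for A
    by metis
  show ?thesis
  proof (rule right_adjoint_of_representable[OF b(7), of Lo \<phi>], goal_cases)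
    case (1 A) then show ?case using L by simp
  next
    case (2 A x) then show ?case using L by simp
  next
    case (3 A x y g f)
    then have L1: "Lo A \<in> VObj C" and L2: "is_iso V (\<phi> A x)" "Dom V (\<phi> A x) =
      VHom C x (Lo A)" "Cod V (\<phi> A x) = eh A (?H x)"
      "is_iso V (\<phi> A y)" "Dom V (\<phi> A y) = VHom C y (Lo A)" "Cod V (\<phi> A y) = eh A (?H y)"
      and eq: "\<phi> A y \<cdot>\<^bsub>V\<^esub> VCmp (vop V C) (Lo A) x y = VCmp nc.N A (?H x) (?H y) \<cdot>\<^bsub>V\<^esub> (?b x y \<boxtimes>\<^bsub>V\<^esub> \<phi> A x)"
      using L[of A] by auto
    from arg_cong[OF eq, of "\<lambda>k. k \<bullet>\<^bsub>V\<^esub> (g \<odot>\<^bsub>V\<^esub> f)"] L1 L2 3 show ?case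
      by (simp del: C.vop_cmp_app)
  qed
qed

text \<open>Full faithfulness is \<open>cp.iso_Pa\<close>, essential surjectivity is
  \<open>right_adjoint_eso\<close>, and \<open>bracket_right_adjoint\<close> ensures that the
  comparison lands among right adjoints.\<close>

lemma algebras_equivalent_RAdj:
  fixes C :: "('c, 'o, 'a) vcat"
  assumes U: "universe (U :: 'u set)" "small U (VObj T)" "small U (VObj C)" "small_complete U V'"
    and C: "vcategory V C" and lim: "admits_algebra_limits V V' j J T C"
  shows "\<exists>P. vequivalence V' (alg_in V V' j J T C) (RAdj V V' j (vop V C) Alg) P \<and>
    (\<forall>E\<in>algebras V J T C. FO P E = br C E)"
proof -
  interpret C: vcategory V C by (rule C)
  interpret bC: vcategory V' "bc C" by (rule vcategory_base[OF C])
  let ?S1 = "algebras V J T C" and ?S2 = "{R. is_right_adjoint V (vop V C) nc.N R}"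
  have S1: "?S1 \<subseteq> {E. vfunctor V T C E}" by (auto simp: algebras_def)
  have S2: "?S2 \<subseteq> {R. vfunctor V (vop V C) nc.N R}" by (auto simp: is_right_adjoint_def)
  have Uop: "small U (VObj (vop V C))" using U(3) by simp
  note A1 = nat_cat_funcat[OF U(1,2,4) T.vcategory_axioms C S1]
  note A2 = nat_cat_funcat[OF U(1) Uop U(4) C.vcategory_vop nc.vcategory_N S2]
  have m: "module_category V' (bc T) (bc nc.N) (\<lambda>A t. jO j (FO A t)) rh' ac'" by (rule
    module_category_alg_base)
  have brS2: "br C E \<in> ?S2" if "E \<in> ?S1" for E
    using bracket_right_adjoint[OF U(1,2,4) C that] lim that unfolding admits_algebra_limits_def by
      blast
  interpret cp: comparison V' "bc T" "bc nc.N" "\<lambda>A t. jO j (FO A t)" rh' ac' "bc C" ?S1 "base_fun j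
    T" "fe T C" "fp T C"
    "bc (vop V C)" ?S2 "base_fun j (vop V C)" "fe (vop V C) nc.N" "fp (vop V C) nc.N" "br C"
  proof (rule comparison.intro[OF m A1(1) A2(1)], rule comparison_axioms.intro, goal_cases)
    case (3 E) then show ?case by (rule brS2)
  next
    case (4 E c t) then show ?case using bracket_ob[OF C 4(1)] by simp
  next
    case (5 E c s t f h)
    then have E [simp]: "E \<in> ?S1" "c \<in> VObj C" "s \<in> VObj T" "t \<in> VObj T" by auto
    interpret E: vfunctor V T C E using S1 E(1) by blast
    note b = bracket[OF C E(1)]
    have [simp]: "FO (br C E) c \<in> algs" "FO (FO (br C E) c) s = VHom C c (FO E s)" "FO (FO (br C E)
      c) t = VHom C c (FO E t)"
      using b(3)[of c] b(4)[of c s] b(4)[of c t] by auto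
    \<comment> \<open>The description of the action, known on elements of \<open>V\<close>, is
      turned into an equation of arrows so that \<open>jA\<close> can be applied to it.\<close>
    have "rh (FO (br C E) c) s t = VCmp C c (FO E s) (FO E t) \<cdot>\<^bsub>V\<^esub> (FA E s t \<boxtimes>\<^bsub>V\<^esub> Idn V (VHom C c (FO E
      s)))"
    proof (rule src.ext2[of _ _ "VHom T s t" "VHom C c (FO E s)"], goal_cases)
      case (7 x y) then show ?case using b(5)[of c s t x y] by (simp del: rh_app)
    qed (simp_all add: rh_def)
    from arg_cong[OF this, of "\<lambda>k. jA j k \<bullet>\<^bsub>V'\<^esub> jT j (VHom T s t) (VHom C c (FO E s)) \<bullet>\<^bsub>V'\<^esub> (f \<odot>\<^bsub>V'\<^esub> h)"] 5
      base_cmp_app[OF C] show ?case by simp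
  next
    case (6 E c d t g h)
    then have E [simp]: "E \<in> ?S1" "c \<in> VObj C" "d \<in> VObj C" "t \<in> VObj T" by auto
    interpret E: vfunctor V T C E using S1 E(1) by blast
    note b = bracket[OF C E(1)]
    interpret b: vfunctor V "vop V C" nc.N "br C E" by (rule b(7))
    have [simp]: "FO (br C E) c \<in> algs" "FO (br C E) d \<in> algs" "FO (FO (br C E) c) t =
      VHom C c (FO E t)" "FO (FO (br C E) d) t = VHom C d (FO E t)"
      using b(3)[of c] b(3)[of d] b(4)[of c t] b(4)[of d t] by auto
    have [simp]: "FA (br C E) c d \<in> Arr V" "Dom V (FA (br C E) c d) = VHom C d c" "Cod V (FA (br C
      E) c d) = eh (FO (br C E) c) (FO (br C E) d)"
      using b.FA_simps[of c d] by auto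
    have "ac (FO (br C E) c) (FO (br C E) d) t \<cdot>\<^bsub>V\<^esub> (FA (br C E) c d \<boxtimes>\<^bsub>V\<^esub> Idn V (VHom C c (FO E t))) =
      VCmp C d c (FO E t) \<cdot>\<^bsub>V\<^esub> Brd V (VHom C d c) (VHom C c (FO E t))"
    proof (rule src.ext2[of _ _ "VHom C d c" "VHom C c (FO E t)"], goal_cases)
      case (7 x y) then show ?case using b(6)[of c d t x y] by (simp add: ac_def)
    qed (simp_all add: ac_def)
    from arg_cong[OF this, of "\<lambda>k. jA j k \<bullet>\<^bsub>V'\<^esub> jT j (VHom C d c) (VHom C c (FO E t)) \<bullet>\<^bsub>V'\<^esub> (g \<odot>\<^bsub>V'\<^esub> h)"] 6
      base_cmp_app[OF C] dj_sym[OF 6(9)] show ?case by (simp add: ac_def)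
  qed simp_all
  have N1: "alg_in V V' j J T C = cp.NA.N" using A1(2) by (simp add: alg_in_def)
  have N2: "RAdj V V' j (vop V C) Alg = cp.NB.N" using A2(2) by (simp add: RAdj_def alg_eq)
  \<comment> \<open>The isomorphism is found over \<open>V\<close>, moved to \<open>V'\<close> by
    \<open>vnat_iso_base\<close>, and then read as a pair of mutually inverse global elements of the
    homs of \<open>RAdj\<close>.\<close>
  have "\<exists>E u v. E \<in> ?S1 \<and> u \<in> Hom V' (Unt V') (fe (vop V C) nc.N (br C E) R) \<and>
    v \<in> Hom V' (Unt V') (fe (vop V C) nc.N R (br C E)) \<and>
     VCmp cp.NB.N R (br C E) R \<bullet>\<^bsub>V'\<^esub> (u \<bullet>\<^bsub>V'\<^esub> un V' \<odot>\<^bsub>V'\<^esub> v \<bullet>\<^bsub>V'\<^esub> un V') = VIdn cp.NB.N R \<bullet>\<^bsub>V'\<^esub> un V' \<and>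
     VCmp cp.NB.N (br C E) R (br C E) \<bullet>\<^bsub>V'\<^esub> (v \<bullet>\<^bsub>V'\<^esub> un V' \<odot>\<^bsub>V'\<^esub> u \<bullet>\<^bsub>V'\<^esub> un V') = VIdn cp.NB.N (br C E) \<bullet>\<^bsub>V'\<^esub>
       un V'"
    if R: "R \<in> ?S2" for R
  proof -
    obtain E \<Psi> where E: "E \<in> ?S1" and i: "vnat_iso V (vop V C) nc.N (br C E) R \<Psi>"
      using right_adjoint_eso[OF C] R by blast
    have "vfunctor V (vop V C) nc.N R" using R S2 by blast
    from vnat_iso_base[OF i bracket_vfunctor[OF C E] this]
    show ?thesis using cp.NB.iso_of_vnat_iso[OF brS2[OF E] R] E by blast
  qed
  then obtain Qo u v where Q: "Qo R \<in> ?S1 \<and> u R \<in> Hom V' (Unt V') (fe (vop V C) nc.N (br C (Qo R))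
    R) \<and> v R \<in> Hom V' (Unt V') (fe (vop V C) nc.N R (br C (Qo R))) \<and>
     VCmp cp.NB.N R (br C (Qo R)) R \<bullet>\<^bsub>V'\<^esub> (u R \<bullet>\<^bsub>V'\<^esub> un V' \<odot>\<^bsub>V'\<^esub> v R \<bullet>\<^bsub>V'\<^esub> un V') = VIdn cp.NB.N R \<bullet>\<^bsub>V'\<^esub> un V' \<and>
     VCmp cp.NB.N (br C (Qo R)) R (br C (Qo R)) \<bullet>\<^bsub>V'\<^esub> (v R \<bullet>\<^bsub>V'\<^esub> un V' \<odot>\<^bsub>V'\<^esub> u R \<bullet>\<^bsub>V'\<^esub> un V') =
       VIdn cp.NB.N (br C (Qo R)) \<bullet>\<^bsub>V'\<^esub> un V'"
    if "R \<in> ?S2" for R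
    by metis
  have FP: "FO cp.P E = br C E" if "E \<in> ?S1" for E by (rule cp.P_simps(1)[OF that])
  have "vequivalence V' cp.NA.N cp.NB.N cp.P"
  proof (rule vequivalence_of_fully_faithful[OF cp.vfunctor_P, of Qo u v], goal_cases)
    case (1 x y)
    then have xy: "x \<in> ?S1" "y \<in> ?S1" by auto
    show ?case unfolding cp.P_simps(2)[OF xy] by (rule cp.iso_Pa[OF xy])
  next
    case (2 b) then show ?case using Q[of b] by simp
  next
    case (3 b) then have "b \<in> ?S2" by simp from Q[OF this] show ?case using FP[of "Qo b"] by simp
  next
    case (4 b) then have "b \<in> ?S2" by simp from Q[OF this] show ?case using FP[of "Qo b"] by simp
  next
    case (5 b) then have "b \<in> ?S2" by simp from Q[OF this] show ?case using FP[of "Qo b"] by simp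
  next
    case (6 b) then have "b \<in> ?S2" by simp from Q[OF this] show ?case using FP[of "Qo b"] by simp
  qed
  then show ?thesis unfolding N1 N2 using FP by blast
qed

end

theorem theorem3p11:
  fixes V :: "('o, 'a) smcc" and V' :: "('p, 'b) smcc" and j :: "('o, 'a, 'p, 'b) emb"
    and U :: "'u set" and \<J> :: "'o set"
    and T :: "('o, 'o, 'a) vcat" and \<tau> :: "('o, 'o, 'a) vfun"
    and C :: "('c, 'o, 'a) vcat" and pw :: "'o \<Rightarrow> 'c \<Rightarrow> 'c" and \<kappa> :: "'o \<Rightarrow> 'c \<Rightarrow> 'c \<Rightarrow> 'a"
  assumes "smcc V" and "has_finite_limits V"
    and "universe U" and "small_category U V" and "small U (VObj C)"
    and "smcc V'" and "small_complete U V'" and "small_cocomplete U V'"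
    and "sym_monoidal_embedding V V' j"
    and "preserves_small_limits U V V' j" and "preserves_internal_homs V V' j"
    and "arity_system V \<J>" and "amenable V V' j \<J>"
    and "is_theory V \<J> T \<tau>"
    and "vcategory V C" and "designated_powers V \<J> C pw \<kappa>"
    and "admits_algebra_limits V V' j \<J> T C"
  shows "\<exists>P. vequivalence V' (alg_in V V' j \<J> T C) (RAdj V V' j (vop V C) (alg V V' j \<J> T)) P \<and>
    (\<forall>E\<in>algebras V \<J> T C. FO P E = bracket V V' j \<J> T C E)"
proof -
  have T: "vcategory V T" "VObj T = \<J>" using assms(14) by (auto simp: is_theory_def)
  have ex: "alg_exists V V' j \<J> T" using assms(13,14) unfolding amenable_def by blast
  interpret sym_monoidal_embedding V V' j by fact
  interpret algebra_category V V' j T \<J>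
    by (intro algebra_category.intro algebra_category_axioms.intro sym_monoidal_embedding_axioms
      T(1) ex assms(11))
  have "\<J> \<subseteq> Obj V" using assms(12) by (simp add: arity_system_def)
  \<comment> \<open>The objects of \<open>T\<close> are the arities, which form a subset of the
    small set of objects of \<open>V\<close>.\<close>
  then have "small U (VObj T)"
    using assms(4) card_of_mono1[of \<J> "Obj V"] ordLeq_ordLess_trans T(2)
    unfolding small_category_def small_def by metis
  then show ?thesis by (rule algebras_equivalent_RAdj[OF assms(3) _ assms(5,7,15,17)])
qed

end
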